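(* Let $X'\subset\mathbb P(1,1,2,3,4,4,5,7)$, with weighted coordinates $x_0,x_1,y,w,u_0,u_1,z,t$, be defined by the $14$ relations $R_1,\dots,R_{14}$ given in the context, depending on parameters $\theta,\tau\in\mathbb C$ and a homogeneous form $P=P_{10}$ of degree $10$. These $14$ relations fit into a Pfaffian presentation \[\operatorname{Pf}_4 M=MV=0,\] where $M$ is the $6\times 6$ skew-symmetric matrix with entries above the diagonal \[ M=\begin{pmatrix} 0&0&x_0 & x_1^2 & u_0 \\ &0&x_1 & y & u_1 \\ &&u_0 & x_1u_1 & t\\ &&&t&-(\tau w^3+\theta u_1z)\\ &&&&P \end{pmatrix},\qquad V=\begin{pmatrix} 0 \\ -u_1^2 \\ 0 \\ w \\ -y \\ 0 \end{pmatrix}. \] For general choices of $P_{10}$ and $\tau$ the singular locus of $X'$ is one point of type $\frac1{25}(1,14)$.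
   Context: We work over $\mathbb C$. The weights of $x_0,x_1,y,w,u_0,u_1,z,t$ are $1,1,2,3,4,4,5,7$. $\operatorname{Pf}_4M$ denotes the collection of $4\times4$ sub-Pfaffians of $M$; diagonal zeros are omitted in the display, so the first displayed row lists the entries $(1,2),\dots,(1,6)$, the second $(2,3),\dots,(2,6)$, etc. The relations are: \begin{align*} R_1&\colon x_0y-x_1^3=0 & R_2&\colon x_0w-x_1^2y=0 \\ R_3&\colon x_1w-y^2=0 & R_4&\colon x_0u_1-x_1u_0=0\\ R_5&\colon x_1^2u_1-yu_0=0 & R_6&\colon x_1yu_1-wu_0=0 \\ R_7&\colon x_0t-u_0^2 =0 & R_8&\colon x_1t-u_0u_1=0\\ R_9&\colon x_1u_1^2-yt=0 & R_{10}&\colon yu_1^2-wt=0 \end{align*} \begin{align*} R_{11}&\colon x_0P+x_1^2(\theta u_1z+\tau w^3)+u_0t =0\\ R_{12}&\colon x_1P+y(\theta u_1z+\tau w^3)+u_1t=0\\ R_{13}&\colon yP+w(\theta u_1z+\tau w^3)+u_1^3=0\\ R_{14}&\colon u_0P+x_1u_1(\theta u_1z+\tau w^3)+t^2=0 \end{align*} where $P=z^2+\dots$ is a general homogeneous form of degree $10$. *)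

theory Defs
  imports
    "HOL-Algebra.Algebra"
    "HOL-Algebra.Algebraic_Closure_Type"
    "HOL-Library.Poly_Mapping"
    "HOL-Library.Extended_Nat"
    "HOL-Computational_Algebra.Formal_Power_Series"
    "Jordan_Normal_Form.Matrix"
begin

section \<open>Polynomials with weighted variables\<close>

text \<open>
  A monomial in the variables \<^typ>\<open>'v\<close> is a finitely supported exponent function, and a
  polynomial is a finitely supported function from monomials to coefficients, multiplied by
  convolution.
\<close>

type_synonym ('v, 'k) mpoly = "('v \<Rightarrow>\<^sub>0 nat) \<Rightarrow>\<^sub>0 'k"

definition pconst :: "'k::zero \<Rightarrow> ('v, 'k) mpoly" where
  "pconst c = Poly_Mapping.single 0 c"

definition pvar :: "'v \<Rightarrow> ('v, 'k::zero_neq_one) mpoly" where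
  "pvar i = Poly_Mapping.single (Poly_Mapping.single i 1) 1"

definition peval :: "('v \<Rightarrow> 'k::comm_semiring_1) \<Rightarrow> ('v, 'k) mpoly \<Rightarrow> 'k" where
  "peval a f = (\<Sum>m\<in>Poly_Mapping.keys f.
     Poly_Mapping.lookup f m * (\<Prod>i\<in>Poly_Mapping.keys m. a i ^ Poly_Mapping.lookup m i))"

definition wdegree :: "('v \<Rightarrow> nat) \<Rightarrow> ('v \<Rightarrow>\<^sub>0 nat) \<Rightarrow> nat" where
  "wdegree wt m = (\<Sum>i\<in>Poly_Mapping.keys m. wt i * Poly_Mapping.lookup m i)"

text \<open>The zero polynomial is homogeneous of every degree.\<close>

definition whomogeneous :: "('v \<Rightarrow> nat) \<Rightarrow> nat \<Rightarrow> ('v, 'k::zero) mpoly \<Rightarrow> bool" where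
  "whomogeneous wt d f \<longleftrightarrow> (\<forall>m\<in>Poly_Mapping.keys f. wdegree wt m = d)"

section \<open>Regular local rings\<close>

definition local_ring :: "('a, 'b) ring_scheme \<Rightarrow> bool" where
  "local_ring R \<longleftrightarrow> cring R \<and> (\<exists>!m. maximalideal m R)"

definition the_maximal_ideal :: "('a, 'b) ring_scheme \<Rightarrow> 'a set" where
  "the_maximal_ideal R = (THE m. maximalideal m R)"

definition krull_dim :: "('a, 'b) ring_scheme \<Rightarrow> enat" where
  "krull_dim R = (SUP n \<in> {n. \<exists>p. (\<forall>i\<le>n. primeideal (p i) R) \<and> (\<forall>i<n. p i \<subset> p (Suc i))}. enat n)"

definition regular_local_ring :: "('a, 'b) ring_scheme \<Rightarrow> bool" where
  "regular_local_ring R \<longleftrightarrow> local_ring R \<and> noetherian_ring R \<and>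
     (\<exists>S \<subseteq> carrier R. finite S \<and> the_maximal_ideal R = genideal R S \<and> enat (card S) = krull_dim R)"

section \<open>Closed subschemes of weighted projective space\<close>

text \<open>
  The (closed) points of the weighted projective space with weights \<^term>\<open>wt\<close> are the orbits of
  the multiplicative group on the nonzero vectors.
\<close>

definition worbit :: "('v \<Rightarrow> nat) \<Rightarrow> ('v \<Rightarrow> 'k::field) \<Rightarrow> ('v \<Rightarrow> 'k) set" where
  "worbit wt a = {(\<lambda>i. c ^ wt i * a i) | c. c \<noteq> 0}"

definition wps_points :: "('v \<Rightarrow> nat) \<Rightarrow> ('v \<Rightarrow> 'k::field) set set" where
  "wps_points wt = {worbit wt a | a. a \<noteq> (\<lambda>_. 0)}"

definition nonvanishing_at :: "('v \<Rightarrow> 'k::field) set \<Rightarrow> ('v, 'k) mpoly \<Rightarrow> bool" where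
  "nonvanishing_at p g \<longleftrightarrow> (\<forall>a\<in>p. peval a g \<noteq> 0)"

text \<open>
  Below, \<^term>\<open>I\<close> is a homogeneous ideal of the polynomial ring \<open>S\<close>, and the scheme in question
  is \<open>Proj (S / I)\<close>.
\<close>

definition proj_points :: "('v \<Rightarrow> nat) \<Rightarrow> ('v, 'k::field) mpoly set \<Rightarrow> ('v \<Rightarrow> 'k) set set" where
  "proj_points wt I = {p \<in> wps_points wt. \<forall>f\<in>I. \<forall>a\<in>p. peval a f = 0}"

text \<open>
  The local ring of \<open>Proj (S / I)\<close> at the point \<^term>\<open>p\<close> is the degree zero part of the localization
  of \<open>S / I\<close> at the homogeneous elements that do not vanish at \<^term>\<open>p\<close>.  Its elements are
  represented by pairs \<open>(f, g)\<close>, to be read as \<open>f / g\<close>, of forms of the same degree.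
\<close>

definition hfractions ::
    "('v \<Rightarrow> nat) \<Rightarrow> ('v \<Rightarrow> 'k::field) set \<Rightarrow> (('v, 'k) mpoly \<times> ('v, 'k) mpoly) set" where
  "hfractions wt p =
     {(f, g). (\<exists>d. whomogeneous wt d f \<and> whomogeneous wt d g) \<and> nonvanishing_at p g}"

definition hfraction_rel ::
    "('v \<Rightarrow> nat) \<Rightarrow> ('v, 'k::field) mpoly set \<Rightarrow> ('v \<Rightarrow> 'k) set \<Rightarrow>
     ((('v, 'k) mpoly \<times> ('v, 'k) mpoly) \<times> (('v, 'k) mpoly \<times> ('v, 'k) mpoly)) set" where
  "hfraction_rel wt I p =
     {((f, g), (f', g')). (f, g) \<in> hfractions wt p \<and> (f', g') \<in> hfractions wt p \<and>
        (\<exists>h d. whomogeneous wt d h \<and> nonvanishing_at p h \<and> h * (f * g' - f' * g) \<in> I)}"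

definition proj_stalk ::
    "('v \<Rightarrow> nat) \<Rightarrow> ('v, 'k::field) mpoly set \<Rightarrow> ('v \<Rightarrow> 'k) set \<Rightarrow>
     (('v, 'k) mpoly \<times> ('v, 'k) mpoly) set ring" where
  "proj_stalk wt I p =
     \<lparr>carrier = hfractions wt p // hfraction_rel wt I p,
      monoid.mult = (\<lambda>A B. \<Union>(f, g)\<in>A. \<Union>(f', g')\<in>B. hfraction_rel wt I p `` {(f * f', g * g')}),
      monoid.one = hfraction_rel wt I p `` {(1, 1)},
      ring.zero = hfraction_rel wt I p `` {(0, 1)},
      ring.add = (\<lambda>A B. \<Union>(f, g)\<in>A. \<Union>(f', g')\<in>B.
               hfraction_rel wt I p `` {(f * g' + f' * g, g * g')})\<rparr>"

definition stalk_const ::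
    "('v \<Rightarrow> nat) \<Rightarrow> ('v, 'k::field) mpoly set \<Rightarrow> ('v \<Rightarrow> 'k) set \<Rightarrow> 'k \<Rightarrow>
     (('v, 'k) mpoly \<times> ('v, 'k) mpoly) set" where
  "stalk_const wt I p c = hfraction_rel wt I p `` {(pconst c, 1)}"

definition singular_locus ::
    "('v \<Rightarrow> nat) \<Rightarrow> ('v, 'k::field) mpoly set \<Rightarrow> ('v \<Rightarrow> 'k) set set" where
  "singular_locus wt I = {p \<in> proj_points wt I. \<not> regular_local_ring (proj_stalk wt I p)}"

section \<open>Cyclic quotient singularities\<close>

primrec ideal_power :: "('a, 'b) ring_scheme \<Rightarrow> 'a set \<Rightarrow> nat \<Rightarrow> 'a set" where
  "ideal_power R I 0 = carrier R"
| "ideal_power R I (Suc n) = ideal_prod R I (ideal_power R I n)"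

text \<open>
  The inverse limit of the rings \<open>R / I ^ n\<close>: a coset of \<open>I ^ (n + 1)\<close> is mapped to a coset of
  \<open>I ^ n\<close> exactly if it is contained in it.
\<close>

definition completion :: "('a, 'b) ring_scheme \<Rightarrow> 'a set \<Rightarrow> (nat \<Rightarrow> 'a set) ring" where
  "completion R I =
     \<lparr>carrier = {s. \<forall>n. s n \<in> carrier (R Quot ideal_power R I n) \<and> s (Suc n) \<subseteq> s n},
      monoid.mult = (\<lambda>s s' n. s n \<otimes>\<^bsub>R Quot ideal_power R I n\<^esub> s' n),
      monoid.one = (\<lambda>n. \<one>\<^bsub>R Quot ideal_power R I n\<^esub>),
      ring.zero = (\<lambda>n. \<zero>\<^bsub>R Quot ideal_power R I n\<^esub>),
      ring.add = (\<lambda>s s' n. s n \<oplus>\<^bsub>R Quot ideal_power R I n\<^esub> s' n)\<rparr>"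

definition completion_map :: "('a, 'b) ring_scheme \<Rightarrow> 'a set \<Rightarrow> 'a \<Rightarrow> (nat \<Rightarrow> 'a set)" where
  "completion_map R I x = (\<lambda>n. ideal_power R I n +>\<^bsub>R\<^esub> x)"

text \<open>
  The type \<^typ>\<open>complex fps fps\<close> is the ring of power series in two variables \<open>u\<close>, \<open>v\<close>; the coefficient
  of \<open>u ^ i * v ^ j\<close> in \<open>F\<close> is \<open>fps_nth (fps_nth F j) i\<close>.  A root of unity \<open>\<zeta>\<close> acts by
  \<open>F(u, v) \<mapsto> F(\<zeta> ^ a * u, \<zeta> ^ b * v)\<close>.
\<close>

definition diagonal_action :: "nat \<Rightarrow> nat \<Rightarrow> complex \<Rightarrow> complex fps fps \<Rightarrow> complex fps fps" where
  "diagonal_action a b \<zeta> F =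
     Abs_fps (\<lambda>j. Abs_fps (\<lambda>i. (\<zeta> ^ a) ^ i * (\<zeta> ^ b) ^ j * fps_nth (fps_nth F j) i))"

definition cyclic_invariants :: "nat \<Rightarrow> nat \<Rightarrow> nat \<Rightarrow> complex fps fps ring" where
  "cyclic_invariants r a b =
     (ring_of_type_algebra :: complex fps fps ring)
       \<lparr>carrier := {F. \<forall>\<zeta>. \<zeta> ^ r = 1 \<longrightarrow> diagonal_action a b \<zeta> F = F}\<rparr>"

text \<open>
  A point of \<open>Proj (S / I)\<close> is of type \<open>1/r(a,b)\<close> if the scheme is there locally the quotient of the
  plane by the group of \<open>r\<close>-th roots of unity acting with weights \<open>a\<close>, \<open>b\<close>.  Locally is taken in the
  formal sense: the completed local ring is isomorphic, as an algebra over the complex numbers, to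
  the completed local ring of that quotient at the origin, which is the ring of invariant power
  series.
\<close>

definition cyclic_quotient_point ::
    "('v \<Rightarrow> nat) \<Rightarrow> ('v, complex) mpoly set \<Rightarrow> ('v \<Rightarrow> complex) set \<Rightarrow> nat \<Rightarrow> nat \<Rightarrow> nat \<Rightarrow> bool" where
  "cyclic_quotient_point wt I p r a b \<longleftrightarrow>
     (let A = proj_stalk wt I p; m = the_maximal_ideal A in
      \<exists>\<phi> \<in> ring_iso (completion A m) (cyclic_invariants r a b).
        \<forall>c. \<phi> (completion_map A m (stalk_const wt I p c)) = fps_const (fps_const c))"

section \<open>The family of surfaces\<close>

datatype var = Vx0 | Vx1 | Vy | Vw | Vu0 | Vu1 | Vz | Vt

primrec weights :: "var \<Rightarrow> nat" where
  "weights Vx0 = 1" | "weights Vx1 = 1" | "weights Vy = 2" | "weights Vw = 3"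
| "weights Vu0 = 4" | "weights Vu1 = 4" | "weights Vz = 5" | "weights Vt = 7"

type_synonym S = "(var, complex) mpoly"

abbreviation S_ring :: "S ring" where
  "S_ring \<equiv> ring_of_type_algebra"

definition relations :: "complex \<Rightarrow> complex \<Rightarrow> S \<Rightarrow> S set" where
  "relations \<theta> \<tau> P =
    (let x0 = pvar Vx0; x1 = pvar Vx1; y = pvar Vy; w = pvar Vw; u0 = pvar Vu0; u1 = pvar Vu1;
         z = pvar Vz; t = pvar Vt; Q = pconst \<theta> * u1 * z + pconst \<tau> * w ^ 3 in
     {x0 * y - x1 ^ 3,
      x0 * w - x1 ^ 2 * y,
      x1 * w - y ^ 2,
      x0 * u1 - x1 * u0,
      x1 ^ 2 * u1 - y * u0,
      x1 * y * u1 - w * u0,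
      x0 * t - u0 ^ 2,
      x1 * t - u0 * u1,
      x1 * u1 ^ 2 - y * t,
      y * u1 ^ 2 - w * t,
      x0 * P + x1 ^ 2 * Q + u0 * t,
      x1 * P + y * Q + u1 * t,
      y * P + w * Q + u1 ^ 3,
      u0 * P + x1 * u1 * Q + t ^ 2})"

definition X'_ideal :: "complex \<Rightarrow> complex \<Rightarrow> S \<Rightarrow> S set" where
  "X'_ideal \<theta> \<tau> P = genideal S_ring (relations \<theta> \<tau> P)"

text \<open>
  The skew-symmetric matrix of size \<open>n\<close> whose \<open>i\<close>-th row to the right of the diagonal is the
  \<open>i\<close>-th list.  Rows and columns are indexed from \<open>0\<close>.
\<close>

definition skew_mat :: "nat \<Rightarrow> 'a::comm_ring_1 list list \<Rightarrow> 'a mat" where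
  "skew_mat n rs = mat n n (\<lambda>(i, j).
     if i < j then rs ! i ! (j - Suc i) else if j < i then - (rs ! j ! (i - Suc j)) else 0)"

definition sub_Pfaffians4 :: "'a::comm_ring_1 mat \<Rightarrow> 'a set" where
  "sub_Pfaffians4 A =
     {A $$ (i, j) * A $$ (k, l) - A $$ (i, k) * A $$ (j, l) + A $$ (i, l) * A $$ (j, k) | i j k l.
        i < j \<and> j < k \<and> k < l \<and> l < dim_row A}"

definition Pfaffian_matrix :: "complex \<Rightarrow> complex \<Rightarrow> S \<Rightarrow> S mat" where
  "Pfaffian_matrix \<theta> \<tau> P =
    (let x0 = pvar Vx0; x1 = pvar Vx1; y = pvar Vy; w = pvar Vw; u0 = pvar Vu0; u1 = pvar Vu1;
         z = pvar Vz; t = pvar Vt in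
     skew_mat 6
      [[0, 0, x0, x1 ^ 2, u0],
          [0, x1, y, u1],
             [u0, x1 * u1, t],
                 [t, - (pconst \<tau> * w ^ 3 + pconst \<theta> * u1 * z)],
                    [P]])"

definition V_vector :: "S vec" where
  "V_vector = vec_of_list [0, - (pvar Vu1 ^ 2), 0, pvar Vw, - pvar Vy, 0]"

definition Pfaffian_equations :: "complex \<Rightarrow> complex \<Rightarrow> S \<Rightarrow> S set" where
  "Pfaffian_equations \<theta> \<tau> P = sub_Pfaffians4 (Pfaffian_matrix \<theta> \<tau> P) \<union> set\<^sub>v (Pfaffian_matrix \<theta> \<tau> P *\<^sub>v V_vector)"

section \<open>General choices of the parameters\<close>

text \<open>
  The parameter space of the pairs \<open>(P, \<tau>)\<close>, where \<open>P = z\<^sup>2 + \<dots>\<close> is a form of degree \<open>10\<close>, is an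
  affine space with coordinates \<open>\<tau>\<close> and the coefficients of the monomials of degree \<open>10\<close> other
  than \<open>z\<^sup>2\<close>.
\<close>

definition parameter_space :: "(S \<times> complex) set" where
  "parameter_space =
     {(P, \<tau>). whomogeneous weights 10 P \<and> Poly_Mapping.lookup P (Poly_Mapping.single Vz 2) = 1}"

datatype coord = Coeff "var \<Rightarrow>\<^sub>0 nat" | Tau

primrec coord_value :: "S \<times> complex \<Rightarrow> coord \<Rightarrow> complex" where
  "coord_value q (Coeff m) = Poly_Mapping.lookup (fst q) m"
| "coord_value q Tau = snd q"

definition zariski_open :: "(S \<times> complex) set \<Rightarrow> bool" where
  "zariski_open U \<longleftrightarrow> (\<exists>G :: (coord, complex) mpoly set.
     U = {q \<in> parameter_space. \<exists>g\<in>G. peval (coord_value q) g \<noteq> 0})"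

definition for_general_parameters :: "(S \<Rightarrow> complex \<Rightarrow> bool) \<Rightarrow> bool" where
  "for_general_parameters Q \<longleftrightarrow> (\<exists>U. zariski_open U \<and> U \<noteq> {} \<and> (\<forall>(P, \<tau>) \<in> U. Q P \<tau>))"

end

theory Submission
  imports Defs "HOL-Library.Product_Lexorder"
begin

text \<open>
  In the charts \<open>x0 = 1\<close> and \<open>w = 1\<close> the surface \<open>X'\<close> is a hypersurface in a three-dimensional space.  For
  \<open>\<tau> \<noteq> 0\<close> the second one is regular outside the first, and the forms \<open>P\<close> for which the first one is
  singular lie on a hypersurface in the space of parameters, since they are parametrized by fewer coordinates.
  The local rings at the points of the charts have dimension at most two because the homogeneous
  coordinate ring grows quadratically, and at least two because of a curve through the point.

  The only point outside both charts is the coordinate point \<open>p\<close> of \<open>z\<close>.  There \<open>P\<close> is a unit, and with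
  \<open>T = - (t P + \<theta> z u1 ^ 3 + \<tau> w ^ 3 u1 ^ 2)\<close> the ideal contains \<open>w T - u1 ^ 5\<close>, while the other
  coordinates are determined by \<open>w\<close>, \<open>u1\<close>, \<open>T\<close>.  Putting \<open>w = s ^ 5\<close>, \<open>u1 = s t\<close>, \<open>T = t ^ 5\<close>, \<open>z = 1\<close>
  defines a homomorphism from the local ring to the power series in \<open>s\<close>, \<open>t\<close>, whose values only involve monomials
  \<open>s ^ p t ^ q\<close> with \<open>p + 14 q\<close> divisible by \<open>25\<close>.  These monomials are values themselves, and their
  preimages generate the maximal ideal, whence the homomorphism identifies the completion
  with the invariant power series.  Three of the monomials, \<open>s ^ 11 t\<close>, \<open>s ^ 8 t ^ 3\<close> and \<open>s ^ 5 t ^ 5\<close>,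
  are not products of others, so the maximal ideal needs more than two generators.
\<close>

section \<open>Substitution into polynomials\<close>

lemma poly_mapping_eq_sum_single:
  fixes f :: "'a \<Rightarrow>\<^sub>0 'b::comm_monoid_add"
  shows "f = (\<Sum>m\<in>Poly_Mapping.keys f. Poly_Mapping.single m (Poly_Mapping.lookup f m))"
proof (rule poly_mapping_eqI)
  fix k
  have "(\<Sum>m\<in>Poly_Mapping.keys f. Poly_Mapping.lookup (Poly_Mapping.single m (Poly_Mapping.lookup f m)) k)
      = (\<Sum>m\<in>Poly_Mapping.keys f. if k = m then Poly_Mapping.lookup f m else 0)"
    by (intro sum.cong) (auto simp: lookup_single)
  also have "\<dots> = Poly_Mapping.lookup f k" by (auto simp: in_keys_iff)
  finally show "Poly_Mapping.lookup f k = Poly_Mapping.lookup (\<Sum>m\<in>Poly_Mapping.keys f. Poly_Mapping.single m (Poly_Mapping.lookup f m)) k"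
    by (simp add: lookup_sum)
qed

definition meval :: "('v \<Rightarrow> 'r::comm_ring_1) \<Rightarrow> ('v \<Rightarrow>\<^sub>0 nat) \<Rightarrow> 'r" where
  "meval a m = (\<Prod>i\<in>Poly_Mapping.keys m. a i ^ Poly_Mapping.lookup m i)"

definition psubst :: "('k::comm_ring_1 \<Rightarrow> 'r::comm_ring_1) \<Rightarrow> ('v \<Rightarrow> 'r) \<Rightarrow> ('v, 'k) mpoly \<Rightarrow> 'r" where
  "psubst h a f = (\<Sum>m\<in>Poly_Mapping.keys f. h (Poly_Mapping.lookup f m) * meval a m)"

definition ishom :: "('k::comm_ring_1 \<Rightarrow> 'r::comm_ring_1) \<Rightarrow> bool" where
  "ishom h \<longleftrightarrow> h 0 = 0 \<and> h 1 = 1 \<and> (\<forall>x y. h (x + y) = h x + h y) \<and> (\<forall>x y. h (x * y) = h x * h y)"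

lemma ishomD:
  assumes "ishom h"
  shows "h 0 = 0" "h 1 = 1" "h (x + y) = h x + h y" "h (x * y) = h x * h y"
    "h (- x) = - h x" "h (x - y) = h x - h y" "h (x ^ n) = h x ^ n" "h (sum g A) = (\<Sum>i\<in>A. h (g i))"
    "h (prod g A) = (\<Prod>i\<in>A. h (g i))"
proof -
  show a: "h 0 = 0" "h 1 = 1" "\<And>x y. h (x + y) = h x + h y" "\<And>x y. h (x * y) = h x * h y"
    using assms by (auto simp: ishom_def)
  show b: "h (- x) = - h x" for x using a(1) a(3)[of x "-x"] by (simp add: eq_neg_iff_add_eq_0 add.commute)
  show "h (x - y) = h x - h y" using a(3)[of x "-y"] b by simp
  show "h (x ^ n) = h x ^ n" by (induction n) (auto simp: a)
  show "h (sum g A) = (\<Sum>i\<in>A. h (g i))" by (induction A rule: infinite_finite_induct) (auto simp: a)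
  show "h (prod g A) = (\<Prod>i\<in>A. h (g i))" by (induction A rule: infinite_finite_induct) (auto simp: a)
qed

lemma peval_eq_psubst: "peval a f = psubst (\<lambda>x. x) a f"
  by (simp add: peval_def psubst_def meval_def)

lemma ishom_id: "ishom (\<lambda>x. x)" by (simp add: ishom_def)

lemma ishom_comp: "ishom g \<Longrightarrow> ishom h \<Longrightarrow> ishom (\<lambda>x. g (h x))" by (simp add: ishom_def)

lemma meval_superset:
  assumes "finite A" "Poly_Mapping.keys m \<subseteq> A"
  shows "meval a m = (\<Prod>i\<in>A. a i ^ Poly_Mapping.lookup m i)"
  unfolding meval_def using assms by (intro prod.mono_neutral_left) (auto simp: in_keys_iff)

lemma meval_0 [simp]: "meval a 0 = 1" by (simp add: meval_def)

lemma meval_add: "meval a (m + n) = meval a m * meval a n"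
proof -
  let ?A = "Poly_Mapping.keys m \<union> Poly_Mapping.keys n"
  have "meval a (m + n) = (\<Prod>i\<in>?A. a i ^ Poly_Mapping.lookup (m + n) i)"
    using keys_add[of m n] by (intro meval_superset) auto
  also have "\<dots> = (\<Prod>i\<in>?A. a i ^ Poly_Mapping.lookup m i) * (\<Prod>i\<in>?A. a i ^ Poly_Mapping.lookup n i)"
    by (simp add: lookup_add power_add prod.distrib)
  also have "\<dots> = meval a m * meval a n"
    by (subst (1 2) meval_superset[of ?A]) auto
  finally show ?thesis .
qed

lemma meval_single [simp]: "meval a (Poly_Mapping.single i n) = a i ^ n"
  by (cases "n = 0") (auto simp: meval_def)

lemma psubst_superset:
  assumes "ishom h" "finite A" "Poly_Mapping.keys f \<subseteq> A"
  shows "psubst h a f = (\<Sum>m\<in>A. h (Poly_Mapping.lookup f m) * meval a m)"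
  unfolding psubst_def using assms by (intro sum.mono_neutral_left) (auto simp: in_keys_iff ishomD)

lemma psubst_add:
  assumes "ishom h"
  shows "psubst h a (f + g) = psubst h a f + psubst h a g"
proof -
  let ?A = "Poly_Mapping.keys f \<union> Poly_Mapping.keys g"
  have "psubst h a (f + g) = (\<Sum>m\<in>?A. h (Poly_Mapping.lookup (f + g) m) * meval a m)"
    using keys_add[of f g] assms by (intro psubst_superset) auto
  also have "\<dots> = (\<Sum>m\<in>?A. h (Poly_Mapping.lookup f m) * meval a m) + (\<Sum>m\<in>?A. h (Poly_Mapping.lookup g m) * meval a m)"
    by (simp add: lookup_add ishomD[OF assms] sum.distrib distrib_right)
  also have "\<dots> = psubst h a f + psubst h a g"
    using assms by (subst (1 2) psubst_superset[of h ?A]) auto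
  finally show ?thesis .
qed

lemma psubst_0 [simp]: "psubst h a 0 = 0" by (simp add: psubst_def)

lemma psubst_sum:
  assumes "ishom h"
  shows "psubst h a (sum f A) = (\<Sum>i\<in>A. psubst h a (f i))"
  by (induction A rule: infinite_finite_induct) (auto simp: psubst_add[OF assms])

lemma psubst_single: "ishom h \<Longrightarrow> psubst h a (Poly_Mapping.single m c) = h c * meval a m"
  by (auto simp: psubst_def ishomD)

lemma psubst_mult:
  assumes h: "ishom h"
  shows "psubst h a (f * g) = psubst h a f * psubst h a g"
proof -
  let ?s = "Poly_Mapping.single" and ?l = "Poly_Mapping.lookup"
  have "f * g = (\<Sum>m\<in>Poly_Mapping.keys f. ?s m (?l f m)) * (\<Sum>n\<in>Poly_Mapping.keys g. ?s n (?l g n))"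
    using poly_mapping_eq_sum_single[of f] poly_mapping_eq_sum_single[of g] by simp
  also have "\<dots> = (\<Sum>m\<in>Poly_Mapping.keys f. \<Sum>n\<in>Poly_Mapping.keys g. ?s (m + n) (?l f m * ?l g n))"
    by (simp add: sum_product mult_single)
  finally have "psubst h a (f * g) = (\<Sum>m\<in>Poly_Mapping.keys f. \<Sum>n\<in>Poly_Mapping.keys g. h (?l f m * ?l g n) * meval a (m + n))"
    by (simp add: psubst_sum[OF h] psubst_single[OF h])
  also have "\<dots> = psubst h a f * psubst h a g"
    by (simp add: psubst_def sum_product meval_add ishomD[OF h] mult_ac)
  finally show ?thesis .
qed

lemma psubst_pconst [simp]: "ishom h \<Longrightarrow> psubst h a (pconst c) = h c"
  by (simp add: pconst_def psubst_single)

lemma psubst_pvar [simp]: "ishom h \<Longrightarrow> psubst h a (pvar i) = a i"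
  by (simp add: pvar_def psubst_single ishomD)

lemma pconst_0: "pconst 0 = 0" by (simp add: pconst_def)

lemma pconst_1: "pconst 1 = 1" by (simp add: pconst_def)

lemma ishom_pconst: "ishom (pconst :: 'k::comm_ring_1 \<Rightarrow> ('v,'k) mpoly)"
  by (simp add: ishom_def pconst_def single_add mult_single)

lemma ishom_psubst: "ishom h \<Longrightarrow> ishom (psubst h a)"
  using psubst_pconst[of h a 1] unfolding ishom_def[of "psubst h a"] 
  by (auto simp: psubst_add psubst_mult pconst_1 ishomD)

lemmas psubst_simps = ishomD[OF ishom_psubst]

lemma ishom_peval: "ishom (peval a)"
  using ishom_psubst[OF ishom_id] by (simp add: peval_eq_psubst[abs_def])

lemma peval_simps [simp]:
  fixes f g :: "('v, 'k::comm_ring_1) mpoly"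
  shows "peval a (0 :: ('v,'k) mpoly) = 0" "peval a (1 :: ('v,'k) mpoly) = 1" "peval a (f + g) = peval a f + peval a g"
    "peval a (f * g) = peval a f * peval a g" "peval a (- f) = - peval a f"
    "peval a (f - g) = peval a f - peval a g" "peval a (f ^ n) = peval a f ^ n"
    "peval a (sum F A) = (\<Sum>i\<in>A. peval a (F i))" "peval a (prod F A) = (\<Prod>i\<in>A. peval a (F i))"
    "peval a (pconst c) = c" "peval a (pvar i) = a i"
  by (auto simp: ishomD[OF ishom_peval[of a]]) (auto simp: peval_eq_psubst ishom_id)

lemma peval_single: "peval a (Poly_Mapping.single m (c::'k::comm_ring_1)) = c * meval a m"
  by (simp add: peval_eq_psubst psubst_single ishom_id)

lemma single_add_one: "Poly_Mapping.single (m + n) (1::'k::comm_ring_1) = Poly_Mapping.single m 1 * Poly_Mapping.single n 1"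
  by (simp add: mult_single)

lemma single_eq_meval: "Poly_Mapping.single m (1::'k::comm_ring_1) = meval pvar m"
proof -
  have p: "Poly_Mapping.single (Poly_Mapping.single i n) (1::'k) = pvar i ^ n" for i :: 'a and n
  proof (induction n)
    case (Suc n)
    have "Poly_Mapping.single i (Suc n) = Poly_Mapping.single i 1 + Poly_Mapping.single i n"
      by (simp add: single_add[symmetric])
    then show ?case using Suc by (simp add: single_add_one pvar_def)
  qed simp
  have "Poly_Mapping.single (\<Sum>i\<in>A. Poly_Mapping.single i (Poly_Mapping.lookup m i)) (1::'k)
      = (\<Prod>i\<in>A. pvar i ^ Poly_Mapping.lookup m i)" if "finite A" for A
    using that by (induction A) (auto simp: single_add_one p)
  from this[of "Poly_Mapping.keys m"] show ?thesis
    using poly_mapping_eq_sum_single[of m] by (simp add: meval_def)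
qed

lemma mpoly_induct [case_names const var add mult]:
  fixes f :: "('v, 'k::comm_ring_1) mpoly"
  assumes c: "\<And>c. Q (pconst c)" and v: "\<And>i. Q (pvar i)"
    and a: "\<And>f g. Q f \<Longrightarrow> Q g \<Longrightarrow> Q (f + g)" and m: "\<And>f g. Q f \<Longrightarrow> Q g \<Longrightarrow> Q (f * g)"
  shows "Q f"
proof -
  have 1: "Q 1" using c[of 1] by (simp add: pconst_1)
  have 0: "Q 0" using c[of 0] by (simp add: pconst_0)
  have pw: "Q (g ^ n)" if "Q g" for g n using that by (induction n) (auto simp: 1 m)
  have pr: "Q (\<Prod>i\<in>A. F i)" if "\<And>i. Q (F i)" for A :: "'v set" and F using that by (induction A rule: infinite_finite_induct) (auto simp: 1 m)
  have s: "Q (\<Sum>i\<in>A. F i)" if "\<And>i. Q (F i)" for A :: "('v \<Rightarrow>\<^sub>0 nat) set" and F using that by (induction A rule: infinite_finite_induct) (auto simp: 0 a)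
  have mon: "Q (Poly_Mapping.single n c)" for n c
  proof -
    have "Poly_Mapping.single n c = pconst c * Poly_Mapping.single n 1" by (simp add: pconst_def mult_single)
    moreover have "Q (Poly_Mapping.single n 1)" unfolding single_eq_meval meval_def by (intro pr pw v)
    ultimately show ?thesis using c m by metis
  qed
  show ?thesis by (subst poly_mapping_eq_sum_single) (intro s mon)
qed

lemma psubst_natural:
  assumes "ishom \<eta>" "ishom h"
  shows "\<eta> (psubst h a f) = psubst (\<lambda>c. \<eta> (h c)) (\<lambda>i. \<eta> (a i)) f"
  by (induction f rule: mpoly_induct)
    (auto simp: assms ishom_comp psubst_add psubst_mult ishomD[OF assms(1)])

section \<open>Ideals\<close>

definition pideal :: "'r::comm_ring_1 set \<Rightarrow> bool" where
  "pideal I \<longleftrightarrow> 0 \<in> I \<and> (\<forall>f\<in>I. \<forall>g\<in>I. f + g \<in> I) \<and> (\<forall>h. \<forall>f\<in>I. h * f \<in> I)"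

lemma pidealD:
  assumes "pideal I"
  shows "0 \<in> I" "f \<in> I \<Longrightarrow> g \<in> I \<Longrightarrow> f + g \<in> I" "f \<in> I \<Longrightarrow> h * f \<in> I" "f \<in> I \<Longrightarrow> f * h \<in> I"
    "f \<in> I \<Longrightarrow> - f \<in> I" "f \<in> I \<Longrightarrow> g \<in> I \<Longrightarrow> f - g \<in> I"
proof -
  show a: "0 \<in> I" "\<And>f g. f \<in> I \<Longrightarrow> g \<in> I \<Longrightarrow> f + g \<in> I" "\<And>f h. f \<in> I \<Longrightarrow> h * f \<in> I"
    using assms by (auto simp: pideal_def)
  then show "f \<in> I \<Longrightarrow> f * h \<in> I" for f h by (metis mult.commute)
  show b: "f \<in> I \<Longrightarrow> - f \<in> I" for f using a(3)[of f "-1"] by simp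
  show "f \<in> I \<Longrightarrow> g \<in> I \<Longrightarrow> f - g \<in> I" using a(2)[of f "-g"] b by simp
qed

lemma pideal_sum: "pideal I \<Longrightarrow> (\<And>i. i \<in> A \<Longrightarrow> f i \<in> I) \<Longrightarrow> sum f A \<in> I"
  by (induction A rule: infinite_finite_induct) (auto simp: pidealD)

lemma cring_type: "cring (ring_of_type_algebra :: 'r::comm_ring_1 ring)"
  by (rule cring_from_type_algebra)

lemma ring_type_simps [simp]:
  "carrier (ring_of_type_algebra :: 'r::comm_ring_1 ring) = UNIV"
  "monoid.mult (ring_of_type_algebra :: 'r::comm_ring_1 ring) = (*)"
  "monoid.one (ring_of_type_algebra :: 'r::comm_ring_1 ring) = 1"
  "ring.zero (ring_of_type_algebra :: 'r::comm_ring_1 ring) = 0"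
  "ring.add (ring_of_type_algebra :: 'r::comm_ring_1 ring) = (+)"
  by (simp_all add: ring_of_type_algebra_def)

lemma ideal_type_iff: "ideal I (ring_of_type_algebra :: 'r::comm_ring_1 ring) \<longleftrightarrow> pideal I"
proof
  interpret cring "ring_of_type_algebra :: 'r ring" by (rule cring_type)
  assume I: "ideal I (ring_of_type_algebra :: 'r ring)"
  interpret ideal I "ring_of_type_algebra :: 'r ring" by (rule I)
  show "pideal I" unfolding pideal_def
    using additive_subgroup.zero_closed[OF is_additive_subgroup] additive_subgroup.a_closed[OF is_additive_subgroup] I_l_closed by auto
next
  interpret cring "ring_of_type_algebra :: 'r ring" by (rule cring_type)
  assume I: "pideal I"
  show "ideal I (ring_of_type_algebra :: 'r ring)"
  proof (rule idealI)
    show "Ring.ring (ring_of_type_algebra :: 'r ring)" by (rule ring_axioms)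
    show "subgroup I (add_monoid (ring_of_type_algebra :: 'r ring))"
    proof (rule add.subgroupI)
      show "\<And>a. a \<in> I \<Longrightarrow> \<ominus>\<^bsub>ring_of_type_algebra\<^esub> a \<in> I"
      proof -
        fix a assume a: "a \<in> I"
        have "\<ominus>\<^bsub>ring_of_type_algebra\<^esub> a = - a"
          by (rule minus_equality) auto
        then show "\<ominus>\<^bsub>ring_of_type_algebra\<^esub> a \<in> I" using pidealD(5)[OF I a] by simp
      qed
    qed (use pidealD[OF I] in auto)
  qed (use pidealD[OF I] in auto)
qed

definition pgen :: "'r::comm_ring_1 set \<Rightarrow> 'r set" where
  "pgen G = genideal ring_of_type_algebra G"

lemma pideal_pgen: "pideal (pgen G)"
  unfolding pgen_def ideal_type_iff[symmetric]
  by (rule ring.genideal_ideal[OF cring.axioms(1)[OF cring_type]]) simp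

lemma pgen_superset: "G \<subseteq> pgen G"
  unfolding pgen_def by (rule ring.genideal_self[OF cring.axioms(1)[OF cring_type]]) simp

lemma pgen_minimal: "pideal J \<Longrightarrow> G \<subseteq> J \<Longrightarrow> pgen G \<subseteq> J"
  unfolding pgen_def by (rule ring.genideal_minimal[OF cring.axioms(1)[OF cring_type]]) (auto simp: ideal_type_iff)

lemma pgen_mono: "G \<subseteq> H \<Longrightarrow> pgen G \<subseteq> pgen H"
  using pgen_minimal[OF pideal_pgen, of G H] pgen_superset[of H] by blast

lemma pgen_finite_sum:
  assumes "f \<in> pgen G"
  shows "\<exists>F h. finite F \<and> F \<subseteq> G \<and> f = (\<Sum>g\<in>F. h g * g)"
proof -
  let ?J = "{f. \<exists>F h. finite F \<and> F \<subseteq> G \<and> f = (\<Sum>g\<in>F. h g * g)}"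
  have ext: "(\<Sum>g\<in>F. h g * g) = (\<Sum>g\<in>F'. (if g \<in> F then h g else 0) * g)" if "finite F'" "F \<subseteq> F'" for F F' :: "'a set" and h
  proof -
    have "(\<Sum>g\<in>F'. (if g \<in> F then h g else 0) * g) = (\<Sum>g\<in>F. (if g \<in> F then h g else 0) * g)"
      using that by (intro sum.mono_neutral_right) auto
    then show ?thesis by simp
  qed
  have "pideal ?J" unfolding pideal_def
  proof (intro conjI ballI allI)
    show "0 \<in> ?J" by (auto intro!: exI[of _ "{}"])
  next
    fix f g assume "f \<in> ?J" "g \<in> ?J"
    then obtain F h F' h' where *: "finite F" "F \<subseteq> G" "f = (\<Sum>g\<in>F. h g * g)" "finite F'" "F' \<subseteq> G" "g = (\<Sum>g\<in>F'. h' g * g)"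
      by blast
    have "f + g = (\<Sum>x\<in>F\<union>F'. ((if x \<in> F then h x else 0) + (if x \<in> F' then h' x else 0)) * x)"
      using ext[of "F \<union> F'" F h] ext[of "F \<union> F'" F' h'] * by (simp add: distrib_right sum.distrib)
    then show "f + g \<in> ?J" using * by (intro CollectI exI[of _ "F \<union> F'"] exI[of _ "\<lambda>x. (if x \<in> F then h x else 0) + (if x \<in> F' then h' x else 0)"]) auto
  next
    fix h' f assume "f \<in> ?J"
    then obtain F h where *: "finite F" "F \<subseteq> G" "f = (\<Sum>g\<in>F. h g * g)" by blast
    then have "h' * f = (\<Sum>g\<in>F. (h' * h g) * g)" by (simp add: sum_distrib_left mult_ac)
    then show "h' * f \<in> ?J" using * by (intro CollectI exI[of _ F] exI[of _ "\<lambda>g. h' * h g"]) auto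
  qed
  moreover have "G \<subseteq> ?J"
  proof
    fix g assume "g \<in> G"
    then show "g \<in> ?J" by (intro CollectI exI[of _ "{g}"] exI[of _ "\<lambda>_. 1"]) auto
  qed
  ultimately show ?thesis using pgen_minimal[of ?J G] assms by blast
qed

section \<open>Homogeneous components\<close>

lemma wdegree_superset:
  assumes "finite A" "Poly_Mapping.keys m \<subseteq> A"
  shows "wdegree wt m = (\<Sum>i\<in>A. wt i * Poly_Mapping.lookup m i)"
  unfolding wdegree_def using assms by (intro sum.mono_neutral_left) (auto simp: in_keys_iff)

lemma wdegree_add: "wdegree wt (m + n) = wdegree wt m + wdegree wt n"
proof -
  let ?A = "Poly_Mapping.keys m \<union> Poly_Mapping.keys n"
  have "wdegree wt (m + n) = (\<Sum>i\<in>?A. wt i * Poly_Mapping.lookup (m + n) i)"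
    using keys_add[of m n] by (intro wdegree_superset) auto
  also have "\<dots> = wdegree wt m + wdegree wt n"
    by (subst (1 2) wdegree_superset[of ?A]) (auto simp: lookup_add distrib_left sum.distrib)
  finally show ?thesis .
qed

lemma wdegree_0 [simp]: "wdegree wt 0 = 0" by (simp add: wdegree_def)

lemma wdegree_single [simp]: "wdegree wt (Poly_Mapping.single i n) = wt i * n"
  by (cases "n = 0") (auto simp: wdegree_def)

lemma whom_0 [simp]: "whomogeneous wt d 0" by (simp add: whomogeneous_def)

lemma whom_add: "whomogeneous wt d f \<Longrightarrow> whomogeneous wt d g \<Longrightarrow> whomogeneous wt d (f + g)"
  using keys_add[of f g] by (auto simp: whomogeneous_def)

lemma whom_sum: "(\<And>i. i \<in> A \<Longrightarrow> whomogeneous wt d (f i)) \<Longrightarrow> whomogeneous wt d (sum f A)"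
  by (induction A rule: infinite_finite_induct) (auto simp: whom_add)

lemma whom_mult: "whomogeneous wt d f \<Longrightarrow> whomogeneous wt e g \<Longrightarrow> whomogeneous wt (d + e) (f * g)"
  using keys_mult[of f g] by (fastforce simp: whomogeneous_def wdegree_add)

lemma whom_pconst: "whomogeneous wt 0 (pconst c)"
  by (auto simp: whomogeneous_def pconst_def)

lemma whom_1: "whomogeneous wt 0 (1 :: ('v,'k::comm_ring_1) mpoly)"
  by (auto simp: whomogeneous_def)

lemma whom_pvar: "whomogeneous wt (wt i) (pvar i)"
  by (auto simp: whomogeneous_def pvar_def)

lemma whom_single: "wdegree wt m = d \<Longrightarrow> whomogeneous wt d (Poly_Mapping.single m c)"
  by (auto simp: whomogeneous_def)

lemma whom_uminus: "whomogeneous wt d (f :: ('v,'k::comm_ring_1) mpoly) \<Longrightarrow> whomogeneous wt d (- f)"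
  by (auto simp: whomogeneous_def in_keys_iff)

lemma whom_diff: "whomogeneous wt d (f :: ('v,'k::comm_ring_1) mpoly) \<Longrightarrow> whomogeneous wt d g \<Longrightarrow> whomogeneous wt d (f - g)"
  using whom_add[of wt d f "-g"] by (simp add: whom_uminus)

lemma whom_power: "whomogeneous wt d (f :: ('v,'k::comm_ring_1) mpoly) \<Longrightarrow> whomogeneous wt (d * n) (f ^ n)"
  by (induction n) (auto simp: whom_1 whom_mult)

definition hcomp :: "('v \<Rightarrow> nat) \<Rightarrow> nat \<Rightarrow> ('v, 'k::comm_ring_1) mpoly \<Rightarrow> ('v, 'k) mpoly" where
  "hcomp wt d f = (\<Sum>m\<in>{m \<in> Poly_Mapping.keys f. wdegree wt m = d}. Poly_Mapping.single m (Poly_Mapping.lookup f m))"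

lemma lookup_hcomp: "Poly_Mapping.lookup (hcomp wt d f) m = (if wdegree wt m = d then Poly_Mapping.lookup f m else 0)"
proof -
  have "Poly_Mapping.lookup (hcomp wt d f) m = (\<Sum>m'\<in>{m \<in> Poly_Mapping.keys f. wdegree wt m = d}. if m = m' then Poly_Mapping.lookup f m' else 0)"
    unfolding hcomp_def lookup_sum by (intro sum.cong) (auto simp: lookup_single)
  then show ?thesis by (auto simp: in_keys_iff)
qed

lemma whom_hcomp: "whomogeneous wt d (hcomp wt d f)"
  by (auto simp: whomogeneous_def in_keys_iff lookup_hcomp split: if_splits)

lemma hcomp_add: "hcomp wt d (f + g) = hcomp wt d f + hcomp wt d g"
  by (rule poly_mapping_eqI) (simp add: lookup_hcomp lookup_add)

lemma hcomp_diff: "hcomp wt d (f - g) = hcomp wt d f - hcomp wt d g"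
  by (rule poly_mapping_eqI) (simp add: lookup_hcomp lookup_minus)

lemma hcomp_0 [simp]: "hcomp wt d 0 = 0"
  by (rule poly_mapping_eqI) (simp add: lookup_hcomp)

lemma hcomp_sum: "hcomp wt d (sum f A) = (\<Sum>i\<in>A. hcomp wt d (f i))"
  by (induction A rule: infinite_finite_induct) (auto simp: hcomp_add)

lemma hcomp_whom: "whomogeneous wt e f \<Longrightarrow> hcomp wt d f = (if d = e then f else 0)"
  by (rule poly_mapping_eqI) (auto simp: lookup_hcomp whomogeneous_def in_keys_iff)

definition wbound :: "('v \<Rightarrow> nat) \<Rightarrow> ('v, 'k::comm_ring_1) mpoly \<Rightarrow> nat" where
  "wbound wt f = (\<Sum>m\<in>Poly_Mapping.keys f. wdegree wt m)"

lemma sum_hcomp: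
  assumes "wbound wt f \<le> N"
  shows "f = (\<Sum>d\<le>N. hcomp wt d f)"
proof (rule poly_mapping_eqI)
  fix m
  have "Poly_Mapping.lookup (\<Sum>d\<le>N. hcomp wt d f) m = (\<Sum>d\<le>N. if wdegree wt m = d then Poly_Mapping.lookup f m else 0)"
    by (simp add: lookup_sum lookup_hcomp)
  also have "\<dots> = (if wdegree wt m \<le> N then Poly_Mapping.lookup f m else 0)" by simp
  also have "\<dots> = Poly_Mapping.lookup f m"
  proof (cases "m \<in> Poly_Mapping.keys f")
    case True
    then have "wdegree wt m \<le> wbound wt f" unfolding wbound_def by (intro member_le_sum) auto
    then show ?thesis using assms by simp
  qed (simp add: in_keys_iff)
  finally show "Poly_Mapping.lookup f m = Poly_Mapping.lookup (\<Sum>d\<le>N. hcomp wt d f) m" by simp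
qed

lemma hcomp_eq_0: "wbound wt f < d \<Longrightarrow> hcomp wt d f = 0"
proof (rule poly_mapping_eqI)
  fix m assume d: "wbound wt f < d"
  show "Poly_Mapping.lookup (hcomp wt d f) m = Poly_Mapping.lookup 0 m"
  proof (cases "m \<in> Poly_Mapping.keys f")
    case True
    then have "wdegree wt m \<le> wbound wt f" unfolding wbound_def by (intro member_le_sum) auto
    then show ?thesis using d by (simp add: lookup_hcomp)
  qed (simp add: in_keys_iff lookup_hcomp)
qed

lemma hcomp_mult:
  assumes "whomogeneous wt e f"
  shows "hcomp wt d (h * f) = (if e \<le> d then hcomp wt (d - e) h * f else 0)"
proof -
  let ?N = "wbound wt h + d"
  have "hcomp wt d (h * f) = hcomp wt d ((\<Sum>k\<le>?N. hcomp wt k h) * f)"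
    using sum_hcomp[of wt h ?N] by simp
  also have "\<dots> = (\<Sum>k\<le>?N. hcomp wt d (hcomp wt k h * f))" by (simp add: sum_distrib_right hcomp_sum)
  also have "\<dots> = (\<Sum>k\<le>?N. if d = k + e then hcomp wt k h * f else 0)"
    by (intro sum.cong refl hcomp_whom whom_mult whom_hcomp assms)
  also have "\<dots> = (\<Sum>k\<le>?N. if k = d - e then (if e \<le> d then hcomp wt (d - e) h * f else 0) else 0)"
    by (intro sum.cong) auto
  also have "\<dots> = (if e \<le> d then hcomp wt (d - e) h * f else 0)" by (simp add: sum.delta trans_le_add2)
  finally show ?thesis .
qed

definition hideal :: "('v \<Rightarrow> nat) \<Rightarrow> ('v, 'k::comm_ring_1) mpoly set \<Rightarrow> bool" where
  "hideal wt I \<longleftrightarrow> pideal I \<and> (\<forall>f\<in>I. \<forall>d. hcomp wt d f \<in> I)"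

lemma hideal_pgen:
  assumes "\<And>g. g \<in> G \<Longrightarrow> \<exists>e. whomogeneous wt e g"
  shows "hideal wt (pgen G)"
proof -
  have "hcomp wt d f \<in> pgen G" if "f \<in> pgen G" for f d
  proof -
    obtain F h where *: "finite F" "F \<subseteq> G" "f = (\<Sum>g\<in>F. h g * g)" using pgen_finite_sum[OF \<open>f \<in> pgen G\<close>] by blast
    have "hcomp wt d f = (\<Sum>g\<in>F. hcomp wt d (h g * g))" by (simp add: * hcomp_sum)
    also have "\<dots> \<in> pgen G"
    proof (intro pideal_sum[OF pideal_pgen])
      fix g assume g: "g \<in> F"
      then obtain e where e: "whomogeneous wt e g" using assms * by blast
      have "g \<in> pgen G" using g * pgen_superset[of G] by blast
      then show "hcomp wt d (h g * g) \<in> pgen G"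
        by (auto simp: hcomp_mult[OF e] pidealD[OF pideal_pgen])
    qed
    finally show ?thesis .
  qed
  then show ?thesis by (simp add: hideal_def pideal_pgen)
qed

lemma peval_scale:
  fixes a :: "'v \<Rightarrow> 'k::comm_ring_1"
  assumes "whomogeneous wt d f"
  shows "peval (\<lambda>i. c ^ wt i * a i) f = c ^ d * peval a f"
proof -
  have "meval (\<lambda>i. c ^ wt i * a i) m = c ^ wdegree wt m * meval a m" for m
    by (simp add: meval_def wdegree_def power_mult_distrib prod.distrib power_sum power_mult)
  then have "peval (\<lambda>i. c ^ wt i * a i) f = (\<Sum>m\<in>Poly_Mapping.keys f. Poly_Mapping.lookup f m * (c ^ wdegree wt m * meval a m))"
    by (simp add: peval_eq_psubst psubst_def)
  also have "\<dots> = (\<Sum>m\<in>Poly_Mapping.keys f. Poly_Mapping.lookup f m * (c ^ d * meval a m))"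
    using assms by (intro sum.cong) (auto simp: whomogeneous_def)
  also have "\<dots> = c ^ d * peval a f"
    by (simp add: peval_eq_psubst psubst_def sum_distrib_left mult_ac)
  finally show ?thesis .
qed

section \<open>Linear and algebraic dependence by counting\<close>

lemma linear_dependence:
  fixes c :: "'i \<Rightarrow> 'b \<Rightarrow> 'k::field"
  assumes "finite B" "finite J" "card B < card J"
  shows "\<exists>l. (\<exists>i\<in>J. l i \<noteq> 0) \<and> (\<forall>b\<in>B. (\<Sum>i\<in>J. l i * c i b) = 0)"
  using assms
proof (induction B arbitrary: J c rule: finite_induct)
  case empty
  then obtain i where "i \<in> J" by fastforce
  then show ?case by (intro exI[of _ "\<lambda>_. 1"]) auto
next
  case (insert b B)
  show ?case
  proof (cases "\<forall>i\<in>J. c i b = 0")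
    case True
    obtain l where "\<exists>i\<in>J. l i \<noteq> 0" "\<forall>b\<in>B. (\<Sum>i\<in>J. l i * c i b) = 0"
      using insert.IH[of J c] insert.prems insert.hyps by auto
    with True show ?thesis by (intro exI[of _ l]) auto
  next
    case False
    then obtain i0 where i0: "i0 \<in> J" "c i0 b \<noteq> 0" by blast
    define J' where "J' = J - {i0}"
    define c' where "c' i x = c i x - c i b / c i0 b * c i0 x" for i x
    have J': "finite J'" "i0 \<notin> J'" "J = insert i0 J'" using i0 insert.prems by (auto simp: J'_def)
    then have "card B < card J'" using insert.prems insert.hyps by simp
    then obtain l where l: "\<exists>i\<in>J'. l i \<noteq> 0" "\<forall>b\<in>B. (\<Sum>i\<in>J'. l i * c' i b) = 0"
      using insert.IH[of J' c'] J' by blast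
    define l' where "l' = l(i0 := - (\<Sum>i\<in>J'. l i * c i b) / c i0 b)"
    have s: "(\<Sum>i\<in>J. l' i * c i x) = - (\<Sum>i\<in>J'. l i * c i b) / c i0 b * c i0 x + (\<Sum>i\<in>J'. l i * c i x)" for x
    proof -
      have "(\<Sum>i\<in>J'. l' i * c i x) = (\<Sum>i\<in>J'. l i * c i x)"
        using J' by (intro sum.cong) (auto simp: l'_def)
      then show ?thesis using J' by (simp add: l'_def)
    qed
    have "(\<Sum>i\<in>J. l' i * c i b) = 0" using i0 by (simp add: s)
    moreover have "(\<Sum>i\<in>J. l' i * c i x) = 0" if "x \<in> B" for x
    proof -
      have "0 = (\<Sum>i\<in>J'. l i * c i x - (l i * c i b) * (c i0 x / c i0 b))"
        using l(2)[rule_format, OF \<open>x \<in> B\<close>] by (simp add: c'_def right_diff_distrib mult_ac)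
      also have "\<dots> = (\<Sum>i\<in>J'. l i * c i x) - (\<Sum>i\<in>J'. l i * c i b) * (c i0 x / c i0 b)"
        by (simp only: sum_subtractf sum_distrib_right)
      finally show ?thesis by (simp add: s)
    qed
    moreover have "\<exists>i\<in>J. l' i \<noteq> 0" using l(1) J' by (auto simp: l'_def)
    ultimately show ?thesis by (intro exI[of _ l']) auto
  qed
qed

definition box :: "'v set \<Rightarrow> nat \<Rightarrow> ('v \<Rightarrow>\<^sub>0 nat) set" where
  "box V E = {m. Poly_Mapping.keys m \<subseteq> V \<and> (\<forall>i. Poly_Mapping.lookup m i \<le> E)}"

lemma box_card:
  assumes "finite V"
  shows "finite (box V E)" "card (box V E) = (E + 1) ^ card V"
proof -
  let ?r = "\<lambda>m. restrict (Poly_Mapping.lookup m) V"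
  have "bij_betw ?r (box V E) (PiE V (\<lambda>_. {..E}))"
  proof (rule bij_betwI[where g = "\<lambda>f. Abs_poly_mapping (\<lambda>i. if i \<in> V then f i else 0)"])
    have fin: "finite {x. (if x \<in> V then f x else 0) \<noteq> (0::nat)}" for f
      by (rule finite_subset[OF _ assms]) auto
    have look: "Poly_Mapping.lookup (Abs_poly_mapping (\<lambda>i. if i \<in> V then f i else (0::nat))) = (\<lambda>i. if i \<in> V then f i else 0)" for f
      by (rule lookup_Abs_poly_mapping) (rule fin)
    show "?r \<in> box V E \<rightarrow> PiE V (\<lambda>_. {..E})" by (auto simp: box_def)
    show "(\<lambda>f. Abs_poly_mapping (\<lambda>i. if i \<in> V then f i else 0)) \<in> PiE V (\<lambda>_. {..E}) \<rightarrow> box V E"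
      by (auto simp: box_def look in_keys_iff split: if_splits)
    show "Abs_poly_mapping (\<lambda>i. if i \<in> V then ?r m i else 0) = m" if "m \<in> box V E" for m
    proof (rule poly_mapping_eqI)
      fix k show "Poly_Mapping.lookup (Abs_poly_mapping (\<lambda>i. if i \<in> V then ?r m i else 0)) k = Poly_Mapping.lookup m k"
        using \<open>m \<in> box V E\<close> by (auto simp: look box_def in_keys_iff)
    qed
    show "?r (Abs_poly_mapping (\<lambda>i. if i \<in> V then f i else 0)) = f" if "f \<in> PiE V (\<lambda>_. {..E})" for f
    proof
      fix k show "?r (Abs_poly_mapping (\<lambda>i. if i \<in> V then f i else 0)) k = f k"
        using \<open>f \<in> PiE V (\<lambda>_. {..E})\<close> by (simp add: look restrict_def PiE_def extensional_def)
    qed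
  qed
  moreover have "finite (PiE V (\<lambda>_. {..E}))" using assms by (intro finite_PiE) auto
  moreover have "card (PiE V (\<lambda>_. {..E})) = (E + 1) ^ card V" using assms by (simp add: card_PiE)
  ultimately show "finite (box V E)" "card (box V E) = (E + 1) ^ card V"
    by (simp_all add: bij_betw_finite bij_betw_same_card)
qed

lemma box_mono: "E \<le> E' \<Longrightarrow> box V E \<subseteq> box V E'"
  by (auto simp: box_def intro: order_trans)

lemma keys_box_mult:
  assumes "Poly_Mapping.keys f \<subseteq> box V E" "Poly_Mapping.keys g \<subseteq> box V E'"
  shows "Poly_Mapping.keys (f * g) \<subseteq> box V (E + E')"
proof
  fix m assume "m \<in> Poly_Mapping.keys (f * g)"
  then obtain a b where ab: "m = a + b" "a \<in> Poly_Mapping.keys f" "b \<in> Poly_Mapping.keys g"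
    using keys_mult[of f g] by auto
  then have ab2: "a \<in> box V E" "b \<in> box V E'" using assms by auto
  then show "m \<in> box V (E + E')" using keys_add[of a b] by (auto simp: ab box_def lookup_add add_mono)
qed

lemma keys_box_1: "Poly_Mapping.keys (1 :: ('v,'k::comm_ring_1) mpoly) \<subseteq> box V E"
  by (simp add: box_def)

lemma keys_box_power:
  fixes f :: "('v, 'k::comm_ring_1) mpoly"
  assumes "Poly_Mapping.keys f \<subseteq> box V E"
  shows "Poly_Mapping.keys (f ^ n) \<subseteq> box V (n * E)"
proof (induction n)
  case 0
  then show ?case using keys_box_1 by simp
next
  case (Suc n)
  then show ?case using keys_box_mult[OF assms Suc] by simp
qed

lemma keys_box_prod:
  fixes f :: "'i \<Rightarrow> ('v, 'k::comm_ring_1) mpoly"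
  assumes "\<And>i. i \<in> A \<Longrightarrow> Poly_Mapping.keys (f i) \<subseteq> box V E"
  shows "Poly_Mapping.keys (prod f A) \<subseteq> box V (card A * E)"
  using assms
proof (induction A rule: infinite_finite_induct)
  case (insert x A)
  have "Poly_Mapping.keys (f x * prod f A) \<subseteq> box V (E + card A * E)"
    using insert by (intro keys_box_mult) auto
  then show ?case using insert.hyps by simp
qed (use keys_box_1 in auto)

lemma lookup_single_mult:
  fixes g :: "('v, 'k::comm_ring_1) mpoly"
  shows "Poly_Mapping.lookup (Poly_Mapping.single s c * g) (s + n) = c * Poly_Mapping.lookup g n"
proof -
  have "Poly_Mapping.single s c * g = (\<Sum>k\<in>Poly_Mapping.keys g. Poly_Mapping.single (s + k) (c * Poly_Mapping.lookup g k))"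
    by (subst poly_mapping_eq_sum_single[of g]) (simp add: sum_distrib_left mult_single)
  then have "Poly_Mapping.lookup (Poly_Mapping.single s c * g) (s + n)
      = (\<Sum>k\<in>Poly_Mapping.keys g. if k = n then c * Poly_Mapping.lookup g k else 0)"
    by (simp add: lookup_sum lookup_single when_def)
  then show ?thesis by (simp add: in_keys_iff)
qed

theorem algebraic_dependence:
  fixes \<phi> :: "'j \<Rightarrow> ('v, 'k::field) mpoly"
  assumes V: "finite V" and J: "finite J" and VJ: "card V < card J"
    and \<phi>: "\<And>j m. j \<in> J \<Longrightarrow> m \<in> Poly_Mapping.keys (\<phi> j) \<Longrightarrow> Poly_Mapping.keys m \<subseteq> V"
  shows "\<exists>G :: ('j, 'k) mpoly. G \<noteq> 0 \<and> (\<forall>m\<in>Poly_Mapping.keys G. Poly_Mapping.keys m \<subseteq> J) \<and> psubst pconst \<phi> G = 0"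
proof -
  define d where "d = (\<Sum>j\<in>J. \<Sum>m\<in>Poly_Mapping.keys (\<phi> j). \<Sum>i\<in>Poly_Mapping.keys m. Poly_Mapping.lookup m i)"
  have le_d: "Poly_Mapping.lookup m i \<le> d" if "j \<in> J" "m \<in> Poly_Mapping.keys (\<phi> j)" for j m i
  proof (cases "i \<in> Poly_Mapping.keys m")
    case True
    then have "Poly_Mapping.lookup m i \<le> (\<Sum>i\<in>Poly_Mapping.keys m. Poly_Mapping.lookup m i)" by (intro member_le_sum) auto
    also have "\<dots> \<le> (\<Sum>m\<in>Poly_Mapping.keys (\<phi> j). \<Sum>i\<in>Poly_Mapping.keys m. Poly_Mapping.lookup m i)"
      using that by (intro member_le_sum) auto
    also have "\<dots> \<le> d" unfolding d_def using that J by (intro member_le_sum) auto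
    finally show ?thesis .
  qed (simp add: in_keys_iff)
  then have kd: "Poly_Mapping.keys (\<phi> j) \<subseteq> box V d" if "j \<in> J" for j
    unfolding box_def using \<phi>[OF that] le_d[OF that] by blast
  define K where "K = card J * d + 1"
  define n where "n = K ^ card V"
  define E where "E = card J * (n * d)"
  have count: "card (box V E) < card (box J n)"
  proof -
    have "E + 1 \<le> K * (n + 1)" by (simp add: E_def K_def algebra_simps)
    then have "(E + 1) ^ card V \<le> (K * (n + 1)) ^ card V" by (rule power_mono) simp
    also have "\<dots> = n * (n + 1) ^ card V" by (simp only: power_mult_distrib n_def)
    also have "\<dots> < (n + 1) ^ Suc (card V)" by simp
    also have "\<dots> \<le> (n + 1) ^ card J" using VJ by (intro power_increasing) auto
    finally show ?thesis by (simp add: box_card V J)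
  qed
  have kE: "Poly_Mapping.keys (meval \<phi> m) \<subseteq> box V E" if "m \<in> box J n" for m
  proof -
    have m: "Poly_Mapping.keys m \<subseteq> J" "\<And>i. Poly_Mapping.lookup m i \<le> n" using that by (auto simp: box_def)
    have e: "meval \<phi> m = (\<Prod>i\<in>J. \<phi> i ^ Poly_Mapping.lookup m i)" by (rule meval_superset) (use m J in auto)
    show ?thesis unfolding e E_def
    proof (rule keys_box_prod)
      fix j assume j: "j \<in> J"
      have "Poly_Mapping.keys (\<phi> j ^ Poly_Mapping.lookup m j) \<subseteq> box V (Poly_Mapping.lookup m j * d)"
        by (rule keys_box_power[OF kd[OF j]])
      also have "\<dots> \<subseteq> box V (n * d)" by (intro box_mono mult_right_mono m) simp
      finally show "Poly_Mapping.keys (\<phi> j ^ Poly_Mapping.lookup m j) \<subseteq> box V (n * d)" .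
    qed
  qed
  obtain l where l: "\<exists>m\<in>box J n. l m \<noteq> 0" "\<forall>b\<in>box V E. (\<Sum>m\<in>box J n. l m * Poly_Mapping.lookup (meval \<phi> m) b) = 0"
    using linear_dependence[OF box_card(1)[OF V] box_card(1)[OF J] count, of "\<lambda>m b. Poly_Mapping.lookup (meval \<phi> m) b"] by blast
  define G where "G = (\<Sum>m\<in>box J n. Poly_Mapping.single m (l m))"
  have look: "Poly_Mapping.lookup G m = (if m \<in> box J n then l m else 0)" for m
  proof -
    have "Poly_Mapping.lookup G m = (\<Sum>m'\<in>box J n. if m = m' then l m' else 0)"
      unfolding G_def lookup_sum by (intro sum.cong) (auto simp: lookup_single)
    then show ?thesis by (simp add: box_card J)
  qed
  have "G \<noteq> 0"
  proof
    assume "G = 0"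
    then have "\<forall>m\<in>box J n. l m = 0" using look by (metis (full_types) lookup_zero)
    then show False using l(1) by blast
  qed
  moreover have "\<forall>m\<in>Poly_Mapping.keys G. Poly_Mapping.keys m \<subseteq> J"
  proof
    fix m assume "m \<in> Poly_Mapping.keys G"
    then have "m \<in> box J n" by (simp add: in_keys_iff look split: if_splits)
    then show "Poly_Mapping.keys m \<subseteq> J" by (simp add: box_def)
  qed
  moreover have "psubst pconst \<phi> G = 0"
  proof (rule poly_mapping_eqI)
    fix b
    have "psubst pconst \<phi> G = (\<Sum>m\<in>box J n. pconst (l m) * meval \<phi> m)"
      by (simp add: G_def psubst_sum ishom_pconst psubst_single)
    then have "Poly_Mapping.lookup (psubst pconst \<phi> G) b = (\<Sum>m\<in>box J n. l m * Poly_Mapping.lookup (meval \<phi> m) b)"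
      using lookup_single_mult[of "0 :: 'v \<Rightarrow>\<^sub>0 nat" "_ :: 'k" _ b] by (simp add: lookup_sum pconst_def)
    also have "\<dots> = 0"
    proof (cases "b \<in> box V E")
      case False
      have "Poly_Mapping.lookup (meval \<phi> m) b = 0" if "m \<in> box J n" for m
        using kE[OF that] False by (metis in_keys_iff subsetD)
      then show ?thesis by (intro sum.neutral) auto
    qed (use l in auto)
    finally show "Poly_Mapping.lookup (psubst pconst \<phi> G) b = Poly_Mapping.lookup 0 b" by simp
  qed
  ultimately show ?thesis by blast
qed

lemma meval_cong: "(\<And>i. i \<in> Poly_Mapping.keys m \<Longrightarrow> a i = b i) \<Longrightarrow> meval a m = meval b m"
  by (simp add: meval_def)

lemma exists_nonroot:
  fixes G :: "('j, 'k::field_char_0) mpoly"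
  assumes "finite J" "G \<noteq> 0" "\<And>m. m \<in> Poly_Mapping.keys G \<Longrightarrow> Poly_Mapping.keys m \<subseteq> J"
  shows "\<exists>a. peval a G \<noteq> 0"
  using assms
proof (induction J arbitrary: G rule: finite_induct)
  case empty
  obtain m where m: "m \<in> Poly_Mapping.keys G" using empty.prems(1) by (metis all_not_in_conv keys_eq_empty)
  have "\<And>m. m \<in> Poly_Mapping.keys G \<Longrightarrow> m = 0" using empty.prems(2) by (metis keys_eq_empty subset_empty)
  then have "Poly_Mapping.keys G = {0}" using m by auto
  then have "G = Poly_Mapping.single 0 (Poly_Mapping.lookup G 0)" "Poly_Mapping.lookup G 0 \<noteq> 0"
    using poly_mapping_eq_sum_single[of G] by (simp, metis in_keys_iff singletonI)
  then have "peval a G \<noteq> 0" for a using peval_single[of a 0 "Poly_Mapping.lookup G 0"] by simp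
  then show ?case by blast
next
  case (insert j J)
  let ?l = "Poly_Mapping.lookup"
  obtain m0 where m0: "m0 \<in> Poly_Mapping.keys G" using insert.prems(1) by (metis all_not_in_conv keys_eq_empty)
  define k where "k = ?l m0 j"
  define A where "A = {m \<in> Poly_Mapping.keys G. ?l m j = k}"
  define s :: "'j \<Rightarrow>\<^sub>0 nat" where "s = Poly_Mapping.single j k"
  have fA: "finite A" "m0 \<in> A" by (auto simp: A_def k_def m0)
  have strip: "m = (m - s) + s" if "m \<in> A" for m
    using that by (intro poly_mapping_eqI) (auto simp: lookup_add lookup_minus A_def s_def lookup_single when_def)
  define G' where "G' = (\<Sum>m\<in>A. Poly_Mapping.single (m - s) (?l G m))"
  have "?l G' (m0 - s) = (\<Sum>m\<in>A. if m = m0 then ?l G m else 0)"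
    unfolding G'_def lookup_sum
  proof (intro sum.cong refl)
    fix m assume "m \<in> A"
    have "m - s = m0 - s \<longleftrightarrow> m = m0"
    proof
      assume "m - s = m0 - s"
      then have "(m - s) + s = (m0 - s) + s" by (rule arg_cong)
      then show "m = m0" unfolding strip[OF \<open>m \<in> A\<close>, symmetric] strip[OF fA(2), symmetric] .
    qed simp
    then show "?l (Poly_Mapping.single (m - s) (?l G m)) (m0 - s) = (if m = m0 then ?l G m else 0)"
      by (auto simp: lookup_single)
  qed
  then have "?l G' (m0 - s) \<noteq> 0" using fA m0 by (simp add: in_keys_iff)
  then have "G' \<noteq> 0" by auto
  moreover have kG': "Poly_Mapping.keys m \<subseteq> J" if mk: "m \<in> Poly_Mapping.keys G'" for m
  proof -
    have "Poly_Mapping.keys G' \<subseteq> (\<Union>m\<in>A. Poly_Mapping.keys (Poly_Mapping.single (m - s) (?l G m)))"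
      unfolding G'_def by (rule keys_sum)
    then obtain m' where m': "m' \<in> A" "m = m' - s" using mk by (auto split: if_splits)
    have "m' \<in> Poly_Mapping.keys G" using m' by (simp add: A_def)
    then have "Poly_Mapping.keys m' \<subseteq> insert j J" using insert.prems(2) by blast
    moreover have "Poly_Mapping.keys m \<subseteq> Poly_Mapping.keys m' - {j}"
      using m' by (auto simp: in_keys_iff lookup_minus A_def s_def lookup_single when_def split: if_splits)
    ultimately show ?thesis by blast
  qed
  ultimately obtain a where a: "peval a G' \<noteq> 0" using insert.IH by blast
  define p where "p = (\<Sum>m\<in>Poly_Mapping.keys G. monom (?l G m * meval (a(j := 1)) m) (?l m j))"
  have "coeff p k = (\<Sum>m\<in>Poly_Mapping.keys G. if ?l m j = k then ?l G m * meval (a(j := 1)) m else 0)"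
    unfolding p_def coeff_sum by (intro sum.cong) auto
  also have "\<dots> = (\<Sum>m\<in>A. ?l G m * meval (a(j := 1)) m)"
    unfolding A_def by (intro sum.inter_filter[symmetric]) auto
  also have "\<dots> = (\<Sum>m\<in>A. ?l G m * meval (a(j := 1)) (m - s))"
  proof (intro sum.cong refl)
    fix m assume "m \<in> A"
    have "meval (a(j := 1)) m = meval (a(j := 1)) (m - s) * meval (a(j := 1)) s" using meval_add[of "a(j := 1)" "m - s" s] unfolding strip[OF \<open>m \<in> A\<close>, symmetric] .
    then show "?l G m * meval (a(j := 1)) m = ?l G m * meval (a(j := 1)) (m - s)" by (simp add: s_def)
  qed
  also have "\<dots> = (\<Sum>m\<in>A. ?l G m * meval a (m - s))"
  proof (intro sum.cong refl)
    fix m assume "m \<in> A"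
    then have "j \<notin> Poly_Mapping.keys (m - s)" by (simp add: in_keys_iff lookup_minus A_def s_def)
    then have "meval (a(j := 1)) (m - s) = meval a (m - s)" by (intro meval_cong) auto
    then show "?l G m * meval (a(j := 1)) (m - s) = ?l G m * meval a (m - s)" by simp
  qed
  also have "\<dots> = peval a G'" by (simp add: G'_def peval_single)
  finally have "p \<noteq> 0" using a by auto
  then have "finite {t. poly p t = 0}" by (rule poly_roots_finite)
  then have "{t. poly p t = 0} \<noteq> UNIV" using infinite_UNIV_char_0[where 'a = 'k] by auto
  then obtain t where t: "poly p t \<noteq> 0" by blast
  have "meval (a(j := t)) m = meval (a(j := 1)) m * t ^ ?l m j" for m
  proof -
    have "meval (a(j := b)) m = (\<Prod>i\<in>Poly_Mapping.keys m - {j}. a i ^ ?l m i) * b ^ ?l m j" for b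
    proof -
      have "meval (a(j := b)) m = (\<Prod>i\<in>insert j (Poly_Mapping.keys m - {j}). (a(j := b)) i ^ ?l m i)"
        by (rule meval_superset) auto
      also have "\<dots> = b ^ ?l m j * (\<Prod>i\<in>Poly_Mapping.keys m - {j}. (a(j := b)) i ^ ?l m i)"
        by (subst prod.insert) auto
      also have "(\<Prod>i\<in>Poly_Mapping.keys m - {j}. (a(j := b)) i ^ ?l m i) = (\<Prod>i\<in>Poly_Mapping.keys m - {j}. a i ^ ?l m i)"
        by (intro prod.cong) auto
      finally show ?thesis by (simp only: mult.commute)
    qed
    then show ?thesis by simp
  qed
  then have "peval (a(j := t)) G = poly p t"
    by (simp add: p_def poly_sum poly_monom peval_eq_psubst psubst_def mult_ac)
  then have "peval (a(j := t)) G \<noteq> 0" using t by (simp del: fun_upd_apply)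
  then show ?case by blast
qed

section \<open>Hilbert's basis theorem\<close>

lemma nat_incseq_subseq:
  fixes f :: "nat \<Rightarrow> nat"
  shows "\<exists>r. strict_mono r \<and> incseq (\<lambda>n. f (r n))"
proof -
  obtain r where r: "strict_mono r" "monoseq (\<lambda>n. f (r n))" using seq_monosub[of f] by blast
  show ?thesis
  proof (cases "incseq (\<lambda>n. f (r n))")
    case False
    then have dec: "decseq (\<lambda>n. f (r n))" using r(2) by (auto simp: monoseq_iff)
    define N where "N = (LEAST v. \<exists>n. v = f (r n))"
    have "\<exists>n. N = f (r n)" unfolding N_def by (rule LeastI_ex) auto
    then obtain n0 where n0: "N = f (r n0)" by blast
    have "N \<le> f (r n)" for n unfolding N_def by (rule Least_le) auto
    then have c: "f (r (n + n0)) = N" for n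
      using dec n0 by (metis decseq_def le_add2 le_antisym)
    have "strict_mono (\<lambda>n. r (n + n0))" using r(1) by (auto simp: strict_mono_def)
    moreover have "incseq (\<lambda>n. f (r (n + n0)))" by (simp add: c)
    ultimately show ?thesis by (intro exI[of _ "\<lambda>n. r (n + n0)"]) blast
  qed (use r in blast)
qed

lemma dickson_subseq:
  fixes m :: "nat \<Rightarrow> 'v \<Rightarrow> nat"
  assumes "finite A"
  shows "\<exists>r. strict_mono r \<and> (\<forall>i\<in>A. incseq (\<lambda>n. m (r n) i))"
  using assms
proof (induction A rule: finite_induct)
  case empty
  then show ?case by (intro exI[of _ id]) (auto simp: strict_mono_def)
next
  case (insert j A)
  then obtain r where r: "strict_mono r" "\<forall>i\<in>A. incseq (\<lambda>n. m (r n) i)" by blast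
  obtain q where q: "strict_mono q" "incseq (\<lambda>n. m (r (q n)) j)" using nat_incseq_subseq[of "\<lambda>n. m (r n) j"] by blast
  have "strict_mono (\<lambda>n. r (q n))" using r(1) q(1) by (simp add: strict_mono_def)
  moreover have "incseq (\<lambda>n. m (r (q n)) i)" if "i \<in> A" for i
    using r(2) q(1) that by (auto simp: incseq_def strict_mono_less_eq)
  ultimately show ?case using q(2) by (intro exI[of _ "\<lambda>n. r (q n)"]) auto
qed

definition mdvd :: "('v \<Rightarrow>\<^sub>0 nat) \<Rightarrow> ('v \<Rightarrow>\<^sub>0 nat) \<Rightarrow> bool" where
  "mdvd m n \<longleftrightarrow> (\<forall>i. Poly_Mapping.lookup m i \<le> Poly_Mapping.lookup n i)"

lemma mdvd_diff: "mdvd m n \<Longrightarrow> (n - m) + m = n"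
  by (intro poly_mapping_eqI) (auto simp: mdvd_def lookup_add lookup_minus)

lemma dickson:
  fixes L :: "('v \<Rightarrow>\<^sub>0 nat) set"
  assumes "finite (UNIV :: 'v set)"
  shows "\<exists>B. finite B \<and> B \<subseteq> L \<and> (\<forall>m\<in>L. \<exists>b\<in>B. mdvd b m)"
proof -
  define B where "B = {b \<in> L. \<forall>m\<in>L. mdvd m b \<longrightarrow> m = b}"
  have "finite B"
  proof (rule ccontr)
    assume "infinite B"
    then obtain f :: "nat \<Rightarrow> _" where f: "inj f" "range f \<subseteq> B" using infinite_countable_subset by blast
    obtain r where r: "strict_mono r" "\<forall>i\<in>UNIV. incseq (\<lambda>n. Poly_Mapping.lookup (f (r n)) i)"
      using dickson_subseq[OF assms, of "\<lambda>n. Poly_Mapping.lookup (f n)"] by blast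
    have "mdvd (f (r 0)) (f (r 1))" using r(2) by (auto simp: mdvd_def incseq_def)
    moreover have "f (r 0) \<in> L" "f (r 1) \<in> B" using f(2) by (auto simp: B_def)
    ultimately have "f (r 0) = f (r 1)" by (auto simp: B_def)
    then have "r 0 = r 1" using f(1) by (simp add: inj_eq)
    then show False using r(1) by (metis strict_mono_eq zero_neq_one)
  qed
  moreover have "\<exists>b\<in>B. mdvd b m" if "m \<in> L" for m
    using that
  proof (induction "wdegree (\<lambda>_. 1) m" arbitrary: m rule: less_induct)
    case less
    show ?case
    proof (cases "m \<in> B")
      case True
      then show ?thesis by (intro bexI[of _ m]) (auto simp: mdvd_def)
    next
      case False
      then obtain m' where m': "m' \<in> L" "mdvd m' m" "m' \<noteq> m" using less.prems by (auto simp: B_def)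
      have e: "m = (m - m') + m'" using mdvd_diff[OF m'(2)] by simp
      have "m - m' \<noteq> 0" using e m'(3) by auto
      then obtain i where "i \<in> Poly_Mapping.keys (m - m')" by (metis all_not_in_conv keys_eq_empty)
      then have "wdegree (\<lambda>_. 1) (m - m') > 0" by (auto simp: wdegree_def in_keys_iff intro!: sum_pos)
      then have "wdegree (\<lambda>_. 1) m' < wdegree (\<lambda>_. 1) m" by (subst e) (simp add: wdegree_add)
      then obtain b where "b \<in> B" "mdvd b m'" using less.hyps m'(1) by blast
      then show ?thesis using m'(2) by (intro bexI[of _ b]) (auto simp: mdvd_def intro: order_trans)
    qed
  qed
  ultimately show ?thesis by (intro exI[of _ B]) (auto simp: B_def)
qed

lemma UNIV_var: "(UNIV :: var set) = {Vx0, Vx1, Vy, Vw, Vu0, Vu1, Vz, Vt}"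
  using var.exhaust by auto

lemma finite_var: "finite (UNIV :: var set)"
  by (simp add: UNIV_var)

lemma all_var: "(\<forall>i. Q i) \<longleftrightarrow> Q Vx0 \<and> Q Vx1 \<and> Q Vy \<and> Q Vw \<and> Q Vu0 \<and> Q Vu1 \<and> Q Vz \<and> Q Vt"
proof -
  have "(\<forall>i. Q i) \<longleftrightarrow> (\<forall>i\<in>UNIV. Q i)" by simp
  then show ?thesis unfolding UNIV_var by simp
qed

definition mkey :: "(var \<Rightarrow>\<^sub>0 nat) \<Rightarrow> nat \<times> nat \<times> nat \<times> nat \<times> nat \<times> nat \<times> nat \<times> nat" where
  "mkey m = (let l = Poly_Mapping.lookup m in (l Vx0, l Vx1, l Vy, l Vw, l Vu0, l Vu1, l Vz, l Vt))"

lemma mkey_inject: "mkey m = mkey n \<longleftrightarrow> m = n"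
proof
  assume "mkey m = mkey n"
  then have "\<forall>i. Poly_Mapping.lookup m i = Poly_Mapping.lookup n i" unfolding all_var by (simp add: mkey_def Let_def)
  then show "m = n" by (intro poly_mapping_eqI) simp
qed simp

lemma mkey_add: "mkey (m + k) < mkey (n + k) \<longleftrightarrow> mkey m < mkey n"
  by (simp add: mkey_def Let_def lookup_add)

definition is_lm :: "(var, 'k::zero) mpoly \<Rightarrow> (var \<Rightarrow>\<^sub>0 nat) \<Rightarrow> bool" where
  "is_lm f m \<longleftrightarrow> m \<in> Poly_Mapping.keys f \<and> (\<forall>m'\<in>Poly_Mapping.keys f. mkey m' \<le> mkey m)"

lemma ex_is_lm:
  assumes "f \<noteq> 0"
  shows "\<exists>m. is_lm f m"
proof -
  have "Poly_Mapping.keys f \<noteq> {}" using assms by simp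
  then have "Max (mkey ` Poly_Mapping.keys f) \<in> mkey ` Poly_Mapping.keys f" by (intro Max_in) auto
  then obtain m where "m \<in> Poly_Mapping.keys f" "mkey m = Max (mkey ` Poly_Mapping.keys f)" by force
  then show ?thesis by (intro exI[of _ m]) (auto simp: is_lm_def)
qed

theorem hilbert_basis:
  fixes G :: "(var, 'k::field) mpoly set"
  shows "\<exists>F. finite F \<and> F \<subseteq> G \<and> G \<subseteq> pgen F"
proof -
  let ?l = "Poly_Mapping.lookup"
  define L where "L = {m. \<exists>f\<in>pgen G. is_lm f m}"
  obtain B where B: "finite B" "B \<subseteq> L" "\<And>m. m \<in> L \<Longrightarrow> \<exists>b\<in>B. mdvd b m"
    using dickson[OF finite_var, of L] by blast
  have "\<forall>b\<in>B. \<exists>f. f \<in> pgen G \<and> is_lm f b" using B(2) by (auto simp: L_def)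
  then obtain \<beta> where \<beta>: "\<And>b. b \<in> B \<Longrightarrow> \<beta> b \<in> pgen G" "\<And>b. b \<in> B \<Longrightarrow> is_lm (\<beta> b) b" by metis
  have red: "f \<in> pgen (\<beta> ` B)" if "f \<in> pgen G" "is_lm f m" for f m
    using that
  proof (induction "mkey m" arbitrary: f m rule: less_induct)
    case less
    have "m \<in> L" using less.prems by (auto simp: L_def)
    then obtain b where b: "b \<in> B" "mdvd b m" using B(3) by blast
    define s where "s = m - b"
    have sb: "s + b = m" using mdvd_diff[OF b(2)] by (simp add: s_def)
    have lmb: "is_lm (\<beta> b) b" using \<beta> b by blast
    have nz: "?l (\<beta> b) b \<noteq> 0" using lmb by (simp add: is_lm_def in_keys_iff)
    define g where "g = Poly_Mapping.single s (?l f m / ?l (\<beta> b) b) * \<beta> b"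
    have gm: "?l g m = ?l f m" using nz lookup_single_mult[of s "?l f m / ?l (\<beta> b) b" "\<beta> b" b] by (simp add: g_def sb)
    have gI: "g \<in> pgen (\<beta> ` B)" unfolding g_def using pgen_superset[of "\<beta> ` B"] b by (intro pidealD(3)[OF pideal_pgen]) auto
    have gJ: "g \<in> pgen G" unfolding g_def using \<beta> b by (intro pidealD(3)[OF pideal_pgen]) auto
    have fgJ: "f - g \<in> pgen G" using less.prems gJ by (intro pidealD(6)[OF pideal_pgen])
    have small: "mkey k < mkey m" if k: "k \<in> Poly_Mapping.keys (f - g)" for k
    proof -
      have "?l (f - g) k \<noteq> 0" using k by (simp add: in_keys_iff)
      then have "k \<noteq> m" using gm by (auto simp: lookup_minus)
      then have ne: "mkey k \<noteq> mkey m" by (simp add: mkey_inject)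
      have "k \<in> Poly_Mapping.keys f \<or> k \<in> Poly_Mapping.keys g" using k by (auto simp: in_keys_iff lookup_minus)
      then show ?thesis
      proof
        assume "k \<in> Poly_Mapping.keys f"
        then have "mkey k \<le> mkey m" using less.prems(2) by (simp add: is_lm_def)
        then show ?thesis using ne by simp
      next
        assume "k \<in> Poly_Mapping.keys g"
        then obtain a n where an: "k = a + n" "n \<in> Poly_Mapping.keys (\<beta> b)" "a \<in> Poly_Mapping.keys (Poly_Mapping.single s (?l f m / ?l (\<beta> b) b))"
          using keys_mult unfolding g_def by blast
        have as: "a = s" using an(3) by (simp split: if_splits)
        have "mkey n \<le> mkey b" using lmb an(2) by (simp add: is_lm_def)
        moreover have "n \<noteq> b" using an(1) as sb \<open>k \<noteq> m\<close> by auto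
        ultimately have "mkey n < mkey b" by (simp add: mkey_inject less_le)
        then have "mkey (n + s) < mkey (b + s)" by (simp add: mkey_add)
        then show ?thesis using an(1) as sb by (simp add: add.commute)
      qed
    qed
    have "f - g \<in> pgen (\<beta> ` B)"
    proof (cases "f - g = 0")
      case True
      then show ?thesis using pidealD(1)[OF pideal_pgen] by simp
    next
      case False
      then obtain n where n: "is_lm (f - g) n" using ex_is_lm by blast
      then have "mkey n < mkey m" using small by (simp add: is_lm_def)
      then show ?thesis using less.hyps fgJ n by blast
    qed
    then have "(f - g) + g \<in> pgen (\<beta> ` B)" using gI by (rule pidealD(2)[OF pideal_pgen])
    then show ?case by simp
  qed
  have "\<forall>b\<in>B. \<exists>F. finite F \<and> F \<subseteq> G \<and> \<beta> b \<in> pgen F"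
  proof
    fix b assume b: "b \<in> B"
    obtain F h where F: "finite F" "F \<subseteq> G" "\<beta> b = (\<Sum>g\<in>F. h g * g)" using pgen_finite_sum[OF \<beta>(1)[OF b]] by blast
    have "\<beta> b \<in> pgen F" unfolding F(3) using pgen_superset[of F] by (intro pideal_sum[OF pideal_pgen] pidealD(3)[OF pideal_pgen]) auto
    with F show "\<exists>F. finite F \<and> F \<subseteq> G \<and> \<beta> b \<in> pgen F" by blast
  qed
  then obtain \<Phi> where \<Phi>: "\<And>b. b \<in> B \<Longrightarrow> finite (\<Phi> b)" "\<And>b. b \<in> B \<Longrightarrow> \<Phi> b \<subseteq> G" "\<And>b. b \<in> B \<Longrightarrow> \<beta> b \<in> pgen (\<Phi> b)" by metis
  define F where "F = (\<Union>b\<in>B. \<Phi> b)"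
  have "\<beta> ` B \<subseteq> pgen F"
  proof
    fix x assume "x \<in> \<beta> ` B"
    then obtain b where b: "b \<in> B" "x = \<beta> b" by blast
    have "pgen (\<Phi> b) \<subseteq> pgen F" using b by (intro pgen_mono) (auto simp: F_def)
    then show "x \<in> pgen F" using \<Phi>(3) b by auto
  qed
  then have sub: "pgen (\<beta> ` B) \<subseteq> pgen F" by (intro pgen_minimal pideal_pgen)
  have "G \<subseteq> pgen F"
  proof
    fix f assume f: "f \<in> G"
    then have fG: "f \<in> pgen G" using pgen_superset[of G] by blast
    show "f \<in> pgen F"
    proof (cases "f = 0")
      case True
      then show ?thesis using pidealD(1)[OF pideal_pgen] by simp
    next
      case False
      then obtain m where "is_lm f m" using ex_is_lm by blast
      then show ?thesis using red fG sub by blast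
    qed
  qed
  moreover have "finite F" "F \<subseteq> G" using \<Phi> B(1) by (auto simp: F_def)
  ultimately show ?thesis by blast
qed

section \<open>The local ring of a point\<close>

locale wproj =
  fixes wt :: "'v \<Rightarrow> nat" and I :: "('v, 'k::field) mpoly set" and a :: "'v \<Rightarrow> 'k"
  assumes hideal: "hideal wt I" and vanish: "\<And>f. f \<in> I \<Longrightarrow> peval a f = 0"
begin

abbreviation hom where "hom \<equiv> whomogeneous wt"
abbreviation A where "A \<equiv> proj_stalk wt I (worbit wt a)"

lemma I: "pideal I" using hideal by (simp add: hideal_def)

definition ok where "ok (f :: ('v, 'k) mpoly) (g :: ('v, 'k) mpoly) \<longleftrightarrow> (\<exists>d. hom d f \<and> hom d g) \<and> peval a g \<noteq> 0"
definition frac where "frac f g = hfraction_rel wt I (worbit wt a) `` {(f, g)}"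

lemma nonvanishing_iff: "hom d g \<Longrightarrow> nonvanishing_at (worbit wt a) g \<longleftrightarrow> peval a g \<noteq> 0"
proof -
  assume g: "hom d g"
  have "a \<in> worbit wt a" by (auto simp: worbit_def intro!: exI[of _ 1])
  then show ?thesis using g by (auto simp: nonvanishing_at_def worbit_def peval_scale)
qed

lemma hfractions_iff: "(f, g) \<in> hfractions wt (worbit wt a) \<longleftrightarrow> ok f g"
  by (auto simp: hfractions_def ok_def nonvanishing_iff)

lemma rel_iff: "((f, g), (f', g')) \<in> hfraction_rel wt I (worbit wt a) \<longleftrightarrow>
    ok f g \<and> ok f' g' \<and> (\<exists>h d. hom d h \<and> peval a h \<noteq> 0 \<and> h * (f * g' - f' * g) \<in> I)"
proof -
  have "(\<exists>h d. hom d h \<and> nonvanishing_at (worbit wt a) h \<and> h * (f * g' - f' * g) \<in> I) \<longleftrightarrow>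
    (\<exists>h d. hom d h \<and> peval a h \<noteq> 0 \<and> h * (f * g' - f' * g) \<in> I)"
    using nonvanishing_iff by blast
  then show ?thesis by (simp add: hfraction_rel_def hfractions_iff)
qed

lemma ok_1: "ok 1 1" "ok 0 1"
  by (auto simp: ok_def whom_1 intro!: exI[of _ 0])

lemma ok_mult: "ok f g \<Longrightarrow> ok f' g' \<Longrightarrow> ok (f * f') (g * g')"
  unfolding ok_def by (auto intro: whom_mult)

lemma ok_add: "ok f g \<Longrightarrow> ok f' g' \<Longrightarrow> ok (f * g' + f' * g) (g * g')"
proof -
  assume *: "ok f g" "ok f' g'"
  then obtain d d' where d: "hom d f" "hom d g" "hom d' f'" "hom d' g'" by (auto simp: ok_def)
  have "hom (d + d') (f * g')" "hom (d + d') (g * g')" using d by (auto intro: whom_mult)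
  moreover have "hom (d + d') (f' * g)" using d whom_mult[of wt d' f' d g] by (simp add: add.commute)
  ultimately have "hom (d + d') (f * g' + f' * g)" "hom (d + d') (g * g')" by (auto intro: whom_add)
  then show ?thesis using * by (auto simp: ok_def)
qed

lemma ok_uminus: "ok f g \<Longrightarrow> ok (- f) g"
  unfolding ok_def using whom_uminus by blast

lemma equiv_rel: "equiv (hfractions wt (worbit wt a)) (hfraction_rel wt I (worbit wt a))"
proof (rule equivI)
  let ?r = "hfraction_rel wt I (worbit wt a)"
  show "?r \<subseteq> hfractions wt (worbit wt a) \<times> hfractions wt (worbit wt a)" by (auto simp: rel_iff hfractions_iff)
  show "refl_on (hfractions wt (worbit wt a)) ?r"
  proof (rule refl_onI)
    fix x assume x: "x \<in> hfractions wt (worbit wt a)"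
    obtain f g where fg: "x = (f, g)" by (cases x)
    have "1 * (f * g - f * g) \<in> I" using pidealD(1)[OF I] by simp
    moreover have "peval a (1 :: ('v, 'k) mpoly) \<noteq> 0" by simp
    ultimately show "(x, x) \<in> ?r" using x whom_1 unfolding fg rel_iff hfractions_iff by blast
  qed
  show "sym ?r"
  proof (rule symI)
    fix x y assume xy: "(x, y) \<in> ?r"
    obtain f g f' g' where e: "x = (f, g)" "y = (f', g')" by (cases x, cases y) auto
    obtain h d where h: "hom d h" "peval a h \<noteq> 0" "h * (f * g' - f' * g) \<in> I" using xy by (auto simp: e rel_iff)
    have "h * (f' * g - f * g') = - (h * (f * g' - f' * g))" by (simp add: algebra_simps)
    then have "h * (f' * g - f * g') \<in> I" using pidealD(5)[OF I h(3)] by simp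
    then show "(y, x) \<in> ?r" using xy h by (auto simp: e rel_iff)
  qed
  show "trans ?r"
  proof (rule transI)
    fix x y z assume xy: "(x, y) \<in> ?r" and yz: "(y, z) \<in> ?r"
    obtain f g f' g' f2 g2 where e: "x = (f, g)" "y = (f', g')" "z = (f2, g2)" by (cases x, cases y, cases z) auto
    obtain h d where h: "hom d h" "peval a h \<noteq> 0" "h * (f * g' - f' * g) \<in> I" using xy by (auto simp: e rel_iff)
    obtain h' d' where h': "hom d' h'" "peval a h' \<noteq> 0" "h' * (f' * g2 - f2 * g') \<in> I" using yz by (auto simp: e rel_iff)
    have okk: "ok f g" "ok f' g'" "ok f2 g2" using xy yz by (auto simp: e rel_iff)
    then obtain d2 where g': "hom d2 g'" "peval a g' \<noteq> 0" by (auto simp: ok_def)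
    have "(h * h' * g') * (f * g2 - f2 * g) = (h' * g2) * (h * (f * g' - f' * g)) + (h * g) * (h' * (f' * g2 - f2 * g'))"
      by (simp add: algebra_simps)
    also have "\<dots> \<in> I" by (rule pidealD(2)[OF I pidealD(3)[OF I h(3)] pidealD(3)[OF I h'(3)]])
    finally have "(h * h' * g') * (f * g2 - f2 * g) \<in> I" .
    moreover have "hom (d + d' + d2) (h * h' * g')" using h h' g' by (intro whom_mult)
    moreover have "peval a (h * h' * g') \<noteq> 0" using h h' g' by simp
    ultimately show "(x, z) \<in> ?r" using okk unfolding e rel_iff by blast
  qed
qed

lemma frac_eq_iff:
  assumes "ok f g" "ok f' g'"
  shows "frac f g = frac f' g' \<longleftrightarrow> (\<exists>h d. hom d h \<and> peval a h \<noteq> 0 \<and> h * (f * g' - f' * g) \<in> I)"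
  unfolding frac_def using eq_equiv_class_iff[OF equiv_rel] assms by (simp add: hfractions_iff rel_iff)

lemma frac_eqI:
  assumes "ok f g" "ok f' g'" "f * g' - f' * g \<in> I"
  shows "frac f g = frac f' g'"
  unfolding frac_eq_iff[OF assms(1,2)] using assms(3) by (intro exI[of _ 1] exI[of _ 0]) (auto simp: whom_1)

lemma frac_eqI': "ok f g \<Longrightarrow> ok f' g' \<Longrightarrow> f * g' = f' * g \<Longrightarrow> frac f g = frac f' g'"
  by (rule frac_eqI) (auto simp: pidealD(1)[OF I])

lemma carrier_A: "carrier A = {frac f g | f g. ok f g}"
proof -
  have "carrier A = (\<lambda>x. hfraction_rel wt I (worbit wt a) `` {x}) ` hfractions wt (worbit wt a)"
    by (auto simp: proj_stalk_def quotient_def)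
  also have "\<dots> = {frac f g | f g. ok f g}"
    by (force simp: frac_def hfractions_iff image_iff)
  finally show ?thesis .
qed

lemma frac_in [simp]: "ok f g \<Longrightarrow> frac f g \<in> carrier A" by (auto simp: carrier_A)

lemma carrierE:
  assumes "x \<in> carrier A"
  obtains f g where "x = frac f g" "ok f g"
  using assms by (auto simp: carrier_A)

lemma mem_frac: "(f', g') \<in> frac f g \<longleftrightarrow> ok f g \<and> ok f' g' \<and> frac f g = frac f' g'"
proof -
  have "(f', g') \<in> frac f g \<longleftrightarrow> ((f, g), (f', g')) \<in> hfraction_rel wt I (worbit wt a)" by (simp add: frac_def)
  then show ?thesis unfolding rel_iff using frac_eq_iff by blast
qed

lemma UN_const:
  assumes "x \<in> M" "y \<in> N" "\<And>f g f' g'. (f, g) \<in> M \<Longrightarrow> (f', g') \<in> N \<Longrightarrow> F f g f' g' = C"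
  shows "(\<Union>(f, g)\<in>M. \<Union>(f', g')\<in>N. F f g f' g') = C"
  using assms by (cases x, cases y) force

lemma frac_mult:
  assumes "ok f g" "ok f' g'"
  shows "frac f g \<otimes>\<^bsub>A\<^esub> frac f' g' = frac (f * f') (g * g')"
proof -
  have "frac f g \<otimes>\<^bsub>A\<^esub> frac f' g' = (\<Union>(f1, g1)\<in>frac f g. \<Union>(f2, g2)\<in>frac f' g'. frac (f1 * f2) (g1 * g2))"
    by (simp add: proj_stalk_def frac_def)
  also have "\<dots> = frac (f * f') (g * g')"
  proof (rule UN_const)
    show "(f, g) \<in> frac f g" "(f', g') \<in> frac f' g'" using assms by (auto simp: mem_frac)
  next
    fix f1 g1 f2 g2 assume *: "(f1, g1) \<in> frac f g" "(f2, g2) \<in> frac f' g'"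
    then have okk: "ok f1 g1" "ok f2 g2" by (auto simp: mem_frac)
    have "frac f1 g1 = frac f g" "frac f2 g2 = frac f' g'" using * by (auto simp: mem_frac)
    then obtain h d h' d' where h: "hom d h" "peval a h \<noteq> 0" "h * (f1 * g - f * g1) \<in> I"
      "hom d' h'" "peval a h' \<noteq> 0" "h' * (f2 * g' - f' * g2) \<in> I"
      unfolding frac_eq_iff[OF okk(1) assms(1)] frac_eq_iff[OF okk(2) assms(2)] by blast
    have "(h * h') * ((f1 * f2) * (g * g') - (f * f') * (g1 * g2)) = (h' * f2 * g') * (h * (f1 * g - f * g1)) + (h * f * g1) * (h' * (f2 * g' - f' * g2))"
      by (simp add: algebra_simps)
    also have "\<dots> \<in> I" by (rule pidealD(2)[OF I pidealD(3)[OF I h(3)] pidealD(3)[OF I h(6)]])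
    finally have "(h * h') * ((f1 * f2) * (g * g') - (f * f') * (g1 * g2)) \<in> I" .
    moreover have "hom (d + d') (h * h')" "peval a (h * h') \<noteq> 0" using h by (auto intro: whom_mult)
    ultimately show "frac (f1 * f2) (g1 * g2) = frac (f * f') (g * g')"
      unfolding frac_eq_iff[OF ok_mult[OF okk] ok_mult[OF assms]] by blast
  qed
  finally show ?thesis .
qed

lemma frac_add:
  assumes "ok f g" "ok f' g'"
  shows "frac f g \<oplus>\<^bsub>A\<^esub> frac f' g' = frac (f * g' + f' * g) (g * g')"
proof -
  have "frac f g \<oplus>\<^bsub>A\<^esub> frac f' g' = (\<Union>(f1, g1)\<in>frac f g. \<Union>(f2, g2)\<in>frac f' g'. frac (f1 * g2 + f2 * g1) (g1 * g2))"
    by (simp add: proj_stalk_def frac_def)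
  also have "\<dots> = frac (f * g' + f' * g) (g * g')"
  proof (rule UN_const)
    show "(f, g) \<in> frac f g" "(f', g') \<in> frac f' g'" using assms by (auto simp: mem_frac)
  next
    fix f1 g1 f2 g2 assume *: "(f1, g1) \<in> frac f g" "(f2, g2) \<in> frac f' g'"
    then have okk: "ok f1 g1" "ok f2 g2" by (auto simp: mem_frac)
    have "frac f1 g1 = frac f g" "frac f2 g2 = frac f' g'" using * by (auto simp: mem_frac)
    then obtain h d h' d' where h: "hom d h" "peval a h \<noteq> 0" "h * (f1 * g - f * g1) \<in> I"
      "hom d' h'" "peval a h' \<noteq> 0" "h' * (f2 * g' - f' * g2) \<in> I"
      unfolding frac_eq_iff[OF okk(1) assms(1)] frac_eq_iff[OF okk(2) assms(2)] by blast
    have "(h * h') * ((f1 * g2 + f2 * g1) * (g * g') - (f * g' + f' * g) * (g1 * g2)) = (h' * g2 * g') * (h * (f1 * g - f * g1)) + (h * g1 * g) * (h' * (f2 * g' - f' * g2))"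
      by (simp add: algebra_simps)
    also have "\<dots> \<in> I" by (rule pidealD(2)[OF I pidealD(3)[OF I h(3)] pidealD(3)[OF I h(6)]])
    finally have "(h * h') * ((f1 * g2 + f2 * g1) * (g * g') - (f * g' + f' * g) * (g1 * g2)) \<in> I" .
    moreover have "hom (d + d') (h * h')" "peval a (h * h') \<noteq> 0" using h by (auto intro: whom_mult)
    ultimately show "frac (f1 * g2 + f2 * g1) (g1 * g2) = frac (f * g' + f' * g) (g * g')"
      unfolding frac_eq_iff[OF ok_add[OF okk] ok_add[OF assms]] by blast
  qed
  finally show ?thesis .
qed

lemma zero_A: "\<zero>\<^bsub>A\<^esub> = frac 0 1" and one_A: "\<one>\<^bsub>A\<^esub> = frac 1 1"
  by (simp_all add: proj_stalk_def frac_def)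

lemma frac_neg: "ok f g \<Longrightarrow> frac (- f) g \<oplus>\<^bsub>A\<^esub> frac f g = \<zero>\<^bsub>A\<^esub>"
proof -
  assume o: "ok f g"
  then obtain d where "hom d g" "peval a g \<noteq> 0" by (auto simp: ok_def)
  then have "frac 0 (g * g) = frac 0 1" by (intro frac_eqI' ok_1) (auto simp: ok_def intro: whom_mult)
  then show ?thesis using o by (simp add: zero_A frac_add ok_uminus)
qed

lemma frac_zero: "hom d g \<Longrightarrow> peval a g \<noteq> 0 \<Longrightarrow> frac 0 g = \<zero>\<^bsub>A\<^esub>"
  unfolding zero_A by (intro frac_eqI' ok_1) (auto simp: ok_def)

lemma cring_A: "cring A"
proof (rule cringI)
  show "abelian_group A"
  proof (rule abelian_groupI)
    fix x y z assume "x \<in> carrier A" "y \<in> carrier A" "z \<in> carrier A"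
    then obtain f g f' g' f2 g2 where [simp]: "x = frac f g" "y = frac f' g'" "z = frac f2 g2" and
      o: "ok f g" "ok f' g'" "ok f2 g2" by (metis carrierE)
    note [simp] = o ok_add ok_mult ok_1
    show "x \<oplus>\<^bsub>A\<^esub> y \<in> carrier A" by (simp add: frac_add)
    show "x \<oplus>\<^bsub>A\<^esub> y \<oplus>\<^bsub>A\<^esub> z = x \<oplus>\<^bsub>A\<^esub> (y \<oplus>\<^bsub>A\<^esub> z)"
      by (simp add: frac_add, intro frac_eqI' ok_add ok_mult o) (simp add: algebra_simps)
    show "x \<oplus>\<^bsub>A\<^esub> y = y \<oplus>\<^bsub>A\<^esub> x"
      by (simp add: frac_add, intro frac_eqI' ok_add ok_mult o) (simp add: algebra_simps)
    show "\<zero>\<^bsub>A\<^esub> \<oplus>\<^bsub>A\<^esub> x = x" by (simp add: frac_add zero_A)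
    show "\<exists>y\<in>carrier A. y \<oplus>\<^bsub>A\<^esub> x = \<zero>\<^bsub>A\<^esub>"
      using frac_neg[OF o(1)] by (intro bexI[of _ "frac (- f) g"]) (simp_all add: ok_uminus)
  qed (simp add: zero_A ok_1)
  show "Group.comm_monoid A"
  proof (rule comm_monoidI)
    fix x y z assume "x \<in> carrier A" "y \<in> carrier A" "z \<in> carrier A"
    then obtain f g f' g' f2 g2 where [simp]: "x = frac f g" "y = frac f' g'" "z = frac f2 g2" and
      o: "ok f g" "ok f' g'" "ok f2 g2" by (metis carrierE)
    note [simp] = o ok_add ok_mult ok_1
    show "x \<otimes>\<^bsub>A\<^esub> y \<in> carrier A" by (simp add: frac_mult)
    show "x \<otimes>\<^bsub>A\<^esub> y \<otimes>\<^bsub>A\<^esub> z = x \<otimes>\<^bsub>A\<^esub> (y \<otimes>\<^bsub>A\<^esub> z)" by (simp add: frac_mult mult.assoc)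
    show "x \<otimes>\<^bsub>A\<^esub> y = y \<otimes>\<^bsub>A\<^esub> x" by (simp add: frac_mult mult.commute)
    show "\<one>\<^bsub>A\<^esub> \<otimes>\<^bsub>A\<^esub> x = x" by (simp add: frac_mult one_A)
  qed (simp add: one_A ok_1)
  fix x y z assume "x \<in> carrier A" "y \<in> carrier A" "z \<in> carrier A"
  then obtain f g f' g' f2 g2 where [simp]: "x = frac f g" "y = frac f' g'" "z = frac f2 g2" and
    o: "ok f g" "ok f' g'" "ok f2 g2" by (metis carrierE)
  note [simp] = o ok_add ok_mult ok_1
  show "(x \<oplus>\<^bsub>A\<^esub> y) \<otimes>\<^bsub>A\<^esub> z = x \<otimes>\<^bsub>A\<^esub> z \<oplus>\<^bsub>A\<^esub> y \<otimes>\<^bsub>A\<^esub> z"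
    by (simp add: frac_add frac_mult, intro frac_eqI' ok_add ok_mult o) (simp add: algebra_simps)
qed

sublocale cring A by (rule cring_A)

lemma frac_add_same:
  assumes "hom d f" "hom d f'" "hom d g" "peval a g \<noteq> 0"
  shows "frac f g \<oplus>\<^bsub>A\<^esub> frac f' g = frac (f + f') g"
proof -
  have o: "ok f g" "ok f' g" "ok (f + f') g" using assms by (auto simp: ok_def intro: whom_add)
  then show ?thesis using frac_eqI'[OF ok_add[OF o(1,2)] o(3)] by (simp add: frac_add algebra_simps)
qed

lemma frac_sum_in:
  assumes J: "ideal J A" and g: "hom d g" "peval a g \<noteq> 0"
    and u: "\<And>i. i \<in> K \<Longrightarrow> hom d (u i)" "\<And>i. i \<in> K \<Longrightarrow> frac (u i) g \<in> J"
  shows "frac (\<Sum>i\<in>K. u i) g \<in> J"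
  using u
proof (induction K rule: infinite_finite_induct)
  case (insert i K)
  have "hom d (\<Sum>i\<in>K. u i)" using insert by (intro whom_sum) auto
  then have "frac (u i + (\<Sum>i\<in>K. u i)) g = frac (u i) g \<oplus>\<^bsub>A\<^esub> frac (\<Sum>i\<in>K. u i) g"
    using frac_add_same[of d "u i" "\<Sum>i\<in>K. u i" g] insert g by simp
  also have "\<dots> \<in> J" using insert by (intro additive_subgroup.a_closed[OF ideal.axioms(1)[OF J]]) auto
  finally show ?case using insert by simp
qed (use frac_zero[OF g] additive_subgroup.zero_closed[OF ideal.axioms(1)[OF J]] in auto)

definition mx where "mx = {frac f g | f g. ok f g \<and> peval a f = 0}"

lemma frac_eq_residue:
  assumes "ok f g" "ok f' g'" "frac f g = frac f' g'"
  shows "peval a f * peval a g' = peval a f' * peval a g"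
proof -
  obtain h where "peval a h \<noteq> 0" "h * (f * g' - f' * g) \<in> I" using assms frac_eq_iff by blast
  then show ?thesis using vanish[of "h * (f * g' - f' * g)"] by simp
qed

lemma frac_in_mx: "ok f g \<Longrightarrow> frac f g \<in> mx \<longleftrightarrow> peval a f = 0"
proof
  assume o: "ok f g" "frac f g \<in> mx"
  then obtain f' g' where *: "ok f' g'" "peval a f' = 0" "frac f g = frac f' g'" by (auto simp: mx_def)
  then show "peval a f = 0" using frac_eq_residue[OF o(1) *(1) *(3)] by (auto simp: ok_def)
qed (auto simp: mx_def)

lemma mx_carrier: "mx \<subseteq> carrier A" by (auto simp: mx_def)

lemma ideal_mx: "ideal mx A"
proof (rule idealI)
  show "Ring.ring A" by (rule ring_axioms)
  show "subgroup mx (add_monoid A)"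
  proof (rule add.subgroupI)
    show "mx \<subseteq> carrier A" by (rule mx_carrier)
    show "mx \<noteq> {}" using frac_in_mx[OF ok_1(2)] by auto
    fix x assume "x \<in> mx"
    then obtain f g where x: "x = frac f g" "ok f g" "peval a f = 0" by (auto simp: mx_def)
    have "\<ominus>\<^bsub>A\<^esub> x = frac (- f) g" using frac_neg[OF x(2)] x(1) by (intro minus_equality) (simp_all add: ok_uminus x)
    then show "\<ominus>\<^bsub>A\<^esub> x \<in> mx" using x by (simp add: frac_in_mx ok_uminus)
    fix y assume "y \<in> mx"
    then obtain f' g' where y: "y = frac f' g'" "ok f' g'" "peval a f' = 0" by (auto simp: mx_def)
    show "x \<oplus>\<^bsub>A\<^esub> y \<in> mx" using x y by (simp add: frac_add frac_in_mx ok_add)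
  qed
  fix x y assume "x \<in> mx" "y \<in> carrier A"
  then obtain f g f' g' where x: "x = frac f g" "ok f g" "peval a f = 0" and y: "y = frac f' g'" "ok f' g'"
    by (auto simp: mx_def elim!: carrierE)
  show "y \<otimes>\<^bsub>A\<^esub> x \<in> mx" "x \<otimes>\<^bsub>A\<^esub> y \<in> mx" using x y by (simp_all add: frac_mult frac_in_mx ok_mult)
qed

lemma unit_frac:
  assumes "ok f g" "peval a f \<noteq> 0"
  shows "ok g f" "frac f g \<otimes>\<^bsub>A\<^esub> frac g f = \<one>\<^bsub>A\<^esub>"
proof -
  show o: "ok g f" using assms by (auto simp: ok_def)
  show "frac f g \<otimes>\<^bsub>A\<^esub> frac g f = \<one>\<^bsub>A\<^esub>"
    unfolding one_A frac_mult[OF assms(1) o] by (intro frac_eqI' ok_mult ok_1 assms o) simp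
qed

lemma proper_ideal_subset:
  assumes "ideal J A" "J \<noteq> carrier A"
  shows "J \<subseteq> mx"
proof
  interpret J: ideal J A by fact
  fix x assume x: "x \<in> J"
  then obtain f g where f: "x = frac f g" "ok f g" using J.a_subset by (auto elim!: carrierE)
  have "peval a f = 0"
  proof (rule ccontr)
    assume n: "peval a f \<noteq> 0"
    have "frac f g \<otimes>\<^bsub>A\<^esub> frac g f \<in> J" using J.I_r_closed[OF x] unit_frac(1)[OF f(2) n] f(1) by simp
    then have "\<one>\<^bsub>A\<^esub> \<in> J" using unit_frac(2)[OF f(2) n] by simp
    then show False using J.one_imp_carrier assms(2) by simp
  qed
  then show "x \<in> mx" using f by (simp add: frac_in_mx)
qed

lemma one_notin_mx: "\<one>\<^bsub>A\<^esub> \<notin> mx" by (simp add: one_A frac_in_mx ok_1)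

lemma maximal_mx: "maximalideal mx A"
proof (rule maximalidealI)
  show "ideal mx A" by (rule ideal_mx)
  show "carrier A \<noteq> mx" using one_notin_mx one_closed by blast
  show "J = mx \<or> J = carrier A" if "ideal J A" "mx \<subseteq> J" "J \<subseteq> carrier A" for J
    using proper_ideal_subset[OF that(1)] that(2) by blast
qed

lemma maximal_unique: "maximalideal M A \<Longrightarrow> M = mx"
proof -
  assume M: "maximalideal M A"
  interpret M: maximalideal M A by (rule M)
  have "M \<subseteq> mx" using proper_ideal_subset[OF M.is_ideal] M.I_notcarr by blast
  then have "mx = M \<or> mx = carrier A" using M.I_maximal[OF ideal_mx _ mx_carrier] by blast
  then show "M = mx" using one_notin_mx one_closed by blast
qed

lemma local_ring_A: "local_ring A"
  unfolding local_ring_def by (intro conjI cring_A ex1I[of _ mx] maximal_mx maximal_unique)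

lemma the_maximal_ideal_A: "the_maximal_ideal A = mx"
  unfolding the_maximal_ideal_def by (rule the_equality) (rule maximal_mx, rule maximal_unique)

lemma mx_generated:
  assumes okA: "ok A1 A2" "ok B1 B2" "peval a A1 = 0" "peval a B1 = 0"
    and gen: "\<And>f d. hom d f \<Longrightarrow> peval a f = 0 \<Longrightarrow>
      \<exists>h e i u v. hom e h \<and> peval a h \<noteq> 0 \<and> i \<in> I \<and> h * f = i + u * A1 + v * B1"
  shows "mx = genideal A {frac A1 A2, frac B1 B2}"
proof
  let ?G = "{frac A1 A2, frac B1 B2}"
  let ?J = "genideal A ?G"
  have G: "?G \<subseteq> carrier A" using okA by simp
  have J: "ideal ?J A" by (rule genideal_ideal[OF G])
  show "?J \<subseteq> mx" using okA by (intro genideal_minimal ideal_mx) (auto simp: frac_in_mx)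
  obtain dA dB where dA: "hom dA A1" "hom dA A2" and dB: "hom dB B1" "hom dB B2" using okA by (auto simp: ok_def)
  have nz: "peval a A2 \<noteq> 0" "peval a B2 \<noteq> 0" using okA by (auto simp: ok_def)
  have mul: "frac (w * C1) g \<in> ?J"
    if C: "hom dC C1" "hom dC C2" "peval a C2 \<noteq> 0" "frac C1 C2 \<in> ?J" and w: "hom e w" "hom (e + dC) g" "peval a g \<noteq> 0" for C1 C2 w g dC e
  proof -
    have o: "ok (w * C2) g" "ok C1 C2" "ok (w * C1) g" using C w by (auto simp: ok_def intro: whom_mult)
    then have "frac (w * C1) g = frac (w * C2) g \<otimes>\<^bsub>A\<^esub> frac C1 C2"
      unfolding frac_mult[OF o(1,2)] by (intro frac_eqI' ok_mult o) (simp add: mult_ac)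
    also have "\<dots> \<in> ?J" using C o by (intro ideal.I_l_closed[OF J]) auto
    finally show ?thesis .
  qed
  have genJ: "?G \<subseteq> ?J" by (rule genideal_self[OF G])
  show "mx \<subseteq> ?J"
  proof
    fix x assume "x \<in> mx"
    then obtain f g where x: "x = frac f g" "ok f g" "peval a f = 0" by (auto simp: mx_def)
    then obtain d where d: "hom d f" "hom d g" "peval a g \<noteq> 0" by (auto simp: ok_def)
    obtain h e i u v where h: "hom e h" "peval a h \<noteq> 0" "i \<in> I" "h * f = i + u * A1 + v * B1"
      using gen[OF d(1) x(3)] by blast
    have hf: "hom (e + d) (h * f)" "hom (e + d) (h * g)" "peval a (h * g) \<noteq> 0"
      using h(2) d whom_mult[OF h(1) d(1)] whom_mult[OF h(1) d(2)] by simp_all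
    let ?D = "e + d"
    define i' where "i' = hcomp wt ?D i"
    define U where "U = hcomp wt ?D (u * A1)"
    define W where "W = hcomp wt ?D (v * B1)"
    have i': "i' \<in> I" using hideal h(3) by (auto simp: hideal_def i'_def)
    have eq: "h * f = i' + U + W" using hcomp_whom[OF hf(1), of ?D] unfolding i'_def U_def W_def h(4) by (simp add: hcomp_add)
    have homs: "hom ?D i'" "hom ?D U" "hom ?D W" by (auto simp: i'_def U_def W_def whom_hcomp)
    have zero: "frac 0 (h * g) \<in> ?J"
      using frac_zero[OF hf(2,3)] additive_subgroup.zero_closed[OF ideal.axioms(1)[OF J]] by simp
    have UJ: "frac U (h * g) \<in> ?J"
    proof (cases "dA \<le> ?D")
      case True
      then have "U = hcomp wt (?D - dA) u * A1" by (simp add: U_def hcomp_mult[OF dA(1)])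
      then show ?thesis using mul[OF dA nz(1) _ whom_hcomp[of wt "?D - dA" u], of "h * g"] genJ hf True by simp
    next
      case False
      then have "U = 0" by (simp add: U_def hcomp_mult[OF dA(1)])
      then show ?thesis using zero by simp
    qed
    have WJ: "frac W (h * g) \<in> ?J"
    proof (cases "dB \<le> ?D")
      case True
      then have "W = hcomp wt (?D - dB) v * B1" by (simp add: W_def hcomp_mult[OF dB(1)])
      then show ?thesis using mul[OF dB nz(2) _ whom_hcomp[of wt "?D - dB" v], of "h * g"] genJ hf True by simp
    next
      case False
      then have "W = 0" by (simp add: W_def hcomp_mult[OF dB(1)])
      then show ?thesis using zero by simp
    qed
    have "x = frac (U + W) (h * g)"
      unfolding x(1)
    proof (rule frac_eqI)
      show "ok f g" by (rule x)
      show "ok (U + W) (h * g)" using homs hf by (auto simp: ok_def intro: whom_add)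
      have "f * (h * g) - (U + W) * g = (h * f - U - W) * g" by (simp add: algebra_simps)
      also have "\<dots> = i' * g" by (simp add: eq)
      finally show "f * (h * g) - (U + W) * g \<in> I" using pidealD(4)[OF I i'] by simp
    qed
    also have "\<dots> = frac U (h * g) \<oplus>\<^bsub>A\<^esub> frac W (h * g)" using homs hf by (intro frac_add_same[symmetric])
    also have "\<dots> \<in> ?J" by (intro additive_subgroup.a_closed[OF ideal.axioms(1)[OF J]] UJ WJ)
    finally show "x \<in> ?J" .
  qed
qed

lemma hom_to_type:
  fixes hk :: "'k \<Rightarrow> 'r::idom" and \<xi> :: "'v \<Rightarrow> 'r"
  assumes hk: "ishom hk" and xi: "\<And>f. f \<in> I \<Longrightarrow> psubst hk \<xi> f = 0"
    and invertible: "\<And>g d. hom d g \<Longrightarrow> peval a g \<noteq> 0 \<Longrightarrow> psubst hk \<xi> g dvd 1"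
  shows "\<exists>\<Phi>. ring_hom_ring A (ring_of_type_algebra :: 'r ring) \<Phi> \<and>
    (\<forall>f g. ok f g \<longrightarrow> \<Phi> (frac f g) * psubst hk \<xi> g = psubst hk \<xi> f)"
proof -
  let ?s = "psubst hk \<xi>"
  define \<Phi> where "\<Phi> x = (SOME v. \<exists>f g. ok f g \<and> x = frac f g \<and> v * ?s g = ?s f)" for x
  have nz: "?s g \<noteq> 0" if "hom d g" "peval a g \<noteq> 0" for g d using invertible[OF that] by auto
  have ex: "\<exists>v. v * ?s g = ?s f" if o: "ok f g" for f g
  proof -
    obtain d where "hom d g" "peval a g \<noteq> 0" using o by (auto simp: ok_def)
    then have "?s g dvd 1" by (rule invertible)
    then obtain u where "1 = ?s g * u" by (rule dvdE)
    then have "(?s f * u) * ?s g = ?s f" using arg_cong[of 1 "?s g * u" "\<lambda>x. ?s f * x"] by (simp add: mult_ac)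
    then show ?thesis by blast
  qed
  have uniq: "v = v'" if o: "ok f g" "ok f' g'" "frac f g = frac f' g'" and v: "v * ?s g = ?s f" "v' * ?s g' = ?s f'" for f g f' g' v v'
  proof -
    obtain h d where h: "hom d h" "peval a h \<noteq> 0" "h * (f * g' - f' * g) \<in> I" using o frac_eq_iff by blast
    have "?s h * (?s f * ?s g' - ?s f' * ?s g) = 0" using xi[OF h(3)] by (simp add: psubst_simps[OF hk])
    then have "?s f * ?s g' = ?s f' * ?s g" using nz[OF h(1,2)] by simp
    then have "v * (?s g * ?s g') = v' * (?s g * ?s g')" by (simp add: v[symmetric] mult_ac)
    moreover have "?s g * ?s g' \<noteq> 0" using o nz by (auto simp: ok_def)
    ultimately show ?thesis by (simp only: mult_cancel_right) blast
  qed
  have \<Phi>: "\<Phi> (frac f g) * ?s g = ?s f" if o: "ok f g" for f g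
  proof -
    obtain v where v: "v * ?s g = ?s f" using ex[OF o] by blast
    have "\<Phi> (frac f g) = v" unfolding \<Phi>_def
    proof (rule some_equality)
      show "\<exists>f' g'. ok f' g' \<and> frac f g = frac f' g' \<and> v * ?s g' = ?s f'" using o v by blast
    next
      fix v' assume "\<exists>f' g'. ok f' g' \<and> frac f g = frac f' g' \<and> v' * ?s g' = ?s f'"
      then obtain f' g' where *: "ok f' g'" "frac f g = frac f' g'" "v' * ?s g' = ?s f'" by blast
      then show "v' = v" using uniq[OF o *(1) *(2) v *(3)] by simp
    qed
    then show ?thesis using v by simp
  qed
  have det: "\<Phi> (frac f g) = v" if "ok f g" "v * ?s g = ?s f" for f g v
    using uniq[OF that(1) that(1) refl \<Phi>[OF that(1)] that(2)] .
  have "ring_hom_ring A (ring_of_type_algebra :: 'r ring) \<Phi>"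
  proof (rule ring_hom_ringI)
    show "Ring.ring A" by (rule ring_axioms)
    show "Ring.ring (ring_of_type_algebra :: 'r ring)" using cring_type cring.axioms(1) by blast
    show "\<Phi> \<one>\<^bsub>A\<^esub> = \<one>\<^bsub>ring_of_type_algebra\<^esub>"
      unfolding one_A using det[OF ok_1(1), of 1] by simp
    fix x y assume "x \<in> carrier A" "y \<in> carrier A"
    then obtain f g f' g' where [simp]: "x = frac f g" "y = frac f' g'" and o: "ok f g" "ok f' g'" by (metis carrierE)
    show "\<Phi> (x \<otimes>\<^bsub>A\<^esub> y) = \<Phi> x \<otimes>\<^bsub>ring_of_type_algebra\<^esub> \<Phi> y"
      using det[OF ok_mult[OF o], of "\<Phi> x * \<Phi> y"] \<Phi>[OF o(1), symmetric] \<Phi>[OF o(2), symmetric]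
      by (simp add: frac_mult o psubst_simps[OF hk] mult_ac)
    show "\<Phi> (x \<oplus>\<^bsub>A\<^esub> y) = \<Phi> x \<oplus>\<^bsub>ring_of_type_algebra\<^esub> \<Phi> y"
      using det[OF ok_add[OF o], of "\<Phi> x + \<Phi> y"] \<Phi>[OF o(1), symmetric] \<Phi>[OF o(2), symmetric]
      by (simp add: frac_add o psubst_simps[OF hk] algebra_simps)
  qed simp
  then show ?thesis using \<Phi> by blast
qed

end

lemma (in wproj) noetherian_fractions:
  assumes "\<And>G :: ('v, 'k) mpoly set. \<exists>F. finite F \<and> F \<subseteq> G \<and> G \<subseteq> pgen F"
  shows "noetherian_ring A"
proof (rule noetherian_ring.intro[OF ring_axioms], unfold_locales)
  fix \<aa> assume aa: "ideal \<aa> A"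
  interpret aa: ideal \<aa> A by (rule aa)
  define H where "H = {f. \<exists>g. ok f g \<and> frac f g \<in> \<aa>}"
  obtain F where F: "finite F" "F \<subseteq> H" "H \<subseteq> pgen F" using assms by blast
  have "\<forall>f\<in>F. \<exists>g. ok f g \<and> frac f g \<in> \<aa>" using F(2) by (auto simp: H_def)
  then obtain \<gamma> where \<gamma>: "\<And>f. f \<in> F \<Longrightarrow> ok f (\<gamma> f)" "\<And>f. f \<in> F \<Longrightarrow> frac f (\<gamma> f) \<in> \<aa>" by metis
  define G where "G = (\<lambda>f. frac f (\<gamma> f)) ` F"
  have G: "G \<subseteq> carrier A" "finite G" "G \<subseteq> \<aa>" using \<gamma> F(1) by (auto simp: G_def)
  let ?J = "genideal A G"
  have J: "ideal ?J A" by (rule genideal_ideal[OF G(1)])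
  have "\<aa> \<subseteq> ?J"
  proof
    fix x assume x: "x \<in> \<aa>"
    then have "x \<in> carrier A" using aa.a_subset by blast
    then obtain f g where fg: "x = frac f g" "ok f g" by (metis carrierE)
    then obtain d where d: "hom d f" "hom d g" "peval a g \<noteq> 0" by (auto simp: ok_def)
    have "f \<in> H" using x fg by (auto simp: H_def)
    then have "f \<in> pgen F" using F(3) by blast
    then obtain F' h where F': "finite F'" "F' \<subseteq> F" "f = (\<Sum>k\<in>F'. h k * k)" using pgen_finite_sum by blast
    have "f = hcomp wt d f" using hcomp_whom[OF d(1), of d] by simp
    also have "\<dots> = (\<Sum>k\<in>F'. hcomp wt d (h k * k))" by (subst F'(3)) (simp add: hcomp_sum)
    finally have e: "f = (\<Sum>k\<in>F'. hcomp wt d (h k * k))" .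
    have "frac (\<Sum>k\<in>F'. hcomp wt d (h k * k)) g \<in> ?J"
    proof (rule frac_sum_in[OF J d(2,3) whom_hcomp])
      fix k assume "k \<in> F'"
      then have kF: "k \<in> F" using F' by blast
      obtain e where e: "hom e k" "hom e (\<gamma> k)" "peval a (\<gamma> k) \<noteq> 0" using \<gamma>(1)[OF kF] by (auto simp: ok_def)
      show "frac (hcomp wt d (h k * k)) g \<in> ?J"
      proof (cases "e \<le> d")
        case True
        define w where "w = hcomp wt (d - e) (h k)"
        have w: "hom (d - e) w" by (simp add: w_def whom_hcomp)
        have hw: "hom d (w * \<gamma> k)" "hom d (w * k)" using whom_mult[OF w e(2)] whom_mult[OF w e(1)] True by auto
        have o: "ok (w * \<gamma> k) g" "ok (w * k) g" using hw d by (auto simp: ok_def)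
        have "frac (w * k) g = frac (w * \<gamma> k) g \<otimes>\<^bsub>A\<^esub> frac k (\<gamma> k)"
          unfolding frac_mult[OF o(1) \<gamma>(1)[OF kF]]
          by (rule frac_eqI'[OF o(2) ok_mult[OF o(1) \<gamma>(1)[OF kF]]]) (simp add: algebra_simps)
        also have "\<dots> \<in> ?J"
        proof (rule ideal.I_l_closed[OF J])
          show "frac k (\<gamma> k) \<in> ?J" using genideal_self[OF G(1)] kF by (auto simp: G_def)
          show "frac (w * \<gamma> k) g \<in> carrier A" using o by simp
        qed
        finally show ?thesis using True by (simp add: hcomp_mult[OF e(1)] w_def)
      next
        case False
        have "frac 0 g = \<zero>\<^bsub>A\<^esub>" using d by (intro frac_zero)
        then show ?thesis using False additive_subgroup.zero_closed[OF ideal.axioms(1)[OF J]] by (simp add: hcomp_mult[OF e(1)])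
      qed
    qed
    then show "x \<in> ?J" using e fg(1) by simp
  qed
  moreover have "?J \<subseteq> \<aa>" by (rule genideal_minimal[OF aa G(3)])
  ultimately show "\<exists>G\<subseteq>carrier A. finite G \<and> \<aa> = genideal A G" using G by blast
qed

section \<open>A bound for the Krull dimension\<close>

definition spanned_by :: "('v, 'k::field) mpoly set \<Rightarrow> ('v, 'k) mpoly set \<Rightarrow> ('v, 'k) mpoly \<Rightarrow> bool" where
  "spanned_by I B f \<longleftrightarrow> (\<exists>k. f - (\<Sum>b\<in>B. pconst (k b) * b) \<in> I)"

definition quadratic_growth :: "('v \<Rightarrow> nat) \<Rightarrow> ('v, 'k::field) mpoly set \<Rightarrow> bool" where
  "quadratic_growth wt I \<longleftrightarrow> (\<exists>C. \<forall>D. \<exists>B. finite B \<and> card B \<le> C * (D + 1) ^ 2 \<and>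
     (\<forall>f. whomogeneous wt D f \<longrightarrow> spanned_by I B f))"

lemma quadratic_growth_dependence:
  fixes f1 f2 f3 g :: "('v, 'k::field) mpoly"
  assumes I: "pideal I" and gr: "quadratic_growth wt I"
    and f: "whomogeneous wt d f1" "whomogeneous wt d f2" "whomogeneous wt d f3" "whomogeneous wt d g"
  shows "\<exists>n c. (\<exists>m\<in>{..n} \<times> {..n} \<times> {..n}. c m \<noteq> 0) \<and>
    (\<Sum>(i, j, k)\<in>{..n} \<times> {..n} \<times> {..n}. pconst (c (i, j, k)) * (f1 ^ i * f2 ^ j * f3 ^ k * g ^ (3 * n - i - j - k))) \<in> I"
proof -
  obtain C where C: "\<And>D. \<exists>B. finite B \<and> card B \<le> C * (D + 1) ^ 2 \<and> (\<forall>f. whomogeneous wt D f \<longrightarrow> spanned_by I B f)"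
    using gr unfolding quadratic_growth_def by blast
  define n where "n = C * (3 * d + 1) ^ 2"
  define M where "M = {..n} \<times> {..n} \<times> {..n}"
  define F where "F m = (case m of (i, j, k) \<Rightarrow> f1 ^ i * f2 ^ j * f3 ^ k * g ^ (3 * n - i - j - k))" for m
  have M: "finite M" "card M = (n + 1) ^ 3" by (auto simp: M_def card_cartesian_product power3_eq_cube)
  obtain B where B: "finite B" "card B \<le> C * (3 * n * d + 1) ^ 2" "\<And>f. whomogeneous wt (3 * n * d) f \<Longrightarrow> spanned_by I B f"
    using C[of "3 * n * d"] by blast
  have "3 * n * d + 1 \<le> (3 * d + 1) * (n + 1)" by (simp add: algebra_simps)
  then have "(3 * n * d + 1) ^ 2 \<le> ((3 * d + 1) * (n + 1)) ^ 2" by (rule power_mono) simp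
  then have "C * (3 * n * d + 1) ^ 2 \<le> C * ((3 * d + 1) * (n + 1)) ^ 2" by (rule mult_left_mono) simp
  also have "\<dots> = n * (n + 1) ^ 2" by (simp only: n_def power_mult_distrib mult.assoc)
  also have "\<dots> < (n + 1) ^ 3" by (simp add: power3_eq_cube power2_eq_square)
  finally have cardBM: "card B < card M" using B(2) M by linarith
  have hF: "whomogeneous wt (3 * n * d) (F m)" if m: "m \<in> M" for m
  proof -
    obtain i j k where ijk: "m = (i, j, k)" "i \<le> n" "j \<le> n" "k \<le> n" using m by (auto simp: M_def)
    have w: "whomogeneous wt (d * i + d * j + d * k + d * (3 * n - i - j - k)) (F m)"
      unfolding F_def ijk(1) prod.case by (intro whom_mult whom_power f)
    have 1: "d * i + d * j + d * k + d * (3 * n - i - j - k) = d * (i + j + k + (3 * n - i - j - k))"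
      by (simp only: distrib_left)
    have 2: "i + j + k + (3 * n - i - j - k) = 3 * n" using ijk(2-4) by simp
    have "d * i + d * j + d * k + d * (3 * n - i - j - k) = 3 * n * d"
      unfolding 1 2 by (rule mult.commute)
    then show ?thesis using w by (simp only:)
  qed
  have "\<forall>m\<in>M. \<exists>k. F m - (\<Sum>b\<in>B. pconst (k b) * b) \<in> I"
    using B(3)[OF hF] unfolding spanned_by_def by (intro ballI)
  then have "\<exists>\<kappa>. \<forall>m\<in>M. F m - (\<Sum>b\<in>B. pconst (\<kappa> m b) * b) \<in> I" by (rule bchoice)
  then obtain \<kappa> where \<kappa>: "\<And>m. m \<in> M \<Longrightarrow> F m - (\<Sum>b\<in>B. pconst (\<kappa> m b) * b) \<in> I" by auto
  obtain l where l: "\<exists>m\<in>M. l m \<noteq> 0" "\<forall>b\<in>B. (\<Sum>m\<in>M. l m * \<kappa> m b) = 0"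
    using linear_dependence[OF B(1) M(1) cardBM, of \<kappa>] by blast
  have "(\<Sum>m\<in>M. pconst (l m) * (\<Sum>b\<in>B. pconst (\<kappa> m b) * b)) = (\<Sum>b\<in>B. \<Sum>m\<in>M. pconst (l m) * (pconst (\<kappa> m b) * b))"
    unfolding sum_distrib_left by (rule sum.swap)
  also have "\<dots> = (\<Sum>b\<in>B. pconst (\<Sum>m\<in>M. l m * \<kappa> m b) * b)"
    by (simp add: ishomD[OF ishom_pconst] sum_distrib_right mult.assoc)
  also have "\<dots> = 0" using l(2) by (simp add: pconst_0)
  finally have z: "(\<Sum>m\<in>M. pconst (l m) * (\<Sum>b\<in>B. pconst (\<kappa> m b) * b)) = 0" .
  have "(\<Sum>m\<in>M. pconst (l m) * F m) = (\<Sum>m\<in>M. pconst (l m) * (F m - (\<Sum>b\<in>B. pconst (\<kappa> m b) * b)))"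
    using z by (simp add: right_diff_distrib sum_subtractf)
  also have "\<dots> \<in> I" by (intro pideal_sum[OF I] pidealD(3)[OF I] \<kappa>)
  finally have "(\<Sum>m\<in>M. pconst (l m) * F m) \<in> I" .
  moreover have "(\<Sum>m\<in>M. pconst (l m) * F m) = (\<Sum>(i, j, k)\<in>M. pconst (l (i, j, k)) * (f1 ^ i * f2 ^ j * f3 ^ k * g ^ (3 * n - i - j - k)))"
    by (intro sum.cong) (auto simp: F_def)
  ultimately show ?thesis using l(1) unfolding M_def by (intro exI[of _ n] exI[of _ l]) simp
qed

text \<open>
  The lexicographically smallest monomial of a relation between three elements is split off; this is
  the elementary characterization of the Krull dimension due to Coquand and Lombardi.
\<close>

lemma lexicographic_split:
  fixes f1 f2 f3 g :: "('v, 'k::field) mpoly"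
  assumes f: "whomogeneous wt d f1" "whomogeneous wt d f2" "whomogeneous wt d f3" "whomogeneous wt d g"
    and c: "\<exists>m\<in>{..n} \<times> {..n} \<times> {..n}. c m \<noteq> 0"
  shows "\<exists>i0 j0 k0 c0 e1 e2 e3 e4 R1 R2 R3. c0 \<noteq> 0 \<and>
    whomogeneous wt (d * e1) R1 \<and> whomogeneous wt (d * e2) R2 \<and> whomogeneous wt (d * e3) R3 \<and>
    e4 = Suc e1 \<and> Suc e2 = k0 + e4 \<and> Suc e3 = j0 + Suc e2 \<and>
    (\<Sum>(i, j, k)\<in>{..n} \<times> {..n} \<times> {..n}. pconst (c (i, j, k)) * (f1 ^ i * f2 ^ j * f3 ^ k * g ^ (3 * n - i - j - k))) * g =
    f1 ^ i0 * (f2 ^ j0 * (f3 ^ k0 * (pconst c0 * g ^ e4 + f3 * R1) + f2 * R2) + f1 * R3)"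
proof -
  define M where "M = {m \<in> {..n} \<times> {..n} \<times> {..n}. c m \<noteq> 0}"
  have M: "finite M" "M \<noteq> {}" using c by (auto simp: M_def)
  define i0 where "i0 = Min (fst ` M)"
  have i0: "i0 \<in> fst ` M" "\<And>m. m \<in> M \<Longrightarrow> i0 \<le> fst m" unfolding i0_def using M by (auto intro: Min_in)
  define M' where "M' = {m \<in> M. fst m = i0}"
  have M': "finite M'" "M' \<noteq> {}" using M i0 by (auto simp: M'_def)
  define j0 where "j0 = Min ((\<lambda>m. fst (snd m)) ` M')"
  have j0: "j0 \<in> (\<lambda>m. fst (snd m)) ` M'" "\<And>m. m \<in> M' \<Longrightarrow> j0 \<le> fst (snd m)" unfolding j0_def using M' by (auto intro: Min_in)
  define M'' where "M'' = {m \<in> M'. fst (snd m) = j0}"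
  have M'': "finite M''" "M'' \<noteq> {}" using M' j0 by (auto simp: M''_def)
  define k0 where "k0 = Min ((\<lambda>m. snd (snd m)) ` M'')"
  have k0: "k0 \<in> (\<lambda>m. snd (snd m)) ` M''" "\<And>m. m \<in> M'' \<Longrightarrow> k0 \<le> snd (snd m)" unfolding k0_def using M'' by (auto intro: Min_in)
  have m0: "(i0, j0, k0) \<in> M" using k0(1) by (auto simp: M''_def M'_def)
  then have le: "i0 \<le> n" "j0 \<le> n" "k0 \<le> n" by (auto simp: M_def)
  define A1 where "A1 = {m \<in> M''. k0 < snd (snd m)}"
  define A2 where "A2 = {m \<in> M'. j0 < fst (snd m)}"
  define A3 where "A3 = {m \<in> M. i0 < fst m}"
  have split: "M = insert (i0, j0, k0) (A1 \<union> A2 \<union> A3)"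
  proof (intro equalityI subsetI)
    fix m assume m: "m \<in> M"
    obtain i j k where ijk: "m = (i, j, k)" by (cases m)
    consider "i0 < i" | "i = i0" "j0 < j" | "i = i0" "j = j0" "k0 < k" | "i = i0" "j = j0" "k = k0"
      using i0(2)[OF m] j0(2)[of m] k0(2)[of m] m unfolding M''_def M'_def ijk by force
    then show "m \<in> insert (i0, j0, k0) (A1 \<union> A2 \<union> A3)"
      using m unfolding A1_def A2_def A3_def M''_def M'_def ijk by cases auto
  next
    fix m assume "m \<in> insert (i0, j0, k0) (A1 \<union> A2 \<union> A3)"
    then show "m \<in> M" using m0 unfolding A1_def A2_def A3_def M''_def M'_def by blast
  qed
  have fin: "finite A1" "finite A2" "finite A3" using M by (auto simp: A1_def A2_def A3_def M'_def M''_def)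
  have dj: "(i0, j0, k0) \<notin> A1 \<union> A2 \<union> A3" "A1 \<inter> A2 = {}" "(A1 \<union> A2) \<inter> A3 = {}"
    by (auto simp: A1_def A2_def A3_def M'_def M''_def)
  define F where "F m = (case m of (i, j, k) \<Rightarrow> pconst (c m) * (f1 ^ i * f2 ^ j * f3 ^ k * g ^ (3 * n - i - j - k)))" for m
  define e4 where "e4 = Suc (3 * n - i0 - j0 - k0)"
  define e1 where "e1 = 3 * n - i0 - j0 - k0"
  define e2 where "e2 = 3 * n - i0 - j0"
  define e3 where "e3 = 3 * n - i0"
  define R1 where "R1 = (\<Sum>(i, j, k)\<in>A1. pconst (c (i, j, k)) * (f3 ^ (k - k0 - 1) * g ^ Suc (3 * n - i - j - k)))"
  define R2 where "R2 = (\<Sum>(i, j, k)\<in>A2. pconst (c (i, j, k)) * (f2 ^ (j - j0 - 1) * f3 ^ k * g ^ Suc (3 * n - i - j - k)))"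
  define R3 where "R3 = (\<Sum>(i, j, k)\<in>A3. pconst (c (i, j, k)) * (f1 ^ (i - i0 - 1) * f2 ^ j * f3 ^ k * g ^ Suc (3 * n - i - j - k)))"
  have pw: "x ^ k = x ^ l * (x * x ^ (k - l - 1))" if "l < k" for x :: "('v, 'k) mpoly" and k l
    using that by (simp flip: power_add power_Suc)
  have s1: "(\<Sum>m\<in>A1. F m) * g = f1 ^ i0 * (f2 ^ j0 * (f3 ^ k0 * (f3 * R1)))"
    unfolding R1_def sum_distrib_left sum_distrib_right
  proof (intro sum.cong refl)
    fix m assume "m \<in> A1"
    then obtain k where m: "m = (i0, j0, k)" "k0 < k" by (cases m) (auto simp: A1_def M''_def M'_def)
    show "F m * g = f1 ^ i0 * (f2 ^ j0 * (f3 ^ k0 * (f3 * (case m of (i, j, k) \<Rightarrow> pconst (c (i, j, k)) * (f3 ^ (k - k0 - 1) * g ^ Suc (3 * n - i - j - k))))))"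
      unfolding F_def m(1) prod.case pw[OF m(2), of f3] by (simp add: mult_ac)
  qed
  have s2: "(\<Sum>m\<in>A2. F m) * g = f1 ^ i0 * (f2 ^ j0 * (f2 * R2))"
    unfolding R2_def sum_distrib_left sum_distrib_right
  proof (intro sum.cong refl)
    fix m assume "m \<in> A2"
    then obtain j k where m: "m = (i0, j, k)" "j0 < j" by (cases m) (auto simp: A2_def M'_def)
    show "F m * g = f1 ^ i0 * (f2 ^ j0 * (f2 * (case m of (i, j, k) \<Rightarrow> pconst (c (i, j, k)) * (f2 ^ (j - j0 - 1) * f3 ^ k * g ^ Suc (3 * n - i - j - k)))))"
      unfolding F_def m(1) prod.case pw[OF m(2), of f2] by (simp add: mult_ac)
  qed
  have s3: "(\<Sum>m\<in>A3. F m) * g = f1 ^ i0 * (f1 * R3)"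
    unfolding R3_def sum_distrib_left sum_distrib_right
  proof (intro sum.cong refl)
    fix m assume "m \<in> A3"
    then obtain i j k where m: "m = (i, j, k)" "i0 < i" by (cases m) (auto simp: A3_def)
    show "F m * g = f1 ^ i0 * (f1 * (case m of (i, j, k) \<Rightarrow> pconst (c (i, j, k)) * (f1 ^ (i - i0 - 1) * f2 ^ j * f3 ^ k * g ^ Suc (3 * n - i - j - k))))"
      unfolding F_def m(1) prod.case pw[OF m(2), of f1] by (simp add: mult_ac)
  qed
  have "(\<Sum>(i, j, k)\<in>{..n} \<times> {..n} \<times> {..n}. pconst (c (i, j, k)) * (f1 ^ i * f2 ^ j * f3 ^ k * g ^ (3 * n - i - j - k))) = (\<Sum>m\<in>{..n} \<times> {..n} \<times> {..n}. F m)"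
    by (intro sum.cong) (auto simp: F_def)
  also have "\<dots> = (\<Sum>m\<in>M. F m)"
    by (intro sum.mono_neutral_right) (auto simp: M_def F_def pconst_0)
  also have "\<dots> = F (i0, j0, k0) + ((\<Sum>m\<in>A1. F m) + (\<Sum>m\<in>A2. F m) + (\<Sum>m\<in>A3. F m))"
    unfolding split using fin dj by (simp add: sum.union_disjoint)
  finally have "(\<Sum>(i, j, k)\<in>{..n} \<times> {..n} \<times> {..n}. pconst (c (i, j, k)) * (f1 ^ i * f2 ^ j * f3 ^ k * g ^ (3 * n - i - j - k))) * g
     = F (i0, j0, k0) * g + ((\<Sum>m\<in>A1. F m) * g + (\<Sum>m\<in>A2. F m) * g + (\<Sum>m\<in>A3. F m) * g)"
    by (simp only: distrib_right)
  also have "\<dots> = f1 ^ i0 * (f2 ^ j0 * (f3 ^ k0 * (pconst (c (i0, j0, k0)) * g ^ e4 + f3 * R1) + f2 * R2) + f1 * R3)"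
    unfolding s1 s2 s3 by (simp add: F_def e4_def algebra_simps)
  finally have eq: "(\<Sum>(i, j, k)\<in>{..n} \<times> {..n} \<times> {..n}. pconst (c (i, j, k)) * (f1 ^ i * f2 ^ j * f3 ^ k * g ^ (3 * n - i - j - k))) * g
     = f1 ^ i0 * (f2 ^ j0 * (f3 ^ k0 * (pconst (c (i0, j0, k0)) * g ^ e4 + f3 * R1) + f2 * R2) + f1 * R3)" .
  have wh: "whomogeneous wt N x \<Longrightarrow> N = N' \<Longrightarrow> whomogeneous wt N' x" for N N' and x :: "('v, 'k) mpoly" by simp
  have "whomogeneous wt (d * e1) R1" unfolding R1_def
  proof (intro whom_sum)
    fix m assume "m \<in> A1"
    then obtain k where m: "m = (i0, j0, k)" "k0 < k" "k \<le> n" by (cases m) (auto simp: A1_def M''_def M'_def M_def)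
    have "(k - k0 - 1) + Suc (3 * n - i0 - j0 - k) = e1" using m le unfolding e1_def by linarith
    then have e: "0 + (d * (k - k0 - 1) + d * Suc (3 * n - i0 - j0 - k)) = d * e1" by (metis add_0 distrib_left)
    show "whomogeneous wt (d * e1) (case m of (i, j, k) \<Rightarrow> pconst (c (i, j, k)) * (f3 ^ (k - k0 - 1) * g ^ Suc (3 * n - i - j - k)))"
      unfolding m(1) prod.case by (rule wh[OF _ e]) (intro whom_mult whom_power f whom_pconst)
  qed
  moreover have "whomogeneous wt (d * e2) R2" unfolding R2_def
  proof (intro whom_sum)
    fix m assume "m \<in> A2"
    then obtain j k where m: "m = (i0, j, k)" "j0 < j" "j \<le> n" "k \<le> n" by (cases m) (auto simp: A2_def M'_def M_def)
    have "(j - j0 - 1) + k + Suc (3 * n - i0 - j - k) = e2" using m le unfolding e2_def by linarith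
    then have e: "0 + (d * (j - j0 - 1) + d * k + d * Suc (3 * n - i0 - j - k)) = d * e2" by (metis add_0 distrib_left)
    show "whomogeneous wt (d * e2) (case m of (i, j, k) \<Rightarrow> pconst (c (i, j, k)) * (f2 ^ (j - j0 - 1) * f3 ^ k * g ^ Suc (3 * n - i - j - k)))"
      unfolding m(1) prod.case by (rule wh[OF _ e]) (intro whom_mult whom_power f whom_pconst)
  qed
  moreover have "whomogeneous wt (d * e3) R3" unfolding R3_def
  proof (intro whom_sum)
    fix m assume "m \<in> A3"
    then obtain i j k where m: "m = (i, j, k)" "i0 < i" "i \<le> n" "j \<le> n" "k \<le> n" by (cases m) (auto simp: A3_def M_def)
    have "(i - i0 - 1) + j + k + Suc (3 * n - i - j - k) = e3" using m le unfolding e3_def by linarith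
    then have e: "0 + (d * (i - i0 - 1) + d * j + d * k + d * Suc (3 * n - i - j - k)) = d * e3" by (metis add_0 distrib_left)
    show "whomogeneous wt (d * e3) (case m of (i, j, k) \<Rightarrow> pconst (c (i, j, k)) * (f1 ^ (i - i0 - 1) * f2 ^ j * f3 ^ k * g ^ Suc (3 * n - i - j - k)))"
      unfolding m(1) prod.case by (rule wh[OF _ e]) (intro whom_mult whom_power f whom_pconst)
  qed
  moreover have "c (i0, j0, k0) \<noteq> 0" using m0 by (simp add: M_def)
  moreover have "e4 = Suc e1" "Suc e2 = k0 + e4" "Suc e3 = j0 + Suc e2" using le by (auto simp: e1_def e2_def e3_def e4_def)
  ultimately show ?thesis using eq by blast
qed

context wproj
begin

lemma no_prime_chain:
  assumes gr: "quadratic_growth wt I"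
    and P: "\<And>i. i \<le> 3 \<Longrightarrow> primeideal (P i) A" "P 0 \<subset> P 1" "P 1 \<subset> P 2" "P 2 \<subset> P (3::nat)"
  shows False
proof -
  have ext: "\<exists>x. x \<in> P (Suc i) \<and> x \<notin> P i \<and> x \<in> carrier A" if "i < 3" "P i \<subset> P (Suc i)" for i
  proof -
    have "P (Suc i) \<subseteq> carrier A"
      using P(1)[of "Suc i"] that(1) additive_subgroup.a_subset[OF ideal.axioms(1)[OF primeideal.axioms(1)]] by auto
    then show ?thesis using that(2) by blast
  qed
  obtain x1 where x1: "x1 \<in> P 1" "x1 \<notin> P 0" "x1 \<in> carrier A" using ext[of 0] P(2) by auto
  obtain x2 where x2: "x2 \<in> P 2" "x2 \<notin> P 1" "x2 \<in> carrier A" using ext[of 1] P(3) by (auto simp: numeral_2_eq_2)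
  obtain x3 where x3: "x3 \<in> P 3" "x3 \<notin> P 2" "x3 \<in> carrier A" using ext[of 2] P(4) by (auto simp: numeral_3_eq_3 numeral_2_eq_2)
  obtain p1 g1 where p1: "x1 = frac p1 g1" "ok p1 g1" using x1 by (metis carrierE)
  obtain p2 g2 where p2: "x2 = frac p2 g2" "ok p2 g2" using x2 by (metis carrierE)
  obtain p3 g3 where p3: "x3 = frac p3 g3" "ok p3 g3" using x3 by (metis carrierE)
  obtain d1 d2 d3 where d: "hom d1 p1" "hom d1 g1" "hom d2 p2" "hom d2 g2" "hom d3 p3" "hom d3 g3"
    using p1 p2 p3 by (auto simp: ok_def)
  define d where "d = d1 + d2 + d3"
  define g where "g = g1 * g2 * g3"
  define f1 where "f1 = p1 * g2 * g3"
  define f2 where "f2 = g1 * p2 * g3"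
  define f3 where "f3 = g1 * g2 * p3"
  have hf: "hom d f1" "hom d f2" "hom d f3" "hom d g"
    unfolding d_def f1_def f2_def f3_def g_def by (intro whom_mult d)+
  have g: "peval a g \<noteq> 0" using p1 p2 p3 by (auto simp: g_def ok_def)
  have okf: "ok f1 g" "ok f2 g" "ok f3 g" using hf g by (auto simp: ok_def)
  have xs: "x1 = frac f1 g" "x2 = frac f2 g" "x3 = frac f3 g"
    unfolding p1 p2 p3 by (intro frac_eqI' p1 p2 p3 okf; simp add: f1_def f2_def f3_def g_def mult_ac)+
  obtain n c where c: "\<exists>m\<in>{..n} \<times> {..n} \<times> {..n}. c m \<noteq> 0"
    "(\<Sum>(i, j, k)\<in>{..n} \<times> {..n} \<times> {..n}. pconst (c (i, j, k)) * (f1 ^ i * f2 ^ j * f3 ^ k * g ^ (3 * n - i - j - k))) \<in> I"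
    using quadratic_growth_dependence[OF I gr hf] by blast
  obtain i0 j0 k0 c0 e1 e2 e3 e4 R1 R2 R3 where R: "c0 \<noteq> 0" "hom (d * e1) R1" "hom (d * e2) R2" "hom (d * e3) R3"
    "e4 = Suc e1" "Suc e2 = k0 + e4" "Suc e3 = j0 + Suc e2" and
    eq: "(\<Sum>(i, j, k)\<in>{..n} \<times> {..n} \<times> {..n}. pconst (c (i, j, k)) * (f1 ^ i * f2 ^ j * f3 ^ k * g ^ (3 * n - i - j - k))) * g =
    f1 ^ i0 * (f2 ^ j0 * (f3 ^ k0 * (pconst c0 * g ^ e4 + f3 * R1) + f2 * R2) + f1 * R3)"
    using lexicographic_split[OF hf c(1)] by blast
  define In where "In Q u e \<longleftrightarrow> hom (d * e) u \<and> frac u (g ^ e) \<in> Q" for Q u e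
  have hg: "hom (d * e) (g ^ e)" "peval a (g ^ e) \<noteq> 0" for e using hf(4) g by (auto intro: whom_power)
  have okg: "ok u (g ^ e)" if "hom (d * e) u" for u e using that hg by (auto simp: ok_def)
  have mulhom: "hom (d * (e + e')) (u * v)" if "hom (d * e) u" "hom (d * e') v" for u v e e'
    using whom_mult[OF that] by (simp add: distrib_left)
  have fm: "frac (u * v) (g ^ (e + e')) = frac u (g ^ e) \<otimes>\<^bsub>A\<^esub> frac v (g ^ e')" if "hom (d * e) u" "hom (d * e') v" for u v e e'
    using frac_mult[OF okg[OF that(1)] okg[OF that(2)]] by (simp add: power_add)
  have pr: "In (P i) v e'" if "i \<le> 3" "In (P i) (u * v) (e + e')" "hom (d * e) u" "hom (d * e') v" "\<not> In (P i) u e" for i u v e e'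
  proof -
    have "frac u (g ^ e) \<otimes>\<^bsub>A\<^esub> frac v (g ^ e') \<in> P i" using that fm by (auto simp: In_def)
    then have "frac u (g ^ e) \<in> P i \<or> frac v (g ^ e') \<in> P i"
      using primeideal.I_prime[OF P(1)[OF that(1)], of "frac u (g ^ e)" "frac v (g ^ e')"] okg that(3,4) by simp
    then show ?thesis using that by (auto simp: In_def)
  qed
  have mul: "In (P i) (u * v) (e + e')" if "i \<le> 3" "In (P i) u e" "hom (d * e') v" for i u v e e'
  proof -
    have "frac u (g ^ e) \<otimes>\<^bsub>A\<^esub> frac v (g ^ e') \<in> P i"
      using that okg by (intro ideal.I_r_closed[OF primeideal.axioms(1)[OF P(1)]]) (auto simp: In_def)
    then show ?thesis using that fm mulhom by (auto simp: In_def)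
  qed
  have dif: "In (P i) u e" if "i \<le> 3" "In (P i) (u + v) e" "In (P i) v e" for i u v e
  proof -
    interpret Pi: primeideal "P i" A using P(1) that(1) by blast
    have h: "hom (d * e) (u + v)" "hom (d * e) v" using that by (auto simp: In_def)
    have hu: "hom (d * e) u" using whom_diff[OF h] by simp
    have n: "In (P i) (v * pconst (-1)) (e + 0)" by (rule mul[OF that(1,3)]) (simp add: whom_pconst)
    have "frac (u + v) (g ^ e) \<oplus>\<^bsub>A\<^esub> frac (v * pconst (-1)) (g ^ e) = frac (u + v + v * pconst (-1)) (g ^ e)"
      using n h hg by (intro frac_add_same) (auto simp: In_def)
    moreover have "u + v + v * pconst (-1) = u" using ishomD(5)[OF ishom_pconst[where 'v = 'v and 'k = 'k], of 1] by (simp add: pconst_1)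
    ultimately have "frac u (g ^ e) = frac (u + v) (g ^ e) \<oplus>\<^bsub>A\<^esub> frac (v * pconst (-1)) (g ^ e)" by simp
    also have "\<dots> \<in> P i" using n that(2) by (intro Pi.a_closed) (auto simp: In_def)
    finally show ?thesis using hu by (simp add: In_def)
  qed
  have notpow: "\<not> In (P i) (u ^ m) m" if i: "i \<le> 3" and u: "hom d u" and nu: "\<not> In (P i) u 1" for i u m
  proof (induction m)
    case 0
    interpret Pi: primeideal "P i" A using P(1) i by blast
    have "\<one>\<^bsub>A\<^esub> \<notin> P i" using Pi.I_notcarr Pi.one_imp_carrier by blast
    then show ?case by (simp add: In_def one_A)
  next
    case (Suc m)
    show ?case
    proof
      assume "In (P i) (u ^ Suc m) (Suc m)"
      then have "In (P i) (u * u ^ m) (1 + m)" by simp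
      from pr[OF i this _ _ nu] u whom_power[OF u, of m] Suc show False by simp
    qed
  qed
  have mono: "In (P i) u e \<Longrightarrow> In (P (Suc i)) u e" if "i < 3" for i u e
  proof -
    have "i = 0 \<or> i = 1 \<or> i = 2" using that by auto
    then have "P i \<subseteq> P (Suc i)" using P(2-4) by (auto simp: numeral_2_eq_2 numeral_3_eq_3)
    then show "In (P i) u e \<Longrightarrow> In (P (Suc i)) u e" by (auto simp: In_def)
  qed
  have Inf: "In (P 1) f1 1" "\<not> In (P 0) f1 1" "In (P 2) f2 1" "\<not> In (P 1) f2 1" "In (P 3) f3 1" "\<not> In (P 2) f3 1"
    using x1 x2 x3 xs hf by (auto simp: In_def)
  have hp: "hom (d * m) (u ^ m)" if "hom d u" for u :: "('v, 'k) mpoly" and m using whom_power[OF that] .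
  define D where "D = pconst c0 * g ^ e4 + f3 * R1"
  define E where "E = f3 ^ k0 * D + f2 * R2"
  define B where "B = f2 ^ j0 * E + f1 * R3"
  have hD: "hom (d * e4) D"
  proof -
    have "hom (d * 0 + d * e4) (pconst c0 * g ^ e4)" using whom_mult[OF whom_pconst hg(1)] by simp
    moreover have "hom (d + d * e1) (f3 * R1)" by (intro whom_mult hf R)
    ultimately show ?thesis unfolding D_def by (intro whom_add) (simp_all add: R(5))
  qed
  have hE: "hom (d * (k0 + e4)) E"
  proof -
    have "hom (d * (k0 + e4)) (f3 ^ k0 * D)" by (intro mulhom hp hf hD)
    moreover have "hom (d + d * e2) (f2 * R2)" by (intro whom_mult hf R)
    ultimately show ?thesis unfolding E_def by (intro whom_add) (simp_all flip: R(6))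
  qed
  have hB: "hom (d * (j0 + (k0 + e4))) B"
  proof -
    have "hom (d * (j0 + (k0 + e4))) (f2 ^ j0 * E)" by (intro mulhom hp hf hE)
    moreover have "hom (d + d * e3) (f1 * R3)" by (intro whom_mult hf R)
    moreover have "d + d * e3 = d * (j0 + (k0 + e4))"
      using R(6,7) by (metis add_Suc_right mult_Suc_right)
    ultimately show ?thesis unfolding B_def by (intro whom_add) simp_all
  qed
  have "f1 ^ i0 * B \<in> I" using pidealD(4)[OF I c(2), of g] unfolding eq B_def E_def D_def .
  then have "frac (f1 ^ i0 * B) (g ^ (i0 + (j0 + (k0 + e4)))) = frac 0 1"
    using okg[OF mulhom[OF hp[OF hf(1)] hB]] by (intro frac_eqI) (auto simp: ok_1)
  then have "In (P 0) (f1 ^ i0 * B) (i0 + (j0 + (k0 + e4)))"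
    using mulhom[OF hp[OF hf(1)] hB] additive_subgroup.zero_closed[OF ideal.axioms(1)[OF primeideal.axioms(1)[OF P(1)[of 0]]]]
    by (simp add: In_def zero_A)
  then have "In (P 0) B (j0 + (k0 + e4))"
    using pr[of 0] hp[OF hf(1)] hB notpow[of 0 f1 i0] hf(1) Inf by blast
  then have "In (P 1) B (j0 + (k0 + e4))" using mono[of 0] by simp
  moreover have "In (P 1) (f1 * R3) (1 + e3)" by (rule mul[OF _ Inf(1) R(4)]) simp
  ultimately have "In (P 1) (f2 ^ j0 * E) (j0 + (k0 + e4))"
    unfolding B_def using dif[of 1] R(6,7) by simp
  then have "In (P 1) E (k0 + e4)"
    using pr[of 1] hp[OF hf(2)] hE notpow[of 1 f2 j0] hf(2) Inf by auto
  then have "In (P 2) E (k0 + e4)" using mono[of 1] by (simp add: numeral_2_eq_2)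
  moreover have "In (P 2) (f2 * R2) (1 + e2)" by (rule mul[OF _ Inf(3) R(3)]) simp
  ultimately have "In (P 2) (f3 ^ k0 * D) (k0 + e4)"
    unfolding E_def using dif[of 2] R(6) by simp
  then have "In (P 2) D e4"
    using pr[of 2] hp[OF hf(3)] hD notpow[of 2 f3 k0] hf(3) Inf by auto
  then have "In (P 3) D e4" using mono[of 2] by (simp add: numeral_2_eq_2 numeral_3_eq_3)
  moreover have "In (P 3) (f3 * R1) (1 + e1)" by (rule mul[OF _ Inf(5) R(2)]) simp
  ultimately have "In (P 3) (pconst c0 * g ^ e4) e4"
    unfolding D_def using dif[of 3] R(5) by simp
  then have fr: "frac (pconst c0 * g ^ e4) (g ^ e4) \<in> P 3" by (simp add: In_def)
  interpret P3: primeideal "P 3" A using P(1) by simp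
  have "P 3 \<subseteq> mx" using proper_ideal_subset[OF P3.is_ideal] P3.I_notcarr by blast
  then have "frac (pconst c0 * g ^ e4) (g ^ e4) \<in> mx" using fr by blast
  moreover have "ok (pconst c0 * g ^ e4) (g ^ e4)" using whom_mult[OF whom_pconst hg(1)] by (intro okg) simp
  ultimately have "peval a (pconst c0 * g ^ e4) = 0" by (simp add: frac_in_mx)
  then show False using R(1) g by simp
qed

lemma krull_dim_le_2:
  assumes "quadratic_growth wt I"
  shows "krull_dim A \<le> 2"
  unfolding krull_dim_def
proof (rule SUP_least)
  fix n assume "n \<in> {n. \<exists>p. (\<forall>i\<le>n. primeideal (p i) A) \<and> (\<forall>i<n. p i \<subset> p (Suc i))}"
  then obtain p where p: "\<And>i. i \<le> n \<Longrightarrow> primeideal (p i) A" "\<And>i. i < n \<Longrightarrow> p i \<subset> p (Suc i)" by blast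
  have "n \<le> 2"
  proof (rule ccontr)
    assume "\<not> n \<le> 2"
    then have n: "3 \<le> n" by simp
    have "primeideal (p i) A" if "i \<le> 3" for i using p(1) n that by simp
    moreover have "p 0 \<subset> p 1" "p 1 \<subset> p 2" "p 2 \<subset> p 3"
      using p(2)[of 0] p(2)[of 1] p(2)[of 2] n by (auto simp: numeral_2_eq_2 numeral_3_eq_3)
    ultimately show False by (rule no_prime_chain[OF assms])
  qed
  then show "enat n \<le> 2" by (metis enat_ord_simps(1) numeral_eq_enat)
qed

lemma krull_dim_ge_2:
  assumes "primeideal P0 A" "primeideal P1 A" "primeideal P2 A" "P0 \<subset> P1" "P1 \<subset> P2"
  shows "2 \<le> krull_dim A"
proof -
  have "enat 2 \<le> krull_dim A"
    unfolding krull_dim_def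
  proof (rule SUP_upper)
    show "2 \<in> {n. \<exists>p. (\<forall>i\<le>n. primeideal (p i) A) \<and> (\<forall>i<n. p i \<subset> p (Suc i))}"
      using assms by (intro CollectI exI[of _ "\<lambda>i. if i = 0 then P0 else if i = 1 then P1 else P2"]) (auto simp: less_2_cases_iff)
  qed
  then show ?thesis by (metis numeral_eq_enat)
qed

end

section \<open>The ideal of the surface\<close>

abbreviation sx0 :: S where "sx0 \<equiv> pvar Vx0"
abbreviation sx1 :: S where "sx1 \<equiv> pvar Vx1"
abbreviation sy :: S where "sy \<equiv> pvar Vy"
abbreviation sw :: S where "sw \<equiv> pvar Vw"
abbreviation su0 :: S where "su0 \<equiv> pvar Vu0"
abbreviation su1 :: S where "su1 \<equiv> pvar Vu1"
abbreviation sz :: S where "sz \<equiv> pvar Vz"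
abbreviation st :: S where "st \<equiv> pvar Vt"

definition Qf :: "complex \<Rightarrow> complex \<Rightarrow> S" where
  "Qf \<theta> \<tau> = pconst \<theta> * su1 * sz + pconst \<tau> * sw ^ 3"

lemma relations_eq: "relations \<theta> \<tau> P =
    {sx0 * sy - sx1 ^ 3, sx0 * sw - sx1 ^ 2 * sy, sx1 * sw - sy ^ 2, sx0 * su1 - sx1 * su0,
     sx1 ^ 2 * su1 - sy * su0, sx1 * sy * su1 - sw * su0, sx0 * st - su0 ^ 2, sx1 * st - su0 * su1,
     sx1 * su1 ^ 2 - sy * st, sy * su1 ^ 2 - sw * st,
     sx0 * P + sx1 ^ 2 * Qf \<theta> \<tau> + su0 * st, sx1 * P + sy * Qf \<theta> \<tau> + su1 * st,
     sy * P + sw * Qf \<theta> \<tau> + su1 ^ 3, su0 * P + sx1 * su1 * Qf \<theta> \<tau> + st ^ 2}"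
  unfolding relations_def Let_def Qf_def ..

lemma X'_ideal_eq: "X'_ideal \<theta> \<tau> P = pgen (relations \<theta> \<tau> P)"
  by (simp add: X'_ideal_def pgen_def)

lemma pideal_X': "pideal (X'_ideal \<theta> \<tau> P)"
  by (simp add: X'_ideal_eq pideal_pgen)

lemma X'_rel:
  "sx0 * sy - sx1 ^ 3 \<in> X'_ideal \<theta> \<tau> P" "sx0 * sw - sx1 ^ 2 * sy \<in> X'_ideal \<theta> \<tau> P"
  "sx1 * sw - sy ^ 2 \<in> X'_ideal \<theta> \<tau> P" "sx0 * su1 - sx1 * su0 \<in> X'_ideal \<theta> \<tau> P"
  "sx1 ^ 2 * su1 - sy * su0 \<in> X'_ideal \<theta> \<tau> P" "sx1 * sy * su1 - sw * su0 \<in> X'_ideal \<theta> \<tau> P"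
  "sx0 * st - su0 ^ 2 \<in> X'_ideal \<theta> \<tau> P" "sx1 * st - su0 * su1 \<in> X'_ideal \<theta> \<tau> P"
  "sx1 * su1 ^ 2 - sy * st \<in> X'_ideal \<theta> \<tau> P" "sy * su1 ^ 2 - sw * st \<in> X'_ideal \<theta> \<tau> P"
  "sx0 * P + sx1 ^ 2 * Qf \<theta> \<tau> + su0 * st \<in> X'_ideal \<theta> \<tau> P"
  "sx1 * P + sy * Qf \<theta> \<tau> + su1 * st \<in> X'_ideal \<theta> \<tau> P"
  "sy * P + sw * Qf \<theta> \<tau> + su1 ^ 3 \<in> X'_ideal \<theta> \<tau> P"
  "su0 * P + sx1 * su1 * Qf \<theta> \<tau> + st ^ 2 \<in> X'_ideal \<theta> \<tau> P"
  unfolding X'_ideal_eq by (rule subsetD[OF pgen_superset], simp add: relations_eq)+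

lemma X'_subset: "pideal J \<Longrightarrow> relations \<theta> \<tau> P \<subseteq> J \<Longrightarrow> X'_ideal \<theta> \<tau> P \<subseteq> J"
  unfolding X'_ideal_eq by (rule pgen_minimal)

subsection \<open>The Pfaffian presentation\<close>

lemma Pfaffian_entries:
  fixes \<theta> \<tau> P
  defines "M \<equiv> Pfaffian_matrix \<theta> \<tau> P"
  shows "dim_row M = 6" "dim_col M = 6"
    "M $$ (0,0) = 0" "M $$ (0,1) = 0" "M $$ (0,2) = 0" "M $$ (0,3) = sx0" "M $$ (0,4) = sx1 ^ 2" "M $$ (0,5) = su0"
    "M $$ (1,0) = 0" "M $$ (1,1) = 0" "M $$ (1,2) = 0" "M $$ (1,3) = sx1" "M $$ (1,4) = sy" "M $$ (1,5) = su1"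
    "M $$ (2,0) = 0" "M $$ (2,1) = 0" "M $$ (2,2) = 0" "M $$ (2,3) = su0" "M $$ (2,4) = sx1 * su1" "M $$ (2,5) = st"
    "M $$ (3,0) = - sx0" "M $$ (3,1) = - sx1" "M $$ (3,2) = - su0" "M $$ (3,3) = 0" "M $$ (3,4) = st" "M $$ (3,5) = - Qf \<theta> \<tau>"
    "M $$ (4,0) = - (sx1 ^ 2)" "M $$ (4,1) = - sy" "M $$ (4,2) = - (sx1 * su1)" "M $$ (4,3) = - st" "M $$ (4,4) = 0" "M $$ (4,5) = P"
    "M $$ (5,0) = - su0" "M $$ (5,1) = - su1" "M $$ (5,2) = - st" "M $$ (5,3) = Qf \<theta> \<tau>" "M $$ (5,4) = - P" "M $$ (5,5) = 0"
  unfolding M_def Pfaffian_matrix_def Let_def skew_mat_def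
  by (simp_all add: Qf_def numeral_eq_Suc add.commute)

lemma MV_entries:
  assumes "i < 6"
  shows "(Pfaffian_matrix \<theta> \<tau> P *\<^sub>v V_vector) $ i =
    Pfaffian_matrix \<theta> \<tau> P $$ (i, 1) * (- (su1 ^ 2)) + Pfaffian_matrix \<theta> \<tau> P $$ (i, 3) * sw + Pfaffian_matrix \<theta> \<tau> P $$ (i, 4) * (- sy)"
proof -
  let ?M = "Pfaffian_matrix \<theta> \<tau> P"
  have s: "{0..<6::nat} = {0,1,2,3,4,5}" by auto
  have "(?M *\<^sub>v V_vector) $ i = (\<Sum>j\<in>{0..<6}. row ?M i $ j * V_vector $ j)"
    using assms by (simp add: Pfaffian_entries scalar_prod_def V_vector_def numeral_eq_Suc)
  also have "\<dots> = (\<Sum>j\<in>{0..<6}. ?M $$ (i, j) * V_vector $ j)"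
    using assms by (intro sum.cong) (auto simp: Pfaffian_entries)
  also have "\<dots> = ?M $$ (i, 1) * (- (su1 ^ 2)) + ?M $$ (i, 3) * sw + ?M $$ (i, 4) * (- sy)"
    unfolding s V_vector_def vec_of_list_index by (simp add: numeral_eq_Suc)
  finally show ?thesis .
qed

lemma Pfaffian_ideal: "X'_ideal \<theta> \<tau> P = genideal S_ring (Pfaffian_equations \<theta> \<tau> P)"
proof -
  let ?M = "Pfaffian_matrix \<theta> \<tau> P" and ?E = "Pfaffian_equations \<theta> \<tau> P" and ?I = "X'_ideal \<theta> \<tau> P"
  note I = pidealD[OF pideal_X'[of \<theta> \<tau> P]]
  note J = pidealD[OF pideal_pgen[of ?E]]
  note R = X'_rel[where \<theta> = \<theta> and \<tau> = \<tau> and P = P]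
  note ent = Pfaffian_entries Pfaffian_entries[unfolded One_nat_def]
  define pf where "pf i j k l = ?M $$ (i, j) * ?M $$ (k, l) - ?M $$ (i, k) * ?M $$ (j, l) + ?M $$ (i, l) * ?M $$ (j, k)" for i j k l
  define mv where "mv i = (?M *\<^sub>v V_vector) $ i" for i
  have pf: "pf 0 1 2 3 = 0" "pf 0 1 2 4 = 0" "pf 0 1 2 5 = 0" "pf 0 1 3 4 = - (sx0 * sy - sx1 ^ 3)" "pf 0 1 3 5 = - (sx0 * su1 - sx1 * su0)"
    "pf 0 1 4 5 = - (sx1 ^ 2 * su1 - sy * su0)" "pf 0 2 3 4 = - (sx1 * (sx0 * su1 - sx1 * su0))" "pf 0 2 3 5 = - (sx0 * st - su0 ^ 2)"
    "pf 0 2 4 5 = - (sx1 * (sx1 * st - su0 * su1))" "pf 0 3 4 5 = sx0 * P + sx1 ^ 2 * Qf \<theta> \<tau> + su0 * st"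
    "pf 1 2 3 4 = - (sx1 ^ 2 * su1 - sy * su0)" "pf 1 2 3 5 = - (sx1 * st - su0 * su1)" "pf 1 2 4 5 = sx1 * su1 ^ 2 - sy * st"
    "pf 1 3 4 5 = sx1 * P + sy * Qf \<theta> \<tau> + su1 * st" "pf 2 3 4 5 = su0 * P + sx1 * su1 * Qf \<theta> \<tau> + st ^ 2"
    unfolding pf_def by (simp_all add: ent algebra_simps power2_eq_square power3_eq_cube)
  have mv: "mv 0 = sx0 * sw - sx1 ^ 2 * sy" "mv 1 = sx1 * sw - sy ^ 2" "mv 2 = - (sx1 * sy * su1 - sw * su0)"
    "mv 3 = sx1 * su1 ^ 2 - sy * st" "mv 4 = sy * su1 ^ 2 - sw * st" "mv 5 = sy * P + sw * Qf \<theta> \<tau> + su1 ^ 3"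
    unfolding mv_def by (simp_all only: MV_entries zero_less_numeral one_less_numeral_iff numeral_less_iff num.simps semiring_norm ent)
      (simp_all add: ent algebra_simps power2_eq_square power3_eq_cube)
  have sub: "sub_Pfaffians4 ?M = {pf i j k l | i j k l. i < j \<and> j < k \<and> k < l \<and> l < 6}"
    unfolding sub_Pfaffians4_def pf_def Pfaffian_entries(1) ..
  have MV: "set\<^sub>v (?M *\<^sub>v V_vector) = mv ` {..<6}"
    by (simp add: vec_set_def Pfaffian_entries mv_def)
  have 1: "pf i j k l \<in> pgen ?E" if "i < j" "j < k" "k < l" "l < 6" for i j k l
    using that by (intro subsetD[OF pgen_superset]) (auto simp: Pfaffian_equations_def sub)
  have 2: "mv i \<in> pgen ?E" if "i < 6" for i
    using that by (intro subsetD[OF pgen_superset]) (auto simp: Pfaffian_equations_def MV)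
  have "- pf 0 1 3 4 \<in> pgen ?E" "mv 0 \<in> pgen ?E" "mv 1 \<in> pgen ?E"
      "- pf 0 1 3 5 \<in> pgen ?E" "- pf 0 1 4 5 \<in> pgen ?E" "- (mv 2) \<in> pgen ?E"
      "- pf 0 2 3 5 \<in> pgen ?E" "- pf 1 2 3 5 \<in> pgen ?E" "pf 1 2 4 5 \<in> pgen ?E" "mv 4 \<in> pgen ?E"
      "pf 0 3 4 5 \<in> pgen ?E" "pf 1 3 4 5 \<in> pgen ?E" "mv 5 \<in> pgen ?E" "pf 2 3 4 5 \<in> pgen ?E"
    by (intro J(5) 1 2; simp)+
  then have "relations \<theta> \<tau> P \<subseteq> pgen ?E"
    unfolding relations_eq pf mv minus_minus by simp
  then have "?I \<subseteq> pgen ?E" by (intro X'_subset pideal_pgen) auto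
  moreover have "?E \<subseteq> ?I"
  proof
    fix r assume "r \<in> ?E"
    then consider i j k l where "r = pf i j k l" "i < j" "j < k" "k < l" "l < 6" | i where "r = mv i" "i < 6"
      by (auto simp: Pfaffian_equations_def sub MV)
    then show "r \<in> ?I"
    proof cases
      case 1
      have "0 \<in> ?I" "- (sx0 * sy - sx1 ^ 3) \<in> ?I" "- (sx0 * su1 - sx1 * su0) \<in> ?I" "- (sx1 ^ 2 * su1 - sy * su0) \<in> ?I"
        "- (sx1 * (sx0 * su1 - sx1 * su0)) \<in> ?I" "- (sx0 * st - su0 ^ 2) \<in> ?I" "- (sx1 * (sx1 * st - su0 * su1)) \<in> ?I"
        "- (sx1 * st - su0 * su1) \<in> ?I"
        by (intro I(1,3,5) R)+
      then have mem: "pf 0 1 2 3 \<in> ?I" "pf 0 1 2 4 \<in> ?I" "pf 0 1 2 5 \<in> ?I" "pf 0 1 3 4 \<in> ?I" "pf 0 1 3 5 \<in> ?I"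
        "pf 0 1 4 5 \<in> ?I" "pf 0 2 3 4 \<in> ?I" "pf 0 2 3 5 \<in> ?I" "pf 0 2 4 5 \<in> ?I" "pf 0 3 4 5 \<in> ?I"
        "pf 1 2 3 4 \<in> ?I" "pf 1 2 3 5 \<in> ?I" "pf 1 2 4 5 \<in> ?I" "pf 1 3 4 5 \<in> ?I" "pf 2 3 4 5 \<in> ?I"
        by (simp_all only: pf R)
      have "l = 3 \<or> l = 4 \<or> l = 5" "k = 2 \<or> k = 3 \<or> k = 4" "j = 1 \<or> j = 2 \<or> j = 3" "i = 0 \<or> i = 1 \<or> i = 2"
        using 1(2-5) by linarith+
      then show ?thesis using mem 1(2-4) unfolding 1(1) by - (elim disjE; simp)
    next
      case 2
      have "i = 0 \<or> i = 1 \<or> i = 2 \<or> i = 3 \<or> i = 4 \<or> i = 5" using 2(2) by linarith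
      moreover have "- (sx1 * sy * su1 - sw * su0) \<in> ?I" by (intro I(5) R)
      ultimately show ?thesis unfolding 2(1)
        by (elim disjE) (simp_all only: mv R)
    qed
  qed
  then have "pgen ?E \<subseteq> ?I" by (intro pgen_minimal pideal_X')
  ultimately show ?thesis by (simp add: pgen_def)
qed

subsection \<open>Homogeneity and growth\<close>

lemma whom_mult': "whomogeneous wt d f \<Longrightarrow> whomogeneous wt e g \<Longrightarrow> n = d + e \<Longrightarrow> whomogeneous wt n (f * g)"
  using whom_mult by blast

lemma whom_power': "whomogeneous wt d (f :: ('v,'k::comm_ring_1) mpoly) \<Longrightarrow> n = d * k \<Longrightarrow> whomogeneous wt n (f ^ k)"
  using whom_power by blast

lemma whom_Qf: "whomogeneous weights 9 (Qf \<theta> \<tau>)"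
  unfolding Qf_def by (rule whom_add whom_mult' whom_power' whom_pvar whom_pconst | simp)+

lemma relations_homogeneous:
  assumes "whomogeneous weights 10 P" "r \<in> relations \<theta> \<tau> P"
  shows "\<exists>e. whomogeneous weights e r"
proof -
  have h: "whomogeneous weights 3 (sx0 * sy - sx1 ^ 3)" "whomogeneous weights 4 (sx0 * sw - sx1 ^ 2 * sy)"
    "whomogeneous weights 4 (sx1 * sw - sy ^ 2)" "whomogeneous weights 5 (sx0 * su1 - sx1 * su0)"
    "whomogeneous weights 6 (sx1 ^ 2 * su1 - sy * su0)" "whomogeneous weights 7 (sx1 * sy * su1 - sw * su0)"
    "whomogeneous weights 8 (sx0 * st - su0 ^ 2)" "whomogeneous weights 8 (sx1 * st - su0 * su1)"
    "whomogeneous weights 9 (sx1 * su1 ^ 2 - sy * st)" "whomogeneous weights 10 (sy * su1 ^ 2 - sw * st)"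
    "whomogeneous weights 11 (sx0 * P + sx1 ^ 2 * Qf \<theta> \<tau> + su0 * st)" "whomogeneous weights 11 (sx1 * P + sy * Qf \<theta> \<tau> + su1 * st)"
    "whomogeneous weights 12 (sy * P + sw * Qf \<theta> \<tau> + su1 ^ 3)" "whomogeneous weights 14 (su0 * P + sx1 * su1 * Qf \<theta> \<tau> + st ^ 2)"
    by (rule whom_add whom_diff whom_mult' whom_power' whom_Qf whom_pvar assms(1) | simp)+
  show ?thesis using assms(2) unfolding relations_eq by (elim insertE emptyE; use h in blast)
qed

lemma hideal_X': "whomogeneous weights 10 P \<Longrightarrow> hideal weights (X'_ideal \<theta> \<tau> P)"
  unfolding X'_ideal_eq using relations_homogeneous by (intro hideal_pgen) blast

text \<open>
  Modulo the ideal, \<open>x0\<close>, \<open>w\<close>, \<open>z\<close> is a system of parameters: the sixth powers of the other variables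
  lie in the ideal generated by \<open>x0\<close>, \<open>w\<close>, \<open>z\<close>.
\<close>

lemma sixth_powers:
  assumes P: "whomogeneous weights 10 P" and v: "v \<notin> {Vx0, Vw, Vz}"
  shows "\<exists>A B C. whomogeneous weights (weights v * 6 - 1) A \<and> whomogeneous weights (weights v * 6 - 3) B \<and>
     whomogeneous weights (weights v * 6 - 5) C \<and> pvar v ^ 6 - (sx0 * A + sw * B + sz * C) \<in> X'_ideal \<theta> \<tau> P"
proof -
  let ?I = "X'_ideal \<theta> \<tau> P"
  note I = pidealD[OF pideal_X'[of \<theta> \<tau> P]]
  note hom = whom_mult' whom_power' whom_Qf whom_pvar whom_pconst P
  have red: "?thesis" if "whomogeneous weights (weights v * 6 - 1) A" "whomogeneous weights (weights v * 6 - 3) B"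
     "whomogeneous weights (weights v * 6 - 5) C" "pvar v ^ 6 - (sx0 * A + sw * B + sz * C) = i" "i \<in> ?I" for A B C i
    using that by blast
  consider "v = Vx1" | "v = Vy" | "v = Vu0" | "v = Vu1" | "v = Vt" using v by (cases v) auto
  then show ?thesis
  proof cases
    case 1
    show ?thesis
    proof (rule red[of "sy * sx1 ^ 3" 0 0])
      show "pvar v ^ 6 - (sx0 * (sy * sx1 ^ 3) + sw * 0 + sz * 0) = - (sx1 ^ 3 * (sx0 * sy - sx1 ^ 3))"
        unfolding 1 by (simp add: algebra_simps numeral_eq_Suc)
      show "whomogeneous weights (weights v * 6 - 1) (sy * sx1 ^ 3)" unfolding 1 by (rule hom | simp)+
      show "- (sx1 ^ 3 * (sx0 * sy - sx1 ^ 3)) \<in> ?I" by (intro I(5,3) X'_rel)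
    qed simp_all
  next
    case 2
    show ?thesis
    proof (rule red[of 0 "sx1 * sy ^ 4" 0])
      show "pvar v ^ 6 - (sx0 * 0 + sw * (sx1 * sy ^ 4) + sz * 0) = - (sy ^ 4 * (sx1 * sw - sy ^ 2))"
        unfolding 2 by (simp add: algebra_simps numeral_eq_Suc)
      show "whomogeneous weights (weights v * 6 - 3) (sx1 * sy ^ 4)" unfolding 2 by (rule hom | simp)+
      show "- (sy ^ 4 * (sx1 * sw - sy ^ 2)) \<in> ?I" by (intro I(5,3) X'_rel)
    qed simp_all
  next
    case 3
    show ?thesis
    proof (rule red[of "st * su0 ^ 4" 0 0])
      show "pvar v ^ 6 - (sx0 * (st * su0 ^ 4) + sw * 0 + sz * 0) = - (su0 ^ 4 * (sx0 * st - su0 ^ 2))"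
        unfolding 3 by (simp add: algebra_simps numeral_eq_Suc)
      show "whomogeneous weights (weights v * 6 - 1) (st * su0 ^ 4)" unfolding 3 by (rule hom | simp)+
      show "- (su0 ^ 4 * (sx0 * st - su0 ^ 2)) \<in> ?I" by (intro I(5,3) X'_rel)
    qed simp_all
  next
    case 4
    let ?Q = "Qf \<theta> \<tau>"
    let ?B = "sx1 * P ^ 2 + 2 * sy * P * ?Q + sw * ?Q ^ 2"
    show ?thesis
    proof (rule red[of 0 ?B 0])
      show "pvar v ^ 6 - (sx0 * 0 + sw * ?B + sz * 0) =
        (su1 ^ 3 - (sy * P + sw * ?Q)) * (sy * P + sw * ?Q + su1 ^ 3) - P ^ 2 * (sx1 * sw - sy ^ 2)"
        unfolding 4 by (simp add: algebra_simps power2_eq_square power3_eq_cube numeral_eq_Suc)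
      have "whomogeneous weights 21 (sx1 * P ^ 2)" "whomogeneous weights 21 (sw * ?Q ^ 2)" "whomogeneous weights 21 (sy * P * ?Q)"
        by (rule hom | simp)+
      moreover from this(3) have "whomogeneous weights 21 (sy * P * ?Q + sy * P * ?Q)" by (intro whom_add)
      ultimately have "whomogeneous weights 21 (sx1 * P ^ 2 + (sy * P * ?Q + sy * P * ?Q) + sw * ?Q ^ 2)"
        by (intro whom_add)
      moreover have "sx1 * P ^ 2 + (sy * P * ?Q + sy * P * ?Q) + sw * ?Q ^ 2 = ?B" by (simp add: algebra_simps)
      ultimately have "whomogeneous weights 21 ?B" by (simp only:)
      then show "whomogeneous weights (weights v * 6 - 3) ?B" unfolding 4 by simp
      show "(su1 ^ 3 - (sy * P + sw * ?Q)) * (sy * P + sw * ?Q + su1 ^ 3) - P ^ 2 * (sx1 * sw - sy ^ 2) \<in> ?I"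
        by (intro I(3,6) X'_rel)
    qed simp_all
  next
    case 5
    let ?Q = "Qf \<theta> \<tau>"
    let ?R = "2 * su0 * P * sx1 * su1 + sx1 ^ 2 * su1 ^ 2 * ?Q"
    have R: "whomogeneous weights 19 ?R"
    proof -
      have "whomogeneous weights 19 (su0 * P * sx1 * su1)" "whomogeneous weights 19 (sx1 ^ 2 * su1 ^ 2 * ?Q)"
        by (rule hom | simp)+
      then have "whomogeneous weights 19 ((su0 * P * sx1 * su1 + su0 * P * sx1 * su1) + sx1 ^ 2 * su1 ^ 2 * ?Q)" by (intro whom_add)
      moreover have "(su0 * P * sx1 * su1 + su0 * P * sx1 * su1) + sx1 ^ 2 * su1 ^ 2 * ?Q = ?R" by (simp add: algebra_simps)
      ultimately show ?thesis by (simp only:)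
    qed
    show ?thesis
    proof (rule red[of "st * (st ^ 2 * P ^ 2)" "pconst \<tau> * sw ^ 2 * (st ^ 2 * ?R)" "pconst \<theta> * su1 * (st ^ 2 * ?R)"])
      show "pvar v ^ 6 - (sx0 * (st * (st ^ 2 * P ^ 2)) + sw * (pconst \<tau> * sw ^ 2 * (st ^ 2 * ?R)) + sz * (pconst \<theta> * su1 * (st ^ 2 * ?R)))
        = st ^ 2 * (st ^ 2 - (su0 * P + sx1 * su1 * ?Q)) * (su0 * P + sx1 * su1 * ?Q + st ^ 2) - (st ^ 2 * P ^ 2) * (sx0 * st - su0 ^ 2)"
      proof -
        have "sw * (pconst \<tau> * sw ^ 2 * (st ^ 2 * ?R)) + sz * (pconst \<theta> * su1 * (st ^ 2 * ?R)) = ?Q * (st ^ 2 * ?R)"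
          unfolding Qf_def by (simp add: algebra_simps power2_eq_square power3_eq_cube)
        moreover have "st ^ 6 - (sx0 * (st * (st ^ 2 * P ^ 2)) + ?Q * (st ^ 2 * ?R)) =
          st ^ 2 * (st ^ 2 - (su0 * P + sx1 * su1 * ?Q)) * (su0 * P + sx1 * su1 * ?Q + st ^ 2) - (st ^ 2 * P ^ 2) * (sx0 * st - su0 ^ 2)"
          by (simp add: algebra_simps power2_eq_square numeral_eq_Suc)
        ultimately show ?thesis unfolding 5 by (simp add: add.assoc)
      qed
      show "whomogeneous weights (weights v * 6 - 1) (st * (st ^ 2 * P ^ 2))" unfolding 5 by (rule hom | simp)+
      show "whomogeneous weights (weights v * 6 - 3) (pconst \<tau> * sw ^ 2 * (st ^ 2 * ?R))" unfolding 5 by (rule R hom | simp)+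
      show "whomogeneous weights (weights v * 6 - 5) (pconst \<theta> * su1 * (st ^ 2 * ?R))" unfolding 5 by (rule R hom | simp)+
      show "st ^ 2 * (st ^ 2 - (su0 * P + sx1 * su1 * ?Q)) * (su0 * P + sx1 * su1 * ?Q + st ^ 2) - (st ^ 2 * P ^ 2) * (sx0 * st - su0 ^ 2) \<in> ?I"
        by (intro I(3,6) X'_rel)
    qed
  qed
qed

definition param_basis :: "nat \<Rightarrow> S set" where
  "param_basis D = {sx0 ^ a * sw ^ b * sz ^ c * Poly_Mapping.single r 1 | a b c r.
     r \<in> box UNIV 6 \<and> a + 3 * b + 5 * c + wdegree weights r = D}"

lemma param_basis_card: "finite (param_basis D)" "card (param_basis D) \<le> card (box (UNIV :: var set) 6) * (D + 1) ^ 2"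
proof -
  let ?f = "\<lambda>(b, c, r). sx0 ^ (D - 3 * b - 5 * c - wdegree weights r) * sw ^ b * sz ^ c * Poly_Mapping.single r 1"
  let ?T = "{..D} \<times> {..D} \<times> box (UNIV :: var set) 6"
  have fin: "finite ?T" using box_card(1)[OF finite_var] by simp
  have sub: "param_basis D \<subseteq> ?f ` ?T"
  proof
    fix x assume "x \<in> param_basis D"
    then obtain a b c r where x: "x = sx0 ^ a * sw ^ b * sz ^ c * Poly_Mapping.single r 1" "r \<in> box UNIV 6" "a + 3 * b + 5 * c + wdegree weights r = D"
      unfolding param_basis_def by blast
    have "a = D - 3 * b - 5 * c - wdegree weights r" using x(3) by linarith
    then have "x = ?f (b, c, r)" using x(1) by simp
    moreover have "(b, c, r) \<in> ?T" using x by simp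
    ultimately show "x \<in> ?f ` ?T" by (rule image_eqI)
  qed
  then show "finite (param_basis D)" using fin finite_surj by blast
  have "card (param_basis D) \<le> card (?f ` ?T)" using sub fin by (intro card_mono) auto
  also have "\<dots> \<le> card ?T" by (rule card_image_le[OF fin])
  also have "\<dots> = card (box (UNIV :: var set) 6) * (D + 1) ^ 2" by (simp add: card_cartesian_product power2_eq_square algebra_simps)
  finally show "card (param_basis D) \<le> card (box (UNIV :: var set) 6) * (D + 1) ^ 2" .
qed

lemma spanned_add:
  assumes "pideal I" "spanned_by I B f" "spanned_by I B g"
  shows "spanned_by I B (f + g)"
proof -
  obtain k l where kl: "f - (\<Sum>b\<in>B. pconst (k b) * b) \<in> I" "g - (\<Sum>b\<in>B. pconst (l b) * b) \<in> I"
    using assms by (auto simp: spanned_by_def)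
  have e: "(f + g) - (\<Sum>b\<in>B. pconst (k b + l b) * b) = (f - (\<Sum>b\<in>B. pconst (k b) * b)) + (g - (\<Sum>b\<in>B. pconst (l b) * b))"
    by (simp add: ishomD[OF ishom_pconst] distrib_right sum.distrib algebra_simps)
  show ?thesis unfolding spanned_by_def using pidealD(2)[OF assms(1) kl] by (intro exI[of _ "\<lambda>b. k b + l b"]) (simp only: e)
qed

lemma spanned_scale:
  assumes "pideal I" "spanned_by I B f"
  shows "spanned_by I B (pconst c * f)"
proof -
  obtain k where k: "f - (\<Sum>b\<in>B. pconst (k b) * b) \<in> I" using assms by (auto simp: spanned_by_def)
  have "pconst c * f - (\<Sum>b\<in>B. pconst (c * k b) * b) = pconst c * (f - (\<Sum>b\<in>B. pconst (k b) * b))"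
    by (simp add: ishomD[OF ishom_pconst] right_diff_distrib sum_distrib_left mult.assoc)
  then show ?thesis unfolding spanned_by_def using pidealD(3)[OF assms(1) k] by (intro exI[of _ "\<lambda>b. c * k b"]) simp
qed

lemma spanned_0: "pideal I \<Longrightarrow> spanned_by I B 0"
  unfolding spanned_by_def by (intro exI[of _ "\<lambda>_. 0"]) (simp add: pidealD pconst_0)

lemma spanned_base: "pideal I \<Longrightarrow> finite B \<Longrightarrow> b \<in> B \<Longrightarrow> spanned_by I B b"
  unfolding spanned_by_def
proof (intro exI[of _ "\<lambda>x. if x = b then 1 else 0"])
  assume *: "pideal I" "finite B" "b \<in> B"
  have "(\<Sum>x\<in>B. pconst (if x = b then 1 else 0) * x) = (\<Sum>x\<in>B. if x = b then b else 0)"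
    by (intro sum.cong) (auto simp: pconst_0 pconst_1)
  then show "b - (\<Sum>x\<in>B. pconst (if x = b then 1 else 0) * x) \<in> I" using * by (simp add: pidealD)
qed

lemma spanned_sum: "pideal I \<Longrightarrow> (\<And>i. i \<in> A \<Longrightarrow> spanned_by I B (f i)) \<Longrightarrow> spanned_by I B (sum f A)"
  by (induction A rule: infinite_finite_induct) (auto simp: spanned_0 spanned_add)

lemma spanned_mult:
  assumes I: "pideal I" and f: "spanned_by I B f" and B: "\<And>b. b \<in> B \<Longrightarrow> spanned_by I B' (x * b)"
  shows "spanned_by I B' (x * f)"
proof -
  obtain k where k: "f - (\<Sum>b\<in>B. pconst (k b) * b) \<in> I" using f by (auto simp: spanned_by_def)
  have "spanned_by I B' (x * (f - (\<Sum>b\<in>B. pconst (k b) * b)))"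
    unfolding spanned_by_def using pidealD(3)[OF I k] by (intro exI[of _ "\<lambda>_. 0"]) (simp add: pconst_0)
  moreover have "spanned_by I B' (\<Sum>b\<in>B. pconst (k b) * (x * b))" by (intro spanned_sum spanned_scale I B)
  ultimately have "spanned_by I B' (x * (f - (\<Sum>b\<in>B. pconst (k b) * b)) + (\<Sum>b\<in>B. pconst (k b) * (x * b)))"
    by (rule spanned_add[OF I])
  moreover have "x * (f - (\<Sum>b\<in>B. pconst (k b) * b)) + (\<Sum>b\<in>B. pconst (k b) * (x * b)) = x * f"
    by (simp add: right_diff_distrib sum_distrib_left mult_ac)
  ultimately show ?thesis by simp
qed

lemma X'_spanned:
  assumes P: "whomogeneous weights 10 P" and f: "whomogeneous weights D f"
  shows "spanned_by (X'_ideal \<theta> \<tau> P) (param_basis D) f"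
  using f
proof (induction D arbitrary: f rule: less_induct)
  case (less D)
  let ?I = "X'_ideal \<theta> \<tau> P"
  note I = pideal_X'[of \<theta> \<tau> P]
  have x0: "spanned_by ?I (param_basis D) (sx0 * g)" if "whomogeneous weights (D - 1) g" "1 \<le> D" for g
  proof (rule spanned_mult[OF I less.IH[OF _ that(1)]])
    fix b assume "b \<in> param_basis (D - 1)"
    then obtain a b' c r where b: "b = sx0 ^ a * sw ^ b' * sz ^ c * Poly_Mapping.single r 1" "r \<in> box UNIV 6" "a + 3 * b' + 5 * c + wdegree weights r = D - 1"
      by (auto simp: param_basis_def)
    have "sx0 * b = sx0 ^ Suc a * sw ^ b' * sz ^ c * Poly_Mapping.single r 1" by (simp add: b mult_ac)
    moreover have "Suc a + 3 * b' + 5 * c + wdegree weights r = D" using b(3) that(2) by simp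
    ultimately have "sx0 * b \<in> param_basis D" unfolding param_basis_def using b(2) by blast
    then show "spanned_by ?I (param_basis D) (sx0 * b)" by (intro spanned_base I param_basis_card)
  qed (use that in simp)
  have w: "spanned_by ?I (param_basis D) (sw * g)" if "whomogeneous weights (D - 3) g" "3 \<le> D" for g
  proof (rule spanned_mult[OF I less.IH[OF _ that(1)]])
    fix b assume "b \<in> param_basis (D - 3)"
    then obtain a b' c r where b: "b = sx0 ^ a * sw ^ b' * sz ^ c * Poly_Mapping.single r 1" "r \<in> box UNIV 6" "a + 3 * b' + 5 * c + wdegree weights r = D - 3"
      by (auto simp: param_basis_def)
    have "sw * b = sx0 ^ a * sw ^ Suc b' * sz ^ c * Poly_Mapping.single r 1" by (simp add: b mult_ac)
    moreover have "a + 3 * Suc b' + 5 * c + wdegree weights r = D" using b(3) that(2) by simp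
    ultimately have "sw * b \<in> param_basis D" unfolding param_basis_def using b(2) by blast
    then show "spanned_by ?I (param_basis D) (sw * b)" by (intro spanned_base I param_basis_card)
  qed (use that in simp)
  have z: "spanned_by ?I (param_basis D) (sz * g)" if "whomogeneous weights (D - 5) g" "5 \<le> D" for g
  proof (rule spanned_mult[OF I less.IH[OF _ that(1)]])
    fix b assume "b \<in> param_basis (D - 5)"
    then obtain a b' c r where b: "b = sx0 ^ a * sw ^ b' * sz ^ c * Poly_Mapping.single r 1" "r \<in> box UNIV 6" "a + 3 * b' + 5 * c + wdegree weights r = D - 5"
      by (auto simp: param_basis_def)
    have "sz * b = sx0 ^ a * sw ^ b' * sz ^ Suc c * Poly_Mapping.single r 1" by (simp add: b mult_ac)
    moreover have "a + 3 * b' + 5 * Suc c + wdegree weights r = D" using b(3) that(2) by simp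
    ultimately have "sz * b \<in> param_basis D" unfolding param_basis_def using b(2) by blast
    then show "spanned_by ?I (param_basis D) (sz * b)" by (intro spanned_base I param_basis_card)
  qed (use that in simp)
  have mon: "spanned_by ?I (param_basis D) (Poly_Mapping.single m 1)" if m: "wdegree weights m = D" for m
  proof (cases "\<exists>v. Poly_Mapping.lookup m v \<ge> 6")
    case False
    then have "m \<in> box UNIV 6" by (auto simp: box_def not_le intro: less_imp_le)
    then have "Poly_Mapping.single m 1 \<in> param_basis D"
      unfolding param_basis_def using m by (intro CollectI exI[of _ 0] exI[of _ m]) simp
    then show ?thesis by (intro spanned_base I param_basis_card)
  next
    case True
    then obtain v where v: "Poly_Mapping.lookup m v \<ge> 6" by blast
    define m' where "m' = m - Poly_Mapping.single v 6"
    have mm: "m' + Poly_Mapping.single v 6 = m"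
      unfolding m'_def by (rule mdvd_diff) (use v in \<open>auto simp: mdvd_def lookup_single when_def\<close>)
    have deg: "wdegree weights m' + weights v * 6 = D" using m wdegree_add[of weights m' "Poly_Mapping.single v 6"] by (simp add: mm)
    have pv: "Poly_Mapping.single (Poly_Mapping.single v 6) (1::complex) = pvar v ^ 6" by (simp add: single_eq_meval)
    let ?s = "Poly_Mapping.single m' (1::complex)"
    have sm: "Poly_Mapping.single m (1::complex) = ?s * pvar v ^ 6" by (subst mm[symmetric]) (simp only: single_add_one pv)
    have hs: "whomogeneous weights (wdegree weights m') ?s" by (rule whom_single) simp
    have "\<exists>A B C. whomogeneous weights (weights v * 6 - 1) A \<and> whomogeneous weights (weights v * 6 - 3) B \<and>
     whomogeneous weights (weights v * 6 - 5) C \<and> pvar v ^ 6 - (sx0 * A + sw * B + sz * C) \<in> ?I"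
    proof (cases "v \<in> {Vx0, Vw, Vz}")
      case False
      then show ?thesis by (rule sixth_powers[OF P])
    next
      case True
      have p5: "whomogeneous weights (weights v * 5) (pvar v ^ 5 :: S)" by (rule whom_power[OF whom_pvar])
      have e: "x ^ 6 = x * x ^ 5" for x :: S by (simp flip: power_Suc)
      consider "v = Vx0" | "v = Vw" | "v = Vz" using True by blast
      then show ?thesis
      proof cases
        case 1 show ?thesis using p5 unfolding 1
          by (intro exI[of _ "sx0 ^ 5"] exI[of _ 0]) (simp add: e pidealD(1)[OF I])
      next
        case 2 show ?thesis using p5 unfolding 2
          by (intro exI[of _ 0] exI[of _ "sw ^ 5"]) (simp add: e pidealD(1)[OF I])
      next
        case 3 show ?thesis using p5 unfolding 3
          by (intro exI[of _ 0] exI[of _ "sz ^ 5"]) (simp add: e pidealD(1)[OF I])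
      qed
    qed
    then obtain A B C where ABC: "whomogeneous weights (weights v * 6 - 1) A" "whomogeneous weights (weights v * 6 - 3) B"
     "whomogeneous weights (weights v * 6 - 5) C" "pvar v ^ 6 - (sx0 * A + sw * B + sz * C) \<in> ?I" by blast
    have wv: "weights v \<ge> 1" by (cases v) auto
    have sA: "spanned_by ?I (param_basis D) (sx0 * (?s * A))"
      using whom_mult[OF hs ABC(1)] wv deg by (intro x0) (simp_all add: diff_add_assoc)
    have sB: "spanned_by ?I (param_basis D) (sw * (?s * B))"
      using whom_mult[OF hs ABC(2)] wv deg by (intro w) (simp_all add: diff_add_assoc)
    have sC: "spanned_by ?I (param_basis D) (sz * (?s * C))"
      using whom_mult[OF hs ABC(3)] wv deg by (intro z) (simp_all add: diff_add_assoc)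
    have sI: "spanned_by ?I (param_basis D) (?s * (pvar v ^ 6 - (sx0 * A + sw * B + sz * C)))"
      unfolding spanned_by_def using pidealD(3)[OF I ABC(4)] by (intro exI[of _ "\<lambda>_. 0"]) (simp add: pconst_0)
    have "Poly_Mapping.single m (1::complex) = ?s * (pvar v ^ 6 - (sx0 * A + sw * B + sz * C)) + (sx0 * (?s * A) + sw * (?s * B) + sz * (?s * C))"
      unfolding sm by (simp add: algebra_simps)
    then show ?thesis using spanned_add[OF I sI spanned_add[OF I spanned_add[OF I sA sB] sC]] by simp
  qed
  have "f = (\<Sum>m\<in>Poly_Mapping.keys f. pconst (Poly_Mapping.lookup f m) * Poly_Mapping.single m 1)"
    by (subst poly_mapping_eq_sum_single[of f]) (simp add: pconst_def mult_single)
  moreover have "spanned_by ?I (param_basis D) (\<Sum>m\<in>Poly_Mapping.keys f. pconst (Poly_Mapping.lookup f m) * Poly_Mapping.single m 1)"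
    using less.prems by (intro spanned_sum spanned_scale I mon) (simp add: whomogeneous_def)
  ultimately show ?case by simp
qed

lemma quadratic_growth_X':
  assumes "whomogeneous weights 10 P"
  shows "quadratic_growth weights (X'_ideal \<theta> \<tau> P)"
  unfolding quadratic_growth_def
  using X'_spanned[OF assms] param_basis_card by (intro exI[of _ "card (box (UNIV :: var set) 6)"]) blast

section \<open>Power series in two variables\<close>

type_synonym K = "complex fps fps"

definition cst :: "complex \<Rightarrow> K" where "cst c = fps_const (fps_const c)"
definition c0 :: "K \<Rightarrow> complex" where "c0 F = fps_nth (fps_nth F 0) 0"
definition ordge :: "nat \<Rightarrow> K \<Rightarrow> bool" where
  "ordge n F \<longleftrightarrow> (\<forall>i j. i + j < n \<longrightarrow> fps_nth (fps_nth F j) i = 0)"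

lemma ishom_cst: "ishom cst" by (simp add: ishom_def cst_def)

lemma ishom_c0: "ishom c0" by (simp add: ishom_def c0_def)

lemma c0_cst [simp]: "c0 (cst c) = c" by (simp add: c0_def cst_def)

lemmas c0_simps [simp] = ishomD[OF ishom_c0]

lemma cst_0 [simp]: "cst 0 = 0" and cst_1 [simp]: "cst 1 = 1"
  by (simp_all add: ishomD[OF ishom_cst])

lemma ordge_0 [simp]: "ordge n 0" by (simp add: ordge_def)

lemma ordge_triv [simp]: "ordge 0 F" by (simp add: ordge_def)

lemma ordge_mono: "ordge n F \<Longrightarrow> m \<le> n \<Longrightarrow> ordge m F" by (auto simp: ordge_def)

lemma ordge_add: "ordge n F \<Longrightarrow> ordge n G \<Longrightarrow> ordge n (F + G)" by (auto simp: ordge_def)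

lemma ordge_uminus: "ordge n F \<Longrightarrow> ordge n (- F)" by (auto simp: ordge_def)

lemma ordge_diff: "ordge n F \<Longrightarrow> ordge n G \<Longrightarrow> ordge n (F - G)" by (auto simp: ordge_def)

lemma K_mult_nth: "fps_nth (fps_nth (F * G) j) i =
    (\<Sum>b=0..j. \<Sum>a=0..i. fps_nth (fps_nth F b) a * fps_nth (fps_nth G (j - b)) (i - a))" for F G :: K
  by (simp add: fps_mult_nth fps_sum_nth)

lemma ordge_mult:
  assumes "ordge m F" "ordge n G"
  shows "ordge (m + n) (F * G)"
  unfolding ordge_def
proof (intro allI impI)
  fix i j assume ij: "i + j < m + n"
  have "fps_nth (fps_nth F b) a * fps_nth (fps_nth G (j - b)) (i - a) = 0" if "b \<in> {0..j}" "a \<in> {0..i}" for a b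
  proof (cases "a + b < m")
    case True
    then show ?thesis using assms(1) by (simp add: ordge_def)
  next
    case False
    then have "(i - a) + (j - b) < n" using ij that by auto
    then show ?thesis using assms(2) by (simp add: ordge_def)
  qed
  then show "fps_nth (fps_nth (F * G) j) i = 0" unfolding K_mult_nth by (intro sum.neutral ballI) auto
qed

lemma ordge_mult_left: "ordge n G \<Longrightarrow> ordge n (F * G)" using ordge_mult[of 0 F n G] by simp

lemma ordge_all: "(\<And>n. ordge n F) \<Longrightarrow> F = 0"
proof (rule fps_ext, rule fps_ext)
  fix j i assume *: "\<And>n. ordge n F"
  show "fps_nth (fps_nth F j) i = fps_nth (fps_nth 0 j) i" using *[of "Suc (i + j)"] by (simp add: ordge_def)
qed

lemma ordge_1_iff: "ordge 1 F \<longleftrightarrow> c0 F = 0" by (auto simp: ordge_def c0_def)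

lemma ordge_Suc_0_iff: "ordge (Suc 0) F \<longleftrightarrow> c0 F = 0" using ordge_1_iff by simp

lemma K_unit:
  assumes "c0 F \<noteq> 0"
  shows "F dvd 1"
proof -
  have 1: "inverse (fps_nth F 0) * fps_nth F 0 = 1" using assms by (intro inverse_mult_eq_1) (simp add: c0_def)
  have "fps_left_inverse F (inverse (fps_nth F 0)) * F = 1" by (rule fps_left_inverse[OF 1])
  then show ?thesis by (metis dvd_triv_right)
qed

lemma K_limit:
  fixes \<chi> :: "nat \<Rightarrow> K"
  assumes "\<And>k. ordge k (\<chi> (Suc k) - \<chi> k)"
  shows "\<exists>L. \<forall>k. ordge k (L - \<chi> k)"
proof -
  define L :: K where "L = Abs_fps (\<lambda>j. Abs_fps (\<lambda>i. fps_nth (fps_nth (\<chi> (Suc (i + j))) j) i))"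
  have st: "fps_nth (fps_nth (\<chi> (Suc (i + j) + d)) j) i = fps_nth (fps_nth (\<chi> (Suc (i + j))) j) i" for i j d
  proof (induction d)
    case (Suc d)
    have "fps_nth (fps_nth (\<chi> (Suc (Suc (i + j) + d)) - \<chi> (Suc (i + j) + d)) j) i = 0"
      using assms[of "Suc (i + j) + d"] by (simp add: ordge_def)
    then show ?case using Suc by simp
  qed simp
  have "ordge k (L - \<chi> k)" for k
    unfolding ordge_def
  proof (intro allI impI)
    fix i j assume "i + j < k"
    then have "k = Suc (i + j) + (k - Suc (i + j))" by simp
    then have "fps_nth (fps_nth (\<chi> k) j) i = fps_nth (fps_nth (\<chi> (Suc (i + j))) j) i" using st by metis
    then show "fps_nth (fps_nth (L - \<chi> k) j) i = 0" by (simp add: L_def)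
  qed
  then show ?thesis by blast
qed

definition kc :: "nat \<Rightarrow> nat \<Rightarrow> K \<Rightarrow> complex" where "kc p q F = fps_nth (fps_nth F q) p"

lemma K_fixpoint:
  fixes T :: "('v \<Rightarrow> K) \<Rightarrow> ('v \<Rightarrow> K)" and a :: "'v \<Rightarrow> complex" and S :: "'v \<Rightarrow> (nat \<times> nat) set"
  assumes D: "\<And>\<xi>. (\<And>i. c0 (\<xi> i) = a i) \<Longrightarrow> \<forall>i. c0 (T \<xi> i) = a i"
    and contr: "\<And>\<xi> \<eta> n. (\<And>i. c0 (\<xi> i) = a i) \<Longrightarrow> (\<And>i. c0 (\<eta> i) = a i) \<Longrightarrow> 1 \<le> n \<Longrightarrow>
      (\<And>i. ordge n (\<xi> i - \<eta> i)) \<Longrightarrow> \<forall>i. ordge (Suc n) (T \<xi> i - T \<eta> i)"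
    and supp: "\<And>\<xi>. (\<And>i. c0 (\<xi> i) = a i) \<Longrightarrow> (\<And>i p q. kc p q (\<xi> i) \<noteq> 0 \<Longrightarrow> (p, q) \<in> S i) \<Longrightarrow>
      \<forall>i p q. kc p q (T \<xi> i) \<noteq> 0 \<longrightarrow> (p, q) \<in> S i"
    and supp0: "\<And>i. a i \<noteq> 0 \<Longrightarrow> (0, 0) \<in> S i"
  shows "\<exists>\<xi>. (\<forall>i. c0 (\<xi> i) = a i) \<and> T \<xi> = \<xi> \<and> (\<forall>i p q. kc p q (\<xi> i) \<noteq> 0 \<longrightarrow> (p, q) \<in> S i)"
proof -
  define \<chi> where "\<chi> k = (T ^^ k) (\<lambda>i. cst (a i))" for k
  have \<chi>0: "\<chi> 0 = (\<lambda>i. cst (a i))" and \<chi>S: "\<chi> (Suc k) = T (\<chi> k)" for k by (simp_all add: \<chi>_def)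
  have D\<chi>: "c0 (\<chi> k i) = a i" for k i
  proof (induction k arbitrary: i)
    case (Suc k)
    then show ?case using D[of "\<chi> k"] by (simp add: \<chi>S)
  qed (simp add: \<chi>0)
  have step: "\<forall>i. ordge (Suc k) (\<chi> (Suc k) i - \<chi> k i)" for k
  proof (induction k)
    case 0
    then show ?case by (simp add: ordge_Suc_0_iff D\<chi>)
  next
    case (Suc k)
    then have "\<forall>i. ordge (Suc (Suc k)) (T (\<chi> (Suc k)) i - T (\<chi> k) i)" by (intro contr D\<chi>) auto
    then show ?case unfolding \<chi>S .
  qed
  have "\<exists>L. \<forall>k. ordge k (L - \<chi> k i)" for i
    using step by (intro K_limit) (metis ordge_mono le_Suc_eq order_refl)
  then obtain L where L: "\<And>i k. ordge k (L i - \<chi> k i)" by metis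
  have DL: "c0 (L i) = a i" for i using L[of "Suc 0" i] D\<chi>[of "Suc 0" i] by (simp add: ordge_Suc_0_iff)
  have "T L i = L i" for i
  proof -
    have "ordge k (T L i - L i)" for k
    proof -
      have "ordge (Suc (Suc k)) (T L i - T (\<chi> (Suc k)) i)" using contr[of L "\<chi> (Suc k)" "Suc k"] DL D\<chi> L by simp
      then have "ordge k (T L i - T (\<chi> (Suc k)) i)" by (rule ordge_mono) simp
      then have 1: "ordge k (T L i - \<chi> (Suc (Suc k)) i)" by (simp only: \<chi>S)
      have "ordge (Suc (Suc k)) (L i - \<chi> (Suc (Suc k)) i)" by (rule L)
      then have 2: "ordge k (L i - \<chi> (Suc (Suc k)) i)" by (rule ordge_mono) simp
      show ?thesis using ordge_diff[OF 1 2] by simp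
    qed
    then have "T L i - L i = 0" by (rule ordge_all)
    then show ?thesis by simp
  qed
  then have TL: "T L = L" by auto
  have S\<chi>: "\<forall>i p q. kc p q (\<chi> k i) \<noteq> 0 \<longrightarrow> (p, q) \<in> S i" for k
  proof (induction k)
    case 0
    then show ?case using supp0 by (auto simp: \<chi>0 kc_def cst_def split: if_splits)
  next
    case (Suc k)
    then show ?case unfolding \<chi>S using D\<chi> by (intro supp) auto
  qed
  have "kc p q (L i) = kc p q (\<chi> (Suc (p + q)) i)" for i p q
    using L[of "Suc (p + q)" i] by (simp add: ordge_def kc_def)
  then have "\<forall>i p q. kc p q (L i) \<noteq> 0 \<longrightarrow> (p, q) \<in> S i" using S\<chi> by simp
  then show ?thesis using DL TL by blast
qed

definition linpart :: "('v \<Rightarrow> complex poly) \<Rightarrow> ('v, complex) mpoly \<Rightarrow> complex poly" where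
  "linpart \<gamma> f = psubst (\<lambda>c. [:c:]) \<gamma> f"

lemma ishom_const_poly: "ishom (\<lambda>c::complex. [:c:])" by (simp add: ishom_def one_pCons)

lemma linpart_simps:
  "linpart \<gamma> (pconst c) = [:c:]" "linpart \<gamma> (pvar i) = \<gamma> i" "linpart \<gamma> (f + g) = linpart \<gamma> f + linpart \<gamma> g"
  "linpart \<gamma> (f * g) = linpart \<gamma> f * linpart \<gamma> g"
  by (simp_all add: linpart_def ishom_const_poly psubst_simps)

lemma coeff_mult_0_1:
  fixes p q :: "complex poly"
  shows "coeff (p * q) 0 = coeff p 0 * coeff q 0"
    "coeff (p * q) (Suc 0) = coeff p 0 * coeff q (Suc 0) + coeff p (Suc 0) * coeff q 0"
  by (simp_all add: coeff_mult)

lemma K_taylor: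
  fixes f :: "('v, complex) mpoly"
  assumes n: "1 \<le> n" "ordge n \<delta>"
    and \<xi>: "\<And>i. c0 (\<xi> i) = coeff (\<gamma> i) 0" "\<And>i. c0 (\<eta> i) = coeff (\<gamma> i) 0"
    and d: "\<And>i. ordge (Suc n) (\<xi> i - \<eta> i - cst (coeff (\<gamma> i) 1) * \<delta>)"
  shows "c0 (psubst cst \<xi> f) = coeff (linpart \<gamma> f) 0 \<and> c0 (psubst cst \<eta> f) = coeff (linpart \<gamma> f) 0 \<and>
    ordge (Suc n) (psubst cst \<xi> f - psubst cst \<eta> f - cst (coeff (linpart \<gamma> f) 1) * \<delta>)"
proof (induction f rule: mpoly_induct)
  case (const c)
  then show ?case by (simp add: linpart_simps ishom_cst)
next
  case (var i)
  then show ?case using \<xi> d by (simp add: linpart_simps ishom_cst)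
next
  case (add f g)
  have e: "psubst cst \<xi> (f + g) - psubst cst \<eta> (f + g) - cst (coeff (linpart \<gamma> (f + g)) 1) * \<delta> =
    (psubst cst \<xi> f - psubst cst \<eta> f - cst (coeff (linpart \<gamma> f) 1) * \<delta>) + (psubst cst \<xi> g - psubst cst \<eta> g - cst (coeff (linpart \<gamma> g) 1) * \<delta>)"
    by (simp add: linpart_simps psubst_simps ishom_cst ishomD[OF ishom_cst] algebra_simps)
  have "ordge (Suc n) (psubst cst \<xi> (f + g) - psubst cst \<eta> (f + g) - cst (coeff (linpart \<gamma> (f + g)) 1) * \<delta>)"
    unfolding e using add by (intro ordge_add) auto
  then show ?case using add by (simp add: linpart_simps psubst_simps ishom_cst)
next
  case (mult f g)
  let ?X = "psubst cst \<xi>" and ?Y = "psubst cst \<eta>" and ?c = "\<lambda>k f. coeff (linpart \<gamma> f) k"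
  have e: "?X (f * g) - ?Y (f * g) - cst (?c 1 (f * g)) * \<delta> =
    ?X f * (?X g - ?Y g - cst (?c 1 g) * \<delta>) + (?X f - cst (?c 0 f)) * (cst (?c 1 g) * \<delta>)
    + ?Y g * (?X f - ?Y f - cst (?c 1 f) * \<delta>) + (?Y g - cst (?c 0 g)) * (cst (?c 1 f) * \<delta>)"
    by (simp add: linpart_simps psubst_simps ishom_cst ishomD[OF ishom_cst] coeff_mult_0_1 algebra_simps)
  have o2: "ordge (1 + n) ((?X f - cst (?c 0 f)) * (cst (?c 1 g) * \<delta>))"
    using mult n(2) by (intro ordge_mult ordge_mult_left) (simp_all add: ordge_Suc_0_iff)
  have o4: "ordge (1 + n) ((?Y g - cst (?c 0 g)) * (cst (?c 1 f) * \<delta>))"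
    using mult n(2) by (intro ordge_mult ordge_mult_left) (simp_all add: ordge_Suc_0_iff)
  have o1: "ordge (1 + n) (?X f * (?X g - ?Y g - cst (?c 1 g) * \<delta>))" using mult by (intro ordge_mult_left) simp
  have o3: "ordge (1 + n) (?Y g * (?X f - ?Y f - cst (?c 1 f) * \<delta>))" using mult by (intro ordge_mult_left) simp
  have "ordge (Suc n) (?X (f * g) - ?Y (f * g) - cst (?c 1 (f * g)) * \<delta>)"
    unfolding e using ordge_add[OF ordge_add[OF ordge_add[OF o1 o2] o3] o4] by simp
  then show ?case using mult by (simp add: linpart_simps psubst_simps ishom_cst coeff_mult_0_1)
qed

definition line :: "('v \<Rightarrow> complex) \<Rightarrow> 'v \<Rightarrow> 'v \<Rightarrow> complex poly" where
  "line b j = (\<lambda>i. if i = j then [:b i, 1:] else [:b i:])"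

lemma K_hensel:
  fixes F :: "('v, complex) mpoly"
  assumes F: "peval b F = 0" and D: "coeff (linpart (line b j) F) 1 \<noteq> 0" and \<zeta>: "\<And>i. i \<noteq> j \<Longrightarrow> c0 (\<zeta> i) = b i"
  shows "\<exists>Z. c0 Z = b j \<and> psubst cst (\<zeta>(j := Z)) F = 0"
proof -
  define D where "D = coeff (linpart (line b j) F) 1"
  have D0: "D \<noteq> 0" using D by (simp add: D_def)
  define T where "T = (\<lambda>(Z :: unit \<Rightarrow> K) i. Z i - cst (1 / D) * psubst cst (\<zeta>(j := Z ())) F)"
  have cc: "c0 (psubst cst (\<zeta>(j := Z)) F) = 0" if "c0 Z = b j" for Z
  proof -
    have "c0 (psubst cst (\<zeta>(j := Z)) F) = psubst (\<lambda>c. c0 (cst c)) (\<lambda>i. c0 ((\<zeta>(j := Z)) i)) F"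
      by (rule psubst_natural[OF ishom_c0 ishom_cst])
    also have "(\<lambda>i. c0 ((\<zeta>(j := Z)) i)) = b" using that \<zeta> by auto
    finally show ?thesis using F by (simp add: peval_eq_psubst del: fun_upd_apply)
  qed
  have "\<exists>Z. (\<forall>i. c0 (Z i) = b j) \<and> T Z = Z \<and> (\<forall>i p q. kc p q (Z i) \<noteq> 0 \<longrightarrow> (p, q) \<in> UNIV)"
  proof (rule K_fixpoint[of "\<lambda>_. b j" T "\<lambda>_. UNIV"])
    fix Z :: "unit \<Rightarrow> K" assume "\<And>i. c0 (Z i) = b j"
    then show "\<forall>i. c0 (T Z i) = b j" using cc by (simp add: T_def)
  next
    fix Z Z' :: "unit \<Rightarrow> K" and n
    assume Z: "\<And>i. c0 (Z i) = b j" "\<And>i. c0 (Z' i) = b j" and n: "1 \<le> n" "\<And>i. ordge n (Z i - Z' i)"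
    define \<delta> where "\<delta> = Z () - Z' ()"
    have "ordge (Suc n) (psubst cst (\<zeta>(j := Z ())) F - psubst cst (\<zeta>(j := Z' ())) F - cst (coeff (linpart (line b j) F) 1) * \<delta>)"
    proof (rule conjunct2[OF conjunct2[OF K_taylor[OF n(1)]]])
      show "ordge n \<delta>" using n by (simp add: \<delta>_def)
    qed (use Z \<zeta> in \<open>auto simp: line_def \<delta>_def\<close>)
    then have o: "ordge (Suc n) (cst (- 1 / D) * (psubst cst (\<zeta>(j := Z ())) F - psubst cst (\<zeta>(j := Z' ())) F - cst D * \<delta>))"
      unfolding D_def[symmetric] by (rule ordge_mult_left)
    have c: "cst (1 / D) * cst D = 1" using D0 ishomD(4)[OF ishom_cst, of "1 / D" D] by simp
    have m: "cst (- 1 / D) = - cst (1 / D)" using ishomD(5)[OF ishom_cst, of "1 / D"] by simp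
    have c\<delta>: "cst (1 / D) * (cst D * \<delta>) = \<delta>" using c by (simp flip: mult.assoc)
    have "T Z () - T Z' () = \<delta> - cst (1 / D) * (psubst cst (\<zeta>(j := Z ())) F - psubst cst (\<zeta>(j := Z' ())) F)"
      by (simp add: T_def \<delta>_def right_diff_distrib del: fun_upd_apply)
    also have "\<dots> = cst (- 1 / D) * (psubst cst (\<zeta>(j := Z ())) F - psubst cst (\<zeta>(j := Z' ())) F - cst D * \<delta>)"
      unfolding m by (simp add: right_diff_distrib c\<delta> del: fun_upd_apply)
    finally have "T Z () - T Z' () = cst (- 1 / D) * (psubst cst (\<zeta>(j := Z ())) F - psubst cst (\<zeta>(j := Z' ())) F - cst D * \<delta>)" .
    moreover
    ultimately show "\<forall>i. ordge (Suc n) (T Z i - T Z' i)" using o by (simp del: fun_upd_apply)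
  qed simp_all
  then obtain Z where Z: "\<And>i. c0 (Z i) = b j" "T Z = Z" by blast
  have "T Z () = Z ()" using Z(2) by simp
  then have "cst (1 / D) * psubst cst (\<zeta>(j := Z ())) F = 0" by (simp add: T_def)
  moreover have "cst (1 / D) \<noteq> 0" using D0 c0_cst[of "1 / D"] by (metis c0_simps(1) divide_eq_0_iff one_neq_zero)
  ultimately show ?thesis using Z(1) by auto
qed

section \<open>A criterion for regularity\<close>

lemma psubst_scale:
  fixes \<xi> :: "'v \<Rightarrow> 'r::comm_ring_1"
  assumes "whomogeneous wt d f"
  shows "psubst h (\<lambda>i. c ^ wt i * \<xi> i) f = c ^ d * psubst h \<xi> f"
proof -
  have "meval (\<lambda>i. c ^ wt i * \<xi> i) m = c ^ wdegree wt m * meval \<xi> m" for m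
    by (simp add: meval_def wdegree_def power_mult_distrib prod.distrib power_sum power_mult)
  then have "psubst h (\<lambda>i. c ^ wt i * \<xi> i) f = (\<Sum>m\<in>Poly_Mapping.keys f. h (Poly_Mapping.lookup f m) * (c ^ wdegree wt m * meval \<xi> m))"
    by (simp add: psubst_def)
  also have "\<dots> = (\<Sum>m\<in>Poly_Mapping.keys f. h (Poly_Mapping.lookup f m) * (c ^ d * meval \<xi> m))"
    using assms by (intro sum.cong) (auto simp: whomogeneous_def)
  also have "\<dots> = c ^ d * psubst h \<xi> f"
    by (simp add: psubst_def sum_distrib_left mult_ac)
  finally show ?thesis .
qed

lemma primeideal_type:
  fixes Q :: "'r::idom set"
  assumes "pideal Q" "1 \<notin> Q" "\<And>x y. x * y \<in> Q \<Longrightarrow> x \<in> Q \<or> y \<in> Q"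
  shows "primeideal Q (ring_of_type_algebra :: 'r ring)"
  by (rule primeidealI) (use assms in \<open>auto simp: ideal_type_iff cring_type\<close>)

locale wproj_complex = wproj wt I a for wt :: "'v \<Rightarrow> nat" and I :: "('v, complex) mpoly set" and a
begin

lemma hom_to_K:
  assumes \<xi>: "\<And>f. f \<in> I \<Longrightarrow> psubst cst \<xi> f = 0" "\<And>i. c0 (\<xi> i) = a i"
  shows "\<exists>\<Phi>. ring_hom_ring A (ring_of_type_algebra :: K ring) \<Phi> \<and>
    (\<forall>f g. ok f g \<longrightarrow> \<Phi> (frac f g) * psubst cst \<xi> g = psubst cst \<xi> f)"
proof (rule hom_to_type[OF ishom_cst \<xi>(1)])
  fix g d assume "hom d g" "peval a g \<noteq> 0"
  moreover have "c0 (psubst cst \<xi> g) = peval a g"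
    using psubst_natural[OF ishom_c0 ishom_cst, of \<xi> g] by (simp add: \<xi>(2) peval_eq_psubst)
  ultimately show "psubst cst \<xi> g dvd 1" by (intro K_unit) simp
qed

lemma krull_dim_ge_2_if_curve_chain:
  assumes \<xi>: "\<And>f. f \<in> I \<Longrightarrow> psubst cst \<xi> f = 0" "\<And>i. c0 (\<xi> i) = a i"
    and o: "ok f1 g1" "ok f2 g2" and f1: "psubst cst \<xi> f1 \<noteq> 0" "fps_nth (psubst cst \<xi> f1) 0 = 0"
    and f2: "peval a f2 = 0" "fps_nth (psubst cst \<xi> f2) 0 \<noteq> 0"
  shows "2 \<le> krull_dim A" "frac f1 g1 \<noteq> frac f2 g2"
proof -
  obtain \<Phi> where \<Phi>: "ring_hom_ring A (ring_of_type_algebra :: K ring) \<Phi>"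
    "\<And>f g. ok f g \<Longrightarrow> \<Phi> (frac f g) * psubst cst \<xi> g = psubst cst \<xi> f"
    using hom_to_K[OF \<xi>] by blast
  interpret \<Phi>: ring_hom_ring A "ring_of_type_algebra :: K ring" \<Phi> by (rule \<Phi>(1))
  have c0p: "c0 (psubst cst \<xi> g) = peval a g" for g
    using psubst_natural[OF ishom_c0 ishom_cst, of \<xi> g] by (simp add: \<xi>(2) peval_eq_psubst)
  define P0 where "P0 = {r \<in> carrier A. \<Phi> r \<in> {0}}"
  define P1 where "P1 = {r \<in> carrier A. \<Phi> r \<in> {F. fps_nth F 0 = 0}}"
  have "primeideal P0 A" unfolding P0_def
    by (rule \<Phi>.primeideal_vimage[OF cring_A]) (auto intro!: primeideal_type simp: pideal_def)
  moreover have "primeideal P1 A" unfolding P1_def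
    by (rule \<Phi>.primeideal_vimage[OF cring_A]) (auto intro!: primeideal_type simp: pideal_def)
  moreover have "primeideal mx A" by (rule maximalideal_prime[OF maximal_mx])
  moreover have nth0: "fps_nth (\<Phi> (frac f g)) 0 * fps_nth (psubst cst \<xi> g) 0 = fps_nth (psubst cst \<xi> f) 0" if "ok f g" for f g
    using arg_cong[OF \<Phi>(2)[OF that], of "\<lambda>F. fps_nth F 0"] by simp
  have g0: "fps_nth (psubst cst \<xi> g) 0 \<noteq> 0" if "ok f g" for f g
    using c0p[of g] that by (auto simp: ok_def c0_def)
  have a1: "frac f1 g1 \<in> P1" "frac f1 g1 \<notin> P0"
    using nth0[OF o(1)] g0[OF o(1)] f1 \<Phi>(2)[OF o(1)] o by (auto simp: P1_def P0_def)
  have a2: "frac f2 g2 \<in> mx" "frac f2 g2 \<notin> P1"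
    using nth0[OF o(2)] f2 o by (auto simp: P1_def frac_in_mx)
  moreover have "P0 \<subseteq> P1" by (auto simp: P0_def P1_def)
  moreover have "P1 \<subseteq> mx"
  proof
    fix x assume x: "x \<in> P1"
    then have "x \<in> carrier A" by (simp add: P1_def)
    then obtain f g where fg: "x = frac f g" "ok f g" by (metis carrierE)
    have "fps_nth (\<Phi> (frac f g)) 0 = 0" using x fg by (simp add: P1_def)
    then have "fps_nth (psubst cst \<xi> f) 0 = 0" using nth0[OF fg(2)] by simp
    then have "peval a f = 0" using c0p[of f] by (simp add: c0_def)
    then show "x \<in> mx" using fg by (simp add: frac_in_mx)
  qed
  ultimately show "2 \<le> krull_dim A" using a1 by (intro krull_dim_ge_2[of P0 P1 mx]) auto
  show "frac f1 g1 \<noteq> frac f2 g2" using a1 a2 by metis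
qed

end

text \<open>
  The form \<open>e1 / e2\<close> has degree one and is a unit at the point, so that every inhomogeneous relation
  modulo \<open>e1 - e2\<close> can be made homogeneous.
\<close>

context wproj
begin

definition homogenize :: "('v, 'k) mpoly \<Rightarrow> ('v, 'k) mpoly \<Rightarrow> nat \<Rightarrow> ('v, 'k) mpoly \<Rightarrow> ('v, 'k) mpoly" where
  "homogenize e1 e2 N g = (\<Sum>d\<le>N. hcomp wt d g * e1 ^ (N - d) * e2 ^ d)"

lemma homogenize_add: "homogenize e1 e2 N (f + g) = homogenize e1 e2 N f + homogenize e1 e2 N g"
  by (simp add: homogenize_def hcomp_add distrib_right sum.distrib)

lemma homogenize_diff: "homogenize e1 e2 N (f - g) = homogenize e1 e2 N f - homogenize e1 e2 N g"
  by (simp add: homogenize_def hcomp_diff left_diff_distrib sum_subtractf)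

lemma homogenize_mult:
  assumes f: "hom e f" and N: "e \<le> N"
  shows "homogenize e1 e2 N (g * f) = f * e2 ^ e * homogenize e1 e2 (N - e) g"
proof -
  have "homogenize e1 e2 N (g * f) = (\<Sum>d\<le>N. if e \<le> d then hcomp wt (d - e) g * f * e1 ^ (N - d) * e2 ^ d else 0)"
    unfolding homogenize_def by (intro sum.cong) (auto simp: hcomp_mult[OF f])
  also have "\<dots> = (\<Sum>d\<in>{e..N}. hcomp wt (d - e) g * f * e1 ^ (N - d) * e2 ^ d)"
    by (intro sum.mono_neutral_cong_right) auto
  also have "\<dots> = (\<Sum>d\<le>N - e. hcomp wt d g * f * e1 ^ (N - e - d) * e2 ^ (d + e))"
    by (rule sum.reindex_bij_witness[of _ "\<lambda>d. d + e" "\<lambda>d. d - e"]) (use N in \<open>auto\<close>)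
  also have "\<dots> = f * e2 ^ e * homogenize e1 e2 (N - e) g"
    unfolding homogenize_def sum_distrib_left by (intro sum.cong) (auto simp: power_add mult_ac)
  finally show ?thesis .
qed

lemma homogenize_Suc:
  assumes "wbound wt g \<le> N"
  shows "homogenize e1 e2 (Suc N) g = e1 * homogenize e1 e2 N g"
proof -
  have "homogenize e1 e2 (Suc N) g = (\<Sum>d\<le>N. hcomp wt d g * e1 ^ (Suc N - d) * e2 ^ d)"
    unfolding homogenize_def using hcomp_eq_0[of wt g "Suc N"] assms by simp
  also have "\<dots> = (\<Sum>d\<le>N. e1 * (hcomp wt d g * e1 ^ (N - d) * e2 ^ d))"
    by (intro sum.cong) (auto simp: Suc_diff_le mult_ac)
  finally show ?thesis by (simp add: homogenize_def sum_distrib_left)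
qed

lemma homogenized_relation:
  assumes e: "hom (Suc k) e1" "hom k e2" "peval a e1 = peval a e2" "peval a e2 \<noteq> 0"
    and hA: "hom dA A1" "hom dB B1" and f: "hom d f"
    and rel: "h * f = i + u * A1 + v * B1 + w * (e1 - e2)" "i \<in> I" "peval a h \<noteq> 0"
  shows "\<exists>h' e i' u' v'. hom e h' \<and> peval a h' \<noteq> 0 \<and> i' \<in> I \<and> h' * f = i' + u' * A1 + v' * B1"
proof -
  let ?H = "homogenize e1 e2"
  define N where "N = d + dA + dB + Suc k + wbound wt h + wbound wt w"
  have "?H N (h * f) = ?H N (i + u * A1 + v * B1 + w * (e1 - e2))" by (simp only: rel(1))
  also have "\<dots> = ?H N i + ?H N (u * A1) + ?H N (v * B1) + (?H N (w * e1) - ?H N (w * e2))"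
    by (simp only: homogenize_add right_diff_distrib homogenize_diff)
  also have "?H N (w * e1) - ?H N (w * e2) = 0"
  proof -
    have "?H N (w * e1) = e1 * e2 ^ Suc k * ?H (N - Suc k) w" by (rule homogenize_mult[OF e(1)]) (simp add: N_def)
    moreover have "?H N (w * e2) = e2 * e2 ^ k * ?H (N - k) w" by (rule homogenize_mult[OF e(2)]) (simp add: N_def)
    moreover have "N - k = Suc (N - Suc k)" "wbound wt w \<le> N - Suc k" by (auto simp: N_def)
    ultimately show ?thesis using homogenize_Suc[of w "N - Suc k"] by (simp add: mult_ac)
  qed
  also have "?H N (u * A1) = (e2 ^ dA * ?H (N - dA) u) * A1"
    by (subst homogenize_mult[OF hA(1)]) (auto simp: N_def mult_ac)
  also have "?H N (v * B1) = (e2 ^ dB * ?H (N - dB) v) * B1"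
    by (subst homogenize_mult[OF hA(2)]) (auto simp: N_def mult_ac)
  finally have 1: "?H N (h * f) = ?H N i + (e2 ^ dA * ?H (N - dA) u) * A1 + (e2 ^ dB * ?H (N - dB) v) * B1" by simp
  have 2: "?H N (h * f) = (e2 ^ d * ?H (N - d) h) * f"
    by (subst homogenize_mult[OF f]) (auto simp: N_def mult_ac)
  have iI: "?H N i \<in> I"
    unfolding homogenize_def using hideal rel(2) by (intro pideal_sum[OF I] pidealD(4)[OF I]) (auto simp: hideal_def)
  have hH: "hom (Suc k * (N - d)) (?H (N - d) h)"
    unfolding homogenize_def
  proof (rule whom_sum)
    fix c assume c: "c \<in> {..N - d}"
    have "hom (c + Suc k * (N - d - c) + k * c) (hcomp wt c h * e1 ^ (N - d - c) * e2 ^ c)"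
      by (intro whom_mult whom_hcomp whom_power e)
    moreover have "c + Suc k * (N - d - c) + k * c = Suc k * (N - d)"
    proof -
      have e: "c + Suc k * M + k * c = Suc k * (M + c)" for M by (simp add: algebra_simps)
      have "N - d - c + c = N - d" using c by simp
      then show ?thesis unfolding e by simp
    qed
    ultimately show "hom (Suc k * (N - d)) (hcomp wt c h * e1 ^ (N - d - c) * e2 ^ c)" by simp
  qed
  have "peval a (?H (N - d) h) = (\<Sum>c\<le>N - d. peval a (hcomp wt c h) * peval a e2 ^ (N - d))"
    unfolding homogenize_def peval_simps
  proof (intro sum.cong refl)
    fix c assume "c \<in> {..N - d}"
    then have "N - d = (N - d - c) + c" by simp
    then have "peval a e2 ^ (N - d) = peval a e2 ^ (N - d - c) * peval a e2 ^ c" by (metis power_add)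
    then show "peval a (hcomp wt c h) * peval a e1 ^ (N - d - c) * peval a e2 ^ c = peval a (hcomp wt c h) * peval a e2 ^ (N - d)"
      by (simp add: e(3))
  qed
  also have "\<dots> = peval a (\<Sum>c\<le>N - d. hcomp wt c h) * peval a e2 ^ (N - d)" by (simp add: sum_distrib_right)
  also have "(\<Sum>c\<le>N - d. hcomp wt c h) = h" by (rule sum_hcomp[symmetric]) (simp add: N_def)
  finally have ph: "peval a (e2 ^ d * ?H (N - d) h) \<noteq> 0" using rel(3) e(4) by simp
  have "hom (k * d + Suc k * (N - d)) (e2 ^ d * ?H (N - d) h)" by (intro whom_mult whom_power e hH)
  then show ?thesis using ph iI 1 2 by metis
qed

definition local_set :: "('v, 'k) mpoly \<Rightarrow> ('v, 'k) mpoly \<Rightarrow> ('v, 'k) mpoly \<Rightarrow> ('v, 'k) mpoly set" where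
  "local_set A1 B1 e = {f. \<exists>h i u v w. peval a h \<noteq> 0 \<and> i \<in> I \<and> h * f = i + u * A1 + v * B1 + w * e}"

lemma local_setI: "peval a h \<noteq> 0 \<Longrightarrow> i \<in> I \<Longrightarrow> h * f = i + u * A1 + v * B1 + w * e \<Longrightarrow> f \<in> local_set A1 B1 e"
  unfolding local_set_def by blast

lemma local_setE:
  assumes "f \<in> local_set A1 B1 e"
  obtains h i u v w where "peval a h \<noteq> 0" "i \<in> I" "h * f = i + u * A1 + v * B1 + w * e"
  using assms unfolding local_set_def by blast

lemma local_set:
  shows "pideal (local_set A1 B1 e)" "A1 \<in> local_set A1 B1 e" "B1 \<in> local_set A1 B1 e" "e \<in> local_set A1 B1 e"
    "i \<in> I \<Longrightarrow> i \<in> local_set A1 B1 e" "peval a h \<noteq> 0 \<Longrightarrow> h * f \<in> local_set A1 B1 e \<Longrightarrow> f \<in> local_set A1 B1 e"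
proof -
  show "A1 \<in> local_set A1 B1 e" by (rule local_setI[of 1 0 _ 1 _ 0 _ 0]) (auto simp: pidealD[OF I])
  show "B1 \<in> local_set A1 B1 e" by (rule local_setI[of 1 0 _ 0 _ 1 _ 0]) (auto simp: pidealD[OF I])
  show "e \<in> local_set A1 B1 e" by (rule local_setI[of 1 0 _ 0 _ 0 _ 1]) (auto simp: pidealD[OF I])
  show "i \<in> I \<Longrightarrow> i \<in> local_set A1 B1 e" for i by (rule local_setI[of 1 i _ 0 _ 0 _ 0]) auto
  show "f \<in> local_set A1 B1 e" if h: "peval a h \<noteq> 0" "h * f \<in> local_set A1 B1 e" for h f
  proof -
    obtain h' i u v w where *: "peval a h' \<noteq> 0" "i \<in> I" "h' * (h * f) = i + u * A1 + v * B1 + w * e"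
      using h(2) by (rule local_setE)
    show ?thesis by (rule local_setI[of "h' * h" i _ u _ v _ w]) (use * h in \<open>auto simp: mult.assoc\<close>)
  qed
  show "pideal (local_set A1 B1 e)"
    unfolding pideal_def
  proof (intro conjI ballI allI)
    show "0 \<in> local_set A1 B1 e" by (rule local_setI[of 1 0 _ 0 _ 0 _ 0]) (auto simp: pidealD[OF I])
  next
    fix f g assume "f \<in> local_set A1 B1 e" "g \<in> local_set A1 B1 e"
    then obtain h i u v w h' i' u' v' w' where *: "peval a h \<noteq> 0" "i \<in> I" "h * f = i + u * A1 + v * B1 + w * e"
      and **: "peval a h' \<noteq> 0" "i' \<in> I" "h' * g = i' + u' * A1 + v' * B1 + w' * e" by (elim local_setE)
    have "(h * h') * (f + g) = h' * (h * f) + h * (h' * g)" by (simp add: algebra_simps)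
    also have "\<dots> = (h' * i + h * i') + (h' * u + h * u') * A1 + (h' * v + h * v') * B1 + (h' * w + h * w') * e"
      unfolding * ** by (simp add: algebra_simps)
    finally show "f + g \<in> local_set A1 B1 e" by (rule local_setI[rotated 2]) (use * ** in \<open>auto intro!: pidealD(2,3)[OF I]\<close>)
  next
    fix g f assume "f \<in> local_set A1 B1 e"
    then obtain h i u v w where *: "peval a h \<noteq> 0" "i \<in> I" "h * f = i + u * A1 + v * B1 + w * e" by (rule local_setE)
    have "h * (g * f) = g * (h * f)" by (simp add: algebra_simps)
    also have "\<dots> = g * i + (g * u) * A1 + (g * v) * B1 + (g * w) * e" unfolding * by (simp add: algebra_simps)
    finally show "g * f \<in> local_set A1 B1 e" by (rule local_setI[rotated 2]) (use * in \<open>auto intro!: pidealD(3)[OF I]\<close>)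
  qed
qed

theorem regular_criterion:
  assumes noeth: "\<And>G :: ('v, 'k) mpoly set. \<exists>F. finite F \<and> F \<subseteq> G \<and> G \<subseteq> pgen F"
    and gr: "quadratic_growth wt I" and ge: "2 \<le> krull_dim A"
    and e: "hom (Suc k) e1" "hom k e2" "peval a e1 = peval a e2" "peval a e2 \<noteq> 0"
    and okA: "ok A1 A2" "ok B1 B2" "peval a A1 = 0" "peval a B1 = 0" "frac A1 A2 \<noteq> frac B1 B2"
    and coord: "\<And>i. pvar i - pconst (a i) \<in> local_set A1 B1 (e1 - e2)"
  shows "regular_local_ring A"
proof -
  have shift: "f - pconst (peval a f) \<in> local_set A1 B1 (e1 - e2)" for f
  proof (induction f rule: mpoly_induct)
    case (add f g)
    have "f + g - pconst (peval a (f + g)) = (f - pconst (peval a f)) + (g - pconst (peval a g))"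
      by (simp add: ishomD[OF ishom_pconst])
    then show ?case using pidealD(2)[OF local_set(1) add] by (simp only:)
  next
    case (mult f g)
    have "f * g - pconst (peval a (f * g)) = g * (f - pconst (peval a f)) + pconst (peval a f) * (g - pconst (peval a g))"
      by (simp add: ishomD[OF ishom_pconst] algebra_simps)
    then show ?case
      using pidealD(2)[OF local_set(1) pidealD(3)[OF local_set(1) mult(1)] pidealD(3)[OF local_set(1) mult(2)]] by simp
  qed (auto simp: coord pidealD[OF local_set(1)])
  obtain dA dB where d: "hom dA A1" "hom dB B1" using okA by (auto simp: ok_def)
  have "mx = genideal A {frac A1 A2, frac B1 B2}"
  proof (rule mx_generated[OF okA(1-4)])
    fix f d assume f: "hom d f" "peval a f = 0"
    have "f \<in> local_set A1 B1 (e1 - e2)" using shift[of f] f(2) by (simp add: pconst_0)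
    then obtain h i u v w where *: "peval a h \<noteq> 0" "i \<in> I" "h * f = i + u * A1 + v * B1 + w * (e1 - e2)" by (rule local_setE)
    show "\<exists>h e i u v. hom e h \<and> peval a h \<noteq> 0 \<and> i \<in> I \<and> h * f = i + u * A1 + v * B1"
      by (rule homogenized_relation[OF e d f(1) *(3,2,1)])
  qed
  moreover have "krull_dim A = 2" using ge krull_dim_le_2[OF gr] by (rule antisym[rotated])
  moreover have "enat (card {frac A1 A2, frac B1 B2}) = 2" using okA(5) by (simp add: numeral_eq_enat)
  ultimately show ?thesis
    unfolding regular_local_ring_def the_maximal_ideal_A
    using local_ring_A noetherian_fractions[OF noeth] okA(1,2)
    by (intro conjI exI[of _ "{frac A1 A2, frac B1 B2}"]) simp_all
qed

end

section \<open>Regular points\<close>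

lemma psubst_compose:
  assumes "ishom h"
  shows "psubst h \<xi> (psubst pconst c f) = psubst h (\<lambda>i. psubst h \<xi> (c i)) f"
  using psubst_natural[OF ishom_psubst[OF assms] ishom_pconst, of \<xi> c f] by (simp add: assms)

lemma linpart_compose: "linpart \<gamma> (psubst pconst c f) = linpart (\<lambda>i. linpart \<gamma> (c i)) f"
  unfolding linpart_def by (rule psubst_compose[OF ishom_const_poly])

lemma coeff_linpart_line: "coeff (linpart (line b j) f) 0 = peval b f"
proof -
  have h: "ishom (\<lambda>p::complex poly. coeff p 0)" by (simp add: ishom_def coeff_mult_0_1)
  have "coeff (linpart (line b j) f) 0 = psubst (\<lambda>c. coeff [:c:] 0) (\<lambda>i. coeff (line b j i) 0) f"
    unfolding linpart_def by (rule psubst_natural[OF h ishom_const_poly])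
  also have "(\<lambda>i. coeff (line b j i) 0) = b" by (auto simp: line_def)
  finally show ?thesis by (simp add: peval_eq_psubst)
qed

definition K_s :: K where "K_s = fps_const fps_X"
definition K_t :: K where "K_t = fps_X"

lemma K_st [simp]: "c0 K_s = 0" "c0 K_t = 0" "fps_nth K_s 0 = fps_X" "fps_nth K_t 0 = 0" "K_t \<noteq> 0" "K_s \<noteq> 0"
  by (auto simp: K_s_def K_t_def c0_def)

lemma chart_solution:
  fixes c :: "'v \<Rightarrow> ('v, complex) mpoly"
  assumes F: "peval b (psubst pconst c R) = 0" "coeff (linpart (line b j) (psubst pconst c R)) 1 \<noteq> 0"
    and d: "j \<noteq> i1" "j \<noteq> i2" "i1 \<noteq> i2"
  shows "\<exists>\<xi>. \<xi> i1 = cst (b i1) + K_s \<and> \<xi> i2 = cst (b i2) + K_t \<and> (\<forall>i. i \<notin> {j, i1, i2} \<longrightarrow> \<xi> i = cst (b i)) \<and>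
    (\<forall>i. c0 (\<xi> i) = b i) \<and> psubst cst (\<lambda>i. psubst cst \<xi> (c i)) R = 0"
proof -
  define \<zeta> where "\<zeta> i = (if i = i1 then cst (b i) + K_s else if i = i2 then cst (b i) + K_t else cst (b i))" for i
  have c\<zeta>: "c0 (\<zeta> i) = b i" for i by (simp add: \<zeta>_def)
  obtain Z where Z: "c0 Z = b j" "psubst cst (\<zeta>(j := Z)) (psubst pconst c R) = 0" using K_hensel[OF F c\<zeta>] by blast
  show ?thesis using Z c\<zeta> d unfolding psubst_compose[OF ishom_cst]
    by (intro exI[of _ "\<zeta>(j := Z)"]) (auto simp: \<zeta>_def)
qed

definition vanishing :: "(complex \<Rightarrow> 'r::comm_ring_1) \<Rightarrow> (var \<Rightarrow> 'r) \<Rightarrow> S set \<Rightarrow> bool" where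
  "vanishing h \<xi> F \<longleftrightarrow> (\<forall>f\<in>F. psubst h \<xi> f = 0)"

lemma vanishing_X':
  assumes "ishom h" "vanishing h \<xi> (relations \<theta> \<tau> P)" "f \<in> X'_ideal \<theta> \<tau> P"
  shows "psubst h \<xi> f = 0"
proof -
  have "X'_ideal \<theta> \<tau> P \<subseteq> {f. psubst h \<xi> f = 0}"
    by (rule X'_subset) (use assms in \<open>auto simp: pideal_def psubst_add psubst_mult vanishing_def\<close>)
  then show ?thesis using assms(3) by auto
qed

definition chart1 :: "var \<Rightarrow> S" where
  "chart1 i = (case i of Vx0 \<Rightarrow> 1 | Vx1 \<Rightarrow> sx1 | Vy \<Rightarrow> sx1 ^ 3 | Vw \<Rightarrow> sx1 ^ 5 | Vu0 \<Rightarrow> su0 | Vu1 \<Rightarrow> sx1 * su0 | Vz \<Rightarrow> sz | Vt \<Rightarrow> su0 ^ 2)"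

definition chart2 :: "var \<Rightarrow> S" where
  "chart2 i = (case i of Vx0 \<Rightarrow> sy ^ 5 | Vx1 \<Rightarrow> sy ^ 2 | Vy \<Rightarrow> sy | Vw \<Rightarrow> 1 | Vu0 \<Rightarrow> sy ^ 3 * su1 | Vu1 \<Rightarrow> su1 | Vz \<Rightarrow> sz | Vt \<Rightarrow> sy * su1 ^ 2)"

definition rel11 :: "complex \<Rightarrow> complex \<Rightarrow> S \<Rightarrow> S" where "rel11 \<theta> \<tau> P = sx0 * P + sx1 ^ 2 * Qf \<theta> \<tau> + su0 * st"
definition rel13 :: "complex \<Rightarrow> complex \<Rightarrow> S \<Rightarrow> S" where "rel13 \<theta> \<tau> P = sy * P + sw * Qf \<theta> \<tau> + su1 ^ 3"

lemma vanishing_chart1: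
  assumes h: "ishom h"
    and \<xi>: "\<xi> Vx0 = 1" "\<xi> Vy = \<xi> Vx1 ^ 3" "\<xi> Vw = \<xi> Vx1 ^ 5" "\<xi> Vu1 = \<xi> Vx1 * \<xi> Vu0" "\<xi> Vt = \<xi> Vu0 ^ 2"
    and 0: "psubst h \<xi> (rel11 \<theta> \<tau> P) = 0"
  shows "vanishing h \<xi> (relations \<theta> \<tau> P)"
proof -
  have F: "psubst h \<xi> P = - (\<xi> Vx1 ^ 2 * psubst h \<xi> (Qf \<theta> \<tau>) + \<xi> Vu0 ^ 3)"
    using 0 by (simp add: rel11_def psubst_simps h \<xi> algebra_simps power3_eq_cube power2_eq_square eq_neg_iff_add_eq_0)
  show ?thesis unfolding vanishing_def relations_eq
    by (simp add: psubst_simps h \<xi> F algebra_simps numeral_eq_Suc)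
qed

lemma vanishing_chart2:
  assumes h: "ishom h"
    and \<xi>: "\<xi> Vw = 1" "\<xi> Vx0 = \<xi> Vy ^ 5" "\<xi> Vx1 = \<xi> Vy ^ 2" "\<xi> Vu0 = \<xi> Vy ^ 3 * \<xi> Vu1" "\<xi> Vt = \<xi> Vy * \<xi> Vu1 ^ 2"
    and 0: "psubst h \<xi> (rel13 \<theta> \<tau> P) = 0"
  shows "vanishing h \<xi> (relations \<theta> \<tau> P)"
proof -
  have F: "psubst h \<xi> (Qf \<theta> \<tau>) = - (\<xi> Vy * psubst h \<xi> P + \<xi> Vu1 ^ 3)"
    using 0 by (simp add: rel13_def psubst_simps h \<xi> algebra_simps power3_eq_cube power2_eq_square eq_neg_iff_add_eq_0)
  show ?thesis unfolding vanishing_def relations_eq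
    by (simp add: psubst_simps h \<xi> F algebra_simps numeral_eq_Suc)
qed

lemma peval_vanish: "vanishing (\<lambda>x. x) a (relations \<theta> \<tau> P) \<Longrightarrow> f \<in> X'_ideal \<theta> \<tau> P \<Longrightarrow> peval a f = 0"
  using vanishing_X'[OF ishom_id] by (simp add: peval_eq_psubst)

definition ptcong :: "S set \<Rightarrow> S \<Rightarrow> S \<Rightarrow> bool" where "ptcong M f g \<longleftrightarrow> f - g \<in> M"

lemma ptcong:
  assumes M: "pideal M"
  shows "ptcong M f f" "ptcong M f g \<Longrightarrow> ptcong M g f" "ptcong M f g \<Longrightarrow> ptcong M g h \<Longrightarrow> ptcong M f h"
    "ptcong M f g \<Longrightarrow> ptcong M f' g' \<Longrightarrow> ptcong M (f + f') (g + g')" "ptcong M f g \<Longrightarrow> ptcong M f' g' \<Longrightarrow> ptcong M (f * f') (g * g')"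
    "ptcong M f g \<Longrightarrow> ptcong M (f ^ n) (g ^ n)"
proof -
  show "ptcong M f f" for f by (simp add: ptcong_def pidealD[OF M])
  then have refl: "\<And>f. ptcong M f f" .
  show "ptcong M f g \<Longrightarrow> ptcong M g f" using pidealD(5)[OF M, of "f - g"] by (simp add: ptcong_def)
  show "ptcong M f g \<Longrightarrow> ptcong M g h \<Longrightarrow> ptcong M f h" using pidealD(2)[OF M, of "f - g" "g - h"] by (simp add: ptcong_def)
  show "ptcong M f g \<Longrightarrow> ptcong M f' g' \<Longrightarrow> ptcong M (f + f') (g + g')"
    using pidealD(2)[OF M, of "f - g" "f' - g'"] by (simp add: ptcong_def algebra_simps)
  show mult: "ptcong M f g \<Longrightarrow> ptcong M f' g' \<Longrightarrow> ptcong M (f * f') (g * g')" for f g f' g'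
  proof -
    assume *: "ptcong M f g" "ptcong M f' g'"
    have "f * f' - g * g' = f' * (f - g) + g * (f' - g')" by (simp add: algebra_simps)
    then show ?thesis using pidealD(2)[OF M pidealD(3)[OF M] pidealD(3)[OF M]] * by (simp only: ptcong_def)
  qed
  show "ptcong M f g \<Longrightarrow> ptcong M (f ^ n) (g ^ n)" by (induction n) (auto intro: refl mult)
qed

definition tangent :: "S set \<Rightarrow> S \<Rightarrow> S \<Rightarrow> complex poly \<Rightarrow> bool" where
  "tangent M \<zeta> f p \<longleftrightarrow> (\<exists>g. f - pconst (coeff p 0) - pconst (coeff p 1) * \<zeta> - \<zeta> ^ 2 * g \<in> M)"

lemma tangent:
  assumes M: "pideal M"
  shows "tangent M \<zeta> (pconst c) [:c:]" "tangent M \<zeta> (pconst c + \<zeta>) [:c, 1:]"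
    "tangent M \<zeta> f p \<Longrightarrow> tangent M \<zeta> g q \<Longrightarrow> tangent M \<zeta> (f + g) (p + q)"
    "tangent M \<zeta> f p \<Longrightarrow> tangent M \<zeta> g q \<Longrightarrow> tangent M \<zeta> (f * g) (p * q)"
    "ptcong M f g \<Longrightarrow> tangent M \<zeta> g p \<Longrightarrow> tangent M \<zeta> f p"
proof -
  note C = ishomD[OF ishom_pconst[where 'v = var and 'k = complex]]
  show "tangent M \<zeta> (pconst c) [:c:]" unfolding tangent_def
    by (intro exI[of _ 0]) (simp add: pidealD[OF M] pconst_0)
  show "tangent M \<zeta> (pconst c + \<zeta>) [:c, 1:]" unfolding tangent_def
    by (intro exI[of _ 0]) (simp add: pidealD[OF M] pconst_1)
  show "tangent M \<zeta> f p \<Longrightarrow> tangent M \<zeta> g q \<Longrightarrow> tangent M \<zeta> (f + g) (p + q)"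
  proof -
    assume "tangent M \<zeta> f p" "tangent M \<zeta> g q"
    then obtain r s where r: "f - pconst (coeff p 0) - pconst (coeff p 1) * \<zeta> - \<zeta> ^ 2 * r \<in> M"
      and s: "g - pconst (coeff q 0) - pconst (coeff q 1) * \<zeta> - \<zeta> ^ 2 * s \<in> M" by (auto simp: tangent_def)
    have "f + g - pconst (coeff (p + q) 0) - pconst (coeff (p + q) 1) * \<zeta> - \<zeta> ^ 2 * (r + s) =
      (f - pconst (coeff p 0) - pconst (coeff p 1) * \<zeta> - \<zeta> ^ 2 * r) + (g - pconst (coeff q 0) - pconst (coeff q 1) * \<zeta> - \<zeta> ^ 2 * s)"
      by (simp add: C algebra_simps)
    then show ?thesis unfolding tangent_def using pidealD(2)[OF M r s] by (intro exI[of _ "r + s"]) (simp only:)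
  qed
  show "tangent M \<zeta> f p \<Longrightarrow> tangent M \<zeta> g q \<Longrightarrow> tangent M \<zeta> (f * g) (p * q)"
  proof -
    assume "tangent M \<zeta> f p" "tangent M \<zeta> g q"
    then obtain r s where r: "f - pconst (coeff p 0) - pconst (coeff p 1) * \<zeta> - \<zeta> ^ 2 * r \<in> M"
      and s: "g - pconst (coeff q 0) - pconst (coeff q 1) * \<zeta> - \<zeta> ^ 2 * s \<in> M" by (auto simp: tangent_def)
    define P0 P1 Q0 Q1 :: S where PQ: "P0 = pconst (coeff p 0)" "P1 = pconst (coeff p 1)" "Q0 = pconst (coeff q 0)" "Q1 = pconst (coeff q 1)"
    define w where "w = P1 * Q1 + P0 * s + Q0 * r + \<zeta> * (P1 * s + Q1 * r) + \<zeta> ^ 2 * r * s"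
    have "f * g - pconst (coeff (p * q) 0) - pconst (coeff (p * q) 1) * \<zeta> - \<zeta> ^ 2 * w =
      g * (f - P0 - P1 * \<zeta> - \<zeta> ^ 2 * r) + (P0 + P1 * \<zeta> + \<zeta> ^ 2 * r) * (g - Q0 - Q1 * \<zeta> - \<zeta> ^ 2 * s)"
      by (simp add: w_def PQ C coeff_mult_0_1 algebra_simps power2_eq_square)
    moreover have "\<dots> \<in> M" unfolding PQ by (rule pidealD(2)[OF M pidealD(3)[OF M r] pidealD(3)[OF M s]])
    ultimately show ?thesis unfolding tangent_def by (intro exI[of _ w]) (simp only:)
  qed
  show "ptcong M f g \<Longrightarrow> tangent M \<zeta> g p \<Longrightarrow> tangent M \<zeta> f p"
  proof -
    assume fg: "ptcong M f g" and "tangent M \<zeta> g p"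
    then obtain r where r: "g - pconst (coeff p 0) - pconst (coeff p 1) * \<zeta> - \<zeta> ^ 2 * r \<in> M" by (auto simp: tangent_def)
    have "f - pconst (coeff p 0) - pconst (coeff p 1) * \<zeta> - \<zeta> ^ 2 * r = (f - g) + (g - pconst (coeff p 0) - pconst (coeff p 1) * \<zeta> - \<zeta> ^ 2 * r)"
      by simp
    moreover have "\<dots> \<in> M" using fg r by (intro pidealD(2)[OF M]) (auto simp: ptcong_def)
    ultimately show ?thesis unfolding tangent_def by (intro exI[of _ r]) (simp only:)
  qed
qed

lemma tangent_power:
  assumes M: "pideal M" and f: "tangent M \<zeta> f p"
  shows "tangent M \<zeta> (f ^ n) (p ^ n)"
proof (induction n)
  case 0
  then show ?case using tangent(1)[OF M, of \<zeta> 1] by (simp add: pconst_1 one_pCons)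
next
  case (Suc n)
  then show ?case using tangent(4)[OF M f] by simp
qed

lemma tangent_linpart:
  assumes M: "pideal M" and v: "\<And>i. tangent M \<zeta> (pvar i) (\<gamma> i)"
  shows "tangent M \<zeta> f (linpart \<gamma> f)"
  by (induction f rule: mpoly_induct) (auto simp: linpart_simps v intro: tangent[OF M])

lemma linpart_power: "linpart \<gamma> (f ^ n) = linpart \<gamma> f ^ n"
  by (simp add: linpart_def psubst_simps ishom_const_poly)

lemma linpart_1: "linpart \<gamma> 1 = 1"
  by (simp add: linpart_def psubst_simps ishom_const_poly)

lemma c0_psubst: "(\<And>i. c0 (\<xi> i) = b i) \<Longrightarrow> c0 (psubst cst \<xi> f) = peval b f"
  using psubst_natural[OF ishom_c0 ishom_cst, of \<xi> f] by (simp add: peval_eq_psubst)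

theorem chart1_regular:
  assumes P: "whomogeneous weights 10 P"
    and a: "a = (\<lambda>i. peval a (chart1 i))" and F: "peval a (psubst pconst chart1 (rel11 \<theta> \<tau> P)) = 0"
    and J: "{j, i1, i2} = {Vx1, Vu0, Vz}" "j \<noteq> i1" "j \<noteq> i2" "i1 \<noteq> i2"
    and D: "coeff (linpart (line a j) (psubst pconst chart1 (rel11 \<theta> \<tau> P))) 1 \<noteq> 0"
  shows "regular_local_ring (proj_stalk weights (X'_ideal \<theta> \<tau> P) (worbit weights a))"
proof -
  let ?I = "X'_ideal \<theta> \<tau> P"
  have av: "a Vx0 = 1" "a Vy = a Vx1 ^ 3" "a Vw = a Vx1 ^ 5" "a Vu1 = a Vx1 * a Vu0" "a Vt = a Vu0 ^ 2"
    using fun_cong[OF a, of Vx0] fun_cong[OF a, of Vy] fun_cong[OF a, of Vw] fun_cong[OF a, of Vu1] fun_cong[OF a, of Vt]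
    by (simp_all add: chart1_def)
  have Fa: "peval a (rel11 \<theta> \<tau> P) = 0"
    using F psubst_compose[OF ishom_id, of a chart1 "rel11 \<theta> \<tau> P"] a by (simp flip: peval_eq_psubst)
  have va: "vanishing (\<lambda>x. x) a (relations \<theta> \<tau> P)"
    using Fa by (intro vanishing_chart1 ishom_id av) (simp add: peval_eq_psubst)
  interpret wproj_complex weights ?I a
    by unfold_locales (use hideal_X'[OF P] peval_vanish[OF va] in auto)
  obtain \<xi> where \<xi>: "\<xi> i1 = cst (a i1) + K_s" "\<xi> i2 = cst (a i2) + K_t" "\<And>i. c0 (\<xi> i) = a i"
    "psubst cst (\<lambda>i. psubst cst \<xi> (chart1 i)) (rel11 \<theta> \<tau> P) = 0"
    using chart_solution[OF F D J(2-4)] by blast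
  define \<chi> where "\<chi> i = psubst cst \<xi> (chart1 i)" for i
  have \<chi>v: "\<chi> Vx0 = 1" "\<chi> Vy = \<chi> Vx1 ^ 3" "\<chi> Vw = \<chi> Vx1 ^ 5" "\<chi> Vu1 = \<chi> Vx1 * \<chi> Vu0" "\<chi> Vt = \<chi> Vu0 ^ 2"
    by (simp_all add: \<chi>_def chart1_def psubst_simps ishom_cst)
  have "vanishing cst \<chi> (relations \<theta> \<tau> P)"
    using \<xi>(4) by (intro vanishing_chart1 ishom_cst \<chi>v) (simp add: \<chi>_def[abs_def])
  then have \<chi>I: "psubst cst \<chi> f = 0" if "f \<in> ?I" for f using vanishing_X'[OF ishom_cst] that by blast
  have \<chi>0: "c0 (\<chi> i) = a i" for i using c0_psubst[of \<xi> a "chart1 i"] \<xi>(3) fun_cong[OF a, of i] by (simp add: \<chi>_def)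
  have iv: "chart1 i1 = pvar i1" "chart1 i2 = pvar i2"
  proof -
    have "i1 \<in> {Vx1, Vu0, Vz}" "i2 \<in> {Vx1, Vu0, Vz}" using J(1) by auto
    then show "chart1 i1 = pvar i1" "chart1 i2 = pvar i2" by (auto simp: chart1_def)
  qed
  define A1 where "A1 i = pvar i - pconst (a i) * sx0 ^ weights i" for i :: var
  have hA: "hom (weights i) (A1 i)" for i unfolding A1_def
    by (rule whom_diff whom_pvar whom_mult' whom_power' whom_pconst | simp)+
  have hx: "hom (weights i) (sx0 ^ weights i)" for i by (rule whom_power' whom_pvar | simp)+
  have okA: "ok (A1 i) (sx0 ^ weights i)" for i using hA hx av by (auto simp: ok_def)
  have A0: "peval a (A1 i) = 0" for i by (simp add: A1_def av)
  have KA: "psubst cst \<chi> (A1 i) = \<chi> i - cst (a i)" for i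
    by (simp add: A1_def psubst_simps ishom_cst \<chi>v)
  have K1: "psubst cst \<chi> (A1 i1) = K_s" "psubst cst \<chi> (A1 i2) = K_t"
    unfolding KA \<chi>_def iv using \<xi> by (simp_all add: ishom_cst)
  have kd: "2 \<le> krull_dim A" "frac (A1 i2) (sx0 ^ weights i2) \<noteq> frac (A1 i1) (sx0 ^ weights i1)"
    using krull_dim_ge_2_if_curve_chain[OF \<chi>I \<chi>0 okA[of i2] okA[of i1]] by (simp_all add: K1 A0)
  let ?M = "local_set (A1 i2) (A1 i1) (sx0 - 1)"
  note M = local_set(1)[of "A1 i2" "A1 i1" "sx0 - 1"]
  note cong = ptcong[OF M]
  have IM: "f \<in> ?I \<Longrightarrow> f \<in> ?M" for f by (rule local_set(5))
  have x0: "ptcong ?M sx0 1" unfolding ptcong_def by (rule local_set(4))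
  have x0m: "ptcong ?M (sx0 * f) f" for f using cong(5)[OF x0 cong(1)[of f]] by simp
  have cA: "ptcong ?M (pvar i) (pconst (a i))" if "A1 i \<in> ?M" for i
  proof -
    have "ptcong ?M (pvar i) (pconst (a i) * sx0 ^ weights i)" using that by (simp add: ptcong_def A1_def)
    moreover have "ptcong ?M (pconst (a i) * sx0 ^ weights i) (pconst (a i) * 1 ^ weights i)" by (intro cong(1,5,6) x0)
    ultimately have "ptcong ?M (pvar i) (pconst (a i) * 1 ^ weights i)" by (rule cong(3))
    then show ?thesis by simp
  qed
  have ci: "ptcong ?M (pvar i1) (pconst (a i1))" "ptcong ?M (pvar i2) (pconst (a i2))"
    using cA local_set(2,3) by blast+
  have rel: "ptcong ?M f g" if "f - g \<in> ?I" for f g using IM[OF that] by (simp add: ptcong_def)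
  have cy: "ptcong ?M sy (sx1 ^ 3)"
    by (rule cong(3)[OF cong(2)[OF x0m] rel]) (rule X'_rel)
  have cw: "ptcong ?M sw (sx1 ^ 5)"
  proof -
    have "ptcong ?M sw (sx1 ^ 2 * sy)" by (rule cong(3)[OF cong(2)[OF x0m] rel]) (rule X'_rel)
    moreover have "ptcong ?M (sx1 ^ 2 * sy) (sx1 ^ 2 * sx1 ^ 3)" by (rule cong(5)[OF cong(1) cy])
    ultimately have "ptcong ?M sw (sx1 ^ 2 * sx1 ^ 3)" by (rule cong(3))
    then show ?thesis by (simp flip: power_add)
  qed
  have cu1: "ptcong ?M su1 (sx1 * su0)" by (rule cong(3)[OF cong(2)[OF x0m] rel]) (rule X'_rel)
  have ct: "ptcong ?M st (su0 ^ 2)" by (rule cong(3)[OF cong(2)[OF x0m] rel]) (rule X'_rel)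
  define \<zeta> where "\<zeta> = pvar j - pconst (a j)"
  have tj: "tangent ?M \<zeta> (pvar j) (line a j j)" using tangent(2)[OF M, of \<zeta> "a j"] by (simp add: \<zeta>_def line_def)
  have ti: "tangent ?M \<zeta> (pvar i1) (line a j i1)" "tangent ?M \<zeta> (pvar i2) (line a j i2)"
    using tangent(5)[OF M ci(1) tangent(1)[OF M]] tangent(5)[OF M ci(2) tangent(1)[OF M]] J by (auto simp: line_def)
  have t3: "tangent ?M \<zeta> (pvar i) (line a j i)" if "i \<in> {Vx1, Vu0, Vz}" for i
    using that tj ti unfolding J(1)[symmetric] by auto
  note t3' = t3[of Vx1, simplified] t3[of Vu0, simplified] t3[of Vz, simplified]
  note tp = tangent_power[OF M]
  have tall: "tangent ?M \<zeta> (pvar i) (linpart (line a j) (chart1 i))" for i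
  proof (cases i)
    case Vx0
    then show ?thesis using tangent(5)[OF M x0] tangent(1)[OF M, of \<zeta> 1] by (simp add: chart1_def linpart_1 pconst_1 one_pCons)
  next
    case Vy
    then show ?thesis using tangent(5)[OF M cy tp[OF t3'(1)]] by (simp add: chart1_def linpart_simps linpart_power)
  next
    case Vw
    then show ?thesis using tangent(5)[OF M cw tp[OF t3'(1)]] by (simp add: chart1_def linpart_simps linpart_power)
  next
    case Vu1
    then show ?thesis using tangent(5)[OF M cu1 tangent(4)[OF M t3'(1,2)]] by (simp add: chart1_def linpart_simps)
  next
    case Vt
    then show ?thesis using tangent(5)[OF M ct tp[OF t3'(2)]] by (simp add: chart1_def linpart_simps linpart_power)
  qed (use t3' in \<open>simp_all add: chart1_def linpart_simps\<close>)
  let ?p = "linpart (line a j) (psubst pconst chart1 (rel11 \<theta> \<tau> P))"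
  have "tangent ?M \<zeta> (rel11 \<theta> \<tau> P) ?p" unfolding linpart_compose by (rule tangent_linpart[OF M tall])
  then obtain g where g: "rel11 \<theta> \<tau> P - pconst (poly.coeff ?p 0) - pconst (poly.coeff ?p 1) * \<zeta> - \<zeta> ^ 2 * g \<in> ?M" by (auto simp: tangent_def)
  have "rel11 \<theta> \<tau> P \<in> ?M" unfolding rel11_def by (intro IM X'_rel)
  then have "rel11 \<theta> \<tau> P - (rel11 \<theta> \<tau> P - pconst (poly.coeff ?p 0) - pconst (poly.coeff ?p 1) * \<zeta> - \<zeta> ^ 2 * g) \<in> ?M"
    using g by (rule pidealD(6)[OF M])
  moreover have "rel11 \<theta> \<tau> P - (rel11 \<theta> \<tau> P - pconst (poly.coeff ?p 0) - pconst (poly.coeff ?p 1) * \<zeta> - \<zeta> ^ 2 * g) = (pconst (poly.coeff ?p 1) + \<zeta> * g) * \<zeta>"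
    unfolding coeff_linpart_line F by (simp add: pconst_0 algebra_simps power2_eq_square)
  ultimately have mm: "(pconst (poly.coeff ?p 1) + \<zeta> * g) * \<zeta> \<in> ?M" by (simp only:)
  have "peval a (pconst (poly.coeff ?p 1) + \<zeta> * g) \<noteq> 0" using D by (simp add: \<zeta>_def)
  then have "\<zeta> \<in> ?M" using mm by (rule local_set(6))
  then have cj: "ptcong ?M (pvar j) (pconst (a j))" by (simp add: ptcong_def \<zeta>_def)
  have c3: "ptcong ?M (pvar i) (pconst (a i))" if "i \<in> {Vx1, Vu0, Vz}" for i
    using that cj ci unfolding J(1)[symmetric] by auto
  note c3' = c3[of Vx1, simplified] c3[of Vu0, simplified] c3[of Vz, simplified]
  note C = ishomD[OF ishom_pconst[where 'v = var and 'k = complex]]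
  have "ptcong ?M (pvar i) (pconst (a i))" for i
  proof (cases i)
    case Vx0 then show ?thesis using x0 by (simp add: av pconst_1)
  next
    case Vy then show ?thesis using cong(3)[OF cy cong(6)[OF c3'(1)]] by (simp add: av C)
  next
    case Vw then show ?thesis using cong(3)[OF cw cong(6)[OF c3'(1)]] by (simp add: av C)
  next
    case Vu1 then show ?thesis using cong(3)[OF cu1 cong(5)[OF c3'(1,2)]] by (simp add: av C)
  next
    case Vt then show ?thesis using cong(3)[OF ct cong(6)[OF c3'(2)]] by (simp add: av C)
  qed (use c3' in simp_all)
  then have coord: "pvar i - pconst (a i) \<in> ?M" for i by (simp add: ptcong_def)
  show ?thesis
    by (rule regular_criterion[where k = 0 and ?e1.0 = sx0 and ?e2.0 = 1, OF hilbert_basis quadratic_growth_X'[OF P] kd(1) _ whom_1 _ _ okA okA A0 A0 kd(2) coord])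
      (use whom_pvar[of weights Vx0] in \<open>simp_all add: av\<close>)
qed

lemma worbit_scale:
  assumes "c \<noteq> (0::'k::field)"
  shows "worbit wt (\<lambda>i. c ^ wt i * a i) = worbit wt a"
proof -
  have 1: "(\<lambda>i. d ^ wt i * (c ^ wt i * a i)) = (\<lambda>i. (d * c) ^ wt i * a i)" for d by (simp add: power_mult_distrib mult.assoc)
  have 2: "(\<lambda>i. d ^ wt i * a i) = (\<lambda>i. (d / c) ^ wt i * (c ^ wt i * a i))" for d
    using assms by (auto simp: power_divide)
  show ?thesis
  proof (rule Set.set_eqI, rule iffI)
    fix x assume "x \<in> worbit wt (\<lambda>i. c ^ wt i * a i)"
    then obtain d where "d \<noteq> 0" "x = (\<lambda>i. (d * c) ^ wt i * a i)" unfolding worbit_def 1 by blast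
    then show "x \<in> worbit wt a" using assms unfolding worbit_def by (intro CollectI exI[of _ "d * c"]) simp
  next
    fix x assume "x \<in> worbit wt a"
    then obtain d where "d \<noteq> 0" "x = (\<lambda>i. d ^ wt i * a i)" unfolding worbit_def by blast
    then show "x \<in> worbit wt (\<lambda>i. c ^ wt i * a i)"
      using assms 2[of d] unfolding worbit_def by (intro CollectI exI[of _ "d / c"]) simp
  qed
qed

theorem chart2_regular:
  assumes P: "whomogeneous weights 10 P" and \<tau>: "\<tau> \<noteq> 0"
    and b: "b = (\<lambda>i. peval b (chart2 i))" "b Vy = 0" and F: "peval b (rel13 \<theta> \<tau> P) = 0"
  shows "regular_local_ring (proj_stalk weights (X'_ideal \<theta> \<tau> P) (worbit weights b))"
proof -
  let ?I = "X'_ideal \<theta> \<tau> P"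
  define u where "u = b Vu1"
  have bv: "b Vw = 1" "b Vx0 = 0" "b Vx1 = 0" "b Vu0 = 0" "b Vt = 0" "b Vy = 0" "b Vu1 = u"
    using fun_cong[OF b(1), of Vx0] fun_cong[OF b(1), of Vx1] fun_cong[OF b(1), of Vw] fun_cong[OF b(1), of Vu0] fun_cong[OF b(1), of Vt]
    by (simp_all add: chart2_def b(2) u_def)
  have rel: "\<theta> * u * b Vz + \<tau> + u ^ 3 = 0" using F by (simp add: rel13_def Qf_def bv)
  have u: "u \<noteq> 0" using rel \<tau> by auto
  define \<mu> where "\<mu> = 1 / u"
  have \<mu>: "\<mu> \<noteq> 0" "\<mu> * u = 1" using u by (auto simp: \<mu>_def)
  define a where "a = (\<lambda>i. \<mu> ^ weights i * b i)"
  define v where "v = \<mu> ^ 3"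
  have v: "v \<noteq> 0" "v * u ^ 3 = 1" using \<mu> by (auto simp: v_def simp flip: power_mult_distrib)
  have av: "a Vx0 = 0" "a Vx1 = 0" "a Vy = 0" "a Vu0 = 0" "a Vt = 0" "a Vw = v" "a Vu1 = v" "a Vz = \<mu> ^ 5 * b Vz"
    using \<mu> by (simp_all add: a_def bv v_def numeral_eq_Suc algebra_simps)
  have orbit: "worbit weights a = worbit weights b" unfolding a_def by (rule worbit_scale[OF \<mu>(1)])
  have vb: "vanishing (\<lambda>x. x) b (relations \<theta> \<tau> P)"
    using F by (intro vanishing_chart2 ishom_id) (simp_all add: peval_eq_psubst bv)
  have vscale: "vanishing h (\<lambda>i. c ^ weights i * \<xi> i) (relations \<theta> \<tau> P)" if "vanishing h \<xi> (relations \<theta> \<tau> P)"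
    for h :: "complex \<Rightarrow> 'r::comm_ring_1" and \<xi> c
    unfolding vanishing_def
  proof
    fix r assume r: "r \<in> relations \<theta> \<tau> P"
    then obtain e where "whomogeneous weights e r" using relations_homogeneous[OF P] by blast
    then show "psubst h (\<lambda>i. c ^ weights i * \<xi> i) r = 0" using that r by (simp add: psubst_scale vanishing_def)
  qed
  have va: "vanishing (\<lambda>x. x) a (relations \<theta> \<tau> P)" unfolding a_def by (rule vscale[OF vb])
  interpret wproj_complex weights ?I a
    by unfold_locales (use hideal_X'[OF P] peval_vanish[OF va] in auto)
  have Fb: "peval b (psubst pconst chart2 (rel13 \<theta> \<tau> P)) = 0"
    using F psubst_compose[OF ishom_id, of b chart2 "rel13 \<theta> \<tau> P"] b(1) by (simp flip: peval_eq_psubst)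
  define j where "j = (if \<theta> = 0 then Vu1 else Vz)"
  define i1 where "i1 = (if \<theta> = 0 then Vz else Vu1)"
  have ji: "j \<noteq> i1" "j \<noteq> Vy" "i1 \<noteq> Vy" by (auto simp: j_def i1_def)
  have D: "poly.coeff (linpart (line b j) (psubst pconst chart2 (rel13 \<theta> \<tau> P))) 1 \<noteq> 0"
  proof -
    have "psubst pconst chart2 (rel13 \<theta> \<tau> P) = sy * psubst pconst chart2 P + (pconst \<theta> * su1 * sz + pconst \<tau>) + su1 * su1 * su1"
      by (simp add: rel13_def Qf_def psubst_simps ishom_pconst chart2_def power3_eq_cube)
    then have "poly.coeff (linpart (line b j) (psubst pconst chart2 (rel13 \<theta> \<tau> P))) 1 = (if \<theta> = 0 then 3 * u ^ 2 else \<theta> * u)"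
      by (auto simp: linpart_simps coeff_mult_0_1 line_def j_def bv power2_eq_square)
    then show ?thesis using u by auto
  qed
  obtain \<xi> where \<xi>: "\<xi> i1 = cst (b i1) + K_s" "\<xi> Vy = cst (b Vy) + K_t" "\<And>i. c0 (\<xi> i) = b i"
    "psubst cst (\<lambda>i. psubst cst \<xi> (chart2 i)) (rel13 \<theta> \<tau> P) = 0"
    using chart_solution[OF Fb D ji(1,2,3)] by blast
  define \<omega> where "\<omega> i = psubst cst \<xi> (chart2 i)" for i
  have \<omega>v: "\<omega> Vw = 1" "\<omega> Vx0 = \<omega> Vy ^ 5" "\<omega> Vx1 = \<omega> Vy ^ 2" "\<omega> Vu0 = \<omega> Vy ^ 3 * \<omega> Vu1" "\<omega> Vt = \<omega> Vy * \<omega> Vu1 ^ 2"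
    "\<omega> Vy = K_t" "\<omega> Vu1 = \<xi> Vu1" "\<omega> Vz = \<xi> Vz"
    using \<xi>(2) by (simp_all add: \<omega>_def chart2_def psubst_simps ishom_cst bv)
  have F\<omega>: "psubst cst \<omega> (rel13 \<theta> \<tau> P) = 0" using \<xi>(4) by (simp add: \<omega>_def[abs_def])
  have "vanishing cst \<omega> (relations \<theta> \<tau> P)" using F\<omega> by (intro vanishing_chart2 ishom_cst \<omega>v(1-5))
  then have v\<omega>: "vanishing cst (\<lambda>i. cst \<mu> ^ weights i * \<omega> i) (relations \<theta> \<tau> P)" by (rule vscale)
  define \<chi> where "\<chi> i = cst \<mu> ^ weights i * \<omega> i" for i
  have \<chi>I: "psubst cst \<chi> f = 0" if "f \<in> ?I" for f using vanishing_X'[OF ishom_cst v\<omega> that] by (simp add: \<chi>_def[abs_def])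
  have \<omega>0: "c0 (\<omega> i) = b i" for i using c0_psubst[of \<xi> b "chart2 i"] \<xi>(3) fun_cong[OF b(1), of i] by (simp add: \<omega>_def)
  have \<chi>0: "c0 (\<chi> i) = a i" for i by (simp add: \<chi>_def a_def \<omega>0)
  have \<chi>hom: "psubst cst \<chi> f = cst (\<mu> ^ d) * psubst cst \<omega> f" if "hom d f" for d f
    using psubst_scale[OF that, of cst "cst \<mu>" \<omega>] by (simp add: \<chi>_def[abs_def] ishomD[OF ishom_cst])
  have cst0: "cst c \<noteq> 0" if "c \<noteq> 0" for c using that c0_cst[of c] by (metis c0_simps(1))
  define zz where "zz = a Vz"
  define B1 where "B1 = (if \<theta> = 0 then sz * sw ^ 5 - pconst zz * su1 ^ 5 else su1 ^ 3 - pconst (u ^ 3) * sw ^ 4)"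
  define B2 where "B2 = (if \<theta> = 0 then su1 ^ 5 else sw ^ 4)"
  define dB where "dB = (if \<theta> = 0 then 20 else 12 :: nat)"
  have hB: "hom dB B1" "hom dB B2"
    unfolding dB_def B1_def B2_def
    by (cases "\<theta> = 0"; simp only: if_True if_False simp_thms; (rule whom_diff whom_pvar whom_mult' whom_power' whom_pconst | simp)+)+
  have okB: "ok B1 B2" using hB v by (auto simp: ok_def B2_def av)
  have hA: "hom 6 (sy * su1)" "hom 6 (sw ^ 2)" by (rule whom_pvar whom_mult' whom_power' | simp)+
  have okA: "ok (sy * su1) (sw ^ 2)" unfolding ok_def using hA v by (auto simp: av)
  have B0: "peval a B1 = 0"
  proof -
    have "v ^ 3 = u ^ 3 * v ^ 4" using v(2) by (simp add: numeral_eq_Suc algebra_simps)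
    then show ?thesis by (simp add: B1_def av zz_def)
  qed
  have A0: "peval a (sy * su1) = 0" by (simp add: av)
  have nzu: "fps_nth (\<xi> Vu1) 0 \<noteq> 0" using \<xi>(3)[of Vu1] u by (auto simp: c0_def bv)
  have KA: "psubst cst \<chi> (sy * su1) \<noteq> 0" "fps_nth (psubst cst \<chi> (sy * su1)) 0 = 0"
  proof -
    have e: "psubst cst \<chi> (sy * su1) = cst (\<mu> ^ 6) * (K_t * \<xi> Vu1)"
      unfolding \<chi>hom[OF hA(1)] by (simp add: psubst_simps ishom_cst \<omega>v)
    have "\<xi> Vu1 \<noteq> 0" using nzu by auto
    then show "psubst cst \<chi> (sy * su1) \<noteq> 0" unfolding e using \<mu> cst0 by simp
    show "fps_nth (psubst cst \<chi> (sy * su1)) 0 = 0" unfolding e by simp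
  qed
  have zz: "zz = \<mu> ^ 5 * b Vz" by (simp add: zz_def av)
  have KB: "fps_nth (psubst cst \<chi> B1) 0 \<noteq> 0"
  proof -
    have "fps_nth (psubst cst \<omega> B1) 0 \<noteq> 0"
    proof (cases "\<theta> = 0")
      case True
      define U where "U = fps_nth (\<xi> Vu1) 0"
      have U0: "fps_nth U 0 = u" using \<xi>(3)[of Vu1] by (simp add: U_def c0_def bv)
      have "fps_nth (psubst cst \<omega> (rel13 \<theta> \<tau> P)) 0 = fps_const \<tau> + U ^ 3"
        by (simp add: rel13_def Qf_def psubst_simps ishom_cst \<omega>v True U_def cst_def power3_eq_cube)
      then have "fps_const \<tau> + U ^ 3 = 0" using F\<omega> by simp
      moreover have "fps_const \<tau> = - (fps_const u ^ 3)" using rel True by (simp add: fps_const_power eq_neg_iff_add_eq_0)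
      ultimately have "(U - fps_const u) * (U ^ 2 + U * fps_const u + fps_const u ^ 2) = 0"
        by (simp add: algebra_simps power2_eq_square power3_eq_cube)
      moreover have "U ^ 2 + U * fps_const u + fps_const u ^ 2 \<noteq> 0"
      proof
        assume z: "U ^ 2 + U * fps_const u + fps_const u ^ 2 = 0"
        have "3 * u ^ 2 = fps_nth (U * U + U * fps_const u + fps_const u * fps_const u) 0" by (simp add: U0 power2_eq_square)
        also have "\<dots> = 0" unfolding z[unfolded power2_eq_square] by simp
        finally show False using u by simp
      qed
      ultimately have Uu: "U = fps_const u" by simp
      have "fps_nth (psubst cst \<omega> B1) 0 = fps_const (b Vz) + fps_X - fps_const zz * U ^ 5"
        using \<xi>(1) True by (simp add: B1_def psubst_simps ishom_cst \<omega>v i1_def U_def cst_def numeral_eq_Suc)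
      also have "\<dots> = fps_X"
      proof -
        have "zz * u ^ 5 = b Vz * (\<mu> * u) ^ 5" by (simp add: zz power_mult_distrib)
        then have "zz * u ^ 5 = b Vz" using \<mu>(2) by simp
        then show ?thesis unfolding Uu by (simp add: fps_const_power)
      qed
      finally show ?thesis by simp
    next
      case False
      have e: "fps_nth (psubst cst \<omega> B1) 0 = (fps_const u + fps_X) ^ 3 - fps_const (u ^ 3)"
        using \<xi>(1) False by (simp add: B1_def psubst_simps ishom_cst \<omega>v i1_def cst_def bv power3_eq_cube)
      have "fps_nth ((fps_const u + fps_X) ^ 3 - fps_const (u ^ 3)) 1 = 3 * u ^ 2"
        by (simp add: power3_eq_cube power2_eq_square)
      then have "(fps_const u + fps_X) ^ 3 - fps_const (u ^ 3) \<noteq> 0" using u by (metis fps_zero_nth mult_eq_0_iff power_not_zero zero_neq_numeral)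
      then show ?thesis unfolding e .
    qed
    moreover have "fps_nth (psubst cst \<chi> B1) 0 = fps_const (\<mu> ^ dB) * fps_nth (psubst cst \<omega> B1) 0"
      unfolding \<chi>hom[OF hB(1)] by (simp add: cst_def)
    ultimately show ?thesis using \<mu> by simp
  qed
  have kd: "2 \<le> krull_dim A" "frac (sy * su1) (sw ^ 2) \<noteq> frac B1 B2"
    using krull_dim_ge_2_if_curve_chain[OF \<chi>I \<chi>0 okA okB KA B0 KB] by simp_all
  let ?M = "local_set (sy * su1) B1 (su1 - sw)"
  note M = local_set(1)[of "sy * su1" B1 "su1 - sw"]
  note cong = ptcong[OF M]
  note sat = local_set(6)[where ?A1.0 = "sy * su1" and ?B1.0 = B1 and e = "su1 - sw"]
  have IM: "f \<in> ?I \<Longrightarrow> f \<in> ?M" for f by (rule local_set(5))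
  have uw: "ptcong ?M su1 sw" unfolding ptcong_def by (rule local_set(4))
  have rel: "ptcong ?M f g" if "f - g \<in> ?I" for f g using IM[OF that] by (simp add: ptcong_def)
  have mem: "ptcong ?M f g \<Longrightarrow> g \<in> ?M \<Longrightarrow> f \<in> ?M" for f g
    using pidealD(2)[OF M, of "f - g" g] by (simp add: ptcong_def)
  have y: "sy \<in> ?M" by (rule sat[of su1]) (use local_set(2)[of "sy * su1"] v in \<open>simp_all add: av mult.commute\<close>)
  have x1: "sx1 \<in> ?M"
  proof (rule sat[of sw])
    show "sw * sx1 \<in> ?M" using mem[OF rel[OF X'_rel(3)]] pidealD(3)[OF M y, of sy] by (simp add: mult.commute power2_eq_square)
  qed (use v in \<open>simp add: av\<close>)
  have x0: "sx0 \<in> ?M"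
  proof (rule sat[of sw])
    show "sw * sx0 \<in> ?M" using mem[OF rel[OF X'_rel(2)]] pidealD(3)[OF M y, of "sx1 ^ 2"] by (simp add: mult.commute)
  qed (use v in \<open>simp add: av\<close>)
  have u0: "su0 \<in> ?M"
  proof (rule sat[of sw])
    show "sw * su0 \<in> ?M" using mem[OF cong(2)[OF rel[OF X'_rel(6)]]] pidealD(3)[OF M y, of "sx1 * su1"] by (simp add: mult_ac)
  qed (use v in \<open>simp add: av\<close>)
  have t: "st \<in> ?M"
  proof (rule sat[of sw])
    show "sw * st \<in> ?M" using mem[OF cong(2)[OF rel[OF X'_rel(10)]]] pidealD(3)[OF M y, of "su1 ^ 2"] by (simp add: mult_ac)
  qed (use v in \<open>simp add: av\<close>)
  note C = ishomD[OF ishom_pconst[where 'v = var and 'k = complex]]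
  have eq: "pconst \<theta> * sz + pconst \<tau> * sw ^ 2 + sw \<in> ?M"
  proof (rule sat[of "sw ^ 2"])
    have "sw * Qf \<theta> \<tau> + su1 ^ 3 = rel13 \<theta> \<tau> P - P * sy" by (simp add: rel13_def)
    also have "\<dots> \<in> ?M" unfolding rel13_def by (intro pidealD(3,6)[OF M] IM X'_rel y)
    finally have "sw * (pconst \<theta> * su1 * sz + pconst \<tau> * sw ^ 3) + su1 ^ 3 \<in> ?M" unfolding Qf_def .
    moreover have "ptcong ?M (sw * (pconst \<theta> * sw * sz + pconst \<tau> * sw ^ 3) + sw ^ 3) (sw * (pconst \<theta> * su1 * sz + pconst \<tau> * sw ^ 3) + su1 ^ 3)"
      by (intro cong(1,4,5,6) cong(2)[OF uw])
    ultimately have "sw * (pconst \<theta> * sw * sz + pconst \<tau> * sw ^ 3) + sw ^ 3 \<in> ?M" using mem by blast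
    then show "sw ^ 2 * (pconst \<theta> * sz + pconst \<tau> * sw ^ 2 + sw) \<in> ?M"
      by (simp add: algebra_simps power2_eq_square power3_eq_cube)
  qed (use v in \<open>simp add: av\<close>)
  have B: "B1 \<in> ?M" by (rule local_set(3))
  have rel': "\<theta> * zz + \<tau> * v ^ 2 + v = 0"
  proof -
    have "\<mu> ^ 6 * (\<theta> * u * b Vz + \<tau> + u ^ 3) = \<theta> * (\<mu> * u) * (\<mu> ^ 5 * b Vz) + \<tau> * (\<mu> ^ 3) ^ 2 + \<mu> ^ 3 * (\<mu> * u) ^ 3"
      by (simp add: algebra_simps power2_eq_square numeral_eq_Suc)
    then show ?thesis using \<open>\<theta> * u * b Vz + \<tau> + u ^ 3 = 0\<close> by (simp add: \<mu>(2) v_def zz)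
  qed
  have w: "ptcong ?M sw (pconst v)"
  proof (cases "\<theta> = 0")
    case True
    have "v * (\<tau> * v + 1) = \<theta> * zz + \<tau> * v ^ 2 + v" using True by (simp add: power2_eq_square algebra_simps)
    then have tv: "\<tau> * v = - 1" unfolding rel' using v(1) by (simp add: eq_neg_iff_add_eq_0)
    have "sw * (pconst \<tau> * sw + 1) \<in> ?M" using eq True by (simp add: pconst_0 algebra_simps power2_eq_square)
    then have "pconst \<tau> * sw + 1 \<in> ?M" using v by - (rule sat[of sw]; simp add: av)
    then have "- pconst v * (pconst \<tau> * sw + 1) \<in> ?M" by (rule pidealD(3)[OF M])
    moreover have "- pconst v * (pconst \<tau> * sw + 1) = sw - pconst v"
    proof -
      have "pconst v * pconst \<tau> = (- 1 :: S)" using arg_cong[OF tv, of "pconst :: complex \<Rightarrow> S"] by (simp add: C mult.commute)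
      then show ?thesis by (simp add: distrib_left flip: mult.assoc)
    qed
    ultimately show ?thesis by (simp add: ptcong_def)
  next
    case False
    have "su1 ^ 3 - pconst (u ^ 3) * sw ^ 4 \<in> ?M" using B False by (simp add: B1_def)
    then have "ptcong ?M (su1 ^ 3) (pconst (u ^ 3) * sw ^ 4)" by (simp add: ptcong_def)
    then have "ptcong ?M (sw ^ 3) (pconst (u ^ 3) * sw ^ 4)" by (rule cong(3)[OF cong(6)[OF cong(2)[OF uw]]])
    then have "sw ^ 3 * (1 - pconst (u ^ 3) * sw) \<in> ?M" by (simp add: ptcong_def algebra_simps numeral_eq_Suc)
    then have "1 - pconst (u ^ 3) * sw \<in> ?M" using v by - (rule sat[of "sw ^ 3"]; simp add: av)
    then have "- pconst v * (1 - pconst (u ^ 3) * sw) \<in> ?M" by (rule pidealD(3)[OF M])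
    moreover have "- pconst v * (1 - pconst (u ^ 3) * sw) = sw - pconst v"
    proof -
      have "pconst v * pconst (u ^ 3) = (1 :: S)" using arg_cong[OF v(2), of "pconst :: complex \<Rightarrow> S"] by (simp add: C)
      then show ?thesis by (simp add: right_diff_distrib flip: mult.assoc)
    qed
    ultimately show ?thesis by (simp add: ptcong_def)
  qed
  have z: "ptcong ?M sz (pconst zz)"
  proof (cases "\<theta> = 0")
    case True
    have "ptcong ?M (sz * sw ^ 5) (pconst zz * su1 ^ 5)" using B True by (simp add: B1_def ptcong_def)
    moreover have "ptcong ?M (pconst zz * su1 ^ 5) (pconst zz * sw ^ 5)" by (intro cong(1,5,6) uw)
    ultimately have "ptcong ?M (sz * sw ^ 5) (pconst zz * sw ^ 5)" by (rule cong(3))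
    then have "sw ^ 5 * (sz - pconst zz) \<in> ?M" by (simp add: ptcong_def algebra_simps)
    then show ?thesis unfolding ptcong_def using v by - (rule sat[of "sw ^ 5"]; simp add: av)
  next
    case False
    have "ptcong ?M (pconst \<theta> * sz + pconst \<tau> * pconst v ^ 2 + pconst v) (pconst \<theta> * sz + pconst \<tau> * sw ^ 2 + sw)"
      by (intro cong(1,4,5,6) cong(2)[OF w])
    then have m: "pconst \<theta> * sz + pconst \<tau> * pconst v ^ 2 + pconst v \<in> ?M" using eq mem by blast
    have e: "pconst \<tau> * pconst v ^ 2 + pconst v = (- (pconst \<theta> * pconst zz) :: S)"
    proof -
      have "\<tau> * v ^ 2 + v = - (\<theta> * zz)" using rel' by (simp add: eq_neg_iff_add_eq_0 algebra_simps)
      from arg_cong[OF this, of "pconst :: complex \<Rightarrow> S"] show ?thesis by (simp add: C)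
    qed
    have "pconst \<theta> * (sz - pconst zz) = pconst \<theta> * sz + (pconst \<tau> * pconst v ^ 2 + pconst v)" unfolding e by (simp add: algebra_simps)
    then have "pconst \<theta> * (sz - pconst zz) \<in> ?M" using m by (simp add: add.assoc)
    then show ?thesis unfolding ptcong_def using False by - (rule sat[of "pconst \<theta>"]; simp)
  qed
  have coord: "pvar i - pconst (a i) \<in> ?M" for i
    using x0 x1 y u0 t w z cong(3)[OF uw w] by (cases i) (simp_all add: av ptcong_def pconst_0 zz_def[symmetric] zz[symmetric])
  have "regular_local_ring A"
    by (rule regular_criterion[where k = 3 and ?e1.0 = su1 and ?e2.0 = sw, OF hilbert_basis quadratic_growth_X'[OF P] kd(1) _ _ _ _ okA okB A0 B0 kd(2) coord])
      (use whom_pvar[of weights Vu1] whom_pvar[of weights Vw] v in \<open>simp_all add: av\<close>)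
  then show ?thesis by (simp only: orbit)
qed

section \<open>The points of the surface\<close>

definition ptz :: "var \<Rightarrow> complex" where "ptz i = (if i = Vz then 1 else 0)"

lemma worbit_self: "a \<in> worbit wt (a :: 'v \<Rightarrow> 'k::field)"
  unfolding worbit_def by (intro CollectI exI[of _ 1]) simp

lemma points_X':
  assumes \<tau>: "\<tau> \<noteq> 0" and p: "p \<in> proj_points weights (X'_ideal \<theta> \<tau> P)"
  shows "\<exists>a. p = worbit weights a \<and>
    ((a = (\<lambda>i. peval a (chart1 i)) \<and> peval a (psubst pconst chart1 (rel11 \<theta> \<tau> P)) = 0) \<or>
     (a = (\<lambda>i. peval a (chart2 i)) \<and> a Vy = 0 \<and> peval a (rel13 \<theta> \<tau> P) = 0) \<or> a = ptz)"
proof -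
  obtain a0 where a0: "p = worbit weights a0" "a0 \<noteq> (\<lambda>_. 0)" using p by (auto simp: proj_points_def wps_points_def)
  have van: "peval b f = 0" if "b \<in> p" "f \<in> X'_ideal \<theta> \<tau> P" for b f using p that by (auto simp: proj_points_def)
  have scale: "worbit weights (\<lambda>i. c ^ weights i * a0 i) = p" "(\<lambda>i. c ^ weights i * a0 i) \<in> p" if "c \<noteq> 0" for c
    using worbit_scale[OF that, of weights a0] worbit_self[of "\<lambda>i. c ^ weights i * a0 i" weights] a0(1) by auto
  note R = X'_rel[where \<theta> = \<theta> and \<tau> = \<tau> and P = P]
  have r: "b Vx0 * b Vy = b Vx1 ^ 3" "b Vx0 * b Vw = b Vx1 ^ 2 * b Vy" "b Vx1 * b Vw = b Vy ^ 2" "b Vx0 * b Vu1 = b Vx1 * b Vu0"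
    "b Vx0 * b Vt = b Vu0 ^ 2" "peval b (rel11 \<theta> \<tau> P) = 0" "peval b (rel13 \<theta> \<tau> P) = 0"
    "b Vu0 * peval b P + b Vx1 * b Vu1 * peval b (Qf \<theta> \<tau>) + b Vt ^ 2 = 0" if "b \<in> p" for b
    using van[OF that R(1)] van[OF that R(2)] van[OF that R(3)] van[OF that R(4)] van[OF that R(7)] van[OF that R(11)]
      van[OF that R(13)] van[OF that R(14)] unfolding rel11_def rel13_def by simp_all
  have a0p: "a0 \<in> p" using a0 worbit_self by metis
  show ?thesis
  proof (cases "a0 Vx0 = 0")
    case False
    define a where "a i = (1 / a0 Vx0) ^ weights i * a0 i" for i
    have ap: "worbit weights a = p" "a \<in> p" using scale[of "1 / a0 Vx0"] False by (simp_all add: a_def[abs_def])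
    have x0: "a Vx0 = 1" using False by (simp add: a_def)
    note ra = r[OF ap(2)]
    have "a i = peval a (chart1 i)" for i
      using ra(1-5) x0 by (cases i) (simp_all add: chart1_def power_add[symmetric] mult.commute)
    then have e: "a = (\<lambda>i. peval a (chart1 i))" by (rule ext)
    have "peval a (psubst pconst chart1 (rel11 \<theta> \<tau> P)) = peval (\<lambda>i. peval a (chart1 i)) (rel11 \<theta> \<tau> P)"
      using psubst_compose[OF ishom_id, of a chart1 "rel11 \<theta> \<tau> P"] by (simp flip: peval_eq_psubst)
    then have "peval a (psubst pconst chart1 (rel11 \<theta> \<tau> P)) = 0" using ra(6) e by simp
    then show ?thesis using e ap(1) by blast
  next
    case x0: True
    note ra = r[OF a0p]
    have x1: "a0 Vx1 = 0" using ra(1) x0 by simp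
    have y: "a0 Vy = 0" using ra(3) x1 by simp
    have u0: "a0 Vu0 = 0" using ra(5) x0 by simp
    have t: "a0 Vt = 0" using ra(8) u0 x1 by simp
    show ?thesis
    proof (cases "a0 Vw = 0")
      case False
      obtain c where c: "c ^ 3 = 1 / a0 Vw" using nth_root_exists[of 3 "1 / a0 Vw"] by auto
      have c0: "c \<noteq> 0" using c False by auto
      define a where "a i = c ^ weights i * a0 i" for i
      have ap: "worbit weights a = p" "a \<in> p" using scale[OF c0] by (simp_all add: a_def[abs_def])
      have w: "a Vw = 1" using c False by (simp add: a_def)
      have z: "a Vx0 = 0" "a Vx1 = 0" "a Vy = 0" "a Vu0 = 0" "a Vt = 0" by (simp_all add: a_def x0 x1 y u0 t)
      have "a i = peval a (chart2 i)" for i by (cases i) (simp_all add: chart2_def w z)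
      then have "a = (\<lambda>i. peval a (chart2 i))" by (rule ext)
      then show ?thesis using ap(1) z(3) r(7)[OF ap(2)] by blast
    next
      case w: True
      have u1: "a0 Vu1 = 0" using ra(7) y w by (simp add: rel13_def)
      have z: "a0 Vz \<noteq> 0"
      proof
        assume z: "a0 Vz = 0"
        have "a0 i = 0" for i by (cases i) (simp_all add: x0 x1 y u0 t w u1 z)
        then show False using a0(2) by auto
      qed
      obtain c where c: "c ^ 5 = 1 / a0 Vz" using nth_root_exists[of 5 "1 / a0 Vz"] by auto
      have c0: "c \<noteq> 0" using c z by auto
      have "(\<lambda>i. c ^ weights i * a0 i) = ptz"
      proof
        fix i show "c ^ weights i * a0 i = ptz i" using c z by (cases i) (simp_all add: x0 x1 y u0 t w u1 ptz_def)
      qed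
      then show ?thesis using scale[OF c0] by metis
    qed
  qed
qed

section \<open>General parameters\<close>

definition vars_in :: "'v set \<Rightarrow> ('v, 'k::comm_ring_1) mpoly \<Rightarrow> bool" where
  "vars_in V f \<longleftrightarrow> (\<forall>m\<in>Poly_Mapping.keys f. Poly_Mapping.keys m \<subseteq> V)"

lemma vars_in_add: "vars_in V f \<Longrightarrow> vars_in V g \<Longrightarrow> vars_in V (f + g)"
  using keys_add[of f g] by (auto simp: vars_in_def)

lemma vars_in_mult:
  assumes "vars_in V f" "vars_in V g"
  shows "vars_in V (f * g)"
  unfolding vars_in_def
proof
  fix m assume "m \<in> Poly_Mapping.keys (f * g)"
  then obtain a b where ab: "m = a + b" "a \<in> Poly_Mapping.keys f" "b \<in> Poly_Mapping.keys g" using keys_mult[of f g] by auto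
  then have "Poly_Mapping.keys a \<subseteq> V" "Poly_Mapping.keys b \<subseteq> V" using assms by (auto simp: vars_in_def)
  then show "Poly_Mapping.keys m \<subseteq> V" using keys_add[of a b] ab(1) by blast
qed

lemma vars_in_pconst: "vars_in V (pconst c)" by (auto simp: vars_in_def pconst_def split: if_splits)

lemma vars_in_1: "vars_in V 1" using vars_in_pconst[of V 1] by (simp add: pconst_1)

lemma vars_in_0: "vars_in V 0" by (simp add: vars_in_def)

lemma vars_in_pvar: "i \<in> V \<Longrightarrow> vars_in V (pvar i)" by (auto simp: vars_in_def pvar_def)

lemma vars_in_uminus: "vars_in V f \<Longrightarrow> vars_in V (- f)" by (auto simp: vars_in_def in_keys_iff)

lemma vars_in_sum: "(\<And>i. i \<in> A \<Longrightarrow> vars_in V (f i)) \<Longrightarrow> vars_in V (sum f A)"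
  by (induction A rule: infinite_finite_induct) (auto simp: vars_in_0 vars_in_add)

lemma vars_in_psubst: "(\<And>i. vars_in V (g i)) \<Longrightarrow> vars_in V (psubst pconst g f)"
  by (induction f rule: mpoly_induct) (auto simp: psubst_add psubst_mult ishom_pconst vars_in_add vars_in_mult vars_in_pconst)

lemma ex_partial_derivative: "\<exists>g. \<forall>a. coeff (linpart (line a j) f) 1 = peval a g"
proof (induction f rule: mpoly_induct)
  case (const c)
  then show ?case by (intro exI[of _ 0]) (simp add: linpart_simps)
next
  case (var i)
  then show ?case by (intro exI[of _ "if i = j then 1 else 0"]) (simp add: linpart_simps line_def)
next
  case (add f g)
  then obtain f' g' where "\<forall>a. coeff (linpart (line a j) f) 1 = peval a f'" "\<forall>a. coeff (linpart (line a j) g) 1 = peval a g'" by blast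
  then show ?case by (intro exI[of _ "f' + g'"]) (simp add: linpart_simps)
next
  case (mult f g)
  then obtain f' g' where "\<forall>a. coeff (linpart (line a j) f) 1 = peval a f'" "\<forall>a. coeff (linpart (line a j) g) 1 = peval a g'" by blast
  then show ?case by (intro exI[of _ "f * g' + f' * g"]) (simp add: linpart_simps coeff_mult_0_1 coeff_linpart_line)
qed

definition pd :: "'v \<Rightarrow> ('v, complex) mpoly \<Rightarrow> ('v, complex) mpoly" where
  "pd j f = (SOME g. \<forall>a. coeff (linpart (line a j) f) 1 = peval a g)"

lemma peval_pd: "peval a (pd j f) = coeff (linpart (line a j) f) 1"
proof -
  have "\<forall>a. coeff (linpart (line a j) f) 1 = peval a (pd j f)"
    unfolding pd_def by (rule someI_ex[OF ex_partial_derivative])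
  then show ?thesis by simp
qed

definition Mon10 :: "(var \<Rightarrow>\<^sub>0 nat) set" where "Mon10 = {m. wdegree weights m = 10}"

lemma finite_Mon10: "finite Mon10"
proof (rule finite_subset)
  show "Mon10 \<subseteq> box UNIV 10"
  proof
    fix m assume "m \<in> Mon10"
    then have m: "wdegree weights m = 10" by (simp add: Mon10_def)
    have "Poly_Mapping.lookup m i \<le> 10" for i
    proof -
      have "1 \<le> weights i" by (cases i) auto
      then have "Poly_Mapping.lookup m i \<le> weights i * Poly_Mapping.lookup m i" by simp
      also have "\<dots> \<le> (\<Sum>i\<in>UNIV. weights i * Poly_Mapping.lookup m i)"
        using finite_var by (intro member_le_sum) auto
      also have "\<dots> = 10" using m wdegree_superset[of UNIV m weights] finite_var by simp
      finally show ?thesis .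
    qed
    then show "m \<in> box UNIV 10" by (simp add: box_def)
  qed
  show "finite (box (UNIV :: var set) 10)" using box_card finite_var by blast
qed

definition mz2 where "mz2 = Poly_Mapping.single Vz (2::nat)"
definition mon1 where "mon1 = Poly_Mapping.single Vx0 (10::nat)"
definition mon2 where "mon2 = Poly_Mapping.single Vx0 (9::nat) + Poly_Mapping.single Vx1 1"
definition mon3 where "mon3 = Poly_Mapping.single Vx0 (6::nat) + Poly_Mapping.single Vu0 1"
definition mon4 where "mon4 = Poly_Mapping.single Vx0 (5::nat) + Poly_Mapping.single Vz 1"

lemma mons:
  "mz2 \<in> Mon10" "mon1 \<in> Mon10" "mon2 \<in> Mon10" "mon3 \<in> Mon10" "mon4 \<in> Mon10" "distinct [mz2, mon1, mon2, mon3, mon4]"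
proof -
  show "mz2 \<in> Mon10" "mon1 \<in> Mon10" "mon2 \<in> Mon10" "mon3 \<in> Mon10" "mon4 \<in> Mon10"
    by (simp_all add: Mon10_def mz2_def mon1_def mon2_def mon3_def mon4_def wdegree_add)
  have "distinct (map (\<lambda>m. Poly_Mapping.lookup m Vx0) [mz2, mon1, mon2, mon3, mon4])"
    by (simp add: mz2_def mon1_def mon2_def mon3_def mon4_def lookup_add lookup_single)
  then show "distinct [mz2, mon1, mon2, mon3, mon4]" unfolding distinct_map by (rule conjunct1)
qed

lemma whom_10_sum:
  assumes "whomogeneous weights 10 P"
  shows "P = (\<Sum>m\<in>Mon10. pconst (Poly_Mapping.lookup P m) * Poly_Mapping.single m (1::complex))"
proof -
  have "P = (\<Sum>m\<in>Poly_Mapping.keys P. Poly_Mapping.single m (Poly_Mapping.lookup P m))"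
    by (rule poly_mapping_eq_sum_single)
  also have "\<dots> = (\<Sum>m\<in>Mon10. Poly_Mapping.single m (Poly_Mapping.lookup P m))"
    using assms finite_Mon10 by (intro sum.mono_neutral_left) (auto simp: whomogeneous_def Mon10_def in_keys_iff)
  finally show ?thesis by (simp add: pconst_def mult_single)
qed

text \<open>
  The equations \<open>F = F_x = F_u = F_z = 0\<close> for a singular point of the chart can be solved for the
  coefficients of the monomials \<open>mon1, mon2, mon3, mon4\<close>.  So the parameters of singular charts
  are parametrized by the other coefficients and the point, which is one parameter less than the dimension of
  the parameter space; in this parametrization the coordinates \<open>Coeff mon2\<close>, \<open>Coeff mon3\<close>,
  \<open>Coeff mon4\<close> are reused for the coordinates of the point.
\<close>

definition pcoords :: "coord set" where "pcoords = insert Tau (Coeff ` (Mon10 - {mz2}))"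

definition pbase :: "var \<Rightarrow> (coord, complex) mpoly" where
  "pbase i = (if i = Vx1 then pvar (Coeff mon2) else if i = Vu0 then pvar (Coeff mon3) else if i = Vz then pvar (Coeff mon4) else 0)"

definition lift :: "S \<Rightarrow> (coord, complex) mpoly" where
  "lift f = psubst pconst (\<lambda>i. psubst pconst pbase (chart1 i)) f"

definition pcoeff :: "(var \<Rightarrow>\<^sub>0 nat) \<Rightarrow> (coord, complex) mpoly" where
  "pcoeff m = (if m = mz2 then 1 else pvar (Coeff m))"

definition plin :: "complex \<Rightarrow> (S \<Rightarrow> S) \<Rightarrow> (coord, complex) mpoly" where
  "plin \<theta> L = lift (L (sx1 ^ 2 * (pconst \<theta> * su1 * sz) + su0 * st)) + pvar Tau * lift (L (sx1 ^ 2 * sw ^ 3)) +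
    (\<Sum>m\<in>Mon10 - {mon1, mon2, mon3, mon4}. pcoeff m * lift (L (Poly_Mapping.single m 1)))"

definition d0 :: "S \<Rightarrow> S" where "d0 f = psubst pconst chart1 f"
definition d1 :: "var \<Rightarrow> S \<Rightarrow> S" where "d1 j f = pd j (psubst pconst chart1 f)"

definition pparam :: "complex \<Rightarrow> coord \<Rightarrow> (coord, complex) mpoly" where
  "pparam \<theta> k =
    (if k = Coeff mon1 then - (plin \<theta> d0 - plin \<theta> (d1 Vx1) * pvar (Coeff mon2) - plin \<theta> (d1 Vu0) * pvar (Coeff mon3) - plin \<theta> (d1 Vz) * pvar (Coeff mon4))
     else if k = Coeff mon2 then - plin \<theta> (d1 Vx1) else if k = Coeff mon3 then - plin \<theta> (d1 Vu0)
     else if k = Coeff mon4 then - plin \<theta> (d1 Vz) else pvar k)"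

definition linear_at :: "(var \<Rightarrow> complex) \<Rightarrow> (S \<Rightarrow> S) \<Rightarrow> bool" where
  "linear_at a L \<longleftrightarrow> (\<forall>f g. peval a (L (f + g)) = peval a (L f) + peval a (L g)) \<and> (\<forall>c f. peval a (L (pconst c * f)) = c * peval a (L f))"

lemma linear_at_sum:
  assumes "linear_at a L"
  shows "peval a (L (sum f A)) = (\<Sum>i\<in>A. peval a (L (f i)))"
proof -
  have "peval a (L (pconst 0 * 0)) = 0 * peval a (L 0)" using assms unfolding linear_at_def by blast
  then have 0: "peval a (L 0) = 0" by simp
  show ?thesis using assms by (induction A rule: infinite_finite_induct) (auto simp: 0 linear_at_def)
qed

lemma linear_d: "linear_at a d0" "linear_at a (d1 j)"
  by (auto simp: linear_at_def d0_def d1_def peval_pd psubst_simps psubst_pconst ishom_pconst linpart_simps)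

lemma plin_eval:
  assumes L: "linear_at a L" and P: "(P, \<tau>) \<in> parameter_space"
    and a: "a = (\<lambda>i. peval a (chart1 i))"
    and \<rho>: "\<And>k. k \<notin> {Coeff mon2, Coeff mon3, Coeff mon4} \<Longrightarrow> \<rho> k = coord_value (P, \<tau>) k"
      "\<rho> (Coeff mon2) = a Vx1" "\<rho> (Coeff mon3) = a Vu0" "\<rho> (Coeff mon4) = a Vz"
  shows "peval a (L (P + sx1 ^ 2 * Qf \<theta> \<tau> + su0 * st)) = peval \<rho> (plin \<theta> L) +
    (\<Sum>m\<in>{mon1, mon2, mon3, mon4}. Poly_Mapping.lookup P m * peval a (L (Poly_Mapping.single m 1)))"
proof -
  have h: "whomogeneous weights 10 P" "Poly_Mapping.lookup P mz2 = 1" using P by (auto simp: parameter_space_def mz2_def)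
  have base: "peval \<rho> (psubst pconst pbase (chart1 i)) = a i" for i
  proof -
    have "peval \<rho> (psubst pconst pbase (chart1 i)) = peval a (chart1 i)"
      by (cases i) (simp_all add: chart1_def psubst_simps ishom_pconst pbase_def \<rho>)
    then show ?thesis using fun_cong[OF a, of i] by simp
  qed
  have lft: "peval \<rho> (lift f) = peval a f" for f
  proof -
    have "peval \<rho> (lift f) = psubst (\<lambda>x. peval \<rho> (pconst x)) (\<lambda>i. peval \<rho> (psubst pconst pbase (chart1 i))) f"
      unfolding lift_def by (rule psubst_natural[OF ishom_peval ishom_pconst])
    then show ?thesis by (simp add: base peval_eq_psubst[of a])
  qed
  have Lsum: "peval a (L P) = (\<Sum>m\<in>Mon10. Poly_Mapping.lookup P m * peval a (L (Poly_Mapping.single m 1)))"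
  proof -
    have "peval a (L P) = peval a (L (\<Sum>m\<in>Mon10. pconst (Poly_Mapping.lookup P m) * Poly_Mapping.single m 1))"
      using whom_10_sum[OF h(1)] by simp
    also have "\<dots> = (\<Sum>m\<in>Mon10. peval a (L (pconst (Poly_Mapping.lookup P m) * Poly_Mapping.single m 1)))"
      by (rule linear_at_sum[OF L])
    finally show ?thesis using L by (simp add: linear_at_def)
  qed
  have "sx1 ^ 2 * Qf \<theta> \<tau> = sx1 ^ 2 * (pconst \<theta> * su1 * sz) + pconst \<tau> * (sx1 ^ 2 * sw ^ 3)"
    by (simp add: Qf_def algebra_simps)
  then have "P + sx1 ^ 2 * Qf \<theta> \<tau> + su0 * st = P + ((sx1 ^ 2 * (pconst \<theta> * su1 * sz) + su0 * st) + pconst \<tau> * (sx1 ^ 2 * sw ^ 3))"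
    by (simp add: algebra_simps)
  then have 1: "peval a (L (P + sx1 ^ 2 * Qf \<theta> \<tau> + su0 * st)) = peval a (L P) +
     (peval a (L (sx1 ^ 2 * (pconst \<theta> * su1 * sz) + su0 * st)) + \<tau> * peval a (L (sx1 ^ 2 * sw ^ 3)))"
    using L unfolding linear_at_def by (simp only:)
  have "Mon10 = (Mon10 - {mon1, mon2, mon3, mon4}) \<union> {mon1, mon2, mon3, mon4}" using mons by blast
  then have 2: "peval a (L P) = (\<Sum>m\<in>Mon10 - {mon1, mon2, mon3, mon4}. Poly_Mapping.lookup P m * peval a (L (Poly_Mapping.single m 1))) +
     (\<Sum>m\<in>{mon1, mon2, mon3, mon4}. Poly_Mapping.lookup P m * peval a (L (Poly_Mapping.single m 1)))"
    unfolding Lsum using finite_Mon10 by (subst sum.union_disjoint[symmetric]) auto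
  have 3: "peval \<rho> (pcoeff m) = Poly_Mapping.lookup P m" if "m \<in> Mon10 - {mon1, mon2, mon3, mon4}" for m
    using that h(2) \<rho>(1)[of "Coeff m"] by (auto simp: pcoeff_def)
  have 4: "\<rho> Tau = \<tau>" using \<rho>(1)[of Tau] by simp
  show ?thesis unfolding 1 2 plin_def by (simp add: lft 3 4)
qed

definition bad :: "complex \<Rightarrow> complex \<Rightarrow> S \<Rightarrow> bool" where
  "bad \<theta> \<tau> P \<longleftrightarrow> (\<exists>a. a = (\<lambda>i. peval a (chart1 i)) \<and> peval a (psubst pconst chart1 (rel11 \<theta> \<tau> P)) = 0 \<and>
     (\<forall>j\<in>{Vx1, Vu0, Vz}. coeff (linpart (line a j) (psubst pconst chart1 (rel11 \<theta> \<tau> P))) 1 = 0))"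

lemma chart1_mons:
  "psubst pconst chart1 (Poly_Mapping.single mon1 1) = 1" "psubst pconst chart1 (Poly_Mapping.single mon2 1) = sx1"
  "psubst pconst chart1 (Poly_Mapping.single mon3 1) = su0" "psubst pconst chart1 (Poly_Mapping.single mon4 1) = sz"
  by (simp_all add: psubst_single ishom_pconst pconst_1 mon1_def mon2_def mon3_def mon4_def meval_add chart1_def)

lemma bad_parametrized:
  assumes P: "(P, \<tau>) \<in> parameter_space" and b: "bad \<theta> \<tau> P"
  shows "\<exists>\<rho>. \<forall>k\<in>pcoords. coord_value (P, \<tau>) k = peval \<rho> (pparam \<theta> k)"
proof -
  obtain a where a: "a = (\<lambda>i. peval a (chart1 i))" "peval a (psubst pconst chart1 (rel11 \<theta> \<tau> P)) = 0"
    "\<And>j. j \<in> {Vx1, Vu0, Vz} \<Longrightarrow> coeff (linpart (line a j) (psubst pconst chart1 (rel11 \<theta> \<tau> P))) 1 = 0"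
    using b unfolding bad_def by blast
  define \<rho> where "\<rho> k = (if k = Coeff mon2 then a Vx1 else if k = Coeff mon3 then a Vu0 else if k = Coeff mon4 then a Vz else coord_value (P, \<tau>) k)" for k
  have \<rho>: "\<And>k. k \<notin> {Coeff mon2, Coeff mon3, Coeff mon4} \<Longrightarrow> \<rho> k = coord_value (P, \<tau>) k"
      "\<rho> (Coeff mon2) = a Vx1" "\<rho> (Coeff mon3) = a Vu0" "\<rho> (Coeff mon4) = a Vz"
    using mons(6) by (auto simp: \<rho>_def)
  let ?G = "P + sx1 ^ 2 * Qf \<theta> \<tau> + su0 * st"
  let ?l = "Poly_Mapping.lookup P"
  have G: "psubst pconst chart1 (rel11 \<theta> \<tau> P) = psubst pconst chart1 ?G"
    by (simp add: rel11_def psubst_simps ishom_pconst chart1_def)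
  note ev = plin_eval[OF _ P a(1) \<rho>]
  have s4: "(\<Sum>m\<in>{mon1, mon2, mon3, mon4}. f m) = f mon1 + f mon2 + f mon3 + f mon4" for f :: "_ \<Rightarrow> complex"
    using mons(6) by (auto simp: add.assoc)
  have e0: "peval \<rho> (plin \<theta> d0) + (?l mon1 + ?l mon2 * a Vx1 + ?l mon3 * a Vu0 + ?l mon4 * a Vz) = 0"
    using ev[OF linear_d(1), of \<theta>] a(2) unfolding s4 G by (simp add: d0_def chart1_mons)
  have pdv: "peval a (pd j (pvar i)) = (if i = j then 1 else 0)" "peval a (pd j 1) = 0" for i j
    by (simp_all add: peval_pd linpart_simps line_def linpart_1)
  have e1: "peval \<rho> (plin \<theta> (d1 j)) + (?l mon2 * (if Vx1 = j then 1 else 0) + ?l mon3 * (if Vu0 = j then 1 else 0) + ?l mon4 * (if Vz = j then 1 else 0)) = 0"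
    if "j \<in> {Vx1, Vu0, Vz}" for j
  proof -
    have z: "peval a (d1 j ?G) = 0" using a(3)[OF that] unfolding G by (simp add: d1_def peval_pd)
    have v: "peval a (d1 j (Poly_Mapping.single mon1 1)) = 0" "peval a (d1 j (Poly_Mapping.single mon2 1)) = (if Vx1 = j then 1 else 0)"
      "peval a (d1 j (Poly_Mapping.single mon3 1)) = (if Vu0 = j then 1 else 0)" "peval a (d1 j (Poly_Mapping.single mon4 1)) = (if Vz = j then 1 else 0)"
      unfolding d1_def chart1_mons by (simp_all only: pdv)
    show ?thesis using ev[OF linear_d(2)[of a j], of \<theta>] unfolding s4 z v by simp
  qed
  have l2: "?l mon2 = - peval \<rho> (plin \<theta> (d1 Vx1))" using e1[of Vx1] by (simp add: eq_neg_iff_add_eq_0 add.commute)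
  have l3: "?l mon3 = - peval \<rho> (plin \<theta> (d1 Vu0))" using e1[of Vu0] by (simp add: eq_neg_iff_add_eq_0 add.commute)
  have l4: "?l mon4 = - peval \<rho> (plin \<theta> (d1 Vz))" using e1[of Vz] by (simp add: eq_neg_iff_add_eq_0 add.commute)
  have l1: "?l mon1 = peval \<rho> (pparam \<theta> (Coeff mon1))"
    using e0 unfolding l2 l3 l4 by (simp add: pparam_def \<rho>(2-4) algebra_simps eq_neg_iff_add_eq_0)
  have "coord_value (P, \<tau>) k = peval \<rho> (pparam \<theta> k)" for k
  proof (cases "k \<in> {Coeff mon1, Coeff mon2, Coeff mon3, Coeff mon4}")
    case True
    then show ?thesis using l1 l2 l3 l4 mons(6) by (auto simp: pparam_def)
  next
    case False
    then show ?thesis using \<rho>(1)[of k] by (simp add: pparam_def)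
  qed
  then show ?thesis by blast
qed

lemma pcoords: "finite pcoords" "Coeff mon1 \<in> pcoords" "Coeff mon2 \<in> pcoords" "Coeff mon3 \<in> pcoords" "Coeff mon4 \<in> pcoords" "Tau \<in> pcoords"
proof -
  have c: "Coeff m \<in> pcoords" if "m \<in> Mon10" "m \<noteq> mz2" for m unfolding pcoords_def using that by blast
  show "Coeff mon1 \<in> pcoords" "Coeff mon2 \<in> pcoords" "Coeff mon3 \<in> pcoords" "Coeff mon4 \<in> pcoords"
    using mons(6) by (intro c mons; auto)+
qed (use finite_Mon10 in \<open>simp_all add: pcoords_def\<close>)

lemma pparam_vars:
  assumes "k \<in> pcoords"
  shows "vars_in (pcoords - {Coeff mon1}) (pparam \<theta> k)"
proof -
  let ?V = "pcoords - {Coeff mon1}"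
  have c: "Coeff mon2 \<in> ?V" "Coeff mon3 \<in> ?V" "Coeff mon4 \<in> ?V" "Tau \<in> ?V" using pcoords mons(6) by auto
  have b: "vars_in ?V (pbase i)" for i using c by (auto simp: pbase_def vars_in_pvar vars_in_0)
  have l: "vars_in ?V (lift f)" for f unfolding lift_def by (intro vars_in_psubst b)
  have pc: "vars_in ?V (pcoeff m)" if "m \<in> Mon10 - {mon1, mon2, mon3, mon4}" for m
    using that by (auto simp: pcoeff_def vars_in_1 pcoords_def intro!: vars_in_pvar)
  have pl: "vars_in ?V (plin \<theta> L)" for L
    unfolding plin_def by (intro vars_in_add vars_in_mult vars_in_sum l pc vars_in_pvar c)
  have df: "vars_in ?V (f - g)" if "vars_in ?V f" "vars_in ?V g" for f g :: "(coord, complex) mpoly"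
    using vars_in_add[OF that(1) vars_in_uminus[OF that(2)]] by simp
  show ?thesis unfolding pparam_def
    using assms c by (auto intro!: df vars_in_add vars_in_mult vars_in_uminus pl vars_in_pvar)
qed

theorem ex_discriminant:
  "\<exists>D :: (coord, complex) mpoly. D \<noteq> 0 \<and> vars_in pcoords D \<and>
    (\<forall>P \<tau>. (P, \<tau>) \<in> parameter_space \<longrightarrow> bad \<theta> \<tau> P \<longrightarrow> peval (coord_value (P, \<tau>)) D = 0)"
proof -
  have "card (pcoords - {Coeff mon1}) < card pcoords" by (rule card_Diff1_less) (use pcoords in auto)
  then obtain D :: "(coord, complex) mpoly" where D: "D \<noteq> 0" "\<forall>m\<in>Poly_Mapping.keys D. Poly_Mapping.keys m \<subseteq> pcoords"
    "psubst pconst (pparam \<theta>) D = 0"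
    using algebraic_dependence[of "pcoords - {Coeff mon1}" pcoords "pparam \<theta>"] pcoords(1) pparam_vars[of _ \<theta>]
    unfolding vars_in_def by blast
  have "peval (coord_value (P, \<tau>)) D = 0" if P: "(P, \<tau>) \<in> parameter_space" "bad \<theta> \<tau> P" for P \<tau>
  proof -
    obtain \<rho> where \<rho>: "\<And>k. k \<in> pcoords \<Longrightarrow> coord_value (P, \<tau>) k = peval \<rho> (pparam \<theta> k)"
      using bad_parametrized[OF P] by blast
    have "peval (coord_value (P, \<tau>)) D = peval (\<lambda>k. peval \<rho> (pparam \<theta> k)) D"
      unfolding peval_eq_psubst[of "coord_value (P, \<tau>)"] peval_eq_psubst[of "\<lambda>k. peval \<rho> (pparam \<theta> k)"] psubst_def
    proof (intro sum.cong refl)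
      fix m assume "m \<in> Poly_Mapping.keys D"
      then have "Poly_Mapping.keys m \<subseteq> pcoords" using D(2) by blast
      then have "meval (coord_value (P, \<tau>)) m = meval (\<lambda>k. peval \<rho> (pparam \<theta> k)) m" using \<rho> by (intro meval_cong) blast
      then show "Poly_Mapping.lookup D m * meval (coord_value (P, \<tau>)) m = Poly_Mapping.lookup D m * meval (\<lambda>k. peval \<rho> (pparam \<theta> k)) m" by simp
    qed
    also have "\<dots> = peval \<rho> (psubst pconst (pparam \<theta>) D)"
      using psubst_compose[OF ishom_id, of \<rho> "pparam \<theta>" D] by (simp flip: peval_eq_psubst)
    finally show ?thesis using D(3) by simp
  qed
  then show ?thesis using D unfolding vars_in_def by blast
qed

theorem general_parameters:
  "\<exists>U. zariski_open U \<and> U \<noteq> {} \<and> (\<forall>(P, \<tau>)\<in>U. (P, \<tau>) \<in> parameter_space \<and> \<tau> \<noteq> 0 \<and> \<not> bad \<theta> \<tau> P)"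
proof -
  obtain D :: "(coord, complex) mpoly" where D: "D \<noteq> 0" "vars_in pcoords D"
    "\<And>P \<tau>. (P, \<tau>) \<in> parameter_space \<Longrightarrow> bad \<theta> \<tau> P \<Longrightarrow> peval (coord_value (P, \<tau>)) D = 0"
    using ex_discriminant[of \<theta>] by blast
  define E where "E = pvar Tau * D"
  obtain m where m: "Poly_Mapping.lookup D m \<noteq> 0" using D(1) by (metis all_not_in_conv in_keys_iff keys_eq_empty)
  have "Poly_Mapping.lookup E (Poly_Mapping.single Tau 1 + m) \<noteq> 0"
    unfolding E_def pvar_def lookup_single_mult using m by simp
  then have E0: "E \<noteq> 0" by auto
  have Ev: "vars_in pcoords E" unfolding E_def using pcoords D(2) by (intro vars_in_mult vars_in_pvar)
  then obtain \<rho> where \<rho>: "peval \<rho> E \<noteq> 0" using exists_nonroot[OF pcoords(1) E0] by (auto simp: vars_in_def)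
  define U where "U = {q \<in> parameter_space. \<exists>g\<in>{E}. peval (coord_value q) g \<noteq> 0}"
  have "zariski_open U" unfolding zariski_open_def U_def by blast
  moreover have "U \<noteq> {}"
  proof -
    define c where "c m = (if m = mz2 then 1 else \<rho> (Coeff m))" for m
    define P :: S where "P = (\<Sum>m\<in>Mon10. Poly_Mapping.single m (c m))"
    have lk: "Poly_Mapping.lookup P m = (if m \<in> Mon10 then c m else 0)" for m
    proof -
      have "Poly_Mapping.lookup P m = (\<Sum>m'\<in>Mon10. if m = m' then c m' else 0)"
        unfolding P_def lookup_sum by (intro sum.cong) (auto simp: lookup_single)
      then show ?thesis by (simp add: finite_Mon10)
    qed
    have "whomogeneous weights 10 P" unfolding P_def by (intro whom_sum whom_single) (simp add: Mon10_def)
    moreover have "Poly_Mapping.lookup P (Poly_Mapping.single Vz 2) = 1" using mons(1) by (simp add: lk c_def flip: mz2_def)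
    ultimately have pp: "(P, \<rho> Tau) \<in> parameter_space" by (simp add: parameter_space_def)
    have "coord_value (P, \<rho> Tau) k = \<rho> k" if "k \<in> pcoords" for k
      using that by (auto simp: pcoords_def lk c_def split: if_splits)
    then have "peval (coord_value (P, \<rho> Tau)) E = peval \<rho> E"
      using Ev unfolding peval_eq_psubst psubst_def vars_in_def by (intro sum.cong refl arg_cong2[of _ _ _ _ "(*)"] meval_cong) blast
    then have "(P, \<rho> Tau) \<in> U" using pp \<rho> by (simp add: U_def)
    then show ?thesis by blast
  qed
  moreover have "(P, \<tau>) \<in> parameter_space \<and> \<tau> \<noteq> 0 \<and> \<not> bad \<theta> \<tau> P" if "(P, \<tau>) \<in> U" for P \<tau>
    using that D(3)[of P \<tau>] by (auto simp: U_def E_def)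
  ultimately show ?thesis by blast
qed

theorem singular_locus_subset:
  assumes P: "whomogeneous weights 10 P" and \<tau>: "\<tau> \<noteq> 0" and nb: "\<not> bad \<theta> \<tau> P"
  shows "singular_locus weights (X'_ideal \<theta> \<tau> P) \<subseteq> {worbit weights ptz}"
proof
  fix p assume p: "p \<in> singular_locus weights (X'_ideal \<theta> \<tau> P)"
  then have p': "p \<in> proj_points weights (X'_ideal \<theta> \<tau> P)" "\<not> regular_local_ring (proj_stalk weights (X'_ideal \<theta> \<tau> P) p)"
    by (auto simp: singular_locus_def)
  obtain a where a: "p = worbit weights a" and
    c: "(a = (\<lambda>i. peval a (chart1 i)) \<and> peval a (psubst pconst chart1 (rel11 \<theta> \<tau> P)) = 0) \<or>
     (a = (\<lambda>i. peval a (chart2 i)) \<and> a Vy = 0 \<and> peval a (rel13 \<theta> \<tau> P) = 0) \<or> a = ptz"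
    using points_X'[OF \<tau> p'(1)] by blast
  consider "a = (\<lambda>i. peval a (chart1 i))" "peval a (psubst pconst chart1 (rel11 \<theta> \<tau> P)) = 0" |
    "a = (\<lambda>i. peval a (chart2 i))" "a Vy = 0" "peval a (rel13 \<theta> \<tau> P) = 0" | "a = ptz" using c by blast
  then show "p \<in> {worbit weights ptz}"
  proof cases
    case 1
    then obtain j where j: "j \<in> {Vx1, Vu0, Vz}" "coeff (linpart (line a j) (psubst pconst chart1 (rel11 \<theta> \<tau> P))) 1 \<noteq> 0"
      using nb unfolding bad_def by blast
    obtain i1 i2 where i: "{j, i1, i2} = {Vx1, Vu0, Vz}" "j \<noteq> i1" "j \<noteq> i2" "i1 \<noteq> i2"
    proof -
      consider "j = Vx1" | "j = Vu0" | "j = Vz" using j(1) by blast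
      then show ?thesis
      proof cases
        case 1 show ?thesis by (rule that[of Vu0 Vz]) (auto simp: 1)
      next
        case 2 show ?thesis by (rule that[of Vx1 Vz]) (auto simp: 2)
      next
        case 3 show ?thesis by (rule that[of Vx1 Vu0]) (auto simp: 3)
      qed
    qed
    show ?thesis using chart1_regular[OF P 1 i j(2)] p'(2) a by simp
  next
    case 2
    then show ?thesis using chart2_regular[OF P \<tau> 2] p'(2) a by simp
  next
    case 3
    then show ?thesis using a by simp
  qed
qed

section \<open>Graded power series\<close>

lemma kc_simps [simp]:
  "kc p q 0 = 0" "kc p q (F + G) = kc p q F + kc p q G" "kc p q (F - G) = kc p q F - kc p q G" "kc p q (- F) = - kc p q F"
  "kc p q (cst c * F) = c * kc p q F"
  by (simp_all add: kc_def cst_def)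

lemma kc_mult: "kc p q (F * G) = (\<Sum>b=0..q. \<Sum>a=0..p. kc a b F * kc (p - a) (q - b) G)"
  by (simp add: kc_def K_mult_nth)

lemma kc_cst: "kc p q (cst c) = (if p = 0 \<and> q = 0 then c else 0)"
  by (simp add: kc_def cst_def)

lemma kc_sum: "kc p q (sum f A) = (\<Sum>i\<in>A. kc p q (f i))"
  by (induction A rule: infinite_finite_induct) auto

lemma kc_monomial: "kc p q (K_s ^ a * K_t ^ b) = (if p = a \<and> q = b then 1 else 0)"
proof -
  have "K_s ^ a = fps_const (fps_X ^ a)" by (simp add: K_s_def fps_const_power)
  then show ?thesis by (simp add: kc_def K_t_def fps_X_power_nth)
qed

lemma K_eqI: "(\<And>p q. kc p q F = kc p q G) \<Longrightarrow> F = G"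
  by (intro fps_ext) (simp add: kc_def)

lemma ordge_kc: "ordge n F \<longleftrightarrow> (\<forall>p q. p + q < n \<longrightarrow> kc p q F = 0)"
  by (simp add: ordge_def kc_def)

lemma c0_kc: "c0 F = kc 0 0 F" by (simp add: c0_def kc_def)

definition gr :: "nat \<Rightarrow> K \<Rightarrow> bool" where
  "gr d F \<longleftrightarrow> (\<forall>p q. kc p q F \<noteq> 0 \<longrightarrow> (p + 14 * q) mod 25 = d mod 25)"

lemma grD: "gr d F \<Longrightarrow> kc p q F \<noteq> 0 \<Longrightarrow> (p + 14 * q) mod 25 = d mod 25" by (simp add: gr_def)

lemma gr_0 [simp]: "gr d 0" by (simp add: gr_def)

lemma gr_add: "gr d F \<Longrightarrow> gr d G \<Longrightarrow> gr d (F + G)"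
  unfolding gr_def kc_simps by (metis add.right_neutral)

lemma gr_uminus: "gr d F \<Longrightarrow> gr d (- F)" by (simp add: gr_def)

lemma gr_diff: "gr d F \<Longrightarrow> gr d G \<Longrightarrow> gr d (F - G)" using gr_add[of d F "- G"] gr_uminus by simp

lemma gr_sum: "(\<And>i. i \<in> A \<Longrightarrow> gr d (f i)) \<Longrightarrow> gr d (sum f A)"
  by (induction A rule: infinite_finite_induct) (auto intro: gr_add)

lemma gr_cst: "gr 0 (cst c)" by (simp add: gr_def kc_cst)

lemma gr_1: "gr 0 1" using gr_cst[of 1] by simp

lemma gr_cong: "gr d F \<Longrightarrow> d mod 25 = e mod 25 \<Longrightarrow> gr e F" by (simp add: gr_def)

lemma gr_mult:
  assumes "gr d F" "gr e G"
  shows "gr (d + e) (F * G)"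
  unfolding gr_def
proof (intro allI impI)
  fix p q assume "kc p q (F * G) \<noteq> 0"
  then obtain a b where ab: "b \<in> {0..q}" "a \<in> {0..p}" "kc a b F * kc (p - a) (q - b) G \<noteq> 0"
    unfolding kc_mult by (meson sum.not_neutral_contains_not_neutral)
  then have "kc a b F \<noteq> 0" "kc (p - a) (q - b) G \<noteq> 0" by auto
  then have "(a + 14 * b) mod 25 = d mod 25" "((p - a) + 14 * (q - b)) mod 25 = e mod 25"
    using grD[OF assms(1)] grD[OF assms(2)] by blast+
  then have "((a + 14 * b) + ((p - a) + 14 * (q - b))) mod 25 = (d + e) mod 25" by (metis mod_add_eq)
  moreover have "(a + 14 * b) + ((p - a) + 14 * (q - b)) = p + 14 * q" using ab(1,2) by auto
  ultimately show "(p + 14 * q) mod 25 = (d + e) mod 25" by (simp only:)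
qed

lemma gr_power: "gr d F \<Longrightarrow> gr (d * n) (F ^ n)"
  by (induction n) (auto simp: gr_1 intro: gr_mult)

lemma gr_mult': "gr d F \<Longrightarrow> gr e G \<Longrightarrow> (d + e) mod 25 = n mod 25 \<Longrightarrow> gr n (F * G)"
  using gr_mult gr_cong by blast

lemma gr_power': "gr d F \<Longrightarrow> (d * k) mod 25 = n mod 25 \<Longrightarrow> gr n (F ^ k)"
  using gr_power gr_cong by blast

lemma gr_s: "gr 1 K_s"
  unfolding gr_def
proof (intro allI impI)
  fix p q assume "kc p q K_s \<noteq> 0"
  then show "(p + 14 * q) mod 25 = 1 mod 25" using kc_monomial[of p q 1 0] by (simp split: if_splits)
qed

lemma gr_t: "gr 14 K_t"
  unfolding gr_def
proof (intro allI impI)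
  fix p q assume "kc p q K_t \<noteq> 0"
  then show "(p + 14 * q) mod 25 = 14 mod 25" using kc_monomial[of p q 0 1] by (simp split: if_splits)
qed

lemma gr_psubst:
  fixes \<xi> :: "'v \<Rightarrow> K"
  assumes \<xi>: "\<And>i. gr (10 * wt i) (\<xi> i)" and f: "whomogeneous wt d f"
  shows "gr (10 * d) (psubst cst \<xi> f)"
  unfolding psubst_def
proof (intro gr_sum)
  fix m assume m: "m \<in> Poly_Mapping.keys f"
  have 1: "gr (\<Sum>i\<in>A. 10 * wt i * Poly_Mapping.lookup m i) (\<Prod>i\<in>A. \<xi> i ^ Poly_Mapping.lookup m i)" for A
    by (induction A rule: infinite_finite_induct) (auto simp: gr_1 intro: gr_mult gr_power \<xi>)
  have 2: "(\<Sum>i\<in>Poly_Mapping.keys m. 10 * wt i * Poly_Mapping.lookup m i) = 10 * d"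
    using f m by (simp add: whomogeneous_def wdegree_def mult.assoc flip: sum_distrib_left)
  have "gr (10 * d) (meval \<xi> m)" using 1[of "Poly_Mapping.keys m"] unfolding 2 meval_def .
  then show "gr (10 * d) (cst (Poly_Mapping.lookup f m) * meval \<xi> m)" using gr_mult[OF gr_cst] by force
qed

lemma gr_divide:
  assumes "gr e G" "c0 G \<noteq> 0" "gr e (F * G)"
  shows "gr 0 F"
proof -
  have e0: "e mod 25 = 0" using grD[OF assms(1), of 0 0] assms(2) by (simp add: c0_kc)
  have "kc p q F \<noteq> 0 \<longrightarrow> (p + 14 * q) mod 25 = 0" for p q
  proof (induction "p + q" arbitrary: p q rule: less_induct)
    case less
    show ?case
    proof (rule ccontr)
      assume n: "\<not> ?thesis"
      have "kc a b F * kc (p - a) (q - b) G = 0" if "b \<in> {0..q}" "a \<in> {0..p}" "(a, b) \<noteq> (p, q)" for a b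
      proof (rule ccontr)
        assume nz: "kc a b F * kc (p - a) (q - b) G \<noteq> 0"
        have "a + b < p + q" using that by auto
        then have 1: "(a + 14 * b) mod 25 = 0" using less.hyps[of a b] nz by auto
        have 2: "((p - a) + 14 * (q - b)) mod 25 = 0" using grD[OF assms(1), of "p - a" "q - b"] nz e0 by auto
        have "((a + 14 * b) + ((p - a) + 14 * (q - b))) mod 25 = 0" using 1 2 by (metis add_0 mod_add_eq mod_0)
        moreover have "(a + 14 * b) + ((p - a) + 14 * (q - b)) = p + 14 * q" using that by auto
        ultimately have "(p + 14 * q) mod 25 = 0" by (simp only:)
        then show False using n by simp
      qed
      then have "(\<Sum>a=0..p. kc a b F * kc (p - a) (q - b) G) = (if b = q then kc p q F * kc 0 0 G else 0)" if "b \<in> {0..q}" for b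
      proof (cases "b = q")
        case True
        have "(\<Sum>a=0..p. kc a b F * kc (p - a) (q - b) G) = (\<Sum>a=0..p. if a = p then kc p q F * kc 0 0 G else 0)"
          using \<open>\<And>a b. b \<in> {0..q} \<Longrightarrow> a \<in> {0..p} \<Longrightarrow> (a, b) \<noteq> (p, q) \<Longrightarrow> kc a b F * kc (p - a) (q - b) G = 0\<close>[of q] True
          by (intro sum.cong) auto
        then show ?thesis using True by simp
      next
        case False
        then show ?thesis
          using \<open>\<And>a b. b \<in> {0..q} \<Longrightarrow> a \<in> {0..p} \<Longrightarrow> (a, b) \<noteq> (p, q) \<Longrightarrow> kc a b F * kc (p - a) (q - b) G = 0\<close>[OF that]
          by (auto intro!: sum.neutral)
      qed
      then have "kc p q (F * G) = (\<Sum>b=0..q. if b = q then kc p q F * kc 0 0 G else 0)" unfolding kc_mult by (intro sum.cong) auto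
      then have "kc p q (F * G) = kc p q F * c0 G" by (simp add: c0_kc)
      then have "kc p q (F * G) \<noteq> 0" using n assms(2) by simp
      then show False using assms(3) n e0 by (auto simp: gr_def)
    qed
  qed
  then show ?thesis by (simp add: gr_def)
qed

lemma kc_mult_indecomposable:
  assumes F: "gr 0 F" "gr 0 G"
    and ind: "\<And>a b. a \<le> i \<Longrightarrow> b \<le> j \<Longrightarrow> (a + 14 * b) mod 25 = 0 \<Longrightarrow> (a, b) = (0, 0) \<or> (a, b) = (i, j)" and ij: "(i, j) \<noteq> (0, 0)"
  shows "kc i j (F * G) = c0 F * kc i j G + kc i j F * c0 G"
proof -
  have "kc i j (F * G) = (\<Sum>(b, a)\<in>{0..j} \<times> {0..i}. kc a b F * kc (i - a) (j - b) G)"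
    unfolding kc_mult by (rule sum.cartesian_product)
  also have "\<dots> = (\<Sum>(b, a)\<in>{(0, 0), (j, i)}. kc a b F * kc (i - a) (j - b) G)"
  proof (intro sum.mono_neutral_right ballI)
    fix x assume x: "x \<in> {0..j} \<times> {0..i} - {(0, 0), (j, i)}"
    then obtain a b where ab: "x = (b, a)" "a \<le> i" "b \<le> j" by auto
    have "kc a b F = 0"
    proof (rule ccontr)
      assume "kc a b F \<noteq> 0"
      then have "(a + 14 * b) mod 25 = 0" using F(1) by (auto simp: gr_def)
      then show False using ind[OF ab(2,3)] x ab(1) by auto
    qed
    then show "(case x of (b, a) \<Rightarrow> kc a b F * kc (i - a) (j - b) G) = 0" using ab(1) by simp
  qed auto
  also have "\<dots> = c0 F * kc i j G + kc i j F * c0 G" using ij by (auto simp: c0_kc)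
  finally show ?thesis .
qed

section \<open>The singular point\<close>

text \<open>
  In the chart \<open>z = 1\<close> the power series \<open>w = s ^ 5\<close>, \<open>u1 = s t\<close>, \<open>T = t ^ 5\<close>, where
  \<open>T = - (t P + \<theta> z u1 ^ 3 + \<tau> w ^ 3 u1 ^ 2)\<close>, satisfy \<open>w T = u1 ^ 5\<close>; the other coordinates are then determined by
  the relations \<open>R11, \<dots>, R14\<close>, in which \<open>P\<close> is a unit.
\<close>

lemma relations_from_unit:
  fixes x0 x1 y w u0 u1 t p Q T :: "'a::idom"
  assumes p: "p \<noteq> 0" and h1: "p * t = - (T + u1 ^ 2 * Q)" and h2: "p * y = - (w * Q + u1 ^ 3)"
    and h3: "p * x1 = - (y * Q + u1 * t)" and h4: "p * x0 = - (x1 ^ 2 * Q + u0 * t)"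
    and h5: "p * u0 = - (x1 * u1 * Q + t ^ 2)" and h6: "w * T = u1 ^ 5"
  shows "x0 * y - x1 ^ 3 = 0" "x0 * w - x1 ^ 2 * y = 0" "x1 * w - y ^ 2 = 0" "x0 * u1 - x1 * u0 = 0"
     "x1 ^ 2 * u1 - y * u0 = 0" "x1 * y * u1 - w * u0 = 0" "x0 * t - u0 ^ 2 = 0" "x1 * t - u0 * u1 = 0"
     "x1 * u1 ^ 2 - y * t = 0" "y * u1 ^ 2 - w * t = 0"
proof -
  note k = numeral_eq_Suc algebra_simps
  note H = h1[unfolded eq_neg_iff_add_eq_0] h2[unfolded eq_neg_iff_add_eq_0] h3[unfolded eq_neg_iff_add_eq_0]
    h4[unfolded eq_neg_iff_add_eq_0] h5[unfolded eq_neg_iff_add_eq_0] h6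
  have "p * (y * u1 ^ 2 - w * t) = (p * y + (w * Q + u1 ^ 3)) * u1 ^ 2 - w * (p * t + (T + u1 ^ 2 * Q)) + (w * T - u1 ^ 5)"
    by (simp add: k)
  then show r10: "y * u1 ^ 2 - w * t = 0" using p unfolding H  by simp
  have "p * (x1 * u1 ^ 2 - y * t) = (p * x1 + (y * Q + u1 * t)) * u1 ^ 2 - t * (p * y + (w * Q + u1 ^ 3)) - Q * (y * u1 ^ 2 - w * t)"
    by (simp add: k)
  then show r9: "x1 * u1 ^ 2 - y * t = 0" using p unfolding H r10 by simp
  have "p * (x1 * w - y ^ 2) = (p * x1 + (y * Q + u1 * t)) * w - y * (p * y + (w * Q + u1 ^ 3)) + u1 * (y * u1 ^ 2 - w * t)"
    by (simp add: k)
  then show r3: "x1 * w - y ^ 2 = 0" using p unfolding H r10 r9 by simp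
  have "p * (x1 * t - u0 * u1) = (p * x1 + (y * Q + u1 * t)) * t - u1 * (p * u0 + (x1 * u1 * Q + t ^ 2)) + Q * (x1 * u1 ^ 2 - y * t)"
    by (simp add: k)
  then show r8: "x1 * t - u0 * u1 = 0" using p unfolding H r10 r9 r3 by simp
  have "p * (x1 ^ 2 * u1 - y * u0) = (p * x1 + (y * Q + u1 * t)) * (x1 * u1) - y * (p * u0 + (x1 * u1 * Q + t ^ 2)) - t * (x1 * u1 ^ 2 - y * t)"
    by (simp add: k)
  then show r5: "x1 ^ 2 * u1 - y * u0 = 0" using p unfolding H r10 r9 r3 r8 by simp
  have "p * (x1 * y * u1 - w * u0) = (p * x1 + (y * Q + u1 * t)) * (y * u1) - w * (p * u0 + (x1 * u1 * Q + t ^ 2)) + Q * u1 * (x1 * w - y ^ 2) - t * (y * u1 ^ 2 - w * t)"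
    by (simp add: k)
  then show r6: "x1 * y * u1 - w * u0 = 0" using p unfolding H r10 r9 r3 r8 r5 by simp
  have "p * (x0 * u1 - x1 * u0) = (p * x0 + (x1 ^ 2 * Q + u0 * t)) * u1 - x1 * (p * u0 + (x1 * u1 * Q + t ^ 2)) + t * (x1 * t - u0 * u1)"
    by (simp add: k)
  then show r4: "x0 * u1 - x1 * u0 = 0" using p unfolding H r10 r9 r3 r8 r5 r6 by simp
  have "p * (x0 * t - u0 ^ 2) = (p * x0 + (x1 ^ 2 * Q + u0 * t)) * t - u0 * (p * u0 + (x1 * u1 * Q + t ^ 2)) - x1 * Q * (x1 * t - u0 * u1)"
    by (simp add: k)
  then show r7: "x0 * t - u0 ^ 2 = 0" using p unfolding H r10 r9 r3 r8 r5 r6 r4 by simp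
  have "p * (x0 * y - x1 ^ 3) = (p * x0 + (x1 ^ 2 * Q + u0 * t)) * y - x1 ^ 2 * (p * x1 + (y * Q + u1 * t)) + t * (x1 ^ 2 * u1 - y * u0)"
    by (simp add: k)
  then show r1: "x0 * y - x1 ^ 3 = 0" using p unfolding H r10 r9 r3 r8 r5 r6 r4 r7 by simp
  have "p * (x0 * w - x1 ^ 2 * y) = (p * x0 + (x1 ^ 2 * Q + u0 * t)) * w - x1 ^ 2 * (p * y + (w * Q + u1 ^ 3)) + x1 * u1 * (x1 * u1 ^ 2 - y * t) + t * (x1 * y * u1 - w * u0)"
    by (simp add: k)
  then show r2: "x0 * w - x1 ^ 2 * y = 0" using p unfolding H r10 r9 r3 r8 r5 r6 r4 r7 r1 by simp
qed

lemma ordge_psubst_diff: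
  assumes "\<And>i. ordge n (\<xi> i - \<eta> i)"
  shows "ordge n (psubst cst \<xi> f - psubst cst \<eta> f)"
proof (induction f rule: mpoly_induct)
  case (add f g)
  have "psubst cst \<xi> (f + g) - psubst cst \<eta> (f + g) = (psubst cst \<xi> f - psubst cst \<eta> f) + (psubst cst \<xi> g - psubst cst \<eta> g)"
    by (simp add: psubst_simps ishom_cst)
  then show ?case using ordge_add[OF add] by (simp only:)
next
  case (mult f g)
  have "psubst cst \<xi> (f * g) - psubst cst \<eta> (f * g) = psubst cst \<xi> f * (psubst cst \<xi> g - psubst cst \<eta> g) + psubst cst \<eta> g * (psubst cst \<xi> f - psubst cst \<eta> f)"
    by (simp add: psubst_simps ishom_cst algebra_simps)
  then show ?case using ordge_add[OF ordge_mult_left[OF mult(2)] ordge_mult_left[OF mult(1)]] by (simp only:)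
qed (use assms in \<open>simp_all add: ishom_cst\<close>)

locale cone_point =
  fixes \<theta> \<tau> :: complex and P :: S
  assumes P: "whomogeneous weights 10 P" and lead: "Poly_Mapping.lookup P (Poly_Mapping.single Vz 2) = 1"
begin

lemma peval_ptz: "whomogeneous weights d f \<Longrightarrow> peval ptz f = Poly_Mapping.lookup f (Poly_Mapping.single Vz (d div 5))"
proof -
  assume f: "whomogeneous weights d f"
  have m: "meval ptz m = (if m = Poly_Mapping.single Vz (d div 5) then 1 else 0)" if "m \<in> Poly_Mapping.keys f" for m
  proof (cases "Poly_Mapping.keys m \<subseteq> {Vz}")
    case True
    then have e: "m = Poly_Mapping.single Vz (Poly_Mapping.lookup m Vz)"
      by (intro poly_mapping_eqI) (auto simp: lookup_single when_def in_keys_iff)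
    have "wdegree weights m = d" using f that by (simp add: whomogeneous_def)
    then have "5 * Poly_Mapping.lookup m Vz = d" by (subst (asm) e) simp
    then have "m = Poly_Mapping.single Vz (d div 5)" using e by auto
    moreover have "meval ptz m = 1" by (subst e) (simp add: ptz_def)
    ultimately show ?thesis by simp
  next
    case False
    then obtain i where i: "i \<in> Poly_Mapping.keys m" "i \<noteq> Vz" by blast
    then have "ptz i ^ Poly_Mapping.lookup m i = 0" by (simp add: ptz_def in_keys_iff)
    then have "meval ptz m = 0" unfolding meval_def using i by (meson finite_keys prod_zero_iff)
    moreover have "m \<noteq> Poly_Mapping.single Vz (d div 5)" using i by (auto split: if_splits)
    ultimately show ?thesis by simp
  qed
  have "peval ptz f = (\<Sum>k\<in>Poly_Mapping.keys f. if k = Poly_Mapping.single Vz (d div 5) then Poly_Mapping.lookup f k else 0)"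
    unfolding peval_eq_psubst psubst_def using m by (intro sum.cong) auto
  then show ?thesis by (simp add: in_keys_iff)
qed

lemma P_ptz: "peval ptz P = 1" using peval_ptz[OF P] lead by simp

lemma vanishing_ptz: "vanishing (\<lambda>x. x) ptz (relations \<theta> \<tau> P)"
  unfolding vanishing_def relations_eq by (simp flip: peval_eq_psubst) (simp add: ptz_def Qf_def)

sublocale wproj_complex weights "X'_ideal \<theta> \<tau> P" ptz
  by unfold_locales (use hideal_X'[OF P] peval_vanish[OF vanishing_ptz] in auto)

lemma ptz_in_X': "worbit weights ptz \<in> proj_points weights (X'_ideal \<theta> \<tau> P)"
proof -
  have "peval b f = 0" if f: "f \<in> X'_ideal \<theta> \<tau> P" and b: "b \<in> worbit weights ptz" for f b
  proof -
    obtain c where c: "b = (\<lambda>i. c ^ weights i * ptz i)" using b by (auto simp: worbit_def)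
    have "vanishing (\<lambda>x. x) b (relations \<theta> \<tau> P)"
      unfolding vanishing_def
    proof
      fix r assume r: "r \<in> relations \<theta> \<tau> P"
      then obtain e where "whomogeneous weights e r" using relations_homogeneous[OF P] by blast
      then show "psubst (\<lambda>x. x) b r = 0" using vanishing_ptz r by (simp add: c psubst_scale vanishing_def)
    qed
    then show ?thesis using f by (rule peval_vanish)
  qed
  moreover have "ptz \<noteq> (\<lambda>_. 0)" by (auto simp: ptz_def dest: fun_cong[of _ _ Vz])
  ultimately show ?thesis by (auto simp: proj_points_def wps_points_def)
qed

definition Q0 :: K where "Q0 = cst \<theta> * (K_s * K_t) + cst \<tau> * K_s ^ 15"

definition step :: "(var \<Rightarrow> K) \<Rightarrow> var \<Rightarrow> K" where
  "step \<xi> i = (let p = psubst cst \<xi> P; u = K_s * K_t; w = K_s ^ 5 in case i of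
     Vz \<Rightarrow> 1 | Vw \<Rightarrow> w | Vu1 \<Rightarrow> u
   | Vt \<Rightarrow> (1 - p) * \<xi> Vt - (K_t ^ 5 + u ^ 2 * Q0)
   | Vy \<Rightarrow> (1 - p) * \<xi> Vy - (w * Q0 + u ^ 3)
   | Vx1 \<Rightarrow> (1 - p) * \<xi> Vx1 - (\<xi> Vy * Q0 + u * \<xi> Vt)
   | Vx0 \<Rightarrow> (1 - p) * \<xi> Vx0 - (\<xi> Vx1 ^ 2 * Q0 + \<xi> Vu0 * \<xi> Vt)
   | Vu0 \<Rightarrow> (1 - p) * \<xi> Vu0 - (\<xi> Vx1 * u * Q0 + \<xi> Vt ^ 2))"

lemma step_simps:
  "step \<xi> Vz = 1" "step \<xi> Vw = K_s ^ 5" "step \<xi> Vu1 = K_s * K_t"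
  "step \<xi> Vt = (1 - psubst cst \<xi> P) * \<xi> Vt - (K_t ^ 5 + (K_s * K_t) ^ 2 * Q0)"
  "step \<xi> Vy = (1 - psubst cst \<xi> P) * \<xi> Vy - (K_s ^ 5 * Q0 + (K_s * K_t) ^ 3)"
  "step \<xi> Vx1 = (1 - psubst cst \<xi> P) * \<xi> Vx1 - (\<xi> Vy * Q0 + K_s * K_t * \<xi> Vt)"
  "step \<xi> Vx0 = (1 - psubst cst \<xi> P) * \<xi> Vx0 - (\<xi> Vx1 ^ 2 * Q0 + \<xi> Vu0 * \<xi> Vt)"
  "step \<xi> Vu0 = (1 - psubst cst \<xi> P) * \<xi> Vu0 - (\<xi> Vx1 * (K_s * K_t) * Q0 + \<xi> Vt ^ 2)"
  by (simp_all add: step_def Let_def)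

lemma gr_Q0: "gr 90 Q0"
  unfolding Q0_def
  by (intro gr_add gr_mult'[OF gr_cst gr_mult[OF gr_s gr_t]] gr_mult'[OF gr_cst gr_power[OF gr_s]]) simp_all

lemma c0_Q0 [simp]: "c0 Q0 = 0" by (simp add: Q0_def)

lemma ex_solution:
  "\<exists>\<xi>. (\<forall>i. c0 (\<xi> i) = ptz i) \<and> step \<xi> = \<xi> \<and> (\<forall>i. gr (10 * weights i) (\<xi> i))"
proof -
  have "\<exists>\<xi>. (\<forall>i. c0 (\<xi> i) = ptz i) \<and> step \<xi> = \<xi> \<and>
    (\<forall>i p q. kc p q (\<xi> i) \<noteq> 0 \<longrightarrow> (p, q) \<in> {(p, q). (p + 14 * q) mod 25 = (10 * weights i) mod 25})"
  proof (rule K_fixpoint)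
    fix \<xi> :: "var \<Rightarrow> K" assume c: "\<And>i. c0 (\<xi> i) = ptz i"
    have p: "c0 (psubst cst \<xi> P) = 1" using c0_psubst[of \<xi> ptz P] c P_ptz by simp
    show "\<forall>i. c0 (step \<xi> i) = ptz i"
    proof
      fix i show "c0 (step \<xi> i) = ptz i" by (cases i) (simp_all add: step_simps c ptz_def p)
    qed
    assume "\<And>i p q. kc p q (\<xi> i) \<noteq> 0 \<Longrightarrow> (p, q) \<in> {(p, q). (p + 14 * q) mod 25 = (10 * weights i) mod 25}"
    then have g: "gr (10 * weights i) (\<xi> i)" for i by (auto simp: gr_def)
    have gp: "gr 0 (1 - psubst cst \<xi> P)" using gr_cong[OF gr_psubst[OF g P], of 0] by (intro gr_diff gr_1) simp
    have gu: "gr 15 (K_s * K_t)" using gr_mult[OF gr_s gr_t] by simp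
    have "gr (10 * weights i) (step \<xi> i)" for i
    proof (cases i)
      case Vz show ?thesis unfolding Vz step_simps by (intro gr_cong[OF gr_1]) simp
    next
      case Vw show ?thesis unfolding Vw step_simps by (intro gr_power'[OF gr_s]) simp
    next
      case Vu1 show ?thesis unfolding Vu1 step_simps by (intro gr_cong[OF gu]) simp
    next
      case Vt
      show ?thesis unfolding Vt step_simps
        by (intro gr_diff gr_add gr_mult'[OF gp g[of Vt]] gr_power'[OF gr_t] gr_mult'[OF gr_power[OF gu] gr_Q0]) simp_all
    next
      case Vy
      show ?thesis unfolding Vy step_simps
        by (intro gr_diff gr_add gr_mult'[OF gp g[of Vy]] gr_mult'[OF gr_power[OF gr_s] gr_Q0] gr_power'[OF gu]) simp_all
    next
      case Vx1
      show ?thesis unfolding Vx1 step_simps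
        by (intro gr_diff gr_add gr_mult'[OF gp g[of Vx1]] gr_mult'[OF g[of Vy] gr_Q0] gr_mult'[OF gu g[of Vt]]) simp_all
    next
      case Vx0
      show ?thesis unfolding Vx0 step_simps
        by (intro gr_diff gr_add gr_mult'[OF gp g[of Vx0]] gr_mult'[OF gr_power[OF g[of Vx1]] gr_Q0] gr_mult'[OF g[of Vu0] g[of Vt]]) simp_all
    next
      case Vu0
      show ?thesis unfolding Vu0 step_simps
        by (intro gr_diff gr_add gr_mult'[OF gp g[of Vu0]] gr_mult'[OF gr_mult[OF g[of Vx1] gu] gr_Q0] gr_power'[OF g[of Vt]]) simp_all
    qed
    then show "\<forall>i p q. kc p q (step \<xi> i) \<noteq> 0 \<longrightarrow> (p, q) \<in> {(p, q). (p + 14 * q) mod 25 = (10 * weights i) mod 25}"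
      by (auto simp: gr_def)
  next
    fix \<xi> \<eta> :: "var \<Rightarrow> K" and n assume c: "\<And>i. c0 (\<xi> i) = ptz i" "\<And>i. c0 (\<eta> i) = ptz i" and n: "1 \<le> n" "\<And>i. ordge n (\<xi> i - \<eta> i)"
    have p: "c0 (psubst cst \<xi> P) = 1" using c0_psubst[of \<xi> ptz P] c P_ptz by simp
    have dp: "ordge n (psubst cst \<eta> P - psubst cst \<xi> P)"
      using ordge_uminus[OF ordge_psubst_diff[OF n(2), where f = P]] by simp
    have pr: "ordge (Suc n) (F * G)" if "c0 F = 0" "ordge n G" for F G
      using ordge_mult[of 1 F n G] that by (simp add: ordge_Suc_0_iff)
    have d1: "ordge (Suc n) ((1 - psubst cst \<xi> P) * \<xi> i - (1 - psubst cst \<eta> P) * \<eta> i)" if "i \<noteq> Vz" for i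
    proof -
      have "(1 - psubst cst \<xi> P) * \<xi> i - (1 - psubst cst \<eta> P) * \<eta> i = (1 - psubst cst \<xi> P) * (\<xi> i - \<eta> i) + \<eta> i * (psubst cst \<eta> P - psubst cst \<xi> P)"
        by (simp add: algebra_simps)
      moreover have "ordge (Suc n) ((1 - psubst cst \<xi> P) * (\<xi> i - \<eta> i) + \<eta> i * (psubst cst \<eta> P - psubst cst \<xi> P))"
        by (intro ordge_add pr n(2) dp) (use p c that in \<open>simp_all add: ptz_def\<close>)
      ultimately show ?thesis by simp
    qed
    have d2: "ordge (Suc n) (\<xi> i * \<xi> j - \<eta> i * \<eta> j)" if "i \<noteq> Vz" "j \<noteq> Vz" for i j
    proof -
      have "\<xi> i * \<xi> j - \<eta> i * \<eta> j = \<xi> i * (\<xi> j - \<eta> j) + \<eta> j * (\<xi> i - \<eta> i)" by (simp add: algebra_simps)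
      moreover have "ordge (Suc n) (\<xi> i * (\<xi> j - \<eta> j) + \<eta> j * (\<xi> i - \<eta> i))"
        by (intro ordge_add pr n(2)) (use c that in \<open>simp_all add: ptz_def\<close>)
      ultimately show ?thesis by simp
    qed
    have sub: "ordge (Suc n) ((a - b) - (a' - b'))" if "ordge (Suc n) (a - a')" "ordge (Suc n) (b - b')" for a b a' b' :: K
      using ordge_diff[OF that] by (simp add: algebra_simps)
    show "\<forall>i. ordge (Suc n) (step \<xi> i - step \<eta> i)"
    proof
      fix i show "ordge (Suc n) (step \<xi> i - step \<eta> i)"
      proof (cases i)
        case Vt then show ?thesis by (simp only: step_simps) (intro sub d1; simp)
      next
        case Vy then show ?thesis by (simp only: step_simps) (intro sub d1; simp)
      next
        case Vx1
        have e: "\<xi> Vy * Q0 + K_s * K_t * \<xi> Vt - (\<eta> Vy * Q0 + K_s * K_t * \<eta> Vt) = Q0 * (\<xi> Vy - \<eta> Vy) + (K_s * K_t) * (\<xi> Vt - \<eta> Vt)"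
          by (simp add: algebra_simps)
        have o: "ordge (Suc n) (Q0 * (\<xi> Vy - \<eta> Vy) + (K_s * K_t) * (\<xi> Vt - \<eta> Vt))" by (intro ordge_add pr n(2)) simp_all
        show ?thesis unfolding Vx1 step_simps by (intro sub d1 o[folded e]) simp
      next
        case Vx0
        have e: "\<xi> Vx1 ^ 2 * Q0 + \<xi> Vu0 * \<xi> Vt - (\<eta> Vx1 ^ 2 * Q0 + \<eta> Vu0 * \<eta> Vt) = Q0 * (\<xi> Vx1 * \<xi> Vx1 - \<eta> Vx1 * \<eta> Vx1) + (\<xi> Vu0 * \<xi> Vt - \<eta> Vu0 * \<eta> Vt)"
          by (simp add: algebra_simps power2_eq_square)
        have o: "ordge (Suc n) (Q0 * (\<xi> Vx1 * \<xi> Vx1 - \<eta> Vx1 * \<eta> Vx1) + (\<xi> Vu0 * \<xi> Vt - \<eta> Vu0 * \<eta> Vt))"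
          by (intro ordge_add ordge_mult_left d2) simp_all
        show ?thesis unfolding Vx0 step_simps by (intro sub d1 o[folded e]) simp
      next
        case Vu0
        have e: "\<xi> Vx1 * (K_s * K_t) * Q0 + \<xi> Vt ^ 2 - (\<eta> Vx1 * (K_s * K_t) * Q0 + \<eta> Vt ^ 2) = (K_s * K_t * Q0) * (\<xi> Vx1 - \<eta> Vx1) + (\<xi> Vt * \<xi> Vt - \<eta> Vt * \<eta> Vt)"
          by (simp add: algebra_simps power2_eq_square)
        have o: "ordge (Suc n) ((K_s * K_t * Q0) * (\<xi> Vx1 - \<eta> Vx1) + (\<xi> Vt * \<xi> Vt - \<eta> Vt * \<eta> Vt))"
          by (intro ordge_add pr n(2) d2) simp_all
        show ?thesis unfolding Vu0 step_simps by (intro sub d1 o[folded e]) simp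
      qed (simp_all add: step_simps)
    qed
  next
    fix i assume "ptz i \<noteq> 0"
    then show "(0, 0) \<in> {(p, q). (p + 14 * q) mod 25 = (10 * weights i) mod 25}" by (cases i) (simp_all add: ptz_def)
  qed
  then show ?thesis unfolding gr_def by blast
qed

definition sol :: "var \<Rightarrow> K" where
  "sol = (SOME \<xi>. (\<forall>i. c0 (\<xi> i) = ptz i) \<and> step \<xi> = \<xi> \<and> (\<forall>i. gr (10 * weights i) (\<xi> i)))"

lemma unit_fixpoint: "x = (1 - p) * x - n \<Longrightarrow> p * x = - (n :: K)"
  by (simp add: algebra_simps eq_neg_iff_add_eq_0)

lemma sol: "c0 (sol i) = ptz i" "step sol = sol" "gr (10 * weights i) (sol i)"
  using someI_ex[OF ex_solution] unfolding sol_def[symmetric] by blast+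

lemma sol_simps: "sol Vz = 1" "sol Vw = K_s ^ 5" "sol Vu1 = K_s * K_t"
  using step_simps(1-3)[of sol] unfolding sol(2) by auto

lemma vanishing_sol: "vanishing cst sol (relations \<theta> \<tau> P)"
proof -
  let ?p = "psubst cst sol P"
  have Q: "psubst cst sol (Qf \<theta> \<tau>) = Q0"
    by (simp add: Qf_def psubst_simps ishom_cst sol_simps Q0_def power_mult[symmetric])
  have "c0 ?p = 1" using c0_psubst[of sol ptz P] sol(1) P_ptz by simp
  then have p: "?p \<noteq> 0" by auto
  have h1: "?p * sol Vt = - (K_t ^ 5 + sol Vu1 ^ 2 * Q0)" unfolding sol_simps by (rule unit_fixpoint) (use step_simps(4)[of sol] in \<open>simp only: sol(2) sol_simps\<close>)
  have h2: "?p * sol Vy = - (sol Vw * Q0 + sol Vu1 ^ 3)" unfolding sol_simps by (rule unit_fixpoint) (use step_simps(5)[of sol] in \<open>simp only: sol(2) sol_simps\<close>)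
  have h3: "?p * sol Vx1 = - (sol Vy * Q0 + sol Vu1 * sol Vt)" unfolding sol_simps by (rule unit_fixpoint) (use step_simps(6)[of sol] in \<open>simp only: sol(2) sol_simps\<close>)
  have h4: "?p * sol Vx0 = - (sol Vx1 ^ 2 * Q0 + sol Vu0 * sol Vt)" unfolding sol_simps by (rule unit_fixpoint) (use step_simps(7)[of sol] in \<open>simp only: sol(2) sol_simps\<close>)
  have h5: "?p * sol Vu0 = - (sol Vx1 * sol Vu1 * Q0 + sol Vt ^ 2)" unfolding sol_simps by (rule unit_fixpoint) (use step_simps(8)[of sol] in \<open>simp only: sol(2) sol_simps\<close>)
  have h6: "sol Vw * K_t ^ 5 = sol Vu1 ^ 5" by (simp add: sol_simps power_mult_distrib)
  note r = relations_from_unit[OF p h1 h2 h3 h4 h5 h6]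
  have R: "sol Vx0 * ?p + sol Vx1 ^ 2 * Q0 + sol Vu0 * sol Vt = 0" "sol Vx1 * ?p + sol Vy * Q0 + sol Vu1 * sol Vt = 0"
    "sol Vy * ?p + sol Vw * Q0 + sol Vu1 ^ 3 = 0" "sol Vu0 * ?p + sol Vx1 * sol Vu1 * Q0 + sol Vt ^ 2 = 0"
    by (simp_all only: mult.commute[of _ ?p] h2 h3 h4 h5) (simp_all add: algebra_simps)
  show ?thesis unfolding vanishing_def relations_eq
    by (simp only: ball_simps psubst_simps[OF ishom_cst] psubst_pvar[OF ishom_cst] Q r R)
qed

lemma sol_X': "f \<in> X'_ideal \<theta> \<tau> P \<Longrightarrow> psubst cst sol f = 0"
  using vanishing_X'[OF ishom_cst vanishing_sol] .

definition \<Phi> where "\<Phi> = (SOME \<Phi>. ring_hom_ring A (ring_of_type_algebra :: K ring) \<Phi> \<and>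
    (\<forall>f g. ok f g \<longrightarrow> \<Phi> (frac f g) * psubst cst sol g = psubst cst sol f))"

lemma \<Phi>: "ring_hom_ring A (ring_of_type_algebra :: K ring) \<Phi>"
    "ok f g \<Longrightarrow> \<Phi> (frac f g) * psubst cst sol g = psubst cst sol f"
proof -
  have "\<exists>\<Phi>. ring_hom_ring A (ring_of_type_algebra :: K ring) \<Phi> \<and>
    (\<forall>f g. ok f g \<longrightarrow> \<Phi> (frac f g) * psubst cst sol g = psubst cst sol f)"
    by (rule hom_to_K) (auto simp: sol_X' sol)
  from someI_ex[OF this] show "ring_hom_ring A (ring_of_type_algebra :: K ring) \<Phi>"
    "ok f g \<Longrightarrow> \<Phi> (frac f g) * psubst cst sol g = psubst cst sol f" unfolding \<Phi>_def[symmetric] by blast+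
qed

lemma c0_sol: "c0 (psubst cst sol f) = peval ptz f" using c0_psubst[of sol ptz f] sol(1) by simp

lemma \<Phi>_simps:
  "x \<in> carrier A \<Longrightarrow> y \<in> carrier A \<Longrightarrow> \<Phi> (x \<otimes>\<^bsub>A\<^esub> y) = \<Phi> x * \<Phi> y"
  "x \<in> carrier A \<Longrightarrow> y \<in> carrier A \<Longrightarrow> \<Phi> (x \<oplus>\<^bsub>A\<^esub> y) = \<Phi> x + \<Phi> y" "\<Phi> \<one>\<^bsub>A\<^esub> = 1" "\<Phi> \<zero>\<^bsub>A\<^esub> = 0"
proof -
  interpret h: ring_hom_ring A "ring_of_type_algebra :: K ring" \<Phi> by (rule \<Phi>(1))
  show "x \<in> carrier A \<Longrightarrow> y \<in> carrier A \<Longrightarrow> \<Phi> (x \<otimes>\<^bsub>A\<^esub> y) = \<Phi> x * \<Phi> y"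
    "x \<in> carrier A \<Longrightarrow> y \<in> carrier A \<Longrightarrow> \<Phi> (x \<oplus>\<^bsub>A\<^esub> y) = \<Phi> x + \<Phi> y" "\<Phi> \<one>\<^bsub>A\<^esub> = 1" "\<Phi> \<zero>\<^bsub>A\<^esub> = 0"
    using h.hom_mult h.hom_add h.hom_one h.hom_zero by simp_all
qed

lemma gr_\<Phi>: "x \<in> carrier A \<Longrightarrow> gr 0 (\<Phi> x)"
proof -
  assume "x \<in> carrier A"
  then obtain f g where fg: "x = frac f g" "ok f g" by (metis carrierE)
  then obtain d where d: "hom d f" "hom d g" "peval ptz g \<noteq> 0" by (auto simp: ok_def)
  have "gr (10 * d) (psubst cst sol g)" "gr (10 * d) (psubst cst sol f)" using gr_psubst[of weights sol, OF sol(3)] d by auto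
  then show ?thesis using \<Phi>(2)[OF fg(2)] d(3) by (intro gr_divide[of "10 * d" "psubst cst sol g"]) (simp_all add: c0_sol fg(1))
qed

lemma \<Phi>_mx: "x \<in> mx \<Longrightarrow> c0 (\<Phi> x) = 0"
proof -
  assume "x \<in> mx"
  then obtain f g where fg: "x = frac f g" "ok f g" "peval ptz f = 0" by (auto simp: mx_def)
  have "c0 (\<Phi> x) * peval ptz g = 0" using arg_cong[OF \<Phi>(2)[OF fg(2)], of c0] fg(1,3) by (simp add: c0_sol)
  then show ?thesis using fg(2) by (auto simp: ok_def)
qed

lemma \<Phi>_frac_z: "ok f (sz ^ n) \<Longrightarrow> \<Phi> (frac f (sz ^ n)) = psubst cst sol f"
  using \<Phi>(2)[of f "sz ^ n"] by (simp add: psubst_simps ishom_cst sol_simps)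

lemma ok_z: "hom (5 * n) f \<Longrightarrow> ok f (sz ^ n)"
  unfolding ok_def using whom_power[OF whom_pvar[of weights Vz], of n] by (auto simp: ptz_def)

definition ind :: "nat \<Rightarrow> nat \<times> nat" where "ind k = (if k = 0 then (11, 1) else if k = 1 then (8, 3) else (5, 5))"
definition gen :: "nat \<Rightarrow> S" where "gen k = (if k = 0 then sw ^ 2 * su1 else if k = 1 then sw * su1 ^ 3 else su1 ^ 5)"

lemma indecomposable:
  assumes "k < 3" "a \<le> fst (ind k)" "b \<le> snd (ind k)" "(a + 14 * b) mod 25 = 0"
  shows "(a, b) = (0, 0) \<or> (a, b) = ind k"
proof -
  have b: "b = 0 \<or> b = 1 \<or> b = 2 \<or> b = 3 \<or> b = 4 \<or> b = 5" and a: "a \<le> 11" using assms(1-3) by (auto simp: ind_def split: if_splits)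
  then have "a = (if b = 0 then 0 else if b = 1 then 11 else if b = 3 then 8 else 5) \<and> b \<noteq> 2 \<and> b \<noteq> 4"
    using assms(4) by (elim disjE; simp; presburger)
  then show ?thesis using assms(1-3) b by (auto simp: ind_def split: if_splits)
qed

lemma kc_ind:
  assumes "k < 3" "gr 0 F" "gr 0 G"
  shows "kc (fst (ind k)) (snd (ind k)) (F * G) = c0 F * kc (fst (ind k)) (snd (ind k)) G + kc (fst (ind k)) (snd (ind k)) F * c0 G"
proof (rule kc_mult_indecomposable[OF assms(2,3)])
  show "(a, b) = (0, 0) \<or> (a, b) = (fst (ind k), snd (ind k))" if "a \<le> fst (ind k)" "b \<le> snd (ind k)" "(a + 14 * b) mod 25 = 0" for a b
    using indecomposable[OF assms(1) that] by simp
  show "(fst (ind k), snd (ind k)) \<noteq> (0, 0)" by (simp add: ind_def)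
qed

lemma gen_mx:
  assumes "k < 3"
  shows "frac (gen k) (sz ^ (k + 2)) \<in> mx" "kc (fst (ind l)) (snd (ind l)) (\<Phi> (frac (gen k) (sz ^ (k + 2)))) = (if ind l = ind k then 1 else 0)"
proof -
  have k: "k = 0 \<or> k = 1 \<or> k = 2" using assms by auto
  have "hom 10 (sw ^ 2 * su1)" "hom 15 (sw * su1 ^ 3)" "hom 20 (su1 ^ 5)" by (rule whom_mult' whom_power' whom_pvar | simp)+
  then have "hom (5 * (k + 2)) (gen k)" using k by (auto simp: gen_def)
  then have o: "ok (gen k) (sz ^ (k + 2))" by (rule ok_z)
  show "frac (gen k) (sz ^ (k + 2)) \<in> mx" unfolding frac_in_mx[OF o] by (simp add: gen_def ptz_def)
  have "psubst cst sol (gen k) = K_s ^ fst (ind k) * K_t ^ snd (ind k)"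
    using k by (auto simp: gen_def ind_def psubst_simps ishom_cst sol_simps power_mult_distrib mult_ac simp flip: power_mult power_add power_Suc)
  then show "kc (fst (ind l)) (snd (ind l)) (\<Phi> (frac (gen k) (sz ^ (k + 2)))) = (if ind l = ind k then 1 else 0)"
    unfolding \<Phi>_frac_z[OF o] by (simp add: kc_monomial prod_eq_iff)
qed

theorem not_regular: "\<not> regular_local_ring A"
proof
  assume "regular_local_ring A"
  then obtain G where G: "G \<subseteq> carrier A" "finite G" "mx = genideal A G" "enat (card G) = krull_dim A"
    unfolding regular_local_ring_def the_maximal_ideal_A by blast
  have "enat (card G) \<le> 2" unfolding G(4) by (rule krull_dim_le_2[OF quadratic_growth_X'[OF P]])
  then have "card G < card {..<3::nat}" by (simp add: numeral_eq_enat)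
  let ?c = "\<lambda>k x. kc (fst (ind k)) (snd (ind k)) (\<Phi> x)"
  obtain l where l: "\<exists>k\<in>{..<3}. l k \<noteq> 0" "\<forall>x\<in>G. (\<Sum>k<3. l k * ?c k x) = 0"
    using linear_dependence[OF G(2) finite_lessThan[of 3] \<open>card G < card {..<3::nat}\<close>, of ?c] by blast
  define N where "N = {x \<in> mx. (\<Sum>k<3. l k * ?c k x) = 0}"
  have NA: "x \<in> carrier A" if "x \<in> N" for x using that mx_carrier by (auto simp: N_def)
  have Nmul: "y \<otimes>\<^bsub>A\<^esub> x \<in> N" if x: "x \<in> N" and y: "y \<in> carrier A" for x y
  proof -
    have "?c k (y \<otimes>\<^bsub>A\<^esub> x) = c0 (\<Phi> y) * ?c k x" if "k < 3" for k
      using kc_ind[OF that gr_\<Phi>[OF y] gr_\<Phi>[OF NA[OF x]]] \<Phi>_mx[of x] x y NA[OF x] by (simp add: \<Phi>_simps N_def)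
    then have "(\<Sum>k<3. l k * ?c k (y \<otimes>\<^bsub>A\<^esub> x)) = c0 (\<Phi> y) * (\<Sum>k<3. l k * ?c k x)"
      by (simp add: sum_distrib_left mult_ac)
    moreover have "y \<otimes>\<^bsub>A\<^esub> x \<in> mx" using x y by (intro ideal.I_l_closed[OF ideal_mx]) (auto simp: N_def)
    ultimately show ?thesis using x by (simp add: N_def)
  qed
  have "ideal N A"
  proof (rule idealI)
    show "Ring.ring A" by (rule ring_axioms)
    show "subgroup N (add_monoid A)"
    proof (rule add.subgroupI)
      show "N \<subseteq> carrier A" using NA by blast
      have "\<zero>\<^bsub>A\<^esub> \<in> N" unfolding N_def using additive_subgroup.zero_closed[OF ideal.axioms(1)[OF ideal_mx]] by (simp add: \<Phi>_simps)
      then show "N \<noteq> {}" by blast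
      show "\<ominus>\<^bsub>A\<^esub> x \<in> N" if "x \<in> N" for x
      proof -
        have "\<ominus>\<^bsub>A\<^esub> x = (\<ominus>\<^bsub>A\<^esub> \<one>\<^bsub>A\<^esub>) \<otimes>\<^bsub>A\<^esub> x" using NA[OF that] by (simp add: l_minus)
        then show ?thesis using Nmul[OF that] by simp
      qed
      show "x \<oplus>\<^bsub>A\<^esub> y \<in> N" if "x \<in> N" "y \<in> N" for x y
        using that NA additive_subgroup.a_closed[OF ideal.axioms(1)[OF ideal_mx]]
        by (simp add: N_def \<Phi>_simps distrib_left sum.distrib)
    qed
    show "y \<otimes>\<^bsub>A\<^esub> x \<in> N" "x \<otimes>\<^bsub>A\<^esub> y \<in> N" if "x \<in> N" "y \<in> carrier A" for x y
      using Nmul[OF that] m_comm[OF NA[OF that(1)] that(2)] by simp_all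
  qed
  moreover have "G \<subseteq> N" using l(2) genideal_self[OF G(1)] unfolding G(3)[symmetric] by (auto simp: N_def)
  ultimately have mN: "mx \<subseteq> N" unfolding G(3) by (rule genideal_minimal)
  have "l k = 0" if k: "k < 3" for k
  proof -
    have "frac (gen k) (sz ^ (k + 2)) \<in> N" using gen_mx(1)[OF k] mN by blast
    then have "(\<Sum>j<3. l j * (if ind j = ind k then 1 else 0)) = 0" unfolding N_def using gen_mx(2)[OF k] by simp
    moreover have "(\<Sum>j<3. l j * (if ind j = ind k then 1 else 0)) = (\<Sum>j<3. if j = k then l k else 0)"
    proof (intro sum.cong refl)
      fix j :: nat assume "j \<in> {..<3}"
      then have "j = 0 \<or> j = 1 \<or> j = 2" "k = 0 \<or> k = 1 \<or> k = 2" using k by auto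
      then show "l j * (if ind j = ind k then 1 else 0) = (if j = k then l k else 0)" by (auto simp: ind_def)
    qed
    ultimately show "l k = 0" using k by simp
  qed
  then show False using l(1) by auto
qed

theorem ptz_singular: "worbit weights ptz \<in> singular_locus weights (X'_ideal \<theta> \<tau> P)"
  using ptz_in_X' not_regular by (simp add: singular_locus_def)

end

section \<open>The completed local ring of the singular point\<close>

lemma (in ring) minus_add_cancel: "x \<in> carrier R \<Longrightarrow> y \<in> carrier R \<Longrightarrow> (x \<ominus> y) \<oplus> y = x"
  by (simp add: a_minus_def a_assoc l_neg)

context cone_point
begin

definition sT :: S where "sT = - (st * P + pconst \<theta> * sz * su1 ^ 3 + pconst \<tau> * sw ^ 3 * su1 ^ 2)"

lemma hom_sT: "hom 17 sT"
  unfolding sT_def by (rule whom_uminus whom_add whom_mult' whom_power' whom_pvar whom_pconst P | simp)+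

lemma sT_ptz: "peval ptz sT = 0" by (simp add: sT_def ptz_def)

lemma sT_sol: "psubst cst sol sT = K_t ^ 5"
proof -
  have "psubst cst sol P * sol Vt = - (K_t ^ 5 + (K_s * K_t) ^ 2 * Q0)"
    by (rule unit_fixpoint) (use step_simps(4)[of sol] in \<open>simp only: sol(2)\<close>)
  then have "sol Vt * psubst cst sol P = - (K_t ^ 5 + (K_s * K_t) ^ 2 * Q0)" by (simp only: mult.commute)
  moreover have "psubst cst sol sT = - (sol Vt * psubst cst sol P + cst \<theta> * (K_s * K_t) ^ 3 + cst \<tau> * (K_s ^ 5) ^ 3 * (K_s * K_t) ^ 2)"
    by (simp add: sT_def psubst_simps ishom_cst sol_simps)
  ultimately show ?thesis by (simp add: Q0_def algebra_simps numeral_eq_Suc)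
qed

lemma wT_rel: "sw * sT - su1 ^ 5 \<in> X'_ideal \<theta> \<tau> P"
proof -
  have "sw * sT - su1 ^ 5 = P * (sy * su1 ^ 2 - sw * st) - su1 ^ 2 * (sy * P + sw * Qf \<theta> \<tau> + su1 ^ 3)"
    by (simp add: sT_def Qf_def algebra_simps numeral_eq_Suc)
  then show ?thesis by (simp only:) (intro pidealD(6,3)[OF pideal_X'] X'_rel)
qed

definition mu :: "nat \<Rightarrow> nat \<Rightarrow> nat \<Rightarrow> S" where "mu i j k = sw ^ i * su1 ^ j * sT ^ k"
definition mdeg :: "nat \<Rightarrow> nat \<Rightarrow> nat \<Rightarrow> nat" where "mdeg i j k = 3 * i + 4 * j + 17 * k"
definition Em where "Em i j k = frac (mu i j k) (sz ^ (mdeg i j k div 5))"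

lemma hom_mu: "hom (mdeg i j k) (mu i j k)"
proof -
  have "hom (weights Vw * i + weights Vu1 * j + 17 * k) (mu i j k)"
    unfolding mu_def by (intro whom_mult whom_power whom_pvar hom_sT)
  then show ?thesis by (simp add: mdeg_def)
qed

lemma mu_ptz: "0 < i + j + k \<Longrightarrow> peval ptz (mu i j k) = 0"
  by (auto simp: mu_def sT_ptz ptz_def)

lemma mu_add: "mu i j k * mu i' j' k' = mu (i + i') (j + j') (k + k')"
  by (simp add: mu_def power_add mult_ac)

lemma mdeg_add: "mdeg i j k + mdeg i' j' k' = mdeg (i + i') (j + j') (k + k')"
  by (simp add: mdeg_def)

lemma ok_mu: "5 dvd mdeg i j k \<Longrightarrow> ok (mu i j k) (sz ^ (mdeg i j k div 5))"
  using hom_mu[of i j k] by (intro ok_z) simp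

lemma Em_carrier: "5 dvd mdeg i j k \<Longrightarrow> Em i j k \<in> carrier A"
  unfolding Em_def by (intro frac_in ok_mu)

lemma Em_mx: "5 dvd mdeg i j k \<Longrightarrow> 0 < i + j + k \<Longrightarrow> Em i j k \<in> mx"
  unfolding Em_def by (simp add: frac_in_mx ok_mu mu_ptz del: add_gr_0)

lemma Em_mult:
  assumes "5 dvd mdeg i j k" "5 dvd mdeg i' j' k'"
  shows "Em i j k \<otimes>\<^bsub>A\<^esub> Em i' j' k' = Em (i + i') (j + j') (k + k')"
proof -
  have "mdeg (i + i') (j + j') (k + k') div 5 = mdeg i j k div 5 + mdeg i' j' k' div 5"
    using assms unfolding mdeg_add[symmetric] by (simp add: div_add)
  then show ?thesis unfolding Em_def using assms by (simp add: frac_mult ok_mu mu_add power_add)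
qed

lemma \<Phi>_Em: "5 dvd mdeg i j k \<Longrightarrow> \<Phi> (Em i j k) = K_s ^ (5 * i + j) * K_t ^ (j + 5 * k)"
proof -
  assume d: "5 dvd mdeg i j k"
  have "\<Phi> (Em i j k) = psubst cst sol (mu i j k)" unfolding Em_def by (rule \<Phi>_frac_z[OF ok_mu[OF d]])
  also have "\<dots> = (K_s ^ 5) ^ i * (K_s * K_t) ^ j * (K_t ^ 5) ^ k"
    by (simp add: mu_def psubst_simps ishom_cst sol_simps sT_sol)
  also have "\<dots> = K_s ^ (5 * i + j) * K_t ^ (j + 5 * k)"
    by (simp only: power_mult[symmetric] power_add power_mult_distrib mult_ac)
  finally show ?thesis .
qed

lemma Em_shift:
  assumes "5 dvd mdeg i (j + 5) k"
  shows "Em i (j + 5) k = Em (Suc i) j (Suc k)"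
proof -
  have d: "mdeg (Suc i) j (Suc k) = mdeg i (j + 5) k" by (simp add: mdeg_def)
  have "mu i (j + 5) k - mu (Suc i) j (Suc k) = - (sw ^ i * su1 ^ j * sT ^ k) * (sw * sT - su1 ^ 5)"
    by (simp add: mu_def power_add algebra_simps)
  then have m: "mu i (j + 5) k - mu (Suc i) j (Suc k) \<in> X'_ideal \<theta> \<tau> P"
    by (simp only:) (intro pidealD(3)[OF pideal_X'] wT_rel)
  show ?thesis unfolding Em_def d
  proof (rule frac_eqI)
    show "ok (mu i (j + 5) k) (sz ^ (mdeg i (j + 5) k div 5))" by (rule ok_mu[OF assms])
    show "ok (mu (Suc i) j (Suc k)) (sz ^ (mdeg i (j + 5) k div 5))" using ok_mu[of "Suc i" j "Suc k"] assms by (simp add: d)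
    show "mu i (j + 5) k * sz ^ (mdeg i (j + 5) k div 5) - mu (Suc i) j (Suc k) * sz ^ (mdeg i (j + 5) k div 5) \<in> X'_ideal \<theta> \<tau> P"
      using pidealD(4)[OF pideal_X' m] by (simp only: left_diff_distrib)
  qed
qed

definition inv_exp :: "(nat \<times> nat) set" where "inv_exp = {(p, q). (p + 14 * q) mod 25 = 0}"
definition E where "E pq = Em (fst pq div 5) (fst pq mod 5) (snd pq div 5)"

lemma inv_exp_mod:
  assumes "(p, q) \<in> inv_exp"
  shows "p mod 5 = q mod 5" "5 dvd mdeg (p div 5) (p mod 5) (q div 5)"
proof -
  have m: "(p + 14 * q) mod 25 = 0" using assms by (simp add: inv_exp_def)
  have "5 * 5 dvd p + 14 * q" using m by (simp add: dvd_eq_mod_eq_0)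
  then have "5 dvd p + 14 * q" by (rule dvd_mult_left)
  then have "(p + 14 * q) mod 5 = 0" by (rule dvd_imp_mod_0)
  then have "(q + (p + 14 * q)) mod 5 = q mod 5" by (metis mod_add_right_eq add_0_right)
  moreover have "q + (p + 14 * q) = p + 5 * (3 * q)" by simp
  ultimately show e: "p mod 5 = q mod 5" by (metis mod_mult_self2)
  define a b r where "a = p div 5" "b = q div 5" "r = p mod 5"
  have p: "p = 5 * a + r" unfolding a_b_r_def by (rule mult_div_mod_eq[symmetric])
  have q: "q = 5 * b + r" unfolding a_b_r_def e by (rule mult_div_mod_eq[symmetric])
  then have "(5 * (a + 3 * r + 14 * b)) mod (5 * 5) = 0" using m unfolding p q by (simp add: algebra_simps)
  then have "(a + 3 * r + 14 * b) mod 5 = 0" unfolding mult_mod_right[symmetric] by simp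
  then have "5 dvd 3 * (a + 3 * r + 14 * b)" by (intro dvd_mult) (simp only: dvd_eq_mod_eq_0)
  moreover have "3 * (a + 3 * r + 14 * b) = (3 * a + 4 * r + 17 * b) + 5 * (r + 5 * b)" by simp
  ultimately have "5 dvd 3 * a + 4 * r + 17 * b" by (metis dvd_add_left_iff dvd_triv_left)
  then show "5 dvd mdeg (p div 5) (p mod 5) (q div 5)" by (simp add: mdeg_def a_b_r_def)
qed

lemma Em_eq_E: "5 dvd mdeg i j k \<Longrightarrow> Em i j k = E (5 * i + j, j + 5 * k)"
proof (induction j arbitrary: i k rule: less_induct)
  case (less j)
  show ?case
  proof (cases "j < 5")
    case True
    then show ?thesis by (simp add: E_def)
  next
    case False
    then obtain j' where j: "j = j' + 5" by (metis le_add_diff_inverse2 not_less)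
    have "Em i j k = Em (Suc i) j' (Suc k)" using Em_shift[of i j' k] less.prems by (simp add: j)
    also have "\<dots> = E (5 * Suc i + j', j' + 5 * Suc k)" proof (rule less.IH)
      have "mdeg (Suc i) j' (Suc k) = mdeg i j k" by (simp add: mdeg_def j)
      then show "5 dvd mdeg (Suc i) j' (Suc k)" using less.prems by (simp only:)
    qed (simp add: j)
    finally show ?thesis by (simp add: j algebra_simps)
  qed
qed

lemma E_props:
  assumes "pq \<in> inv_exp"
  shows "E pq \<in> carrier A" "\<Phi> (E pq) = K_s ^ fst pq * K_t ^ snd pq" "pq \<noteq> (0, 0) \<Longrightarrow> E pq \<in> mx"
proof -
  obtain p q where pq: "pq = (p, q)" by (cases pq)
  note d = inv_exp_mod[OF assms[unfolded pq]]
  show "E pq \<in> carrier A" using d by (simp add: E_def pq Em_carrier)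
  have "5 * (p div 5) + p mod 5 = p" by simp
  moreover have "p mod 5 + 5 * (q div 5) = q" unfolding d(1) by simp
  ultimately show "\<Phi> (E pq) = K_s ^ fst pq * K_t ^ snd pq" using \<Phi>_Em[OF d(2)] by (simp add: E_def pq)
  show "E pq \<in> mx" if "pq \<noteq> (0, 0)"
  proof -
    have "0 < p div 5 + p mod 5 + q div 5"
    proof (rule ccontr)
      assume "\<not> ?thesis"
      then have "p div 5 = 0" "p mod 5 = 0" "q div 5 = 0" by auto
      moreover from this have "q mod 5 = 0" using d(1) by simp
      ultimately have "p = 0" "q = 0" using mult_div_mod_eq[of 5 p] mult_div_mod_eq[of 5 q] by simp_all
      then show False using that pq by simp
    qed
    then show ?thesis using d Em_mx by (simp add: E_def pq)
  qed
qed

lemma inv_exp_add: "(p, q) \<in> inv_exp \<Longrightarrow> (p', q') \<in> inv_exp \<Longrightarrow> (p + p', q + q') \<in> inv_exp"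
proof -
  assume "(p, q) \<in> inv_exp" "(p', q') \<in> inv_exp"
  then have "25 dvd p + 14 * q" "25 dvd p' + 14 * q'" unfolding inv_exp_def by (simp_all only: mem_Collect_eq case_prod_conv dvd_eq_mod_eq_0)
  then have "25 dvd (p + 14 * q) + (p' + 14 * q')" by (rule dvd_add)
  moreover have "(p + 14 * q) + (p' + 14 * q') = (p + p') + 14 * (q + q')" by simp
  ultimately show ?thesis unfolding inv_exp_def by (simp only: mem_Collect_eq case_prod_conv dvd_eq_mod_eq_0)
qed

lemma E_mult:
  assumes "(p, q) \<in> inv_exp" "(p', q') \<in> inv_exp"
  shows "E (p, q) \<otimes>\<^bsub>A\<^esub> E (p', q') = E (p + p', q + q')"
proof -
  note d = inv_exp_mod[OF assms(1)] and d' = inv_exp_mod[OF assms(2)]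
  have "E (p, q) \<otimes>\<^bsub>A\<^esub> E (p', q') = Em (p div 5 + p' div 5) (p mod 5 + p' mod 5) (q div 5 + q' div 5)"
    using Em_mult[OF d(2) d'(2)] by (simp add: E_def)
  also have "\<dots> = E (5 * (p div 5 + p' div 5) + (p mod 5 + p' mod 5), (p mod 5 + p' mod 5) + 5 * (q div 5 + q' div 5))"
    using d(2) d'(2) unfolding mdeg_add[symmetric] by (intro Em_eq_E) (simp flip: mdeg_add)
  also have "5 * (p div 5 + p' div 5) + (p mod 5 + p' mod 5) = p + p'" by simp
  also have "(p mod 5 + p' mod 5) + 5 * (q div 5 + q' div 5) = q + q'" unfolding d(1) d'(1) by simp
  finally show ?thesis .
qed

lemma E_0: "E (0, 0) = \<one>\<^bsub>A\<^esub>" by (simp add: E_def Em_def mu_def mdeg_def one_A)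

lemma five_factors:
  assumes "5 \<le> i + j + (k::nat)"
  shows "\<exists>i' j' k'. i' \<le> i \<and> j' \<le> j \<and> k' \<le> k \<and> 0 < i' + j' + k' \<and> i' + j' + k' \<le> 5 \<and> 5 dvd mdeg i' j' k'"
proof -
  consider "5 \<le> i" | "5 \<le> j" | "5 \<le> k" | "1 \<le> i" "1 \<le> k" | "i = 0" "2 \<le> j" "1 \<le> k" | "i = 0" "1 \<le> j" "3 \<le> k"
    | "k = 0" "2 \<le> i" "1 \<le> j" | "k = 0" "1 \<le> i" "3 \<le> j" using assms by linarith
  then show ?thesis
  proof cases
    case 1 then show ?thesis by (intro exI[of _ 5] exI[of _ 0] conjI) (simp_all add: mdeg_def)
  next
    case 2 then show ?thesis by (intro exI[of _ 0] exI[of _ 5] exI[of _ 0] conjI) (simp_all add: mdeg_def)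
  next
    case 3 then show ?thesis by (intro exI[of _ 0] exI[of _ 0] exI[of _ 5] conjI) (simp_all add: mdeg_def)
  next
    case 4 then show ?thesis by (intro exI[of _ 1] exI[of _ 0] exI[of _ 1] conjI) (simp_all add: mdeg_def)
  next
    case 5 then show ?thesis by (intro exI[of _ 0] exI[of _ 2] exI[of _ 1] conjI) (simp_all add: mdeg_def)
  next
    case 6 then show ?thesis by (intro exI[of _ 0] exI[of _ 1] exI[of _ 3] conjI) (simp_all add: mdeg_def)
  next
    case 7 then show ?thesis by (intro exI[of _ 2] exI[of _ 1] exI[of _ 0] conjI) (simp_all add: mdeg_def)
  next
    case 8 then show ?thesis by (intro exI[of _ 1] exI[of _ 3] exI[of _ 0] conjI) (simp_all add: mdeg_def)
  qed
qed

abbreviation mpow where "mpow n \<equiv> ideal_power A mx n"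

lemma ideal_mpow: "ideal (mpow n) A"
  by (induction n) (auto intro: oneideal ideal_prod_is_ideal ideal_mx)

lemma mpow_carrier: "mpow n \<subseteq> carrier A"
  using additive_subgroup.a_subset[OF ideal.axioms(1)[OF ideal_mpow]] .

lemma mpow_Suc: "mpow (Suc n) \<subseteq> mpow n"
  using ideal_prod_inter[OF ideal_mx ideal_mpow] by auto

lemma mpow_mono: "m \<le> n \<Longrightarrow> mpow n \<subseteq> mpow m"
  by (induction n rule: dec_induct) (use mpow_Suc in blast)+

lemma mpow_add: "x \<in> mpow n \<Longrightarrow> y \<in> mpow n \<Longrightarrow> x \<oplus>\<^bsub>A\<^esub> y \<in> mpow n"
  using additive_subgroup.a_closed[OF ideal.axioms(1)[OF ideal_mpow]] .

lemma Em_mpow: "5 dvd mdeg i j k \<Longrightarrow> 5 * n \<le> i + j + k \<Longrightarrow> Em i j k \<in> mpow n"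
proof (induction n arbitrary: i j k)
  case 0
  then show ?case by (simp add: Em_carrier)
next
  case (Suc n)
  have "5 \<le> i + j + k" using Suc.prems(2) by simp
  then obtain i' j' k' where f: "i' \<le> i" "j' \<le> j" "k' \<le> k" "0 < i' + j' + k'" "i' + j' + k' \<le> 5" "5 dvd mdeg i' j' k'"
    using five_factors by blast
  have s: "i' + (i - i') = i" "j' + (j - j') = j" "k' + (k - k') = k" using f by auto
  have "mdeg i' j' k' + mdeg (i - i') (j - j') (k - k') = mdeg i j k" unfolding mdeg_add s ..
  then have d: "5 dvd mdeg (i - i') (j - j') (k - k')" using Suc.prems(1) f(6) by (metis dvd_add_right_iff)
  have "5 * n + 5 \<le> (i' + (i - i')) + (j' + (j - j')) + (k' + (k - k'))" unfolding s using Suc.prems(2) by simp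
  then have "5 * n + 5 \<le> (i - i' + (j - j') + (k - k')) + (i' + j' + k')" by (simp only: add_ac)
  then have "5 * n \<le> i - i' + (j - j') + (k - k')" using f(5) by (meson add_le_cancel_right add_le_mono le_trans order_refl)
  then have "Em (i - i') (j - j') (k - k') \<in> mpow n" by (rule Suc.IH[OF d])
  then have "Em i' j' k' \<otimes>\<^bsub>A\<^esub> Em (i - i') (j - j') (k - k') \<in> mpow (Suc n)"
    using Em_mx[OF f(6,4)] by (simp add: ideal_prod.prod)
  then show ?case unfolding Em_mult[OF f(6) d] s .
qed

lemma E_mpow:
  assumes "pq \<in> inv_exp" "25 * n \<le> fst pq + snd pq"
  shows "E pq \<in> mpow n"
proof -
  obtain p q where pq: "pq = (p, q)" by (cases pq)
  note d = inv_exp_mod[OF assms(1)[unfolded pq]]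
  have "5 * (p div 5) + p mod 5 = p" by simp
  moreover have "p mod 5 + 5 * (q div 5) = q" unfolding d(1) by simp
  ultimately have "5 * n \<le> p div 5 + p mod 5 + q div 5" using assms(2) unfolding pq fst_conv snd_conv by linarith
  then show ?thesis using Em_mpow[OF d(2)] by (simp add: E_def pq)
qed

lemma \<Phi>_mpow: "x \<in> mpow n \<Longrightarrow> ordge n (\<Phi> x)"
proof (induction n arbitrary: x)
  case (Suc n)
  have "x \<in> ideal_prod A mx (mpow n)" using Suc.prems by simp
  then have "x \<in> carrier A \<and> ordge (Suc n) (\<Phi> x)"
  proof (induction x rule: ideal_prod.induct)
    case (prod i j)
    have "i \<in> carrier A" "j \<in> carrier A" using prod mx_carrier mpow_carrier by auto
    moreover have "ordge (1 + n) (\<Phi> i * \<Phi> j)"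
      using prod Suc.IH by (intro ordge_mult) (auto simp: ordge_Suc_0_iff \<Phi>_mx)
    ultimately show ?case by (simp add: \<Phi>_simps)
  next
    case (sum s1 s2)
    then show ?case by (simp add: \<Phi>_simps ordge_add)
  qed
  then show ?case by simp
qed simp

subsection \<open>The maximal ideal is generated by invariant monomials\<close>

definition sat :: "S set \<Rightarrow> S set" where "sat J = {f. \<exists>h. peval ptz h \<noteq> 0 \<and> h * f \<in> J}"

lemma sat:
  assumes J: "pideal J"
  shows "pideal (sat J)" "J \<subseteq> sat J" "peval ptz h \<noteq> 0 \<Longrightarrow> h * f \<in> sat J \<Longrightarrow> f \<in> sat J"
proof -
  show s: "J \<subseteq> sat J" by (auto simp: sat_def intro!: exI[of _ 1])
  show "peval ptz h \<noteq> 0 \<Longrightarrow> h * f \<in> sat J \<Longrightarrow> f \<in> sat J"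
  proof -
    assume h: "peval ptz h \<noteq> 0" "h * f \<in> sat J"
    then obtain k where "peval ptz k \<noteq> 0" "k * (h * f) \<in> J" by (auto simp: sat_def)
    then have "peval ptz (k * h) \<noteq> 0 \<and> (k * h) * f \<in> J" using h by (simp add: mult.assoc)
    then show ?thesis unfolding sat_def by blast
  qed
  show "pideal (sat J)" unfolding pideal_def
  proof (intro conjI ballI allI)
    show "0 \<in> sat J" using s pidealD(1)[OF J] by blast
  next
    fix f g assume "f \<in> sat J" "g \<in> sat J"
    then obtain h k where h: "peval ptz h \<noteq> 0" "h * f \<in> J" "peval ptz k \<noteq> 0" "k * g \<in> J" by (auto simp: sat_def)
    have "(h * k) * (f + g) = k * (h * f) + h * (k * g)" by (simp add: algebra_simps)
    also have "\<dots> \<in> J" by (rule pidealD(2)[OF J pidealD(3)[OF J h(2)] pidealD(3)[OF J h(4)]])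
    finally have "peval ptz (h * k) \<noteq> 0 \<and> (h * k) * (f + g) \<in> J" using h by simp
    then show "f + g \<in> sat J" unfolding sat_def by blast
  next
    fix g f assume "f \<in> sat J"
    then obtain h where h: "peval ptz h \<noteq> 0" "h * f \<in> J" by (auto simp: sat_def)
    have "h * (g * f) = g * (h * f)" by (simp add: algebra_simps)
    then have "h * (g * f) \<in> J" using pidealD(3)[OF J h(2)] by (simp only:)
    then show "g * f \<in> sat J" unfolding sat_def using h by blast
  qed
qed

definition J0 where "J0 = pgen (X'_ideal \<theta> \<tau> P \<union> {sw, su1, sT})"

lemma J0: "f \<in> J0 \<Longrightarrow> \<exists>i\<in>X'_ideal \<theta> \<tau> P. \<exists>a b c. f = i + a * sw + b * su1 + c * sT"
proof -
  let ?K = "{f. \<exists>i\<in>X'_ideal \<theta> \<tau> P. \<exists>a b c. f = i + a * sw + b * su1 + c * sT}"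
  note I = pidealD[OF pideal_X'[of \<theta> \<tau> P]]
  have K: "f \<in> ?K" if "i \<in> X'_ideal \<theta> \<tau> P" "f = i + a * sw + b * su1 + c * sT" for f i a b c using that by blast
  have "pideal ?K" unfolding pideal_def
  proof (intro conjI ballI allI)
    show "0 \<in> ?K" by (rule K[of 0 _ 0 0 0]) (simp_all add: I)
  next
    fix f g assume "f \<in> ?K" "g \<in> ?K"
    then obtain i a b c i' a' b' c' where *: "i \<in> X'_ideal \<theta> \<tau> P" "f = i + a * sw + b * su1 + c * sT"
      "i' \<in> X'_ideal \<theta> \<tau> P" "g = i' + a' * sw + b' * su1 + c' * sT" by blast
    show "f + g \<in> ?K" by (rule K[of "i + i'" _ "a + a'" "b + b'" "c + c'"]) (simp_all add: * I algebra_simps)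
  next
    fix h f assume "f \<in> ?K"
    then obtain i a b c where *: "i \<in> X'_ideal \<theta> \<tau> P" "f = i + a * sw + b * su1 + c * sT" by blast
    show "h * f \<in> ?K" by (rule K[of "h * i" _ "h * a" "h * b" "h * c"]) (simp_all add: * I algebra_simps)
  qed
  moreover have "X'_ideal \<theta> \<tau> P \<union> {sw, su1, sT} \<subseteq> ?K"
  proof
    fix f assume "f \<in> X'_ideal \<theta> \<tau> P \<union> {sw, su1, sT}"
    then consider "f \<in> X'_ideal \<theta> \<tau> P" | "f = sw" | "f = su1" | "f = sT" by blast
    then show "f \<in> ?K"
    proof cases
      case 1 then show ?thesis by (intro K[of f _ 0 0 0]) simp_all
    next
      case 2 then show ?thesis by (intro K[of 0 _ 1 0 0]) (simp_all add: I)
    next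
      case 3 then show ?thesis by (intro K[of 0 _ 0 1 0]) (simp_all add: I)
    next
      case 4 then show ?thesis by (intro K[of 0 _ 0 0 1]) (simp_all add: I)
    qed
  qed
  ultimately show "f \<in> J0 \<Longrightarrow> \<exists>i\<in>X'_ideal \<theta> \<tau> P. \<exists>a b c. f = i + a * sw + b * su1 + c * sT"
    using pgen_minimal[of ?K] unfolding J0_def by blast
qed

lemma pideal_J0: "pideal J0" by (simp add: J0_def pideal_pgen)

lemma vars_in_J0: "i \<noteq> Vz \<Longrightarrow> pvar i \<in> sat J0"
proof -
  note s = sat[OF pideal_J0]
  note M = pidealD[OF s(1)]
  have gens: "sw \<in> sat J0" "su1 \<in> sat J0" "sT \<in> sat J0"
    using s(2) pgen_superset[of "X'_ideal \<theta> \<tau> P \<union> {sw, su1, sT}"] unfolding J0_def by auto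
  have IM: "f \<in> sat J0" if "f \<in> X'_ideal \<theta> \<tau> P" for f
    using s(2) pgen_superset[of "X'_ideal \<theta> \<tau> P \<union> {sw, su1, sT}"] that unfolding J0_def by auto
  have un: "f \<in> sat J0" if "P * f \<in> sat J0" for f using s(3)[of P f] that P_ptz by simp
  have Q: "Qf \<theta> \<tau> \<in> sat J0"
  proof -
    have "Qf \<theta> \<tau> = (pconst \<theta> * sz) * su1 + (pconst \<tau> * sw ^ 2) * sw" by (simp add: Qf_def power3_eq_cube power2_eq_square)
    then show ?thesis by (simp only:) (intro M(2) M(3) gens)
  qed
  have t: "st \<in> sat J0"
  proof (rule un)
    have "P * st = - sT - (pconst \<theta> * sz * su1 ^ 2) * su1 - (pconst \<tau> * sw ^ 3 * su1) * su1"
      by (simp add: sT_def algebra_simps power2_eq_square power3_eq_cube)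
    then show "P * st \<in> sat J0" by (simp only:) (intro M(6) M(5) M(3) gens)
  qed
  have y: "sy \<in> sat J0"
  proof (rule un)
    have "P * sy = (sy * P + sw * Qf \<theta> \<tau> + su1 ^ 3) - Qf \<theta> \<tau> * sw - (su1 ^ 2) * su1" by (simp add: algebra_simps power2_eq_square power3_eq_cube)
    moreover have "\<dots> \<in> sat J0" by (rule M(6)[OF M(6)[OF IM[OF X'_rel(13)] M(3)[OF gens(1)]] M(3)[OF gens(2)]])
    ultimately show "P * sy \<in> sat J0" by (simp only:)
  qed
  have x1: "sx1 \<in> sat J0"
  proof (rule un)
    have "P * sx1 = (sx1 * P + sy * Qf \<theta> \<tau> + su1 * st) - sy * Qf \<theta> \<tau> - su1 * st" by (simp add: algebra_simps)
    moreover have "\<dots> \<in> sat J0" by (rule M(6)[OF M(6)[OF IM[OF X'_rel(12)] M(3)[OF Q]] M(3)[OF t]])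
    ultimately show "P * sx1 \<in> sat J0" by (simp only:)
  qed
  have u0: "su0 \<in> sat J0"
  proof (rule un)
    have "P * su0 = (su0 * P + sx1 * su1 * Qf \<theta> \<tau> + st ^ 2) - (sx1 * su1) * Qf \<theta> \<tau> - st * st" by (simp add: algebra_simps power2_eq_square)
    moreover have "\<dots> \<in> sat J0" by (rule M(6)[OF M(6)[OF IM[OF X'_rel(14)] M(3)[OF Q]] M(3)[OF t]])
    ultimately show "P * su0 \<in> sat J0" by (simp only:)
  qed
  have x0: "sx0 \<in> sat J0"
  proof (rule un)
    have "P * sx0 = (sx0 * P + sx1 ^ 2 * Qf \<theta> \<tau> + su0 * st) - sx1 ^ 2 * Qf \<theta> \<tau> - su0 * st" by (simp add: algebra_simps)
    moreover have "\<dots> \<in> sat J0" by (rule M(6)[OF M(6)[OF IM[OF X'_rel(11)] M(3)[OF Q]] M(3)[OF t]])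
    ultimately show "P * sx0 \<in> sat J0" by (simp only:)
  qed
  assume "i \<noteq> Vz"
  then show ?thesis using x0 x1 u0 t y gens by (cases i) simp_all
qed

lemma vanishing_in_J0:
  assumes f: "hom d f" "peval ptz f = 0"
  shows "f \<in> sat J0"
proof -
  let ?\<zeta> = "\<lambda>i. if i = Vz then sz else (0 :: S)"
  note M = pidealD[OF sat(1)[OF pideal_J0]]
  have "f - psubst pconst ?\<zeta> f \<in> sat J0" for f
  proof (induction f rule: mpoly_induct)
    case (var i)
    then show ?case using vars_in_J0[of i] M(1) by (simp add: ishom_pconst)
  next
    case (add f g)
    have "f + g - psubst pconst ?\<zeta> (f + g) = (f - psubst pconst ?\<zeta> f) + (g - psubst pconst ?\<zeta> g)"
      by (simp add: psubst_simps ishom_pconst)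
    then show ?case using M(2)[OF add] by (simp only:)
  next
    case (mult f g)
    have "f * g - psubst pconst ?\<zeta> (f * g) = g * (f - psubst pconst ?\<zeta> f) + psubst pconst ?\<zeta> f * (g - psubst pconst ?\<zeta> g)"
      by (simp add: psubst_simps ishom_pconst algebra_simps)
    then show ?case using M(2)[OF M(3)[OF mult(1)] M(3)[OF mult(2)]] by (simp only:)
  qed (simp add: ishom_pconst M(1))
  moreover have "psubst pconst ?\<zeta> f = 0"
    unfolding psubst_def
  proof (intro sum.neutral ballI)
    fix m assume m: "m \<in> Poly_Mapping.keys f"
    show "pconst (Poly_Mapping.lookup f m) * meval ?\<zeta> m = 0"
    proof (cases "Poly_Mapping.keys m \<subseteq> {Vz}")
      case True
      then have e: "m = Poly_Mapping.single Vz (Poly_Mapping.lookup m Vz)"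
        by (intro poly_mapping_eqI) (auto simp: lookup_single when_def in_keys_iff)
      have "wdegree weights m = d" using f m by (simp add: whomogeneous_def)
      then have "5 * Poly_Mapping.lookup m Vz = d" by (subst (asm) e) simp
      then have "m = Poly_Mapping.single Vz (d div 5)" using e by auto
      then have "Poly_Mapping.lookup f m = 0" using peval_ptz[OF f(1)] f(2) by simp
      then show ?thesis by (simp add: pconst_0)
    next
      case False
      then obtain i where i: "i \<in> Poly_Mapping.keys m" "i \<noteq> Vz" by blast
      then have "?\<zeta> i ^ Poly_Mapping.lookup m i = 0" using i by (simp add: in_keys_iff zero_power)
      then have "meval ?\<zeta> m = 0" unfolding meval_def using i by (intro prod_zero) auto
      then show ?thesis by simp
    qed
  qed
  ultimately show ?thesis by (metis diff_zero)
qed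

lemma hcomp_nonvanishing: "peval ptz h \<noteq> 0 \<Longrightarrow> \<exists>e. peval ptz (hcomp weights e h) \<noteq> 0"
proof (rule ccontr)
  assume "peval ptz h \<noteq> 0" "\<nexists>e. peval ptz (hcomp weights e h) \<noteq> 0"
  moreover have "peval ptz h = (\<Sum>e\<le>wbound weights h. peval ptz (hcomp weights e h))"
    using arg_cong[OF sum_hcomp[of weights h, OF order_refl], of "peval ptz"] by simp
  ultimately show False by simp
qed

lemma nonvanishing_degree: "hom d f \<Longrightarrow> peval ptz f \<noteq> 0 \<Longrightarrow> 5 dvd d"
proof -
  assume f: "hom d f" "peval ptz f \<noteq> 0"
  then have "Poly_Mapping.single Vz (d div 5) \<in> Poly_Mapping.keys f" using peval_ptz[OF f(1)] by (simp add: in_keys_iff)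
  then have "5 * (d div 5) = d" using f(1) unfolding whomogeneous_def by fastforce
  then show "5 dvd d" by (metis dvd_triv_left)
qed

lemma vanishing_decomposition:
  assumes f: "hom d f" "peval ptz f = 0"
  shows "\<exists>h e i a b c. hom e h \<and> peval ptz h \<noteq> 0 \<and> i \<in> X'_ideal \<theta> \<tau> P \<and> h * f = i + a * sw + b * su1 + c * sT \<and>
     (hom (e + d - 3) a \<and> 3 \<le> e + d \<or> a = 0) \<and> (hom (e + d - 4) b \<and> 4 \<le> e + d \<or> b = 0) \<and> (hom (e + d - 17) c \<and> 17 \<le> e + d \<or> c = 0)"
proof -
  obtain h where h: "peval ptz h \<noteq> 0" "h * f \<in> J0" using vanishing_in_J0[OF f] by (auto simp: sat_def)
  obtain i a b c where i: "i \<in> X'_ideal \<theta> \<tau> P" "h * f = i + a * sw + b * su1 + c * sT" using J0[OF h(2)] by blast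
  obtain e where e: "peval ptz (hcomp weights e h) \<noteq> 0" using hcomp_nonvanishing[OF h(1)] by blast
  let ?c = "\<lambda>x. hcomp weights (e + d) x"
  have w: "hom 3 sw" "hom 4 su1" using whom_pvar[of weights Vw] whom_pvar[of weights Vu1] by simp_all
  have "hcomp weights e h * f = ?c (h * f)" by (simp add: hcomp_mult[OF f(1)])
  also have "\<dots> = ?c i + ?c (a * sw) + ?c (b * su1) + ?c (c * sT)" unfolding i(2) by (simp add: hcomp_add)
  finally have eq: "hcomp weights e h * f = ?c i + (if 3 \<le> e + d then hcomp weights (e + d - 3) a else 0) * sw +
    (if 4 \<le> e + d then hcomp weights (e + d - 4) b else 0) * su1 + (if 17 \<le> e + d then hcomp weights (e + d - 17) c else 0) * sT"
    by (simp add: hcomp_mult[OF w(1)] hcomp_mult[OF w(2)] hcomp_mult[OF hom_sT])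
  have "?c i \<in> X'_ideal \<theta> \<tau> P" using hideal i(1) by (simp add: hideal_def)
  moreover have p: "hom (e + d - n) (if n \<le> e + d then hcomp weights (e + d - n) x else 0) \<and> n \<le> e + d \<or>
    (if n \<le> e + d then hcomp weights (e + d - n) x else 0) = 0" for n x by (simp add: whom_hcomp)
  ultimately show ?thesis
    by (intro exI[of _ "hcomp weights e h"] exI[of _ e] exI[of _ "?c i"] exI[of _ "if 3 \<le> e + d then hcomp weights (e + d - 3) a else 0"]
      exI[of _ "if 4 \<le> e + d then hcomp weights (e + d - 4) b else 0"] exI[of _ "if 17 \<le> e + d then hcomp weights (e + d - 17) c else 0"]
      conjI p e eq whom_hcomp)
qed

definition Inv :: "S set" where "Inv = {mu i j k | i j k. 0 < i + j + k \<and> 5 dvd mdeg i j k}"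
definition J1 where "J1 = pgen (X'_ideal \<theta> \<tau> P \<union> Inv)"

lemma pideal_J1: "pideal J1" by (simp add: J1_def pideal_pgen)

lemma Inv_J1: "0 < i + j + k \<Longrightarrow> 5 dvd mdeg i j k \<Longrightarrow> mu i j k \<in> sat J1"
proof -
  assume "0 < i + j + k" "5 dvd mdeg i j k"
  then have "mu i j k \<in> Inv" unfolding Inv_def by blast
  then show ?thesis using sat(2)[OF pideal_J1] pgen_superset[of "X'_ideal \<theta> \<tau> P \<union> Inv"] unfolding J1_def by blast
qed

lemma invariant_vanishing_in_J1:
  assumes "hom d f" "5 dvd d + mdeg i j k" "peval ptz f = 0 \<or> 0 < i + j + k"
  shows "mu i j k * f \<in> sat J1"
  using assms
proof (induction "5 - (i + j + k)" arbitrary: d f i j k rule: less_induct)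
  case less
  note M = pidealD[OF sat(1)[OF pideal_J1]]
  show ?case
  proof (cases "5 \<le> i + j + k")
    case True
    then obtain i' j' k' where f: "i' \<le> i" "j' \<le> j" "k' \<le> k" "0 < i' + j' + k'" "5 dvd mdeg i' j' k'" using five_factors by blast
    have s: "i' + (i - i') = i" "j' + (j - j') = j" "k' + (k - k') = k" using f by auto
    have "mu i j k * f = (mu (i - i') (j - j') (k - k') * f) * mu i' j' k'"
      using mu_add[of i' j' k' "i - i'" "j - j'" "k - k'"] unfolding s by (simp add: mult_ac)
    then show ?thesis using M(3)[OF Inv_J1[OF f(4,5)]] by (simp only:)
  next
    case lt: False
    show ?thesis
    proof (cases "peval ptz f = 0")
      case False
      then have "5 dvd d" using nonvanishing_degree less.prems(1) by blast
      then have "5 dvd mdeg i j k" using less.prems(2) by (simp add: dvd_add_right_iff)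
      then have "mu i j k \<in> sat J1" using less.prems(3) False by (intro Inv_J1) auto
      then show ?thesis by (rule M(4))
    next
      case True
      obtain h e r a b c where h: "hom e h" "peval ptz h \<noteq> 0" "r \<in> X'_ideal \<theta> \<tau> P" "h * f = r + a * sw + b * su1 + c * sT"
       "hom (e + d - 3) a \<and> 3 \<le> e + d \<or> a = 0" "hom (e + d - 4) b \<and> 4 \<le> e + d \<or> b = 0" "hom (e + d - 17) c \<and> 17 \<le> e + d \<or> c = 0"
        using vanishing_decomposition[OF less.prems(1) True] by blast
      have e5: "5 dvd e" using nonvanishing_degree h by blast
      then have tot: "5 dvd e + d + mdeg i j k" using less.prems(2) by (simp add: add.assoc)
      have "mu (Suc i) j k * a \<in> sat J1"
      proof (cases "a = 0")
        case False
        then have a: "hom (e + d - 3) a" "3 \<le> e + d" using h(5) by auto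
        show ?thesis
        proof (rule less.hyps[OF _ a(1)])
          have "e + d - 3 + mdeg (Suc i) j k = e + d + mdeg i j k" using a(2) by (simp add: mdeg_def)
          then show "5 dvd e + d - 3 + mdeg (Suc i) j k" using tot by simp
        qed (use lt in auto)
      qed (simp add: M(1))
      moreover have "mu i (Suc j) k * b \<in> sat J1"
      proof (cases "b = 0")
        case False
        then have b: "hom (e + d - 4) b" "4 \<le> e + d" using h(6) by auto
        show ?thesis
        proof (rule less.hyps[OF _ b(1)])
          have "e + d - 4 + mdeg i (Suc j) k = e + d + mdeg i j k" using b(2) by (simp add: mdeg_def)
          then show "5 dvd e + d - 4 + mdeg i (Suc j) k" using tot by simp
        qed (use lt in auto)
      qed (simp add: M(1))
      moreover have "mu i j (Suc k) * c \<in> sat J1"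
      proof (cases "c = 0")
        case False
        then have c: "hom (e + d - 17) c" "17 \<le> e + d" using h(7) by auto
        show ?thesis
        proof (rule less.hyps[OF _ c(1)])
          have "e + d - 17 + mdeg i j (Suc k) = e + d + mdeg i j k" using c(2) by (simp add: mdeg_def)
          then show "5 dvd e + d - 17 + mdeg i j (Suc k)" using tot by simp
        qed (use lt in auto)
      qed (simp add: M(1))
      moreover have "mu i j k * r \<in> sat J1"
      proof -
        have "r \<in> sat J1" using h(3) sat(2)[OF pideal_J1] pgen_superset[of "X'_ideal \<theta> \<tau> P \<union> Inv"] unfolding J1_def by blast
        then show ?thesis by (rule M(3))
      qed
      moreover have "h * (mu i j k * f) = mu i j k * r + mu (Suc i) j k * a + mu i (Suc j) k * b + mu i j (Suc k) * c"
      proof -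
        have "h * (mu i j k * f) = mu i j k * (h * f)" by (simp add: mult_ac)
        then show ?thesis unfolding h(4) by (simp add: mu_def algebra_simps)
      qed
      ultimately have "h * (mu i j k * f) \<in> sat J1" by (simp only: M(2))
      then show ?thesis using sat(3)[OF pideal_J1 h(2)] by blast
    qed
  qed
qed

lemma mx_subset_invariants: "mx \<subseteq> genideal A (E ` (inv_exp - {(0, 0)}))"
proof
  let ?G = "E ` (inv_exp - {(0, 0)})"
  let ?K = "genideal A ?G"
  have G: "?G \<subseteq> carrier A" using E_props(1) by blast
  have K: "ideal ?K A" by (rule genideal_ideal[OF G])
  fix x assume "x \<in> mx"
  then obtain f g where x: "x = frac f g" "ok f g" "peval ptz f = 0" by (auto simp: mx_def)
  then obtain d where d: "hom d f" "hom d g" "peval ptz g \<noteq> 0" by (auto simp: ok_def)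
  have d5: "5 dvd d" using nonvanishing_degree d by blast
  have "mu 0 0 0 * f \<in> sat J1" using d5 x(3) by (intro invariant_vanishing_in_J1[OF d(1)]) (auto simp: mdeg_def)
  then obtain h where h: "peval ptz h \<noteq> 0" "h * f \<in> J1" by (auto simp: sat_def mu_def)
  obtain e where e: "peval ptz (hcomp weights e h) \<noteq> 0" using hcomp_nonvanishing[OF h(1)] by blast
  obtain F v where F: "finite F" "F \<subseteq> X'_ideal \<theta> \<tau> P \<union> Inv" "h * f = (\<Sum>k\<in>F. v k * k)"
    using pgen_finite_sum[OF h(2)[unfolded J1_def]] by blast
  define h' where "h' = hcomp weights e h"
  have h': "hom e h'" "peval ptz h' \<noteq> 0" using e by (simp_all add: h'_def whom_hcomp)
  have hf: "hom (e + d) (h' * f)" "hom (e + d) (h' * g)" "peval ptz (h' * g) \<noteq> 0"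
    using whom_mult[OF h'(1) d(1)] whom_mult[OF h'(1) d(2)] h' d by auto
  have "h' * f = hcomp weights (e + d) (h * f)" by (simp add: h'_def hcomp_mult[OF d(1)])
  also have "\<dots> = (\<Sum>k\<in>F. hcomp weights (e + d) (v k * k))" unfolding F(3) by (rule hcomp_sum)
  finally have eq: "h' * f = (\<Sum>k\<in>F. hcomp weights (e + d) (v k * k))" .
  have ed5: "5 dvd e + d" using nonvanishing_degree[OF hf(2,3)] .
  have "frac (\<Sum>k\<in>F. hcomp weights (e + d) (v k * k)) (h' * g) \<in> ?K"
  proof (rule frac_sum_in[OF K hf(2,3) whom_hcomp])
    fix k assume k: "k \<in> F"
    show "frac (hcomp weights (e + d) (v k * k)) (h' * g) \<in> ?K"
    proof (cases "k \<in> X'_ideal \<theta> \<tau> P")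
      case True
      then have "hcomp weights (e + d) (v k * k) \<in> X'_ideal \<theta> \<tau> P"
        using hideal pidealD(3)[OF pideal_X' True] by (simp add: hideal_def)
      moreover have "ok (hcomp weights (e + d) (v k * k)) (h' * g)"
        unfolding ok_def using hf(2,3) whom_hcomp[of weights "e + d" "v k * k"] by blast
      moreover have "ok 0 1" unfolding ok_def by (auto intro!: exI[of _ 0] simp: whom_1)
      ultimately have "frac (hcomp weights (e + d) (v k * k)) (h' * g) = frac 0 1" by (intro frac_eqI) simp_all
      then show ?thesis using additive_subgroup.zero_closed[OF ideal.axioms(1)[OF K]] by (simp add: zero_A)
    next
      case False
      then obtain i j l where m: "k = mu i j l" "0 < i + j + l" "5 dvd mdeg i j l" using k F(2) by (auto simp: Inv_def)
      show ?thesis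
      proof (cases "mdeg i j l \<le> e + d")
        case True
        define n where "n = mdeg i j l div 5"
        have n: "5 * n = mdeg i j l" using m(3) by (simp add: n_def)
        define w where "w = hcomp weights (e + d - mdeg i j l) (v k)"
        have w: "hom (e + d - mdeg i j l) w" by (simp add: w_def whom_hcomp)
        have hz: "hom (5 * n) (sz ^ n)" using whom_power[OF whom_pvar[of weights Vz], of n] by simp
        have wz: "hom (e + d) (w * sz ^ n)" "hom (e + d) (w * k)"
          using whom_mult[OF w hz] whom_mult[OF w hom_mu[of i j l]] True n m(1) by simp_all
        have o: "ok (w * sz ^ n) (h' * g)" "ok (w * k) (h' * g)" using wz hf by (auto simp: ok_def)
        have om: "ok k (sz ^ n)" using ok_mu[OF m(3)] by (simp add: m(1) n_def)
        have "frac (w * k) (h' * g) = frac (w * sz ^ n) (h' * g) \<otimes>\<^bsub>A\<^esub> frac k (sz ^ n)"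
          unfolding frac_mult[OF o(1) om] by (intro frac_eqI' o ok_mult om) (simp add: mult_ac)
        also have "\<dots> \<in> ?K"
        proof (rule ideal.I_l_closed[OF K])
          have Ek: "frac k (sz ^ n) = E (5 * i + j, j + 5 * l)" using Em_eq_E[OF m(3)] by (simp add: Em_def m(1) n_def)
          have "(5 * i + j + 14 * (j + 5 * l)) mod 25 = 0"
          proof -
            have "5 dvd 2 * (3 * i + 4 * j + 17 * l)" using m(3) unfolding mdeg_def by (rule dvd_mult)
            moreover have "2 * (3 * i + 4 * j + 17 * l) = (i + 3 * j + 14 * l) + 5 * (i + j + 4 * l)" by simp
            ultimately have "5 dvd i + 3 * j + 14 * l" by (metis dvd_add_left_iff dvd_triv_left)
            then have "(i + 3 * j + 14 * l) mod 5 = 0" by (simp only: dvd_eq_mod_eq_0)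
            then have "(5 * (i + 3 * j + 14 * l)) mod (5 * 5) = 0" unfolding mult_mod_right[symmetric] by simp
            then show ?thesis by (simp add: algebra_simps)
          qed
          then have "(5 * i + j, j + 5 * l) \<in> inv_exp - {(0, 0)}" using m(2) by (auto simp: inv_exp_def)
          then show "frac k (sz ^ n) \<in> ?K" unfolding Ek using genideal_self[OF G] by blast
          show "frac (w * sz ^ n) (h' * g) \<in> carrier A" using o by simp
        qed
        finally show ?thesis using True hcomp_mult[OF hom_mu[of i j l], of "e + d" "v k"] by (simp add: m(1) w_def)
      next
        case False
        then have "hcomp weights (e + d) (v k * k) = 0" using hcomp_mult[OF hom_mu[of i j l], of "e + d" "v k"] by (simp add: m(1))
        then show ?thesis using frac_zero[OF hf(2,3)] additive_subgroup.zero_closed[OF ideal.axioms(1)[OF K]] by simp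
      qed
    qed
  qed
  moreover have "x = frac (h' * f) (h' * g)"
    unfolding x(1) using x(2) hf by (intro frac_eqI') (auto simp: ok_def)
  ultimately show "x \<in> ?K" unfolding eq by simp
qed

end

section \<open>The completed local ring as a ring of power series\<close>

lemma K_eq_if_close: "(\<And>n. ordge n (F - G)) \<Longrightarrow> F = G"
proof (rule K_eqI)
  fix p q assume "\<And>n. ordge n (F - G)"
  then have "kc p q (F - G) = 0" unfolding ordge_kc by blast
  then show "kc p q F = kc p q G" by simp
qed

lemma (in cring) completion_iso_power_series:
  fixes \<phi> :: "'a \<Rightarrow> K" and C :: "K set" and \<nu> :: "nat \<Rightarrow> nat"
  assumes I: "ideal I R"
    and mult: "\<And>x y. x \<in> carrier R \<Longrightarrow> y \<in> carrier R \<Longrightarrow> \<phi> (x \<otimes> y) = \<phi> x * \<phi> y"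
    and add: "\<And>x y. x \<in> carrier R \<Longrightarrow> y \<in> carrier R \<Longrightarrow> \<phi> (x \<oplus> y) = \<phi> x + \<phi> y" and one: "\<phi> \<one> = 1"
    and cont: "\<And>x n. x \<in> ideal_power R I n \<Longrightarrow> ordge n (\<phi> x)"
    and separated: "\<And>x n. x \<in> carrier R \<Longrightarrow> ordge (\<nu> n) (\<phi> x) \<Longrightarrow> x \<in> ideal_power R I n"
    and \<nu>: "\<And>n. n \<le> \<nu> n" "\<And>n. \<nu> n \<le> \<nu> (Suc n)"
    and image: "\<And>x. x \<in> carrier R \<Longrightarrow> \<phi> x \<in> C"
    and dense: "\<And>F n. F \<in> C \<Longrightarrow> \<exists>x\<in>carrier R. ordge n (F - \<phi> x)"
    and closed: "\<And>F. (\<And>n. \<exists>G\<in>C. ordge n (F - G)) \<Longrightarrow> F \<in> C"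
  shows "\<exists>\<psi> \<in> ring_iso (completion R I) ((ring_of_type_algebra :: K ring) \<lparr>carrier := C\<rparr>).
    \<forall>x\<in>carrier R. \<psi> (completion_map R I x) = \<phi> x"
proof -
  let ?C = "completion R I" and ?p = "ideal_power R I"
  have p: "ideal (?p n) R" for n
    by (induction n) (auto intro: oneideal ideal_prod_is_ideal I)
  have sub: "abelian_subgroup (?p n) R" for n using p by (simp add: abelian_subgroupI3 ideal.axioms(1) is_abelian_group)
  have desc: "?p (Suc n) \<subseteq> ?p n" for n using ideal_prod_inter[OF I p] by auto
  have diff: "\<phi> (x \<ominus> y) = \<phi> x - \<phi> y" if "x \<in> carrier R" "y \<in> carrier R" for x y
    using add[of "x \<ominus> y" y] that by (simp add: minus_add_cancel)
  have close: "ordge n (\<phi> x - \<phi> y)" if "x \<in> carrier R" "y \<in> carrier R" "?p n +> x = ?p n +> y" for x y n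
    using cont[of "x \<ominus> y" n] that quotient_eq_iff_same_a_r_cos[OF p that(1,2)] by (simp add: diff)
  have elem: "s n \<in> carrier (R Quot ?p n)" "s (Suc n) \<subseteq> s n" if "s \<in> carrier ?C" for s n
    using that by (auto simp: completion_def)
  have rep: "\<exists>x\<in>carrier R. s n = ?p n +> x" if "s \<in> carrier ?C" for s n
    using elem(1)[OF that, of n] by (auto simp: FactRing_def A_RCOSETS_def RCOSETS_def a_r_coset_def)
  have coset: "s m = ?p m +> x" if s: "s \<in> carrier ?C" and x: "x \<in> carrier R" "s n = ?p n +> x" and "m \<le> n" for s x m n
  proof -
    have "s n \<subseteq> s m" using \<open>m \<le> n\<close> by (induction n rule: dec_induct) (use elem(2)[OF s] in blast)+
    moreover have "x \<in> s n" unfolding x(2) by (rule abelian_subgroup.a_rcos_self[OF sub x(1)])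
    moreover obtain y where y: "y \<in> carrier R" "s m = ?p m +> y" using rep[OF s] by blast
    ultimately have "x \<in> ?p m +> y" by auto
    then show ?thesis unfolding y(2) by (rule abelian_subgroup.a_repr_independence'[OF sub _ y(1)])
  qed
  define lim where "lim s L \<longleftrightarrow> (\<forall>n. \<exists>x\<in>carrier R. s n = ?p n +> x \<and> ordge n (L - \<phi> x))" for s L
  have limD: "ordge n (L - \<phi> x)" if s: "lim s L" and x: "x \<in> carrier R" "s n = ?p n +> x" for s L x n
  proof -
    obtain y where y: "y \<in> carrier R" "s n = ?p n +> y" "ordge n (L - \<phi> y)" using s unfolding lim_def by blast
    have "ordge n (\<phi> y - \<phi> x)" by (rule close) (use y x in auto)
    then show ?thesis using ordge_add[OF y(3)] by fastforce
  qed
  have lim_unique: "L = L'" if s: "lim s L" and s': "lim s L'" for s L L'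
  proof (rule K_eq_if_close)
    fix n
    obtain y where y: "y \<in> carrier R" "s n = ?p n +> y" "ordge n (L - \<phi> y)" using s unfolding lim_def by blast
    have "ordge n (L' - \<phi> y)" by (rule limD[OF s' y(1,2)])
    then show "ordge n (L - L')" using ordge_diff[OF y(3)] by fastforce
  qed
  have lim_ex: "\<exists>L. lim s L" if s: "s \<in> carrier ?C" for s
  proof -
    obtain r where r: "\<And>n. r n \<in> carrier R" "\<And>n. s n = ?p n +> r n" using rep[OF s] by metis
    have "ordge k (\<phi> (r (Suc k)) - \<phi> (r k))" for k
    proof (rule close[OF r(1) r(1)])
      have "s k = ?p k +> r (Suc k)" by (rule coset[OF s r(1) r(2)]) simp
      then show "?p k +> r (Suc k) = ?p k +> r k" using r(2) by simp
    qed
    then obtain L where "\<forall>k. ordge k (L - \<phi> (r k))" using K_limit[of "\<lambda>k. \<phi> (r k)"] by blast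
    then show ?thesis unfolding lim_def using r by blast
  qed
  define \<psi> where "\<psi> s = (SOME L. lim s L)" for s
  have \<psi>: "lim s (\<psi> s)" if "s \<in> carrier ?C" for s unfolding \<psi>_def by (rule someI_ex[OF lim_ex[OF that]])
  have \<psi>_eq: "\<psi> s = L" if "lim s L" for s L
  proof -
    have "lim s (\<psi> s)" unfolding \<psi>_def by (rule someI[of "lim s", OF that])
    then show ?thesis using lim_unique that by blast
  qed
  have lim_mult: "lim (s \<otimes>\<^bsub>?C\<^esub> s') (L * L')" if s: "lim s L" and s': "lim s' L'" for s s' L L'
    unfolding lim_def
  proof
    fix n
    obtain x where x: "x \<in> carrier R" "s n = ?p n +> x" "ordge n (L - \<phi> x)" using s unfolding lim_def by blast
    obtain y where y: "y \<in> carrier R" "s' n = ?p n +> y" "ordge n (L' - \<phi> y)" using s' unfolding lim_def by blast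
    have "(s \<otimes>\<^bsub>?C\<^esub> s') n = ?p n +> (x \<otimes> y)"
      using ideal.rcoset_mult_add[OF p x(1) y(1), of n] x(2) y(2) by (simp add: completion_def FactRing_def)
    moreover have "L * L' - \<phi> (x \<otimes> y) = L * (L' - \<phi> y) + (L - \<phi> x) * \<phi> y" using x y by (simp add: mult algebra_simps)
    moreover have "ordge n (L * (L' - \<phi> y) + (L - \<phi> x) * \<phi> y)"
      using ordge_mult[OF ordge_triv[of L] y(3)] ordge_mult[OF x(3) ordge_triv[of "\<phi> y"]] by (simp add: ordge_add)
    ultimately show "\<exists>x\<in>carrier R. (s \<otimes>\<^bsub>?C\<^esub> s') n = ?p n +> x \<and> ordge n (L * L' - \<phi> x)"
      using x(1) y(1) by (intro bexI[of _ "x \<otimes> y"] conjI) simp_all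
  qed
  have lim_add: "lim (s \<oplus>\<^bsub>?C\<^esub> s') (L + L')" if s: "lim s L" and s': "lim s' L'" for s s' L L'
    unfolding lim_def
  proof
    fix n
    obtain x where x: "x \<in> carrier R" "s n = ?p n +> x" "ordge n (L - \<phi> x)" using s unfolding lim_def by blast
    obtain y where y: "y \<in> carrier R" "s' n = ?p n +> y" "ordge n (L' - \<phi> y)" using s' unfolding lim_def by blast
    have "(s \<oplus>\<^bsub>?C\<^esub> s') n = ?p n +> (x \<oplus> y)"
      using abelian_subgroup.a_rcos_sum[OF sub x(1) y(1), of n] x(2) y(2) by (simp add: completion_def FactRing_def)
    moreover have "ordge n (L + L' - \<phi> (x \<oplus> y))"
      using ordge_add[OF x(3) y(3)] x y by (simp add: add algebra_simps)
    ultimately show "\<exists>x\<in>carrier R. (s \<oplus>\<^bsub>?C\<^esub> s') n = ?p n +> x \<and> ordge n (L + L' - \<phi> x)"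
      using x(1) y(1) by (intro bexI[of _ "x \<oplus> y"] conjI) simp_all
  qed
  have lim_map: "lim (completion_map R I x) (\<phi> x)" if "x \<in> carrier R" for x
    unfolding lim_def completion_map_def using that by (intro allI bexI[of _ x]) simp_all
  have lim_one: "lim \<one>\<^bsub>?C\<^esub> 1"
    using lim_map[OF one_closed] by (simp add: one completion_map_def completion_def FactRing_def)
  have lim_C: "L \<in> C" if s: "lim s L" for s L
  proof (rule closed)
    fix n
    obtain y where "y \<in> carrier R" "ordge n (L - \<phi> y)" using s unfolding lim_def by blast
    then show "\<exists>G\<in>C. ordge n (L - G)" using image by blast
  qed
  have "inj_on \<psi> (carrier ?C)"
  proof (rule inj_onI)
    fix s s' assume s: "s \<in> carrier ?C" "s' \<in> carrier ?C" and e: "\<psi> s = \<psi> s'"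
    show "s = s'"
    proof
      fix n
      obtain x where x: "x \<in> carrier R" "s (\<nu> n) = ?p (\<nu> n) +> x" using rep[OF s(1)] by blast
      obtain y where y: "y \<in> carrier R" "s' (\<nu> n) = ?p (\<nu> n) +> y" using rep[OF s(2)] by blast
      have "ordge (\<nu> n) (\<psi> s' - \<phi> y - (\<psi> s - \<phi> x))"
        by (rule ordge_diff[OF limD[OF \<psi>[OF s(2)] y] limD[OF \<psi>[OF s(1)] x]])
      then have "ordge (\<nu> n) (\<phi> (x \<ominus> y))" using x y by (simp add: diff e)
      then have "x \<ominus> y \<in> ?p n" using x(1) y(1) by (intro separated) simp_all
      then have "?p n +> x = ?p n +> y" using quotient_eq_iff_same_a_r_cos[OF p x(1) y(1)] by blast
      then show "s n = s' n" using coset[OF s(1) x \<nu>(1)] coset[OF s(2) y \<nu>(1)] by simp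
    qed
  qed
  moreover have "\<psi> ` carrier ?C = C"
  proof
    show "\<psi> ` carrier ?C \<subseteq> C" using \<psi> lim_C by blast
    show "C \<subseteq> \<psi> ` carrier ?C"
    proof
      fix F assume "F \<in> C"
      then obtain f where f: "\<And>n. f n \<in> carrier R" "\<And>n. ordge n (F - \<phi> (f n))" using dense by metis
      define s where "s n = ?p n +> f (\<nu> n)" for n
      have "s (Suc n) \<subseteq> s n" for n
      proof -
        have "ordge (\<nu> n) (\<phi> (f (\<nu> (Suc n)) \<ominus> f (\<nu> n)))"
          using ordge_diff[OF f(2)[of "\<nu> n"] ordge_mono[OF f(2)[of "\<nu> (Suc n)"] \<nu>(2)[of n]]] f(1) by (simp add: diff)
        then have "f (\<nu> (Suc n)) \<ominus> f (\<nu> n) \<in> ?p n" using f(1) by (intro separated) simp_all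
        then have "?p n +> f (\<nu> (Suc n)) = ?p n +> f (\<nu> n)" using quotient_eq_iff_same_a_r_cos[OF p f(1) f(1)] by blast
        moreover have "?p (Suc n) +> z \<subseteq> ?p n +> z" for z using desc[of n] unfolding a_r_coset_def' by blast
        ultimately show ?thesis unfolding s_def by blast
      qed
      then have "s \<in> carrier ?C" using f(1) by (auto simp: completion_def s_def FactRing_def A_RCOSETS_def RCOSETS_def a_r_coset_def)
      moreover have "lim s F" unfolding lim_def s_def using f(1) ordge_mono[OF f(2) \<nu>(1)] by blast
      ultimately show "F \<in> \<psi> ` carrier ?C" using \<psi>_eq by (intro image_eqI[of _ _ s]) simp_all
    qed
  qed
  moreover have "\<psi> \<in> Ring.ring_hom ?C ((ring_of_type_algebra :: K ring) \<lparr>carrier := C\<rparr>)"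
  proof (rule ring_hom_memI)
    fix s assume s: "s \<in> carrier ?C"
    show "\<psi> s \<in> carrier ((ring_of_type_algebra :: K ring) \<lparr>carrier := C\<rparr>)" using lim_C[OF \<psi>[OF s]] by simp
    fix s' assume s': "s' \<in> carrier ?C"
    show "\<psi> (s \<otimes>\<^bsub>?C\<^esub> s') = \<psi> s \<otimes>\<^bsub>(ring_of_type_algebra :: K ring) \<lparr>carrier := C\<rparr>\<^esub> \<psi> s'"
      using \<psi>_eq[OF lim_mult[OF \<psi>[OF s] \<psi>[OF s']]] by (simp add: ring_of_type_algebra_def)
    show "\<psi> (s \<oplus>\<^bsub>?C\<^esub> s') = \<psi> s \<oplus>\<^bsub>(ring_of_type_algebra :: K ring) \<lparr>carrier := C\<rparr>\<^esub> \<psi> s'"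
      using \<psi>_eq[OF lim_add[OF \<psi>[OF s] \<psi>[OF s']]] by (simp add: ring_of_type_algebra_def)
  next
    show "\<psi> \<one>\<^bsub>?C\<^esub> = \<one>\<^bsub>(ring_of_type_algebra :: K ring) \<lparr>carrier := C\<rparr>\<^esub>"
      using \<psi>_eq[OF lim_one] by (simp add: ring_of_type_algebra_def)
  qed
  ultimately have "\<psi> \<in> ring_iso ?C ((ring_of_type_algebra :: K ring) \<lparr>carrier := C\<rparr>)"
    by (simp add: ring_iso_def bij_betw_def)
  then show ?thesis using \<psi>_eq[OF lim_map] by blast
qed

lemma cyclic_invariants_gr: "cyclic_invariants 25 1 14 = (ring_of_type_algebra :: K ring) \<lparr>carrier := {F. gr 0 F}\<rparr>"
proof -
  have k: "kc p q (diagonal_action 1 14 \<zeta> F) = \<zeta> ^ (p + 14 * q) * kc p q F" for p q \<zeta> F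
    by (simp add: kc_def diagonal_action_def power_add power_mult)
  have "(\<forall>\<zeta>. \<zeta> ^ 25 = 1 \<longrightarrow> diagonal_action 1 14 \<zeta> F = F) \<longleftrightarrow> gr 0 F" for F
  proof
    assume inv: "\<forall>\<zeta>. \<zeta> ^ 25 = 1 \<longrightarrow> diagonal_action 1 14 \<zeta> F = F"
    define \<zeta> where "\<zeta> = cis (2 * pi / 25)"
    have "\<zeta> ^ 25 = 1" by (simp add: \<zeta>_def DeMoivre)
    then have fx: "diagonal_action 1 14 \<zeta> F = F" using inv by blast
    show "gr 0 F" unfolding gr_def
    proof (intro allI impI)
      fix p q assume nz: "kc p q F \<noteq> 0"
      define n where "n = p + 14 * q"
      have "\<zeta> ^ n * kc p q F = 1 * kc p q F" using k[of p q \<zeta> F] unfolding fx n_def by simp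
      then have "\<zeta> ^ n = 1" using nz by (simp only: mult_cancel_right) simp
      then have "cos (real n * (2 * pi / 25)) = 1" by (simp add: \<zeta>_def DeMoivre complex_eq_iff)
      then obtain j :: int where "real n * (2 * pi / 25) = j * (2 * pi)" unfolding cos_one_2pi_int by (auto simp: mult_ac)
      then have "real n = 25 * j" by (simp add: field_simps)
      then have "int n = 25 * j" by linarith
      then have "25 dvd n" by presburger
      then show "(p + 14 * q) mod 25 = 0 mod 25" unfolding n_def by simp
    qed
  next
    assume g: "gr 0 F"
    show "\<forall>\<zeta>. \<zeta> ^ 25 = 1 \<longrightarrow> diagonal_action 1 14 \<zeta> F = F"
    proof (intro allI impI K_eqI)
      fix \<zeta> :: complex and p q assume z: "\<zeta> ^ 25 = 1"
      show "kc p q (diagonal_action 1 14 \<zeta> F) = kc p q F"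
      proof (cases "kc p q F = 0")
        case False
        then have "(p + 14 * q) mod 25 = 0" using grD[OF g] by simp
        then obtain m where "p + 14 * q = 25 * m" by (auto simp: mod_eq_0_iff_dvd)
        then have "\<zeta> ^ (p + 14 * q) = 1" using z by (simp add: power_mult)
        then show ?thesis unfolding k by simp
      qed (simp only: k mult_zero_right)
    qed
  qed
  then show ?thesis by (simp add: cyclic_invariants_def)
qed

context cone_point
begin

abbreviation sc where "sc \<equiv> stalk_const weights (X'_ideal \<theta> \<tau> P) (worbit weights ptz)"

lemma sc_frac: "sc c = frac (pconst c) 1" by (simp add: stalk_const_def frac_def)

lemma ok_const: "ok (pconst c) 1" unfolding ok_def by (intro conjI exI[of _ 0] whom_pconst whom_1) simp

lemma sc_carrier [simp]: "sc c \<in> carrier A" unfolding sc_frac by (rule frac_in[OF ok_const])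

lemma sc_add: "sc (c + d) = sc c \<oplus>\<^bsub>A\<^esub> sc d"
  unfolding sc_frac frac_add[OF ok_const ok_const] by (simp add: ishomD[OF ishom_pconst])

lemma sc_0: "sc 0 = \<zero>\<^bsub>A\<^esub>" by (simp add: sc_frac zero_A pconst_0)

lemma \<Phi>_sc: "\<Phi> (sc c) = cst c"
  using \<Phi>(2)[OF ok_const[of c]] by (simp add: sc_frac psubst_simps ishom_cst)

inductive_set V where
  V_zero: "\<zero>\<^bsub>A\<^esub> \<in> V"
| V_step: "v \<in> V \<Longrightarrow> pq \<in> inv_exp \<Longrightarrow> v \<oplus>\<^bsub>A\<^esub> (sc c \<otimes>\<^bsub>A\<^esub> E pq) \<in> V"

lemma V_carrier: "v \<in> V \<Longrightarrow> v \<in> carrier A"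
  by (induction rule: V.induct) (simp_all add: E_props(1))

lemma V_add: "w \<in> V \<Longrightarrow> v \<in> V \<Longrightarrow> v \<oplus>\<^bsub>A\<^esub> w \<in> V"
proof (induction rule: V.induct)
  case V_zero
  then show ?case by (simp add: V_carrier)
next
  case (V_step w pq c)
  have "v \<oplus>\<^bsub>A\<^esub> (w \<oplus>\<^bsub>A\<^esub> (sc c \<otimes>\<^bsub>A\<^esub> E pq)) = (v \<oplus>\<^bsub>A\<^esub> w) \<oplus>\<^bsub>A\<^esub> (sc c \<otimes>\<^bsub>A\<^esub> E pq)"
    using V_step by (intro a_assoc[symmetric]) (simp_all add: V_carrier E_props(1))
  also have "\<dots> \<in> V" by (rule V.V_step[OF V_step.IH[OF V_step.prems] V_step.hyps(2)])
  finally show ?case .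
qed

lemma V_monomial: "pq \<in> inv_exp \<Longrightarrow> sc c \<otimes>\<^bsub>A\<^esub> E pq \<in> V"
  using V.V_step[OF V.V_zero, of pq c] by (simp add: E_props(1))

lemma V_const: "sc c \<in> V"
  using V_monomial[of "(0, 0)" c] by (simp add: E_0 inv_exp_def)

lemma V_mult: "v \<in> V \<Longrightarrow> pq \<in> inv_exp \<Longrightarrow> v \<otimes>\<^bsub>A\<^esub> E pq \<in> V"
proof (induction rule: V.induct)
  case V_zero
  then show ?case by (simp add: E_props(1) V.V_zero)
next
  case (V_step v pq' c)
  obtain p q p' q' where pq: "pq = (p, q)" "pq' = (p', q')" by (cases pq, cases pq')
  have "(v \<oplus>\<^bsub>A\<^esub> (sc c \<otimes>\<^bsub>A\<^esub> E pq')) \<otimes>\<^bsub>A\<^esub> E pq = (v \<otimes>\<^bsub>A\<^esub> E pq) \<oplus>\<^bsub>A\<^esub> (sc c \<otimes>\<^bsub>A\<^esub> (E pq' \<otimes>\<^bsub>A\<^esub> E pq))"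
    using V_step by (simp add: l_distr m_assoc V_carrier E_props(1))
  also have "E pq' \<otimes>\<^bsub>A\<^esub> E pq = E (p' + p, q' + q)" unfolding pq using V_step pq by (intro E_mult) simp_all
  also have "(v \<otimes>\<^bsub>A\<^esub> E pq) \<oplus>\<^bsub>A\<^esub> (sc c \<otimes>\<^bsub>A\<^esub> E (p' + p, q' + q)) \<in> V"
    by (intro V.V_step V_step.IH V_step.prems inv_exp_add) (use V_step pq in simp_all)
  finally show ?case .
qed

definition W where "W n = {v \<oplus>\<^bsub>A\<^esub> r | v r. v \<in> V \<and> r \<in> mpow n}"

lemma W_add: "x \<in> W n \<Longrightarrow> y \<in> W n \<Longrightarrow> x \<oplus>\<^bsub>A\<^esub> y \<in> W n"
proof -
  assume "x \<in> W n" "y \<in> W n"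
  then obtain v r v' r' where x: "x = v \<oplus>\<^bsub>A\<^esub> r" "v \<in> V" "r \<in> mpow n" and y: "y = v' \<oplus>\<^bsub>A\<^esub> r'" "v' \<in> V" "r' \<in> mpow n"
    unfolding W_def by blast
  have c: "v \<in> carrier A" "r \<in> carrier A" "v' \<in> carrier A" "r' \<in> carrier A" using x y V_carrier mpow_carrier by blast+
  have "x \<oplus>\<^bsub>A\<^esub> y = (v \<oplus>\<^bsub>A\<^esub> v') \<oplus>\<^bsub>A\<^esub> (r \<oplus>\<^bsub>A\<^esub> r')" unfolding x y using c by (simp add: a_ac)
  then show ?thesis unfolding W_def using V_add[OF y(2) x(2)] mpow_add[OF x(3) y(3)] by blast
qed

lemma V_W: "v \<in> V \<Longrightarrow> v \<in> W n"
proof -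
  assume v: "v \<in> V"
  have "\<zero>\<^bsub>A\<^esub> \<in> mpow n" by (rule additive_subgroup.zero_closed[OF ideal.axioms(1)[OF ideal_mpow]])
  moreover have "v = v \<oplus>\<^bsub>A\<^esub> \<zero>\<^bsub>A\<^esub>" using V_carrier[OF v] by simp
  ultimately show ?thesis unfolding W_def using v by blast
qed

lemma carrier_W: "carrier A \<subseteq> W n"
proof (induction n)
  case 0
  show ?case
  proof
    fix x assume "x \<in> carrier A"
    then have "x = \<zero>\<^bsub>A\<^esub> \<oplus>\<^bsub>A\<^esub> x \<and> \<zero>\<^bsub>A\<^esub> \<in> V \<and> x \<in> mpow 0" by (simp add: V.V_zero)
    then show "x \<in> W 0" unfolding W_def by blast
  qed
next
  case (Suc n)
  let ?J = "{x \<in> carrier A. \<forall>a\<in>carrier A. a \<otimes>\<^bsub>A\<^esub> x \<in> W (Suc n)}"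
  have J: "ideal ?J A"
  proof (rule idealI)
    show "Ring.ring A" by (rule ring_axioms)
    show "subgroup ?J (add_monoid A)"
    proof (rule add.subgroupI)
      show "?J \<subseteq> carrier A" by blast
      have "\<zero>\<^bsub>A\<^esub> \<in> ?J" using V_W[OF V.V_zero, of "Suc n"] by simp
      then show "?J \<noteq> {}" by blast
      fix x assume x: "x \<in> ?J"
      have "a \<otimes>\<^bsub>A\<^esub> (\<ominus>\<^bsub>A\<^esub> x) \<in> W (Suc n)" if a: "a \<in> carrier A" for a
      proof -
        have "(\<ominus>\<^bsub>A\<^esub> a) \<otimes>\<^bsub>A\<^esub> x \<in> W (Suc n)" using x a by simp
        then show ?thesis using x a by (simp add: l_minus r_minus)
      qed
      then show "\<ominus>\<^bsub>A\<^esub> x \<in> ?J" using x by simp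
      fix y assume y: "y \<in> ?J"
      have "a \<otimes>\<^bsub>A\<^esub> (x \<oplus>\<^bsub>A\<^esub> y) \<in> W (Suc n)" if "a \<in> carrier A" for a
        using x y that W_add by (simp add: r_distr)
      then show "x \<oplus>\<^bsub>A\<^esub> y \<in> ?J" using x y by simp
    qed
    fix x b assume x: "x \<in> ?J" "b \<in> carrier A"
    have "a \<otimes>\<^bsub>A\<^esub> (b \<otimes>\<^bsub>A\<^esub> x) \<in> W (Suc n)" if a: "a \<in> carrier A" for a
    proof -
      have "(a \<otimes>\<^bsub>A\<^esub> b) \<otimes>\<^bsub>A\<^esub> x \<in> W (Suc n)" using x a by simp
      then show ?thesis using x a by (simp add: m_assoc)
    qed
    then show "b \<otimes>\<^bsub>A\<^esub> x \<in> ?J" using x by simp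
    then show "x \<otimes>\<^bsub>A\<^esub> b \<in> ?J" using x m_comm[of x b] by simp
  qed
  have "E ` (inv_exp - {(0, 0)}) \<subseteq> ?J"
  proof
    fix e assume "e \<in> E ` (inv_exp - {(0, 0)})"
    then obtain pq where e: "e = E pq" "pq \<in> inv_exp" "pq \<noteq> (0, 0)" by blast
    have "a \<otimes>\<^bsub>A\<^esub> e \<in> W (Suc n)" if "a \<in> carrier A" for a
    proof -
      have "a \<in> W n" by (rule subsetD[OF Suc.IH that])
      then obtain v r where a: "a = v \<oplus>\<^bsub>A\<^esub> r" "v \<in> V" "r \<in> mpow n" unfolding W_def by blast
      have c: "v \<in> carrier A" "r \<in> carrier A" "e \<in> carrier A"
        using V_carrier[OF a(2)] subsetD[OF mpow_carrier a(3)] E_props(1)[OF e(2)] e(1) by simp_all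
      have "a \<otimes>\<^bsub>A\<^esub> e = (v \<otimes>\<^bsub>A\<^esub> e) \<oplus>\<^bsub>A\<^esub> (e \<otimes>\<^bsub>A\<^esub> r)" unfolding a(1) using c by (simp only: l_distr m_comm[of r e])
      moreover have "v \<otimes>\<^bsub>A\<^esub> e \<in> V" unfolding e(1) by (rule V_mult[OF a(2) e(2)])
      moreover have "e \<otimes>\<^bsub>A\<^esub> r \<in> mpow (Suc n)" using E_props(3)[OF e(2,3)] a(3) by (simp add: e(1) ideal_prod.prod)
      ultimately show ?thesis unfolding W_def by blast
    qed
    then show "e \<in> ?J" using e E_props(1) by simp
  qed
  then have "genideal A (E ` (inv_exp - {(0, 0)})) \<subseteq> ?J" by (rule genideal_minimal[OF J])
  then have mxJ: "mx \<subseteq> ?J" using mx_subset_invariants by (rule subset_trans[rotated])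
  have mxW: "r \<in> W (Suc n)" if "r \<in> mx" for r
  proof -
    have "r \<in> ?J" using mxJ that by (rule subsetD)
    then have "r \<in> carrier A" "\<one>\<^bsub>A\<^esub> \<otimes>\<^bsub>A\<^esub> r \<in> W (Suc n)" by blast+
    then show ?thesis by simp
  qed
  show ?case
  proof
    fix x assume "x \<in> carrier A"
    then obtain f g where x: "x = frac f g" "ok f g" by (metis carrierE)
    then obtain d where d: "hom d f" "hom d g" "peval ptz g \<noteq> 0" by (auto simp: ok_def)
    define c where "c = peval ptz f / peval ptz g"
    define f' where "f' = f - pconst c * g"
    have cg: "hom d (pconst c * g)" using whom_mult[OF whom_pconst d(2)] by simp
    have f': "hom d f'" "peval ptz f' = 0" using whom_diff[OF d(1) cg] d(3) by (simp_all add: f'_def c_def)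
    have "x = frac (pconst c * g) g \<oplus>\<^bsub>A\<^esub> frac f' g"
      unfolding x(1) frac_add_same[OF cg f'(1) d(2,3)] by (simp add: f'_def)
    also have "frac (pconst c * g) g = sc c"
      unfolding sc_frac using cg d ok_const by (intro frac_eqI') (auto simp: ok_def)
    finally have "x = sc c \<oplus>\<^bsub>A\<^esub> frac f' g" .
    moreover have "frac f' g \<in> mx" using f' d by (subst frac_in_mx) (auto simp: ok_def)
    ultimately show "x \<in> W (Suc n)" using W_add[OF V_W[OF V_const] mxW] by simp
  qed
qed

definition low :: "nat \<Rightarrow> (nat \<times> nat) set" where "low n = {pq \<in> inv_exp. fst pq + snd pq < n}"
definition trunc where "trunc n F = (\<Oplus>\<^bsub>A\<^esub>pq\<in>low n. sc (kc (fst pq) (snd pq) F) \<otimes>\<^bsub>A\<^esub> E pq)"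

lemma finite_low: "finite (low n)"
proof (rule finite_subset)
  show "low n \<subseteq> {..n} \<times> {..n}" by (auto simp: low_def)
qed simp

lemma low_term [simp]: "pq \<in> low n \<Longrightarrow> sc c \<otimes>\<^bsub>A\<^esub> E pq \<in> carrier A" by (simp add: low_def E_props(1))

lemma trunc_carrier: "trunc n F \<in> carrier A" unfolding trunc_def by (intro finsum_closed) auto

lemma trunc_add: "trunc n (F + G) = trunc n F \<oplus>\<^bsub>A\<^esub> trunc n G"
proof -
  have "trunc n (F + G) = (\<Oplus>\<^bsub>A\<^esub>pq\<in>low n. sc (kc (fst pq) (snd pq) F) \<otimes>\<^bsub>A\<^esub> E pq \<oplus>\<^bsub>A\<^esub> sc (kc (fst pq) (snd pq) G) \<otimes>\<^bsub>A\<^esub> E pq)"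
    unfolding trunc_def by (intro finsum_cong') (auto simp: sc_add l_distr low_def E_props(1))
  also have "\<dots> = trunc n F \<oplus>\<^bsub>A\<^esub> trunc n G" unfolding trunc_def by (intro finsum_addf) auto
  finally show ?thesis .
qed

lemma trunc_zero: "ordge n F \<Longrightarrow> trunc n F = \<zero>\<^bsub>A\<^esub>"
proof -
  assume F: "ordge n F"
  have "trunc n F = (\<Oplus>\<^bsub>A\<^esub>pq\<in>low n. \<zero>\<^bsub>A\<^esub>)"
    unfolding trunc_def by (intro finsum_cong') (use F in \<open>auto simp: ordge_kc low_def sc_0 E_props(1)\<close>)
  then show ?thesis by (simp add: finsum_zero)
qed

lemma \<Phi>_finsum: "finite B \<Longrightarrow> (\<And>i. i \<in> B \<Longrightarrow> f i \<in> carrier A) \<Longrightarrow> \<Phi> (finsum A f B) = (\<Sum>i\<in>B. \<Phi> (f i))"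
proof (induction B rule: finite_induct)
  case (insert i B)
  have "finsum A f (insert i B) = f i \<oplus>\<^bsub>A\<^esub> finsum A f B" using insert by (intro finsum_insert) auto
  then show ?case using insert by (simp add: \<Phi>_simps(2) finsum_closed)
qed (simp add: \<Phi>_simps(4))

lemma \<Phi>_monomial: "pq \<in> inv_exp \<Longrightarrow> \<Phi> (sc c \<otimes>\<^bsub>A\<^esub> E pq) = cst c * (K_s ^ fst pq * K_t ^ snd pq)"
  by (simp add: \<Phi>_simps(1) E_props \<Phi>_sc)

lemma \<Phi>_trunc:
  assumes "gr 0 F"
  shows "ordge n (F - \<Phi> (trunc n F))"
  unfolding ordge_kc
proof (intro allI impI)
  fix p q assume pq: "p + q < n"
  have "\<Phi> (trunc n F) = (\<Sum>ab\<in>low n. cst (kc (fst ab) (snd ab) F) * (K_s ^ fst ab * K_t ^ snd ab))"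
    unfolding trunc_def by (subst \<Phi>_finsum[OF finite_low]) (auto simp: low_def \<Phi>_monomial E_props(1))
  then have "kc p q (\<Phi> (trunc n F)) = (\<Sum>ab\<in>low n. if ab = (p, q) then kc p q F else 0)"
    unfolding kc_sum[symmetric] by (simp add: kc_sum kc_monomial prod_eq_iff) (intro sum.cong; auto)
  also have "\<dots> = (if (p, q) \<in> low n then kc p q F else 0)" by (simp add: finite_low)
  also have "\<dots> = kc p q F"
  proof (cases "kc p q F = 0")
    case False
    then have "(p, q) \<in> low n" using grD[OF assms False] pq by (simp add: low_def inv_exp_def)
    then show ?thesis by simp
  qed simp
  finally show "kc p q (F - \<Phi> (trunc n F)) = 0" by simp
qed

lemma trunc_monomial:
  assumes pq: "pq \<in> inv_exp"
  shows "trunc n (cst c * (K_s ^ fst pq * K_t ^ snd pq)) = (if pq \<in> low n then sc c \<otimes>\<^bsub>A\<^esub> E pq else \<zero>\<^bsub>A\<^esub>)"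
proof -
  have "trunc n (cst c * (K_s ^ fst pq * K_t ^ snd pq)) = (\<Oplus>\<^bsub>A\<^esub>ab\<in>low n. if pq = ab then sc c \<otimes>\<^bsub>A\<^esub> E ab else \<zero>\<^bsub>A\<^esub>)"
    unfolding trunc_def
    by (intro finsum_cong') (auto simp: kc_monomial sc_0 low_def E_props(1) prod_eq_iff)
  also have "\<dots> = (if pq \<in> low n then sc c \<otimes>\<^bsub>A\<^esub> E pq else \<zero>\<^bsub>A\<^esub>)"
  proof (cases "pq \<in> low n")
    case True
    then show ?thesis using add.finprod_singleton[OF True finite_low, of "\<lambda>ab. sc c \<otimes>\<^bsub>A\<^esub> E ab"] by (simp add: Pi_def)
  next
    case False
    then have "(\<Oplus>\<^bsub>A\<^esub>ab\<in>low n. if pq = ab then sc c \<otimes>\<^bsub>A\<^esub> E ab else \<zero>\<^bsub>A\<^esub>) = (\<Oplus>\<^bsub>A\<^esub>ab\<in>low n. \<zero>\<^bsub>A\<^esub>)"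
      by (intro finsum_cong') auto
    then show ?thesis using False by (simp add: finsum_zero)
  qed
  finally show ?thesis .
qed

definition approx where "approx n = {x. \<exists>r\<in>mpow n. x = trunc (25 * n) (\<Phi> x) \<oplus>\<^bsub>A\<^esub> r}"

lemma approx_add:
  assumes "x \<in> approx n" "y \<in> approx n"
  shows "x \<oplus>\<^bsub>A\<^esub> y \<in> approx n"
proof -
  obtain r r' where x: "r \<in> mpow n" "x = trunc (25 * n) (\<Phi> x) \<oplus>\<^bsub>A\<^esub> r" and y: "r' \<in> mpow n" "y = trunc (25 * n) (\<Phi> y) \<oplus>\<^bsub>A\<^esub> r'"
    using assms unfolding approx_def by blast
  have c: "r \<in> carrier A" "r' \<in> carrier A" using x y mpow_carrier by blast+
  note T = trunc_carrier[of "25 * n" "\<Phi> x"] trunc_carrier[of "25 * n" "\<Phi> y"]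
  have xy: "x \<in> carrier A" "y \<in> carrier A" using c T by (subst x(2), simp, subst y(2), simp)
  have "x \<oplus>\<^bsub>A\<^esub> y = (trunc (25 * n) (\<Phi> x) \<oplus>\<^bsub>A\<^esub> r) \<oplus>\<^bsub>A\<^esub> (trunc (25 * n) (\<Phi> y) \<oplus>\<^bsub>A\<^esub> r')"
    by (rule arg_cong2[OF x(2) y(2)])
  also have "\<dots> = trunc (25 * n) (\<Phi> (x \<oplus>\<^bsub>A\<^esub> y)) \<oplus>\<^bsub>A\<^esub> (r \<oplus>\<^bsub>A\<^esub> r')"
    using c T xy by (simp add: \<Phi>_simps(2) trunc_add a_ac)
  finally show ?thesis using mpow_add[OF x(1) y(1)] unfolding approx_def by blast
qed

lemma approx_mpow: "r \<in> mpow (25 * n) \<Longrightarrow> r \<in> approx n"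
proof -
  assume r: "r \<in> mpow (25 * n)"
  have "trunc (25 * n) (\<Phi> r) = \<zero>\<^bsub>A\<^esub>" by (rule trunc_zero[OF \<Phi>_mpow[OF r]])
  moreover have "r \<in> mpow n" using r mpow_mono[of n "25 * n"] by auto
  moreover have "r \<in> carrier A" using r mpow_carrier by blast
  ultimately have "r \<in> mpow n \<and> r = trunc (25 * n) (\<Phi> r) \<oplus>\<^bsub>A\<^esub> r" by simp
  then show ?thesis unfolding approx_def by blast
qed

lemma approx_monomial:
  assumes pq: "pq \<in> inv_exp"
  shows "sc c \<otimes>\<^bsub>A\<^esub> E pq \<in> approx n"
proof -
  let ?x = "sc c \<otimes>\<^bsub>A\<^esub> E pq"
  have e: "trunc (25 * n) (\<Phi> ?x) = (if pq \<in> low (25 * n) then ?x else \<zero>\<^bsub>A\<^esub>)"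
    unfolding \<Phi>_monomial[OF pq] by (rule trunc_monomial[OF pq])
  have x: "?x \<in> carrier A" using E_props(1)[OF pq] by simp
  have "\<exists>r\<in>mpow n. ?x = trunc (25 * n) (\<Phi> ?x) \<oplus>\<^bsub>A\<^esub> r"
  proof (cases "pq \<in> low (25 * n)")
    case True
    then show ?thesis unfolding e using x additive_subgroup.zero_closed[OF ideal.axioms(1)[OF ideal_mpow]]
      by (intro bexI[of _ "\<zero>\<^bsub>A\<^esub>"]) simp_all
  next
    case False
    then have "25 * n \<le> fst pq + snd pq" using pq by (simp add: low_def not_less)
    then have "?x \<in> mpow n" by (intro ideal.I_l_closed[OF ideal_mpow] E_mpow[OF pq] sc_carrier)
    then show ?thesis unfolding e using x False by (intro bexI[of _ ?x]) simp_all
  qed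
  then show ?thesis unfolding approx_def by blast
qed

lemma approx_V: "v \<in> V \<Longrightarrow> v \<in> approx n"
proof (induction rule: V.induct)
  case V_zero
  then show ?case by (intro approx_mpow additive_subgroup.zero_closed[OF ideal.axioms(1)[OF ideal_mpow]])
next
  case (V_step v pq c)
  then show ?case by (intro approx_add approx_monomial)
qed

lemma mpow_if_ordge:
  assumes x: "x \<in> carrier A" "ordge (25 * n) (\<Phi> x)"
  shows "x \<in> mpow n"
proof -
  have "x \<in> W (25 * n)" by (rule subsetD[OF carrier_W x(1)])
  then obtain v r where "x = v \<oplus>\<^bsub>A\<^esub> r" "v \<in> V" "r \<in> mpow (25 * n)" unfolding W_def by blast
  then have "x \<in> approx n" using approx_add[OF approx_V approx_mpow] by blast
  then obtain s where s: "s \<in> mpow n" "x = trunc (25 * n) (\<Phi> x) \<oplus>\<^bsub>A\<^esub> s" unfolding approx_def by blast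
  have "s \<in> carrier A" using s(1) mpow_carrier by blast
  then have "x = s" using s(2) unfolding trunc_zero[OF x(2)] by simp
  then show ?thesis using s(1) by simp
qed

lemma gr_closed:
  assumes "\<And>n. \<exists>G\<in>{F. gr 0 F}. ordge n (F - G)"
  shows "gr 0 F"
  unfolding gr_def
proof (intro allI impI)
  fix p q assume nz: "kc p q F \<noteq> 0"
  obtain G where G: "gr 0 G" "ordge (Suc (p + q)) (F - G)" using assms by blast
  then have "kc p q (F - G) = 0" unfolding ordge_kc by blast
  then have "kc p q G \<noteq> 0" using nz by simp
  then show "(p + 14 * q) mod 25 = 0 mod 25" by (rule grD[OF G(1)])
qed

lemma cyclic_quotient_point_ptz: "cyclic_quotient_point weights (X'_ideal \<theta> \<tau> P) (worbit weights ptz) 25 1 14"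
proof -
  have "\<exists>\<psi> \<in> ring_iso (completion A mx) ((ring_of_type_algebra :: K ring) \<lparr>carrier := {F. gr 0 F}\<rparr>).
    \<forall>x\<in>carrier A. \<psi> (completion_map A mx x) = \<Phi> x"
  proof (rule completion_iso_power_series[where \<nu> = "\<lambda>n. 25 * n"])
    show "ideal mx A" by (rule ideal_mx)
    show "\<And>x. x \<in> carrier A \<Longrightarrow> \<Phi> x \<in> {F. gr 0 F}" by (simp add: gr_\<Phi>)
    show "\<exists>x\<in>carrier A. ordge n (F - \<Phi> x)" if "F \<in> {F. gr 0 F}" for F n
      using that \<Phi>_trunc[of F n] trunc_carrier[of n F] by blast
    show "F \<in> {F. gr 0 F}" if "\<And>n. \<exists>G\<in>{F. gr 0 F}. ordge n (F - G)" for F using gr_closed[OF that] by simp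
  qed (simp_all add: \<Phi>_simps \<Phi>_mpow mpow_if_ordge)
  then obtain \<psi> where "\<psi> \<in> ring_iso (completion A mx) (cyclic_invariants 25 1 14)"
    "\<forall>x\<in>carrier A. \<psi> (completion_map A mx x) = \<Phi> x" unfolding cyclic_invariants_gr by blast
  then show ?thesis unfolding cyclic_quotient_point_def Let_def the_maximal_ideal_A
    by (intro bexI[of _ \<psi>]) (simp_all add: \<Phi>_sc cst_def)
qed

end

theorem corollary3p11:
  fixes \<theta> :: complex
  shows "(\<forall>\<tau> P. whomogeneous weights 10 P \<longrightarrow>
            X'_ideal \<theta> \<tau> P = genideal S_ring (Pfaffian_equations \<theta> \<tau> P)) \<and>
         for_general_parameters (\<lambda>P \<tau>.
            \<exists>p. singular_locus weights (X'_ideal \<theta> \<tau> P) = {p} \<and>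
                cyclic_quotient_point weights (X'_ideal \<theta> \<tau> P) p 25 1 14)"
proof
  show "\<forall>\<tau> P. whomogeneous weights 10 P \<longrightarrow> X'_ideal \<theta> \<tau> P = genideal S_ring (Pfaffian_equations \<theta> \<tau> P)"
    using Pfaffian_ideal by blast
  obtain U where U: "zariski_open U" "U \<noteq> {}" "\<forall>(P, \<tau>)\<in>U. (P, \<tau>) \<in> parameter_space \<and> \<tau> \<noteq> 0 \<and> \<not> bad \<theta> \<tau> P"
    using general_parameters by blast
  have "\<exists>p. singular_locus weights (X'_ideal \<theta> \<tau> P) = {p} \<and> cyclic_quotient_point weights (X'_ideal \<theta> \<tau> P) p 25 1 14"
    if "(P, \<tau>) \<in> U" for P \<tau>
  proof -
    have *: "(P, \<tau>) \<in> parameter_space" "\<tau> \<noteq> 0" "\<not> bad \<theta> \<tau> P" using U(3) that by blast+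
    then interpret cone_point \<theta> \<tau> P by unfold_locales (simp_all add: parameter_space_def)
    have "singular_locus weights (X'_ideal \<theta> \<tau> P) = {worbit weights ptz}"
      using singular_locus_subset[OF P *(2,3)] ptz_singular by blast
    then show ?thesis using cyclic_quotient_point_ptz by blast
  qed
  then show "for_general_parameters (\<lambda>P \<tau>. \<exists>p. singular_locus weights (X'_ideal \<theta> \<tau> P) = {p} \<and>
      cyclic_quotient_point weights (X'_ideal \<theta> \<tau> P) p 25 1 14)"
    unfolding for_general_parameters_def using U(1,2) by blast
qed

end
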